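(* Let $k$ be an uncountable algebraically closed field and let $R$ be an affine prime Goldie non-simple non-PI $k$-algebra with $\operatorname{GKdim}(R)<3$. Then $R$ is stably almost PI.
   Context: All algebras are associative with 1. A $k$-algebra is affine if it is finitely generated as a $k$-algebra. $\operatorname{GKdim}$ is Gelfand--Kirillov dimension over $k$. PI means satisfying a (nontrivial) polynomial identity. Goldie means left and right Goldie. An algebra $R$ over a field is almost PI if $R$ is not PI and $R/I$ is PI for every nonzero two-sided ideal $I$ of $R$. An almost PI $k$-algebra $R$ is stably almost PI if for every field extension $K/k$ the $K$-algebra $R\otimes_k K$ is almost PI. *)

theory Defs
  imports
    "Jordan_Normal_Form.Missing_VectorSpace"
    "HOL-Algebra.Algebraic_Closure"
    "HOL-Algebra.Free_Abelian_Groups"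
    "HOL-Algebra.Ideal_Product"
    Complex_Main
    "HOL-Library.Countable_Set"
    "HOL-Library.Extended_Real"
    "HOL-Library.Liminf_Limsup"
begin

section \<open>Associative unital algebras over a field\<close>

text \<open>The library's locale \<^locale>\<open>algebra\<close> demands a commutative ring, hence this
  noncommutative version. The zero ring is allowed. That \<open>A\<close> is a ring is an assumption
  rather than an imported locale because \<open>vectorspace\<close> and \<open>ring\<close> both declare a
  constant \<open>dim\<close>.\<close>

locale assoc_algebra = vectorspace k A for k and A (structure) +
  assumes ring: "ring A"
    and smult_mult_left:
      "\<lbrakk>c \<in> carrier k; x \<in> carrier A; y \<in> carrier A\<rbrakk>
        \<Longrightarrow> (c \<odot> x) \<otimes> y = c \<odot> (x \<otimes> y)"
    and smult_mult_right:
      "\<lbrakk>c \<in> carrier k; x \<in> carrier A; y \<in> carrier A\<rbrakk>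
        \<Longrightarrow> x \<otimes> (c \<odot> y) = c \<odot> (x \<otimes> y)"

definition subalgebra_of :: "'k ring \<Rightarrow> 'r set \<Rightarrow> ('k, 'r) module \<Rightarrow> bool" where
  "subalgebra_of k B A \<longleftrightarrow>
     subring B A \<and> (\<forall>c\<in>carrier k. \<forall>x\<in>B. c \<odot>\<^bsub>A\<^esub> x \<in> B)"

definition affine_algebra :: "'k ring \<Rightarrow> ('k, 'r) module \<Rightarrow> bool" where
  "affine_algebra k A \<longleftrightarrow>
     (\<exists>S. finite S \<and> S \<subseteq> carrier A \<and>
          (\<forall>B. subalgebra_of k B A \<and> S \<subseteq> B \<longrightarrow> B = carrier A))"

text \<open>For an arbitrary set \<open>I\<close> this is only a record; it is an algebra when \<open>I\<close> is an ideal
  stable under the scalars (as every ideal of a unital algebra is).\<close>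

definition quot_algebra :: "('k, 'r) module \<Rightarrow> 'r set \<Rightarrow> ('k, 'r set) module" where
  "quot_algebra A I =
     \<lparr>carrier = carrier (A Quot I), monoid.mult = monoid.mult (A Quot I), one = one (A Quot I),
      ring.zero = ring.zero (A Quot I), add = add (A Quot I),
      smult = (\<lambda>c C. \<Union>x\<in>C. I +>\<^bsub>A\<^esub> (c \<odot>\<^bsub>A\<^esub> x))\<rparr>"

definition word_val :: "('r, 'm) ring_scheme \<Rightarrow> 'r list \<Rightarrow> 'r" where
  "word_val A ws = foldr (\<otimes>\<^bsub>A\<^esub>) ws \<one>\<^bsub>A\<^esub>"


section \<open>Prime, simple and Goldie rings\<close>

definition prime_ring :: "('r, 'm) ring_scheme \<Rightarrow> bool" where
  "prime_ring R \<longleftrightarrow>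
     carrier R \<noteq> {\<zero>\<^bsub>R\<^esub>} \<and>
     (\<forall>I J. ideal I R \<and> ideal J R \<and> ideal_prod R I J = {\<zero>\<^bsub>R\<^esub>}
        \<longrightarrow> I = {\<zero>\<^bsub>R\<^esub>} \<or> J = {\<zero>\<^bsub>R\<^esub>})"

definition simple_ring :: "('r, 'm) ring_scheme \<Rightarrow> bool" where
  "simple_ring R \<longleftrightarrow>
     carrier R \<noteq> {\<zero>\<^bsub>R\<^esub>} \<and> (\<forall>I. ideal I R \<longrightarrow> I = {\<zero>\<^bsub>R\<^esub>} \<or> I = carrier R)"

definition opposite_ring :: "('r, 'm) ring_scheme \<Rightarrow> ('r, 'm) ring_scheme" where
  "opposite_ring R = R\<lparr>monoid.mult := (\<lambda>x y. y \<otimes>\<^bsub>R\<^esub> x)\<rparr>"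

definition left_ideal :: "'r set \<Rightarrow> ('r, 'm) ring_scheme \<Rightarrow> bool" where
  "left_ideal L R \<longleftrightarrow>
     additive_subgroup L R \<and> (\<forall>a\<in>carrier R. \<forall>x\<in>L. a \<otimes>\<^bsub>R\<^esub> x \<in> L)"

definition independent_sequence :: "(nat \<Rightarrow> 'r set) \<Rightarrow> ('r, 'm) ring_scheme \<Rightarrow> bool" where
  "independent_sequence L R \<longleftrightarrow>
     (\<forall>F x. finite F \<and> (\<forall>i\<in>F. x i \<in> L i) \<and> finsum R x F = \<zero>\<^bsub>R\<^esub>
        \<longrightarrow> (\<forall>i\<in>F. x i = \<zero>\<^bsub>R\<^esub>))"

definition left_annihilator :: "('r, 'm) ring_scheme \<Rightarrow> 'r set \<Rightarrow> 'r set" where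
  "left_annihilator R S = {a \<in> carrier R. \<forall>s\<in>S. a \<otimes>\<^bsub>R\<^esub> s = \<zero>\<^bsub>R\<^esub>}"

text \<open>No infinite direct sum of nonzero left ideals (finite uniform dimension), and the
  ascending chain condition on left annihilators of subsets.\<close>

definition left_goldie :: "('r, 'm) ring_scheme \<Rightarrow> bool" where
  "left_goldie R \<longleftrightarrow>
     \<not> (\<exists>L. (\<forall>n. left_ideal (L n) R \<and> L n \<noteq> {\<zero>\<^bsub>R\<^esub>}) \<and> independent_sequence L R) \<and>
     (\<forall>S. (\<forall>n. S n \<subseteq> carrier R \<and> left_annihilator R (S n) \<subseteq> left_annihilator R (S (Suc n)))
        \<longrightarrow> (\<exists>N. \<forall>n\<ge>N. left_annihilator R (S n) = left_annihilator R (S N)))"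

definition goldie_ring :: "('r, 'm) ring_scheme \<Rightarrow> bool" where
  "goldie_ring R \<longleftrightarrow> left_goldie R \<and> left_goldie (opposite_ring R)"


section \<open>Gelfand--Kirillov dimension\<close>

text \<open>\<open>subspace_growth k A V n\<close> is the dimension of \<open>k + V + V\<^sup>2 + \<dots> + V\<^sup>n\<close>.\<close>

definition subspace_growth :: "'k ring \<Rightarrow> ('k, 'r) module \<Rightarrow> 'r set \<Rightarrow> nat \<Rightarrow> nat" where
  "subspace_growth k A V n =
     vectorspace.dim k
       (A\<lparr>carrier := LinearCombinations.module.span k A {word_val A ws | ws. set ws \<subseteq> V \<and> length ws \<le> n}\<rparr>)"

definition GKdim :: "'k ring \<Rightarrow> ('k, 'r) module \<Rightarrow> ereal" where
  "GKdim k A =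
     (SUP V \<in> {V. VectorSpace.subspace k V A \<and> vectorspace.fin_dim k (A\<lparr>carrier := V\<rparr>)}.
        limsup (\<lambda>n. ereal (ln (real (subspace_growth k A V n)) / ln (real n))))"


section \<open>Polynomial identities\<close>

text \<open>An element of the free algebra \<open>k\<langle>X\<^sub>0, X\<^sub>1, \<dots>\<rangle>\<close> is given by its coefficients: the word
  \<open>X\<^sub>i X\<^sub>j \<dots>\<close> is the list \<open>[i, j, \<dots>]\<close>.\<close>

definition nc_polys :: "'k ring \<Rightarrow> (nat list \<Rightarrow> 'k) set" where
  "nc_polys k = {f. range f \<subseteq> carrier k \<and> finite {w. f w \<noteq> \<zero>\<^bsub>k\<^esub>}}"

definition nc_eval :: "'k ring \<Rightarrow> ('k, 'r) module \<Rightarrow> (nat list \<Rightarrow> 'k) \<Rightarrow> (nat \<Rightarrow> 'r) \<Rightarrow> 'r" where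
  "nc_eval k A f x =
     finsum A (\<lambda>w. f w \<odot>\<^bsub>A\<^esub> word_val A (map x w)) {w. f w \<noteq> \<zero>\<^bsub>k\<^esub>}"

definition PI_algebra :: "'k ring \<Rightarrow> ('k, 'r) module \<Rightarrow> bool" where
  "PI_algebra k A \<longleftrightarrow>
     (\<exists>f\<in>nc_polys k. (\<exists>w. f w \<noteq> \<zero>\<^bsub>k\<^esub>) \<and>
        (\<forall>x. range x \<subseteq> carrier A \<longrightarrow> nc_eval k A f x = \<zero>\<^bsub>A\<^esub>))"

definition almost_PI :: "'k ring \<Rightarrow> ('k, 'r) module \<Rightarrow> bool" where
  "almost_PI k A \<longleftrightarrow>
     \<not> PI_algebra k A \<and>
     (\<forall>I. ideal I A \<and> I \<noteq> {\<zero>\<^bsub>A\<^esub>} \<longrightarrow> PI_algebra k (quot_algebra A I))"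


section \<open>Extension of scalars\<close>

text \<open>A field extension of \<open>k\<close> is a field \<open>K\<close> with a ring homomorphism \<open>h\<close> from \<open>k\<close> to \<open>K\<close>.
  The tensor product \<open>A \<otimes>\<^sub>k K\<close> is the free abelian group on \<open>A \<times> K\<close> modulo the subgroup
  generated by the balanced bilinear relations, with multiplication
  \<open>(x \<otimes> c) (y \<otimes> d) = xy \<otimes> cd\<close> and \<open>K\<close> acting on the second factor. The record \<open>free_on_pairs\<close>
  carries these operations on the free abelian group before passing to the quotient; it is a
  ring, but its \<open>smult\<close> is not a module structure.\<close>

definition free_on_pairs ::
    "('k, 'r) module \<Rightarrow> 'c ring \<Rightarrow> ('c, ('r \<times> 'c) \<Rightarrow>\<^sub>0 int) module" where
  "free_on_pairs A K =
     \<lparr>carrier = carrier (free_Abelian_group (carrier A \<times> carrier K)),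
      monoid.mult = (\<lambda>f g. frag_extend (\<lambda>(x, c).
                frag_extend (\<lambda>(y, d). frag_of (x \<otimes>\<^bsub>A\<^esub> y, c \<otimes>\<^bsub>K\<^esub> d)) g) f),
      one = frag_of (\<one>\<^bsub>A\<^esub>, \<one>\<^bsub>K\<^esub>),
      ring.zero = 0,
      add = (+),
      smult = (\<lambda>c. frag_extend (\<lambda>(x, d). frag_of (x, c \<otimes>\<^bsub>K\<^esub> d)))\<rparr>"

definition tensor_relations ::
    "'k ring \<Rightarrow> ('k, 'r) module \<Rightarrow> 'c ring \<Rightarrow> ('k \<Rightarrow> 'c) \<Rightarrow> (('r \<times> 'c) \<Rightarrow>\<^sub>0 int) set" where
  "tensor_relations k A K h =
     {frag_of (x \<oplus>\<^bsub>A\<^esub> y, c) - frag_of (x, c) - frag_of (y, c) | x y c.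
        x \<in> carrier A \<and> y \<in> carrier A \<and> c \<in> carrier K} \<union>
     {frag_of (x, c \<oplus>\<^bsub>K\<^esub> d) - frag_of (x, c) - frag_of (x, d) | x c d.
        x \<in> carrier A \<and> c \<in> carrier K \<and> d \<in> carrier K} \<union>
     {frag_of (a \<odot>\<^bsub>A\<^esub> x, c) - frag_of (x, h a \<otimes>\<^bsub>K\<^esub> c) | a x c.
        a \<in> carrier k \<and> x \<in> carrier A \<and> c \<in> carrier K}"

definition base_change ::
    "'k ring \<Rightarrow> ('k, 'r) module \<Rightarrow> 'c ring \<Rightarrow> ('k \<Rightarrow> 'c) \<Rightarrow> ('c, (('r \<times> 'c) \<Rightarrow>\<^sub>0 int) set) module" where
  "base_change k A K h =
     quot_algebra (free_on_pairs A K)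
       (generate (free_Abelian_group (carrier A \<times> carrier K)) (tensor_relations k A K h))"

text \<open>HOL cannot quantify over types inside a formula, so the type in which the extension fields
  live is a parameter; a theorem stated for a type variable \<open>'c\<close> covers all extension fields.\<close>

definition stably_almost_PI :: "'c itself \<Rightarrow> 'k ring \<Rightarrow> ('k, 'r) module \<Rightarrow> bool" where
  "stably_almost_PI TYPE('c) k A \<longleftrightarrow>
     almost_PI k A \<and>
     (\<forall>(K :: 'c ring) h. field K \<and> h \<in> ring_hom k K \<longrightarrow> almost_PI K (base_change k A K h))"

end

theory Submission
  imports Defs
    "HOL-Combinatorics.Permutations"
begin

text \<open>Let \<open>I\<close> be a nonzero ideal. By Goldie it contains a nonzerodivisor \<open>x\<close>, and the products of the
  normal words of \<open>R/I\<close> with the powers of \<open>x\<close> are independent, so \<open>R/I\<close> grows one degree slower than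
  \<open>R\<close>: less than quadratically. Hence for some \<open>d\<close> there are at most \<open>d\<close> normal words of length \<open>d\<close>,
  and \<open>R/I\<close> is spanned by words \<open>u v\<^sup>m w\<close> with \<open>(u, v, w)\<close> in a finite set. Over an algebraically
  closed field such an algebra satisfies a product of three standard polynomials, which is proved
  by letting it act on finitely generated modules over the commutative rings \<open>k[v]\<close>.

  So there are countably many polynomials such that every nonzero ideal contains all values of one
  of them; as \<open>R\<close> is not PI, there is a countable set of nonzero elements which every nonzero ideal
  meets. If \<open>\<lambda>\<close> in the extended centroid were not in \<open>k\<close>, then uncountably many of the ideals
  of all multiples of \<open>\<lambda> - \<alpha>\<close>, for \<open>\<alpha>\<close> in \<open>k\<close>, would contain the same nonzero \<open>y\<close>, and the elements
  \<open>(\<lambda> - \<alpha>)\<^sup>-\<^sup>1 y\<close> of \<open>R\<close> would be linearly independent, which is impossible in countable dimension.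
  Therefore the extended centroid is \<open>k\<close>, every nonzero ideal of \<open>R \<otimes> K\<close> contains \<open>r \<otimes> 1\<close> for some
  \<open>r \<noteq> 0\<close>, and the identities of the quotients of \<open>R\<close> pass to those of \<open>R \<otimes> K\<close> by multilinearity.\<close>

section \<open>Linear spans in an algebra\<close>

text \<open>The degrees of an identity must be fixed before its arguments, and this shapes the
  argument for R/I. Up to powers of a monic g, R/I is a finitely generated right module over k[v],
  but the power needed varies with the element; so one standard value e only makes eA
  finite-dimensional modulo I, in a dimension that depends on the arguments of e. The annihilator of
  eA then contains a monic polynomial in each v, of unknown degree, and what is needed is a
  denominator that serves all such annihilators at once. Here algebraic closure enters: a relation
  among powers is divided by linear factors v - b until it stays nontrivial at every scalar b, and
  then exponent one is enough modulo every ideal that contains a monic polynomial. The degrees of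
  the later factors thus do not depend on e. The identity has only two parameters, its degrees D and
  E, which is why countably many identities suffice. The bound 3 enters as 2 + 1: two degrees for
  about n^2/2 normal words of length at most n, one for the powers of x.\<close>

locale kalg = assoc_algebra k A for k and A (structure)
begin

sublocale A: ring A
  by (rule ring)

definition subsp :: "'c set \<Rightarrow> bool" where
  "subsp N \<longleftrightarrow> N \<subseteq> carrier A \<and> \<zero> \<in> N \<and> (\<forall>x\<in>N. \<forall>y\<in>N. x \<oplus> y \<in> N) \<and>
     (\<forall>c\<in>carrier k. \<forall>x\<in>N. c \<odot> x \<in> N)"

text \<open>An inductive form of the linear span, so that facts about spans follow by rule induction
  on one added term. The guard \<open>s \<in> carrier A\<close> makes it a subspace for every set
  \<open>S\<close>. \<open>span_eq_lspan\<close> links it to the library span, in which growth is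
  defined.\<close>

inductive_set lspan :: "'c set \<Rightarrow> 'c set" for S where
  zero: "\<zero> \<in> lspan S"
| step: "\<lbrakk>c \<in> carrier k; s \<in> S; s \<in> carrier A; v \<in> lspan S\<rbrakk> \<Longrightarrow> c \<odot> s \<oplus> v \<in> lspan S"

lemma lspan_carrier: "x \<in> lspan S \<Longrightarrow> x \<in> carrier A"
  by (induction rule: lspan.induct) auto

lemma lspan_base: "\<lbrakk>s \<in> S; s \<in> carrier A\<rbrakk> \<Longrightarrow> s \<in> lspan S"
  using lspan.step[of "\<one>\<^bsub>k\<^esub>" s S \<zero>] lspan.zero by (simp add: smult_one)

lemma lspan_add: "\<lbrakk>x \<in> lspan S; y \<in> lspan S\<rbrakk> \<Longrightarrow> x \<oplus> y \<in> lspan S"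
proof (induction rule: lspan.induct)
  case zero
  then show ?case using lspan_carrier by simp
next
  case (step c s v)
  then have "c \<odot> s \<oplus> (v \<oplus> y) \<in> lspan S" by (intro lspan.step) auto
  then show ?case using step lspan_carrier[of v] lspan_carrier[of y] by (simp add: M.a_assoc)
qed

lemma lspan_smult: "\<lbrakk>x \<in> lspan S; c \<in> carrier k\<rbrakk> \<Longrightarrow> c \<odot> x \<in> lspan S"
proof (induction rule: lspan.induct)
  case zero
  then show ?case using lspan.zero by (simp add: smult_r_null)
next
  case (step d s v)
  then have "(c \<otimes>\<^bsub>k\<^esub> d) \<odot> s \<oplus> c \<odot> v \<in> lspan S" by (intro lspan.step) auto
  then show ?case using step lspan_carrier[of v] by (simp add: smult_r_distr smult_assoc1)
qed

lemma subsp_lspan: "subsp (lspan S)"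
  unfolding subsp_def using lspan_carrier lspan_add lspan_smult lspan.zero by auto

lemma minus_one_smult: "x \<in> carrier A \<Longrightarrow> (\<ominus>\<^bsub>k\<^esub> \<one>\<^bsub>k\<^esub>) \<odot> x = \<ominus> x"
  using smult_l_minus[of "\<one>\<^bsub>k\<^esub>" x] smult_one[of x] by simp

context
  fixes N assumes N: "subsp N"
begin

lemma subspD:
  "x \<in> N \<Longrightarrow> x \<in> carrier A" "\<zero> \<in> N" "\<lbrakk>x \<in> N; y \<in> N\<rbrakk> \<Longrightarrow> x \<oplus> y \<in> N"
  "\<lbrakk>c \<in> carrier k; x \<in> N\<rbrakk> \<Longrightarrow> c \<odot> x \<in> N"
  using N unfolding subsp_def by auto

lemma subsp_uminus: "x \<in> N \<Longrightarrow> \<ominus> x \<in> N"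
  using subspD(4)[where c = "\<ominus>\<^bsub>k\<^esub> \<one>\<^bsub>k\<^esub>" and x = x] subspD(1)[where x = x]
  by (simp add: minus_one_smult)

lemma subsp_minus: "\<lbrakk>x \<in> N; y \<in> N\<rbrakk> \<Longrightarrow> x \<ominus> y \<in> N"
  using subspD(3) subsp_uminus by (simp add: a_minus_def)

lemma subsp_add_mem:
  assumes "x \<in> carrier A" "x \<oplus> y \<in> N" "y \<in> N" shows "x \<in> N"
proof -
  have "(x \<oplus> y) \<ominus> y \<in> N" using assms subsp_minus by blast
  moreover have "(x \<oplus> y) \<ominus> y = x" using assms(1) subspD(1)[OF assms(3)] by algebra
  ultimately show ?thesis by simp
qed

lemma subsp_smult_mem:
  assumes "x \<in> carrier A" "c \<in> carrier k" "c \<noteq> \<zero>\<^bsub>k\<^esub>" "c \<odot> x \<in> N" shows "x \<in> N"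
proof -
  have u: "c \<in> Units k" using assms field.field_Units by auto
  have "inv\<^bsub>k\<^esub> c \<odot> (c \<odot> x) \<in> N" using assms u subspD(4) by simp
  moreover have "inv\<^bsub>k\<^esub> c \<odot> (c \<odot> x) = x"
    using assms u smult_assoc1[of "inv\<^bsub>k\<^esub> c" c x] by (simp add: smult_one)
  ultimately show ?thesis by simp
qed

lemma lspan_least: "\<lbrakk>x \<in> lspan S; S \<inter> carrier A \<subseteq> N\<rbrakk> \<Longrightarrow> x \<in> N"
  by (induction rule: lspan.induct) (auto intro!: subspD)

end

lemma lspan_subset: "\<lbrakk>x \<in> lspan S; S \<inter> carrier A \<subseteq> lspan T\<rbrakk> \<Longrightarrow> x \<in> lspan T"
  by (rule lspan_least[OF subsp_lspan])

lemma lspan_mono: "\<lbrakk>x \<in> lspan S; S \<subseteq> T\<rbrakk> \<Longrightarrow> x \<in> lspan T"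
  by (rule lspan_subset) (auto intro: lspan_base)

lemma lspan_of_subsp: "subsp N \<Longrightarrow> lspan N = N"
  using lspan_least[where S=N and N=N] lspan_base[of _ N] subspD(1)[of N] by blast

text \<open>All linear maps that occur are compositions of multiplications, so linearity is
  stated pointwise.\<close>

definition linmap :: "('c \<Rightarrow> 'c) \<Rightarrow> bool" where
  "linmap f \<longleftrightarrow> (\<forall>x\<in>carrier A. f x \<in> carrier A) \<and>
     (\<forall>x\<in>carrier A. \<forall>y\<in>carrier A. f (x \<oplus> y) = f x \<oplus> f y) \<and>
     (\<forall>c\<in>carrier k. \<forall>x\<in>carrier A. f (c \<odot> x) = c \<odot> f x)"

lemma linmapD:
  assumes "linmap f"
  shows "x \<in> carrier A \<Longrightarrow> f x \<in> carrier A"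
    "\<lbrakk>x \<in> carrier A; y \<in> carrier A\<rbrakk> \<Longrightarrow> f (x \<oplus> y) = f x \<oplus> f y"
    "\<lbrakk>c \<in> carrier k; x \<in> carrier A\<rbrakk> \<Longrightarrow> f (c \<odot> x) = c \<odot> f x"
  using assms unfolding linmap_def by auto

lemma linmap_zero: assumes "linmap f" shows "f \<zero> = \<zero>"
proof -
  have "f (\<zero> \<oplus> \<zero>) = f \<zero> \<oplus> f \<zero>" using linmapD(2)[OF assms, of \<zero> \<zero>] by simp
  then show ?thesis using linmapD(1)[OF assms, of \<zero>] by (simp add: M.add.l_cancel_one)
qed

lemma linmap_mult_left: "a \<in> carrier A \<Longrightarrow> linmap (\<lambda>x. a \<otimes> x)"
  unfolding linmap_def by (auto simp: A.r_distr smult_mult_right)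

lemma linmap_mult_right: "a \<in> carrier A \<Longrightarrow> linmap (\<lambda>x. x \<otimes> a)"
  unfolding linmap_def by (auto simp: A.l_distr smult_mult_left)

lemma linmap_comp: "\<lbrakk>linmap f; linmap g\<rbrakk> \<Longrightarrow> linmap (\<lambda>x. f (g x))"
  unfolding linmap_def by simp

lemma lspan_image:
  assumes "linmap f" "x \<in> lspan S" "\<And>s. \<lbrakk>s \<in> S; s \<in> carrier A\<rbrakk> \<Longrightarrow> f s \<in> N" "subsp N"
  shows "f x \<in> N"
  using assms(2)
proof (induction rule: lspan.induct)
  case zero
  then show ?case using linmap_zero[OF assms(1)] subspD(2)[OF assms(4)] by simp
next
  case (step c s v)
  then show ?case using linmapD[OF assms(1)] assms(3) subspD[OF assms(4)] lspan_carrier[of v] by auto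
qed

lemma lspan_insertE:
  assumes "x \<in> lspan (insert s B)" "s \<in> carrier A"
  obtains c v where "c \<in> carrier k" "v \<in> lspan B" "x = c \<odot> s \<oplus> v"
proof -
  have "\<exists>c v. c \<in> carrier k \<and> v \<in> lspan B \<and> x = c \<odot> s \<oplus> v"
    using assms(1)
  proof (induction rule: lspan.induct)
    case zero
    show ?case using lspan.zero[of B] assms(2)
      by (intro exI[of _ "\<zero>\<^bsub>k\<^esub>"] exI[of _ \<zero>]) (auto simp: smult_l_null)
  next
    case (step c t v)
    then obtain d w where dw: "d \<in> carrier k" "w \<in> lspan B" "v = d \<odot> s \<oplus> w" by blast
    have w: "w \<in> carrier A" using dw lspan_carrier by simp
    show ?case
    proof (cases "t = s")
      case True
      have "c \<odot> t \<oplus> v = (c \<oplus>\<^bsub>k\<^esub> d) \<odot> s \<oplus> w"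
        using True dw w step(1) assms(2) by (simp add: smult_l_distr M.a_assoc)
      then show ?thesis using dw step(1) by (intro exI[of _ "c \<oplus>\<^bsub>k\<^esub> d"] exI[of _ w]) auto
    next
      case False
      then have "c \<odot> t \<oplus> w \<in> lspan B" using step dw by (intro lspan.step) auto
      moreover have "c \<odot> t \<oplus> v = d \<odot> s \<oplus> (c \<odot> t \<oplus> w)"
        using dw w step(1,3) assms(2) by (simp add: M.a_lcomm)
      ultimately show ?thesis using dw by blast
    qed
  qed
  then show thesis using that by blast
qed

text \<open>Steinitz exchange: the coefficient of \<open>s\<close> cannot be zero, so it can be
  divided by.\<close>

lemma lspan_exchange:
  assumes "x \<in> lspan (insert s B)" "x \<notin> lspan B" "s \<in> carrier A" "B \<subseteq> carrier A"
  shows "s \<in> lspan (insert x B)"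
proof -
  obtain c v where cv: "c \<in> carrier k" "v \<in> lspan B" "x = c \<odot> s \<oplus> v"
    using lspan_insertE[OF assms(1,3)] by blast
  have cne: "c \<noteq> \<zero>\<^bsub>k\<^esub>" using cv assms(2,3) lspan_carrier[of v] by (auto simp: smult_l_null)
  have v: "v \<in> lspan (insert x B)" using cv lspan_mono by blast
  have "x \<in> carrier A" using cv assms(3) lspan_carrier by simp
  then have "c \<odot> s \<oplus> v \<in> lspan (insert x B)" using cv lspan_base by simp
  then have "c \<odot> s \<in> lspan (insert x B)"
    using subsp_add_mem[OF subsp_lspan _ _ v] cv(1) assms(3) by simp
  then show ?thesis using subsp_smult_mem[OF subsp_lspan assms(3) cv(1) cne] by blast
qed

text \<open>Steinitz's bound relative to \<open>I\<close>, with an ordered conclusion: the order of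
  the sequence decides which term of a dependence is the leading one. The induction exchanges an
  element of \<open>S\<close> for \<open>x 0\<close> and moves \<open>x 0\<close> into
  \<open>I\<close>.\<close>

lemma lspan_dependent:
  assumes "finite S" "card S \<le> n" "S \<subseteq> carrier A" "I \<subseteq> carrier A"
    and "\<And>i. i \<le> n \<Longrightarrow> x i \<in> lspan (S \<union> I)"
  shows "\<exists>m\<le>n. x m \<in> lspan (x ` {..<m} \<union> I)"
  using assms
proof (induction n arbitrary: S I x)
  case 0
  then show ?case by (intro exI[of _ 0]) simp
next
  case (Suc n)
  show ?case
  proof (cases "x 0 \<in> lspan I")
    case True
    then show ?thesis by (intro exI[of _ 0]) simp
  next
    case False
    define P where "P T \<longleftrightarrow> T \<subseteq> S \<and> x 0 \<in> lspan (T \<union> I)" for T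
    have "P S" unfolding P_def using Suc.prems(5) by simp
    then obtain T where T: "P T" "\<And>U. P U \<Longrightarrow> card T \<le> card U"
      using ex_has_least_nat[of P S card] by blast
    have finT: "finite T" using T Suc.prems(1) finite_subset P_def by blast
    have "T \<noteq> {}" using T False P_def by auto
    then obtain s where s: "s \<in> T" by blast
    have sc: "s \<in> carrier A" "s \<in> S" using s T P_def Suc.prems by blast+
    have "\<not> P (T - {s})" using T(2)[of "T - {s}"] card_Diff1_less[OF finT s] by auto
    then have nx: "x 0 \<notin> lspan ((T - {s}) \<union> I)" using T unfolding P_def by blast
    have "insert s (T - {s} \<union> I) = T \<union> I" using s by blast
    then have "x 0 \<in> lspan (insert s (T - {s} \<union> I))" using T unfolding P_def by simp
    moreover have "T - {s} \<union> I \<subseteq> carrier A" using T Suc.prems P_def by blast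
    ultimately have se: "s \<in> lspan (insert (x 0) (T - {s} \<union> I))"
      using lspan_exchange[OF _ nx sc(1)] by blast
    have x0: "x 0 \<in> carrier A" using Suc.prems(5)[of 0] lspan_carrier by simp
    have "T - {s} \<subseteq> S - {s}" using T(1) unfolding P_def by blast
    then have se': "s \<in> lspan ((S - {s}) \<union> insert (x 0) I)"
      by (intro lspan_mono[OF se]) auto
    have sub: "S \<union> I \<subseteq> lspan ((S - {s}) \<union> insert (x 0) I)"
    proof
      fix u assume u: "u \<in> S \<union> I"
      show "u \<in> lspan ((S - {s}) \<union> insert (x 0) I)"
      proof (cases "u = s")
        case True then show ?thesis using se' by simp
      next
        case False then show ?thesis using u Suc.prems(3,4) by (intro lspan_base) auto
      qed
    qed
    have "\<exists>m\<le>n. (x \<circ> Suc) m \<in> lspan ((x \<circ> Suc) ` {..<m} \<union> insert (x 0) I)"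
    proof (rule Suc.IH)
      show "finite (S - {s})" "S - {s} \<subseteq> carrier A" "insert (x 0) I \<subseteq> carrier A"
        using Suc.prems x0 by auto
      show "card (S - {s}) \<le> n" using sc(2) Suc.prems by simp
      fix i assume "i \<le> n"
      then have "x (Suc i) \<in> lspan (S \<union> I)" using Suc.prems(5) by simp
      then show "(x \<circ> Suc) i \<in> lspan ((S - {s}) \<union> insert (x 0) I)"
        using lspan_subset[of "x (Suc i)" "S \<union> I"] sub by auto
    qed
    then obtain m where m: "m \<le> n" "x (Suc m) \<in> lspan ((x \<circ> Suc) ` {..<m} \<union> insert (x 0) I)"
      by auto
    have "(x \<circ> Suc) ` {..<m} \<union> insert (x 0) I = x ` {..<Suc m} \<union> I"
      by (auto simp: lessThan_Suc_eq_insert_0 image_image)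
    then show ?thesis using m by (intro exI[of _ "Suc m"]) auto
  qed
qed

end

section \<open>Alternating sums and standard polynomials\<close>

context ring
begin

text \<open>The signed sum over all permutations of \<open>D\<close> indices, written as even part
  minus odd part, so that no scalars enter and additive maps commute with it.\<close>

definition alt :: "nat \<Rightarrow> ((nat \<Rightarrow> nat) \<Rightarrow> 'a) \<Rightarrow> 'a" where
  "alt D F = finsum R F {p. p permutes {..<D} \<and> evenperm p} \<ominus>
     finsum R F {p. p permutes {..<D} \<and> \<not> evenperm p}"

lemma finite_perms [simp]:
  "finite {p. p permutes {..<D::nat} \<and> Q p}"
  by (rule finite_subset[OF _ finite_permutations[of "{..<D}"]]) auto

lemma finsum_mem:
  assumes "additive_subgroup N R" "finite S" "\<And>s. s \<in> S \<Longrightarrow> f s \<in> N"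
  shows "finsum R f S \<in> N"
  using assms(2,3)
proof (induction S)
  case empty
  then show ?case using additive_subgroup.zero_closed[OF assms(1)] by simp
next
  case (insert s S)
  then show ?case
    using additive_subgroup.a_closed[OF assms(1)] additive_subgroup.a_Hcarr[OF assms(1)]
    by (subst finsum_insert) auto
qed

lemma additive_finsum:
  assumes "\<And>x. x \<in> carrier R \<Longrightarrow> h x \<in> carrier R"
    "\<And>x y. \<lbrakk>x \<in> carrier R; y \<in> carrier R\<rbrakk> \<Longrightarrow> h (x \<oplus> y) = h x \<oplus> h y"
    "finite S" "\<And>s. s \<in> S \<Longrightarrow> f s \<in> carrier R"
  shows "h (finsum R f S) = finsum R (\<lambda>s. h (f s)) S"
  using assms(3,4)
proof (induction S)
  case empty
  have "h \<zero> \<oplus> h \<zero> = h \<zero>" using assms(2)[of \<zero> \<zero>] by simp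
  then show ?case using assms(1)[of \<zero>] by simp
next
  case (insert s S)
  then show ?case using assms(1,2) by (simp add: Pi_def)
qed

lemma alt_closed: "(\<And>p. p permutes {..<D} \<Longrightarrow> F p \<in> carrier R) \<Longrightarrow> alt D F \<in> carrier R"
  unfolding alt_def by (intro minus_closed finsum_closed) auto

lemma alt_cong:
  assumes "\<And>p. p permutes {..<D} \<Longrightarrow> F p = G p" "\<And>p. p permutes {..<D} \<Longrightarrow> G p \<in> carrier R"
  shows "alt D F = alt D G"
  unfolding alt_def using assms by (intro arg_cong2[where f = "a_minus R"] finsum_cong') auto

lemma alt_add:
  assumes "\<And>p. p permutes {..<D} \<Longrightarrow> F p \<in> carrier R" "\<And>p. p permutes {..<D} \<Longrightarrow> G p \<in> carrier R"
  shows "alt D (\<lambda>p. F p \<oplus> G p) = alt D F \<oplus> alt D G"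
proof -
  let ?E = "{p. p permutes {..<D} \<and> evenperm p}" and ?O = "{p. p permutes {..<D} \<and> \<not> evenperm p}"
  have "finsum R (\<lambda>p. F p \<oplus> G p) ?E = finsum R F ?E \<oplus> finsum R G ?E"
    "finsum R (\<lambda>p. F p \<oplus> G p) ?O = finsum R F ?O \<oplus> finsum R G ?O"
    using assms by (intro finsum_addf; auto)+
  moreover have "finsum R F ?E \<in> carrier R" "finsum R G ?E \<in> carrier R"
    "finsum R F ?O \<in> carrier R" "finsum R G ?O \<in> carrier R"
    using assms by (intro finsum_closed; auto)+
  ultimately show ?thesis unfolding alt_def by (simp add: a_minus_def minus_add a_ac)
qed

lemma alt_mem:
  assumes "additive_subgroup N R" "\<And>p. p permutes {..<D} \<Longrightarrow> F p \<in> N"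
  shows "alt D F \<in> N"
proof -
  have "finsum R F {p. p permutes {..<D} \<and> evenperm p} \<in> N"
    "finsum R F {p. p permutes {..<D} \<and> \<not> evenperm p} \<in> N"
    using assms by (intro finsum_mem; auto)+
  then show ?thesis unfolding alt_def a_minus_def
    using additive_subgroup.a_closed[OF assms(1)] additive_subgroup.a_inv_closed[OF assms(1)] by blast
qed

lemma alt_additive:
  assumes "\<And>x. x \<in> carrier R \<Longrightarrow> h x \<in> carrier R"
    "\<And>x y. \<lbrakk>x \<in> carrier R; y \<in> carrier R\<rbrakk> \<Longrightarrow> h (x \<oplus> y) = h x \<oplus> h y"
    "\<And>p. p permutes {..<D} \<Longrightarrow> F p \<in> carrier R"
  shows "h (alt D F) = alt D (\<lambda>p. h (F p))"
proof -
  let ?E = "{p. p permutes {..<D} \<and> evenperm p}" and ?O = "{p. p permutes {..<D} \<and> \<not> evenperm p}"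
  have c: "finsum R F ?E \<in> carrier R" "finsum R F ?O \<in> carrier R"
    using assms by (intro finsum_closed; auto)+
  have m: "h (x \<ominus> y) = h x \<ominus> h y" if "x \<in> carrier R" "y \<in> carrier R" for x y
  proof -
    have "h x = h (x \<ominus> y) \<oplus> h y" using assms(2)[of "x \<ominus> y" y] that
      by (simp add: a_minus_def a_assoc l_neg)
    then show ?thesis using that assms(1)[of x] assms(1)[of y] assms(1)[of "x \<ominus> y"]
      by (simp add: a_minus_def a_assoc r_neg)
  qed
  have "h (finsum R F ?E) = finsum R (\<lambda>p. h (F p)) ?E" "h (finsum R F ?O) = finsum R (\<lambda>p. h (F p)) ?O"
    using assms by (intro additive_finsum; auto)+
  then show ?thesis unfolding alt_def using m[OF c] by simp
qed

text \<open>Composition with the transposition pairs even permutations with odd ones, and paired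
  terms agree.\<close>

lemma alt_swap:
  assumes "i < D" "j < D" "i \<noteq> j"
    and F: "\<And>p. p permutes {..<D} \<Longrightarrow> F p \<in> carrier R"
    and s: "\<And>p. p permutes {..<D} \<Longrightarrow> F (p \<circ> transpose i j) = F p"
  shows "alt D F = \<zero>"
proof -
  let ?E = "{p. p permutes {..<D} \<and> evenperm p}" and ?O = "{p. p permutes {..<D} \<and> \<not> evenperm p}"
  let ?h = "\<lambda>p. p \<circ> transpose i j"
  have t: "transpose i j permutes {..<D}" using assms by (intro permutes_swap_id) auto
  have perm: "permutation p" if "p permutes {..<D}" for p
    using that permutation_permutes by blast
  have ev: "evenperm (?h p) \<longleftrightarrow> \<not> evenperm p" if "p permutes {..<D}" for p
    using evenperm_comp[OF perm[OF that] perm[OF t]] evenperm_swap[of i j] assms(3) by simp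
  have inv: "?h (?h p) = p" for p :: "nat \<Rightarrow> nat" by (simp add: fun_eq_iff)
  have im: "?h ` ?E = ?O"
  proof
    show "?h ` ?E \<subseteq> ?O" using ev permutes_compose[OF t] by auto
    show "?O \<subseteq> ?h ` ?E"
    proof
      fix p assume "p \<in> ?O"
      then have "?h p \<in> ?E" using ev permutes_compose[OF t] by auto
      then show "p \<in> ?h ` ?E" by (rule image_eqI[of p ?h "?h p", OF inv[symmetric]])
    qed
  qed
  have inj: "inj_on ?h ?E" by (rule inj_on_inverseI[where g = ?h]) (rule inv)
  have "finsum R F ?O = finsum R F (?h ` ?E)" using im by simp
  also have "\<dots> = finsum R (\<lambda>p. F (?h p)) ?E"
    by (rule finsum_reindex[OF _ inj]) (use F im in auto)
  also have "\<dots> = finsum R F ?E" using F s by (intro finsum_cong') auto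
  finally have "finsum R F ?O = finsum R F ?E" .
  moreover have "finsum R F ?E \<in> carrier R" using F by (intro finsum_closed) auto
  ultimately show ?thesis unfolding alt_def by (simp add: a_minus_def r_neg)
qed

lemma alt_finsum_mem:
  assumes N: "additive_subgroup N R" and "finite Q"
    and "\<And>q p. \<lbrakk>q \<in> Q; p permutes {..<D}\<rbrakk> \<Longrightarrow> G q p \<in> carrier R"
    and "\<And>q. q \<in> Q \<Longrightarrow> alt D (G q) \<in> N"
  shows "alt D (\<lambda>p. finsum R (\<lambda>q. G q p) Q) \<in> N"
  using assms(2-)
proof (induction Q)
  case empty
  then show ?case using additive_subgroup.zero_closed[OF N] by (intro alt_mem[OF N]) simp
next
  case (insert q Q)
  have "alt D (\<lambda>p. finsum R (\<lambda>q. G q p) (insert q Q)) = alt D (\<lambda>p. G q p \<oplus> finsum R (\<lambda>q. G q p) Q)"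
    using insert by (intro alt_cong) (auto intro!: finsum_closed)
  also have "\<dots> = alt D (G q) \<oplus> alt D (\<lambda>p. finsum R (\<lambda>q. G q p) Q)"
    using insert by (intro alt_add) (auto intro!: finsum_closed)
  finally show ?case using insert additive_subgroup.a_closed[OF N] by simp
qed

text \<open>A weak form of the Amitsur-Levitzki theorem: modulo \<open>N\<close>, and after spending
  one factor \<open>z\<close>, each \<open>T l\<close> acts on \<open>Y\<close> as a matrix over the
  commutative set \<open>C\<close>, and there are fewer matrix units than the \<open>D\<close>
  operators. Keeping \<open>T\<close> abstract covers left and right multiplications alike.\<close>

lemma alternating_operators_vanish:
  fixes T :: "nat \<Rightarrow> 'a \<Rightarrow> 'a"
  assumes N: "additive_subgroup N R"
    and T: "\<And>l x. x \<in> carrier R \<Longrightarrow> T l x \<in> carrier R"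
      "\<And>l x y. \<lbrakk>x \<in> carrier R; y \<in> carrier R\<rbrakk> \<Longrightarrow> T l (x \<oplus> y) = T l x \<oplus> T l y"
      "\<And>l x. x \<in> N \<Longrightarrow> T l x \<in> N"
      "\<And>l x d. \<lbrakk>x \<in> carrier R; d \<in> C\<rbrakk> \<Longrightarrow> T l (x \<otimes> d) = T l x \<otimes> d"
    and C: "C \<subseteq> carrier R" "\<one> \<in> C" "\<And>x y. \<lbrakk>x \<in> C; y \<in> C\<rbrakk> \<Longrightarrow> x \<otimes> y \<in> C"
      "\<And>x y. \<lbrakk>x \<in> C; y \<in> C\<rbrakk> \<Longrightarrow> x \<otimes> y = y \<otimes> x"
      "\<And>x y. \<lbrakk>x \<in> N; y \<in> C\<rbrakk> \<Longrightarrow> x \<otimes> y \<in> N"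
    and Y: "finite Y" "Y \<subseteq> carrier R" "card Y * card Y < D"
    and z: "z \<in> C" and c: "\<And>l y q. c l y q \<in> C"
    and rel: "\<And>l y. \<lbrakk>l < D; y \<in> Y\<rbrakk> \<Longrightarrow> (T l y \<otimes> z) \<ominus> finsum R (\<lambda>q. q \<otimes> c l y q) Y \<in> N"
    and y: "y \<in> Y"
  shows "alt D (\<lambda>p. foldr (\<lambda>i. T (p i)) [0..<D] (y \<otimes> z [^] D)) \<in> N"
proof -
  let ?M = "R\<lparr>carrier := C\<rparr>"
  have Cc: "x \<in> C \<Longrightarrow> x \<in> carrier R" for x using C(1) by blast
  have Nc: "x \<in> N \<Longrightarrow> x \<in> carrier R" for x using additive_subgroup.a_Hcarr[OF N] .
  interpret M: comm_monoid ?M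
    by unfold_locales (auto simp: m_assoc Cc C(2,3) intro: C(4))
  \<comment> \<open>\<open>e i\<close> records the pair (source, target) of generators used at
    position \<open>i\<close>; \<open>P m p e\<close> multiplies the matrix entries met at the
    positions from \<open>m\<close> on.\<close>
  define P where "P m p e = finprod ?M (\<lambda>i. c (p i) (fst (e i)) (snd (e i))) {m..<D}"
    for m :: nat and p :: "nat \<Rightarrow> nat" and e :: "nat \<Rightarrow> 'a \<times> 'a"
  have PC: "P m p e \<in> C" for m p e
    using M.finprod_closed[of "\<lambda>i. c (p i) (fst (e i)) (snd (e i))" "{m..<D}"] c unfolding P_def by auto
  have zC: "z [^] m \<in> C" for m :: nat using z C(2,3) by (induction m) auto
  define W where "W m p x = foldr (\<lambda>i. T (p i)) [0..<m] x" for m :: nat and p :: "nat \<Rightarrow> nat" and x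
  have Wc: "x \<in> carrier R \<Longrightarrow> foldr (\<lambda>i. T (p i)) ms x \<in> carrier R" for p x and ms :: "nat list"
    by (induction ms) (auto simp: T)
  have Wadd: "\<lbrakk>x \<in> carrier R; y \<in> carrier R\<rbrakk> \<Longrightarrow>
      foldr (\<lambda>i. T (p i)) ms (x \<oplus> y) = foldr (\<lambda>i. T (p i)) ms x \<oplus> foldr (\<lambda>i. T (p i)) ms y"
    for p x y and ms :: "nat list"
    by (induction ms) (auto simp: T Wc)
  have WN: "x \<in> N \<Longrightarrow> foldr (\<lambda>i. T (p i)) ms x \<in> N" for p x and ms :: "nat list"
    by (induction ms) (auto simp: T)
  note Yc = subsetD[OF Y(2)]
  \<comment> \<open>\<open>m\<close> operators are still to be applied. The step from
    \<open>Suc m\<close> to \<open>m\<close> applies the innermost one, at position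
    \<open>m\<close>, and expands the result along \<open>Y\<close>, using up one
    \<open>z\<close>.\<close>
  have main: "alt D (\<lambda>p. W m p (y \<otimes> (z [^] m \<otimes> P m p e))) \<in> N"
    if "m \<le> D" "y \<in> Y" "\<And>i. i < D \<Longrightarrow> e i \<in> Y \<times> Y" for m y and e :: "nat \<Rightarrow> 'a \<times> 'a"
    using that
  proof (induction m arbitrary: y e)
    case 0
    \<comment> \<open>Pigeonhole: two positions use the same pair of generators, and swapping them
      only permutes the factors of a commutative product.\<close>
    have "\<not> inj_on e {..<D}"
    proof
      assume "inj_on e {..<D}"
      moreover have "e ` {..<D} \<subseteq> Y \<times> Y" using 0(3) by blast
      ultimately have "card {..<D} \<le> card (Y \<times> Y)" using Y(1) by (intro card_inj_on_le) simp_all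
      then show False using Y by (simp add: card_cartesian_product)
    qed
    then obtain i j where ij: "i < D" "j < D" "i \<noteq> j" "e i = e j" unfolding inj_on_def by auto
    have et: "e (transpose i j l) = e l" for l using ij(4) unfolding transpose_def by simp
    have "P 0 (p \<circ> transpose i j) e = P 0 p e" for p
    proof -
      let ?g = "\<lambda>i. c (p i) (fst (e i)) (snd (e i))"
      have "transpose i j permutes {0..<D}" using ij by (intro permutes_swap_id) auto
      then have im: "transpose i j ` {0..<D} = {0..<D}" by (rule permutes_image)
      have "P 0 (p \<circ> transpose i j) e = finprod ?M (\<lambda>l. ?g (transpose i j l)) {0..<D}"
        unfolding P_def using et by simp
      also have "\<dots> = finprod ?M ?g (transpose i j ` {0..<D})"
        by (rule M.finprod_reindex[symmetric]) (use c in \<open>auto intro: inj_on_transpose\<close>)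
      finally show ?thesis using im unfolding P_def by simp
    qed
    then have "alt D (\<lambda>p. W 0 p (y \<otimes> (z [^] (0::nat) \<otimes> P 0 p e))) = \<zero>"
      using 0(2) Yc PC Cc unfolding W_def by (intro alt_swap[OF ij(1-3)]) auto
    then show ?case using additive_subgroup.zero_closed[OF N] by simp
  next
    case (Suc m)
    define e' where "e' q = e(m := (y, q))" for q
    let ?F = "\<lambda>p. W (Suc m) p (y \<otimes> (z [^] Suc m \<otimes> P (Suc m) p e))"
    let ?G = "\<lambda>q p. W m p (q \<otimes> (z [^] m \<otimes> P m p (e' q)))"
    have yc: "y \<in> carrier R" using Suc.prems Yc by blast
    have Gc: "?G q p \<in> carrier R" if "q \<in> Y" for q p
      using that Yc PC zC Cc unfolding W_def by (intro Wc) auto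
    have Fc: "?F p \<in> carrier R" for p using yc PC zC[of "Suc m"] Cc unfolding W_def by (intro Wc) auto
    have diff: "?F p \<ominus> finsum R (\<lambda>q. ?G q p) Y \<in> N" if p: "p permutes {..<D}" for p
    proof -
      let ?d = "z [^] m \<otimes> P (Suc m) p e"
      let ?l = "p m"
      have l: "?l < D" using permutes_in_image[OF p, of m] Suc.prems(1) by simp
      have dC: "?d \<in> C" using zC PC C by blast
      have zm: "z [^] Suc m \<otimes> P (Suc m) p e = z \<otimes> ?d"
        using C(4)[OF zC[of m] z] Cc[OF zC[of m]] Cc[OF z] Cc[OF PC] by (simp add: m_assoc)
      have "T ?l (y \<otimes> (z [^] Suc m \<otimes> P (Suc m) p e)) = T ?l y \<otimes> (z \<otimes> ?d)"
        unfolding zm using T(4)[OF yc, of "z \<otimes> ?d"] C(3)[OF z dC] by simp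
      also have "\<dots> = (T ?l y \<otimes> z) \<otimes> ?d"
        using T(1)[OF yc] Cc[OF z] Cc[OF dC] by (simp add: m_assoc)
      finally have 1: "?F p = W m p ((T ?l y \<otimes> z) \<otimes> ?d)"
        unfolding W_def by simp
      define s where "s = finsum R (\<lambda>q. q \<otimes> c ?l y q) Y"
      have cc: "c ?l y q \<in> carrier R" for q using c Cc by blast
      have sc: "s \<in> carrier R" unfolding s_def using Yc cc by (intro finsum_closed) auto
      have 2: "finsum R (\<lambda>q. ?G q p) Y = W m p (s \<otimes> ?d)"
      proof -
        have "s \<otimes> ?d = finsum R (\<lambda>q. (q \<otimes> c ?l y q) \<otimes> ?d) Y"
          unfolding s_def using Y(1) Yc cc Cc[OF dC] by (intro finsum_ldistr) auto
        also have "\<dots> = finsum R (\<lambda>q. q \<otimes> (z [^] m \<otimes> P m p (e' q))) Y"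
        proof (rule finsum_cong')
          show "(\<lambda>q. q \<otimes> (z [^] m \<otimes> P m p (e' q))) \<in> Y \<rightarrow> carrier R"
            using Yc PC zC Cc by blast
          fix q assume q: "q \<in> Y"
          have ins: "{m..<D} = insert m {Suc m..<D}" using Suc.prems(1) by auto
          have "P m p (e' q) = c ?l y q \<otimes> finprod ?M (\<lambda>i. c (p i) (fst (e' q i)) (snd (e' q i))) {Suc m..<D}"
            unfolding P_def ins using c by (subst M.finprod_insert) (auto simp: e'_def)
          also have "finprod ?M (\<lambda>i. c (p i) (fst (e' q i)) (snd (e' q i))) {Suc m..<D} = P (Suc m) p e"
            unfolding P_def using c by (intro M.finprod_cong') (auto simp: e'_def)
          finally have Pm: "P m p (e' q) = c ?l y q \<otimes> P (Suc m) p e" .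
          have "c ?l y q \<otimes> ?d = z [^] m \<otimes> (c ?l y q \<otimes> P (Suc m) p e)"
            using C(4)[OF c[of ?l y q] zC[of m]] cc[of q] Cc[OF zC[of m]] Cc[OF PC]
            by (metis m_assoc)
          then show "(q \<otimes> c ?l y q) \<otimes> ?d = q \<otimes> (z [^] m \<otimes> P m p (e' q))"
            unfolding Pm using Yc[OF q] cc[of q] Cc[OF dC] by (simp add: m_assoc)
        qed auto
        finally have sd: "s \<otimes> ?d = finsum R (\<lambda>q. q \<otimes> (z [^] m \<otimes> P m p (e' q))) Y" .
        show ?thesis unfolding sd W_def
          by (rule additive_finsum[symmetric]) (use Wc Wadd Y(1) Yc PC zC Cc in auto)
      qed
      have "(T ?l y \<otimes> z) \<ominus> s \<in> N" unfolding s_def by (rule rel[OF l Suc.prems(2)])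
      then have n: "((T ?l y \<otimes> z) \<ominus> s) \<otimes> ?d \<in> N" using C(5) dC by blast
      have tz: "T ?l y \<otimes> z \<in> carrier R" using T(1)[OF yc] Cc[OF z] by simp
      have "(T ?l y \<otimes> z) \<otimes> ?d = ((T ?l y \<otimes> z) \<ominus> s) \<otimes> ?d \<oplus> s \<otimes> ?d"
        using tz sc Cc[OF dC] by (simp add: a_minus_def l_distr[symmetric] a_assoc l_neg)
      then have "?F p = W m p (((T ?l y \<otimes> z) \<ominus> s) \<otimes> ?d) \<oplus> finsum R (\<lambda>q. ?G q p) Y"
        unfolding 1 2 using Wadd[of "((T ?l y \<otimes> z) \<ominus> s) \<otimes> ?d" "s \<otimes> ?d"] Nc[OF n] sc Cc[OF dC]
        unfolding W_def by simp
      moreover have "W m p (((T ?l y \<otimes> z) \<ominus> s) \<otimes> ?d) \<in> N" unfolding W_def using WN[OF n] .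
      moreover have "finsum R (\<lambda>q. ?G q p) Y \<in> carrier R" using Gc by (intro finsum_closed) auto
      ultimately show ?thesis using Nc by (simp add: a_minus_def a_assoc r_neg)
    qed
    have "alt D ?F = alt D (\<lambda>p. (?F p \<ominus> finsum R (\<lambda>q. ?G q p) Y) \<oplus> finsum R (\<lambda>q. ?G q p) Y)"
    proof (rule alt_cong)
      fix p :: "nat \<Rightarrow> nat"
      have "finsum R (\<lambda>q. ?G q p) Y \<in> carrier R" using Gc by (intro finsum_closed) auto
      then show "?F p = (?F p \<ominus> finsum R (\<lambda>q. ?G q p) Y) \<oplus> finsum R (\<lambda>q. ?G q p) Y"
        "(?F p \<ominus> finsum R (\<lambda>q. ?G q p) Y) \<oplus> finsum R (\<lambda>q. ?G q p) Y \<in> carrier R"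
        using Fc[of p] by (simp_all add: a_minus_def a_assoc l_neg)
    qed
    also have "\<dots> = alt D (\<lambda>p. ?F p \<ominus> finsum R (\<lambda>q. ?G q p) Y) \<oplus> alt D (\<lambda>p. finsum R (\<lambda>q. ?G q p) Y)"
      by (rule alt_add) (use Fc Gc in \<open>auto intro!: minus_closed finsum_closed\<close>)
    also have "\<dots> \<in> N"
    proof (rule additive_subgroup.a_closed[OF N])
      show "alt D (\<lambda>p. ?F p \<ominus> finsum R (\<lambda>q. ?G q p) Y) \<in> N" by (rule alt_mem[OF N diff])
      show "alt D (\<lambda>p. finsum R (\<lambda>q. ?G q p) Y) \<in> N"
      proof (rule alt_finsum_mem[OF N Y(1)])
        fix q assume q: "q \<in> Y"
        show "alt D (?G q) \<in> N"
          using Suc.prems q by (intro Suc.IH) (auto simp: e'_def)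
      qed (use Gc in auto)
    qed
    finally show ?case .
  qed
  have "alt D (\<lambda>p. W D p (y \<otimes> (z [^] D \<otimes> P D p (\<lambda>_. (y, y))))) \<in> N"
    using y by (intro main) auto
  then show ?thesis using Cc[OF zC[of D]] unfolding W_def P_def by simp
qed

lemma word_val_closed: "set ws \<subseteq> carrier R \<Longrightarrow> word_val R ws \<in> carrier R"
  by (induction ws) (auto simp: word_val_def)

lemma word_val_Nil [simp]: "word_val R [] = \<one>" and
  word_val_Cons [simp]: "word_val R (x # ws) = x \<otimes> word_val R ws"
  by (simp_all add: word_val_def)

lemma word_val_append:
  "\<lbrakk>set u \<subseteq> carrier R; set w \<subseteq> carrier R\<rbrakk> \<Longrightarrow> word_val R (u @ w) = word_val R u \<otimes> word_val R w"
  by (induction u) (auto simp: word_val_closed m_assoc)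

lemma foldr_mult_left:
  "\<lbrakk>\<And>i. f i \<in> carrier R; x \<in> carrier R\<rbrakk> \<Longrightarrow>
    foldr (\<lambda>i x. f i \<otimes> x) is x = word_val R (map f is) \<otimes> x"
proof (induction "is")
  case (Cons i js)
  then show ?case by (simp add: word_val_closed image_subset_iff m_assoc)
qed simp

lemma foldr_mult_right:
  "\<lbrakk>\<And>i. f i \<in> carrier R; x \<in> carrier R\<rbrakk> \<Longrightarrow>
    foldr (\<lambda>i x. x \<otimes> f i) is x = x \<otimes> word_val R (map f (rev is))"
proof (induction "is")
  case (Cons i js)
  have "word_val R (map f (rev js) @ [f i]) = word_val R (map f (rev js)) \<otimes> f i"
    using Cons.prems(1) by (subst word_val_append) (auto simp: image_subset_iff)
  then show ?case using Cons by (simp add: word_val_closed image_subset_iff m_assoc)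
qed simp

definition stdp :: "nat \<Rightarrow> (nat \<Rightarrow> 'a) \<Rightarrow> 'a" where
  "stdp D a = alt D (\<lambda>p. word_val R (map (a \<circ> p) [0..<D]))"

text \<open>The standard polynomial with all words reversed, hence equal to it up to sign. This is
  the form that right multiplications produce, since composing them reverses the order of the
  factors.\<close>

definition rstdp :: "nat \<Rightarrow> (nat \<Rightarrow> 'a) \<Rightarrow> 'a" where
  "rstdp D a = alt D (\<lambda>p. word_val R (map (a \<circ> p) (rev [0..<D])))"

lemma stdp_closed: "(\<And>i. a i \<in> carrier R) \<Longrightarrow> stdp D a \<in> carrier R"
  unfolding stdp_def by (intro alt_closed word_val_closed) (auto simp: image_subset_iff)

lemma rstdp_closed: "(\<And>i. a i \<in> carrier R) \<Longrightarrow> rstdp D a \<in> carrier R"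
  unfolding rstdp_def by (intro alt_closed word_val_closed) (auto simp: image_subset_iff)

end

section \<open>Right modules over \<open>k[v]\<close> and their annihilation by standard
  polynomials\<close>

context kalg
begin

lemma ideal_subsp:
  assumes "ideal I A" shows "subsp I"
proof -
  interpret I: ideal I A by fact
  have "c \<odot> x \<in> I" if "c \<in> carrier k" "x \<in> I" for c x
  proof -
    have "c \<odot> x = (c \<odot> \<one>) \<otimes> x" using that I.a_Hcarr[of x] smult_mult_left[of c \<one> x] by simp
    then show ?thesis using that I.I_l_closed[of x "c \<odot> \<one>"] by simp
  qed
  then show ?thesis
    unfolding subsp_def using I.a_Hcarr additive_subgroup.zero_closed[OF I.additive_subgroup_axioms]
      additive_subgroup.a_closed[OF I.additive_subgroup_axioms] by auto
qed

lemma ideal_additive_subgroup: "ideal I A \<Longrightarrow> additive_subgroup I A"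
  using ideal_def by blast

lemma idealD:
  assumes "ideal I A"
  shows "x \<in> I \<Longrightarrow> x \<in> carrier A" "\<lbrakk>x \<in> I; a \<in> carrier A\<rbrakk> \<Longrightarrow> a \<otimes> x \<in> I"
    "\<lbrakk>x \<in> I; a \<in> carrier A\<rbrakk> \<Longrightarrow> x \<otimes> a \<in> I"
  using ideal.I_l_closed[OF assms] ideal.I_r_closed[OF assms] subspD(1)[OF ideal_subsp[OF assms]] by auto

text \<open>The subalgebra \<open>k[v]\<close> and, modulo \<open>I\<close>, the right \<open>k[v]\<close>-module generated by \<open>Y\<close>.\<close>

definition KV :: "'c \<Rightarrow> 'c set" where
  "KV v = lspan (range (\<lambda>b::nat. v [^] b))"

definition YK :: "'c set \<Rightarrow> 'c \<Rightarrow> 'c set \<Rightarrow> 'c set" where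
  "YK Y v I = lspan ({y \<otimes> v [^] b | y b. y \<in> Y \<and> b \<in> (UNIV :: nat set)} \<union> I)"

lemma subsp_YK: "subsp (YK Y v I)"
  unfolding YK_def by (rule subsp_lspan)

lemma YK_mono: "\<lbrakk>x \<in> YK Y v I; Y \<subseteq> Y'; I \<subseteq> I'\<rbrakk> \<Longrightarrow> x \<in> YK Y' v I'"
  unfolding YK_def by (erule lspan_mono) auto

lemma YK_base: "\<lbrakk>y \<in> Y; y \<in> carrier A; v \<in> carrier A\<rbrakk> \<Longrightarrow> y \<otimes> v [^] (b::nat) \<in> YK Y v I"
  unfolding YK_def by (rule lspan_base) auto

lemma YK_gen: "\<lbrakk>y \<in> Y; y \<in> carrier A; v \<in> carrier A\<rbrakk> \<Longrightarrow> y \<in> YK Y v I"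
  using YK_base[of y Y v 0 I] by simp

lemma YK_ideal: "\<lbrakk>x \<in> I; I \<subseteq> carrier A\<rbrakk> \<Longrightarrow> x \<in> YK Y v I"
  unfolding YK_def by (rule lspan_base) auto

context
  fixes v assumes v: "v \<in> carrier A"
begin

lemma KV_carrier: "d \<in> KV v \<Longrightarrow> d \<in> carrier A"
  unfolding KV_def by (rule lspan_carrier)

lemma KV_pow: "v [^] (b::nat) \<in> KV v"
  unfolding KV_def using v by (intro lspan_base) auto

lemma KV_one: "\<one> \<in> KV v"
  using KV_pow[of 0] v by simp

lemma KV_mult:
  assumes "x \<in> KV v" "y \<in> KV v" shows "x \<otimes> y \<in> KV v"
proof -
  have 1: "v [^] (b::nat) \<otimes> y \<in> KV v" for b
  proof (rule lspan_image[OF linmap_mult_left])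
    show "y \<in> lspan (range (\<lambda>b::nat. v [^] b))" using assms(2) unfolding KV_def .
    fix s assume "s \<in> range (\<lambda>b::nat. v [^] b)"
    then show "v [^] b \<otimes> s \<in> KV v" using KV_pow v by (auto simp: A.nat_pow_mult)
  qed (use v in \<open>auto simp: KV_def subsp_lspan\<close>)
  show ?thesis
  proof (rule lspan_image[OF linmap_mult_right])
    show "x \<in> lspan (range (\<lambda>b::nat. v [^] b))" using assms(1) unfolding KV_def .
  qed (use 1 KV_carrier[OF assms(2)] in \<open>auto simp: KV_def subsp_lspan\<close>)
qed

lemma KV_comm:
  assumes "x \<in> KV v" "y \<in> KV v" shows "x \<otimes> y = y \<otimes> x"
proof -
  have c: "subsp {y \<in> carrier A. x \<otimes> y = y \<otimes> x}" if "x \<in> carrier A" for x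
    using that unfolding subsp_def
    by (auto simp: A.r_distr A.l_distr smult_mult_left smult_mult_right)
  have 1: "v [^] (b::nat) \<otimes> y = y \<otimes> v [^] b" for b
  proof -
    have "y \<in> {y \<in> carrier A. v [^] b \<otimes> y = y \<otimes> v [^] b}"
      by (rule lspan_least[OF c, of _ _ "range (\<lambda>b::nat. v [^] b)"])
        (use assms v in \<open>auto simp: KV_def A.nat_pow_mult add.commute\<close>)
    then show ?thesis by simp
  qed
  have "x \<in> {x \<in> carrier A. y \<otimes> x = x \<otimes> y}"
    by (rule lspan_least[OF c, of _ _ "range (\<lambda>b::nat. v [^] b)"])
      (use assms v 1 KV_carrier in \<open>auto simp: KV_def\<close>)
  then show ?thesis by simp
qed

lemma KV_nat_pow: "d \<in> KV v \<Longrightarrow> d [^] (n::nat) \<in> KV v"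
  by (induction n) (auto simp: KV_one KV_mult)

lemma subsp_KV: "subsp (KV v)"
  unfolding KV_def by (rule subsp_lspan)

lemma YK_mult:
  assumes I: "ideal I A" and "Y \<subseteq> carrier A" "x \<in> YK Y v I" "d \<in> KV v"
  shows "x \<otimes> d \<in> YK Y v I"
proof (rule lspan_image[OF linmap_mult_right])
  show "d \<in> carrier A" using assms KV_carrier by blast
  show "x \<in> lspan ({y \<otimes> v [^] b | y b. y \<in> Y \<and> b \<in> (UNIV :: nat set)} \<union> I)"
    using assms(3) unfolding YK_def .
  show "subsp (YK Y v I)" by (rule subsp_YK)
  fix s assume s: "s \<in> {y \<otimes> v [^] b | y b. y \<in> Y \<and> b \<in> (UNIV :: nat set)} \<union> I"
  show "s \<otimes> d \<in> YK Y v I"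
  proof (cases "s \<in> I")
    case True
    have "s \<otimes> d \<in> I" by (rule idealD(3)[OF I True \<open>d \<in> carrier A\<close>])
    then show ?thesis by (rule YK_ideal) (rule subsetI, erule idealD(1)[OF I])
  next
    case False
    then obtain y b where yb: "y \<in> Y" "s = y \<otimes> v [^] (b::nat)" using s by blast
    have yc: "y \<in> carrier A" using yb assms by blast
    have sc: "s \<in> carrier A" using yb yc v by simp
    show ?thesis
    proof (rule lspan_image[OF linmap_mult_left[OF sc]])
      show "d \<in> lspan (range (\<lambda>b::nat. v [^] b))" using assms(4) unfolding KV_def .
      fix t assume "t \<in> range (\<lambda>b::nat. v [^] b)"
      then obtain a where "t = v [^] (a::nat)" by blast
      then have "s \<otimes> t = y \<otimes> v [^] (b + a)" using yb yc v by (simp add: A.m_assoc A.nat_pow_mult)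
      then show "s \<otimes> t \<in> YK Y v I" using YK_base[OF yb(1) yc v] by simp
    qed (rule subsp_YK)
  qed
qed

lemma YK_coeffs:
  assumes I: "ideal I A" and Y: "finite Y" "Y \<subseteq> carrier A" and x: "x \<in> YK Y v I"
  shows "\<exists>c. (\<forall>q. c q \<in> KV v) \<and> x \<ominus> finsum A (\<lambda>q. q \<otimes> c q) Y \<in> I"
proof -
  let ?P = "{x \<in> carrier A. \<exists>c. (\<forall>q. c q \<in> KV v) \<and> x \<ominus> finsum A (\<lambda>q. q \<otimes> c q) Y \<in> I}"
  note Is = ideal_subsp[OF I]
  have fc: "finsum A (\<lambda>q. q \<otimes> c q) Y \<in> carrier A" if "\<forall>q. c q \<in> KV v" for c
    using that Y KV_carrier by (intro M.finsum_closed) auto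
  have K0: "\<zero> \<in> KV v" using subspD(2)[OF subsp_KV] .
  have fz: "finsum A (\<lambda>q. q \<otimes> \<zero>) Y = \<zero>"
  proof -
    have "finsum A (\<lambda>q. q \<otimes> \<zero>) Y = finsum A (\<lambda>_. \<zero>) Y"
      using Y(2) by (intro M.finsum_cong') auto
    then show ?thesis by simp
  qed
  have mem: "x \<in> ?P" if "x \<in> carrier A" "\<forall>q. c q \<in> KV v" "x \<ominus> finsum A (\<lambda>q. q \<otimes> c q) Y \<in> I" for x c
    using that by blast
  have "subsp ?P"
    unfolding subsp_def
  proof (intro conjI ballI)
    show "\<zero> \<in> ?P" using fz K0 subspD(2)[OF Is] by (intro mem[of _ "\<lambda>_. \<zero>"]) (auto simp: a_minus_def)
  next
    fix x y assume "x \<in> ?P" "y \<in> ?P"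
    then obtain c d where c: "\<forall>q. c q \<in> KV v" "x \<ominus> finsum A (\<lambda>q. q \<otimes> c q) Y \<in> I" "x \<in> carrier A"
      and d: "\<forall>q. d q \<in> KV v" "y \<ominus> finsum A (\<lambda>q. q \<otimes> d q) Y \<in> I" "y \<in> carrier A" by blast
    have e: "finsum A (\<lambda>q. q \<otimes> (c q \<oplus> d q)) Y = finsum A (\<lambda>q. q \<otimes> c q) Y \<oplus> finsum A (\<lambda>q. q \<otimes> d q) Y"
    proof -
      have "finsum A (\<lambda>q. q \<otimes> (c q \<oplus> d q)) Y = finsum A (\<lambda>q. q \<otimes> c q \<oplus> q \<otimes> d q) Y"
        using Y c d KV_carrier by (intro M.finsum_cong') (auto simp: A.r_distr subset_iff)
      also have "\<dots> = finsum A (\<lambda>q. q \<otimes> c q) Y \<oplus> finsum A (\<lambda>q. q \<otimes> d q) Y"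
        using Y c d KV_carrier by (intro M.finsum_addf) auto
      finally show ?thesis .
    qed
    have "(x \<oplus> y) \<ominus> (finsum A (\<lambda>q. q \<otimes> c q) Y \<oplus> finsum A (\<lambda>q. q \<otimes> d q) Y)
      = (x \<ominus> finsum A (\<lambda>q. q \<otimes> c q) Y) \<oplus> (y \<ominus> finsum A (\<lambda>q. q \<otimes> d q) Y)"
      using fc[OF c(1)] fc[OF d(1)] c(3) d(3) by (simp add: a_minus_def M.minus_add M.a_ac)
    then show "x \<oplus> y \<in> ?P"
      using c d e subspD(3)[OF Is c(2) d(2)] subspD(3)[OF subsp_KV]
      by (intro mem[of _ "\<lambda>q. c q \<oplus> d q"]) auto
  next
    fix \<alpha> x assume \<alpha>: "\<alpha> \<in> carrier k" and "x \<in> ?P"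
    then obtain c where c: "\<forall>q. c q \<in> KV v" "x \<ominus> finsum A (\<lambda>q. q \<otimes> c q) Y \<in> I" "x \<in> carrier A" by blast
    have "finsum A (\<lambda>q. q \<otimes> (\<alpha> \<odot> c q)) Y = finsum A (\<lambda>q. \<alpha> \<odot> (q \<otimes> c q)) Y"
      using Y c \<alpha> KV_carrier by (intro M.finsum_cong') (auto simp: smult_mult_right subset_iff)
    also have "\<dots> = \<alpha> \<odot> finsum A (\<lambda>q. q \<otimes> c q) Y"
      by (rule A.additive_finsum[of "\<lambda>x. \<alpha> \<odot> x", symmetric])
        (use Y c \<alpha> KV_carrier in \<open>auto simp: smult_r_distr subset_iff\<close>)
    finally have e: "finsum A (\<lambda>q. q \<otimes> (\<alpha> \<odot> c q)) Y = \<alpha> \<odot> finsum A (\<lambda>q. q \<otimes> c q) Y" .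
    have "\<alpha> \<odot> x \<ominus> \<alpha> \<odot> finsum A (\<lambda>q. q \<otimes> c q) Y = \<alpha> \<odot> (x \<ominus> finsum A (\<lambda>q. q \<otimes> c q) Y)"
      using fc[OF c(1)] c(3) \<alpha> by (simp add: a_minus_def smult_r_distr smult_r_minus)
    then show "\<alpha> \<odot> x \<in> ?P"
      using c e subspD(4)[OF Is \<alpha> c(2)] subspD(4)[OF subsp_KV \<alpha>] \<alpha>
      by (intro mem[of _ "\<lambda>q. \<alpha> \<odot> c q"]) auto
  qed auto
  moreover have "({y \<otimes> v [^] b | y b. y \<in> Y \<and> b \<in> (UNIV :: nat set)} \<union> I) \<inter> carrier A \<subseteq> ?P"
  proof
    fix s assume s: "s \<in> ({y \<otimes> v [^] b | y b. y \<in> Y \<and> b \<in> (UNIV :: nat set)} \<union> I) \<inter> carrier A"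
    show "s \<in> ?P"
    proof (cases "s \<in> I")
      case True
      then show ?thesis using fz K0 True s by (intro mem[of _ "\<lambda>_. \<zero>"]) (auto simp: a_minus_def)
    next
      case False
      then obtain y b where yb: "y \<in> Y" "s = y \<otimes> v [^] (b::nat)" using s by blast
      let ?c = "\<lambda>q. if y = q then v [^] b else \<zero>"
      have "finsum A (\<lambda>q. q \<otimes> ?c q) Y = finsum A (\<lambda>q. if y = q then q \<otimes> v [^] b else \<zero>) Y"
        using Y v by (intro M.finsum_cong') auto
      also have "\<dots> = s" using yb Y v by (subst M.finsum_singleton) auto
      finally have "s \<ominus> finsum A (\<lambda>q. q \<otimes> ?c q) Y = \<zero>" using s by (simp add: a_minus_def M.r_neg)
      moreover have "\<forall>q. ?c q \<in> KV v" using KV_pow K0 by simp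
      ultimately show ?thesis using s subspD(2)[OF Is] by (intro mem[of s ?c]) auto
    qed
  qed
  ultimately have "x \<in> ?P" using lspan_least[of ?P x] x unfolding YK_def by blast
  then show ?thesis by blast
qed

text \<open>Modulo \<open>I\<close>, the elements \<open>a l\<close> act on the span of \<open>Y\<close> by matrices over the commutative
  ring \<open>k[v]\<close>, up to the denominator \<open>z\<close>. Expanding an alternating sum of longer products than
  there are pairs of generators, two matrix units coincide and the terms cancel.\<close>

lemma stdp_annihilates:
  assumes I: "ideal I A" and Y: "finite Y" "Y \<subseteq> carrier A" "card Y * card Y < D"
    and z: "z \<in> KV v" and a: "\<And>l. a l \<in> carrier A"
    and rel: "\<And>l y. \<lbrakk>l < D; y \<in> Y\<rbrakk> \<Longrightarrow> a l \<otimes> y \<otimes> z \<in> YK Y v I" and y: "y \<in> Y"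
  shows "A.stdp D a \<otimes> (y \<otimes> z [^] D) \<in> I"
proof -
  note Is = ideal_subsp[OF I]
  have "\<exists>c. (\<forall>q. c q \<in> KV v) \<and> (l < D \<and> y \<in> Y \<longrightarrow> a l \<otimes> y \<otimes> z \<ominus> finsum A (\<lambda>q. q \<otimes> c q) Y \<in> I)" for l y
    using YK_coeffs[OF I Y(1,2) rel[of l y]] KV_one by (cases "l < D \<and> y \<in> Y") auto
  then have "\<forall>ly. \<exists>c. case ly of (l, y) \<Rightarrow> (\<forall>q. c q \<in> KV v) \<and> (l < D \<and> y \<in> Y \<longrightarrow> a l \<otimes> y \<otimes> z \<ominus> finsum A (\<lambda>q. q \<otimes> c q) Y \<in> I)"
    by auto
  from choice[OF this] obtain f where f: "\<forall>ly. case ly of (l, y) \<Rightarrow> (\<forall>q. f ly q \<in> KV v) \<and> (l < D \<and> y \<in> Y \<longrightarrow> a l \<otimes> y \<otimes> z \<ominus> finsum A (\<lambda>q. q \<otimes> f ly q) Y \<in> I)"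
    by (rule exE)
  define c where "c l y = f (l, y)" for l y
  have c: "\<And>l y q. c l y q \<in> KV v"
    "\<And>l y. \<lbrakk>l < D; y \<in> Y\<rbrakk> \<Longrightarrow> a l \<otimes> y \<otimes> z \<ominus> finsum A (\<lambda>q. q \<otimes> c l y q) Y \<in> I"
    unfolding c_def using f by simp_all
  have "A.alt D (\<lambda>p. foldr (\<lambda>i x. a (p i) \<otimes> x) [0..<D] (y \<otimes> z [^] D)) \<in> I"
    by (rule A.alternating_operators_vanish[where C = "KV v" and c = c and Y = Y
          and T = "\<lambda>l x. a l \<otimes> x"])
      (use ideal_additive_subgroup[OF I] a idealD[OF I] KV_carrier KV_one KV_mult KV_comm Y z c y in
        \<open>auto simp: A.r_distr A.m_assoc\<close>)
  moreover have yz: "y \<otimes> z [^] D \<in> carrier A" using y Y z KV_carrier by auto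
  moreover have "A.alt D (\<lambda>p. foldr (\<lambda>i x. a (p i) \<otimes> x) [0..<D] (y \<otimes> z [^] D)) =
      A.alt D (\<lambda>p. word_val A (map (a \<circ> p) [0..<D]) \<otimes> (y \<otimes> z [^] D))"
  proof (rule A.alt_cong)
    fix p :: "nat \<Rightarrow> nat"
    show "foldr (\<lambda>i x. a (p i) \<otimes> x) [0..<D] (y \<otimes> z [^] D) =
        word_val A (map (a \<circ> p) [0..<D]) \<otimes> (y \<otimes> z [^] D)"
      using A.foldr_mult_left[of "a \<circ> p" "y \<otimes> z [^] D" "[0..<D]"] a yz by simp
    show "word_val A (map (a \<circ> p) [0..<D]) \<otimes> (y \<otimes> z [^] D) \<in> carrier A"
      using a by (intro A.m_closed[OF _ yz] A.word_val_closed) auto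
  qed
  moreover have "A.stdp D a \<otimes> (y \<otimes> z [^] D) =
      A.alt D (\<lambda>p. word_val A (map (a \<circ> p) [0..<D]) \<otimes> (y \<otimes> z [^] D))"
    unfolding A.stdp_def using yz a subsetD[OF Y(2) y] KV_carrier[OF z]
    by (intro A.alt_additive[of "\<lambda>x. x \<otimes> (y \<otimes> z [^] D)"]) (auto simp: A.l_distr intro!: A.word_val_closed)
  ultimately show ?thesis by simp
qed

end

lemma KV_one_central:
  assumes "d \<in> KV \<one>" "x \<in> carrier A" shows "x \<otimes> d = d \<otimes> x"
proof -
  have "subsp {y \<in> carrier A. x \<otimes> y = y \<otimes> x}"
    using assms(2) unfolding subsp_def
    by (auto simp: A.r_distr A.l_distr smult_mult_left smult_mult_right)
  then have "d \<in> {y \<in> carrier A. x \<otimes> y = y \<otimes> x}"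
    by (rule lspan_least[of _ _ "range (\<lambda>b::nat. \<one> [^] b)"]) (use assms in \<open>auto simp: KV_def\<close>)
  then show ?thesis by simp
qed

lemma rstdp_annihilates:
  assumes I: "ideal I A" and Y: "finite Y" "Y \<subseteq> carrier A" "card Y * card Y < D"
    and a: "\<And>l. a l \<in> carrier A"
    and rel: "\<And>l y. y \<in> Y \<Longrightarrow> y \<otimes> a l \<in> lspan (Y \<union> I)" and y: "y \<in> Y"
  shows "y \<otimes> A.rstdp D a \<in> I"
proof -
  note Is = ideal_subsp[OF I] and one = A.one_closed
  have "\<exists>c. (\<forall>q. c q \<in> KV \<one>) \<and> (y \<in> Y \<longrightarrow> y \<otimes> a l \<ominus> finsum A (\<lambda>q. q \<otimes> c q) Y \<in> I)" for l y
  proof (cases "y \<in> Y")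
    case True
    have "Y \<union> I \<subseteq> YK Y \<one> I"
      using Y YK_gen[OF _ _ one] YK_ideal[of _ I] subspD(1)[OF Is] by blast
    then have "y \<otimes> a l \<in> YK Y \<one> I"
      using rel[OF True, of l] lspan_least[OF subsp_YK] by blast
    then show ?thesis using YK_coeffs[OF one I Y(1,2)] by blast
  qed (use KV_one[OF one] in auto)
  then have "\<forall>ly. \<exists>c. case ly of (l, y) \<Rightarrow> (\<forall>q. c q \<in> KV \<one>) \<and> (y \<in> Y \<longrightarrow> y \<otimes> a l \<ominus> finsum A (\<lambda>q. q \<otimes> c q) Y \<in> I)"
    by auto
  from choice[OF this] obtain f where f: "\<forall>ly. case ly of (l, y) \<Rightarrow> (\<forall>q. f ly q \<in> KV \<one>) \<and> (y \<in> Y \<longrightarrow> y \<otimes> a l \<ominus> finsum A (\<lambda>q. q \<otimes> f ly q) Y \<in> I)"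
    by (rule exE)
  define c where "c l y = f (l, y)" for l y
  have c: "\<And>l y q. c l y q \<in> KV \<one>"
    "\<And>l y. y \<in> Y \<Longrightarrow> y \<otimes> a l \<ominus> finsum A (\<lambda>q. q \<otimes> c l y q) Y \<in> I"
    unfolding c_def using f by simp_all
  have mc: "x \<otimes> d \<otimes> a l = x \<otimes> a l \<otimes> d" if "x \<in> carrier A" "d \<in> KV \<one>" for x d l
    using that KV_one_central[of d "a l"] KV_carrier[OF one] a by (simp add: A.m_assoc)
  have "A.alt D (\<lambda>p. foldr (\<lambda>i x. x \<otimes> a (p i)) [0..<D] (y \<otimes> \<one> [^] D)) \<in> I"
    by (rule A.alternating_operators_vanish[where C = "KV \<one>" and c = c and Y = Y
          and T = "\<lambda>l x. x \<otimes> a l"])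
      (use ideal_additive_subgroup[OF I] a idealD[OF I] KV_carrier[OF one] KV_one[OF one]
          KV_mult[OF one] KV_comm[OF one] Y c y mc in
        \<open>auto simp: A.l_distr\<close>)
  moreover have yc: "y \<in> carrier A" using y Y by auto
  moreover have "A.alt D (\<lambda>p. foldr (\<lambda>i x. x \<otimes> a (p i)) [0..<D] y) =
      A.alt D (\<lambda>p. y \<otimes> word_val A (map (a \<circ> p) (rev [0..<D])))"
  proof (rule A.alt_cong)
    fix p :: "nat \<Rightarrow> nat"
    show "foldr (\<lambda>i x. x \<otimes> a (p i)) [0..<D] y = y \<otimes> word_val A (map (a \<circ> p) (rev [0..<D]))"
      using A.foldr_mult_right[of "a \<circ> p" y "[0..<D]"] a yc by simp
    show "y \<otimes> word_val A (map (a \<circ> p) (rev [0..<D])) \<in> carrier A"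
      using a yc by (intro A.m_closed A.word_val_closed) auto
  qed
  moreover have "y \<otimes> A.rstdp D a = A.alt D (\<lambda>p. y \<otimes> word_val A (map (a \<circ> p) (rev [0..<D])))"
    unfolding A.rstdp_def using yc a
    by (intro A.alt_additive[of "\<lambda>x. y \<otimes> x"]) (auto simp: A.r_distr intro!: A.word_val_closed)
  ultimately show ?thesis by simp
qed

end

section \<open>Monic polynomials in an element\<close>

text \<open>Coefficients are listed from the constant term upwards, so that removing the head is a
  shift; polynomials of the library are listed the other way round.\<close>

fun horner :: "('a, 'm) ring_scheme \<Rightarrow> 'a list \<Rightarrow> 'a \<Rightarrow> 'a" where
  "horner K [] b = \<zero>\<^bsub>K\<^esub>"
| "horner K (c # p) b = c \<oplus>\<^bsub>K\<^esub> b \<otimes>\<^bsub>K\<^esub> horner K p b"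

lemma (in algebraically_closed) horner_root:
  assumes "set p \<subseteq> carrier L" "length p \<ge> 2" "last p = \<one>"
  shows "\<exists>b\<in>carrier L. horner L p b = \<zero>"
proof -
  have ev: "horner L q b = eval (rev q) b" if "set q \<subseteq> carrier L" "b \<in> carrier L" for q b
    using that
  proof (induction q)
    case (Cons c q)
    then show ?case using eval_in_carrier[of "rev q" b]
      by (subst rev.simps, subst eval_append) (auto simp: m_comm a_comm)
  qed simp
  have "hd (rev p) = \<one>" using assms(2,3) by (simp add: hd_rev)
  then have "polynomial (carrier L) (rev p)"
    using assms(1,2) unfolding polynomial_def by auto
  then have "rev p \<in> carrier (poly_ring L)" by (simp add: univ_poly_carrier)
  then have s: "splitted (rev p)" and c: "rev p \<in> carrier (poly_ring L)"
    using roots_over_carrier by auto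
  have "size (roots (rev p)) \<noteq> 0" using s assms(2) unfolding splitted_def by simp
  then obtain b where "b \<in># roots (rev p)" by (metis multiset_nonemptyE size_empty)
  then have "is_root (rev p) b" using roots_mem_iff_is_root[OF c] by blast
  then show ?thesis unfolding is_root_def using ev assms(1) by auto
qed

context kalg
begin

text \<open>Synthetic division by \<open>X - b\<close>: the coefficients of the quotient are the
  Horner values of the tails.\<close>

fun pquot :: "'a \<Rightarrow> 'a list \<Rightarrow> 'a list" where
  "pquot b [] = []"
| "pquot b [c] = []"
| "pquot b (c # d # p) = horner k (d # p) b # pquot b (d # p)"

text \<open>A polynomial applied to a sequence instead of the powers of an element: passing from
  \<open>y i\<close> to \<open>y (Suc i)\<close> plays the role of multiplication by
  \<open>X\<close>. This serves both for powers of \<open>v\<close> and for orbits under an element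
  of the extended centroid, which need not act on the whole algebra.\<close>

fun plin :: "'a list \<Rightarrow> (nat \<Rightarrow> 'c) \<Rightarrow> 'c" where
  "plin [] y = \<zero>"
| "plin (c # p) y = c \<odot> y 0 \<oplus> plin p (\<lambda>i. y (Suc i))"

lemma horner_closed: "\<lbrakk>set p \<subseteq> carrier k; b \<in> carrier k\<rbrakk> \<Longrightarrow> horner k p b \<in> carrier k"
  by (induction p) auto

lemma plin_closed: "\<lbrakk>set p \<subseteq> carrier k; \<And>i. y i \<in> carrier A\<rbrakk> \<Longrightarrow> plin p y \<in> carrier A"
  by (induction p arbitrary: y) auto

lemma pquot_props:
  assumes "set p \<subseteq> carrier k" "b \<in> carrier k"
  shows "set (pquot b p) \<subseteq> carrier k" "length (pquot b p) = length p - 1"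
    "length p \<ge> 2 \<Longrightarrow> last (pquot b p) = last p"
  using assms
proof (induction b p rule: pquot.induct)
  case (3 b c d p)
  {
    case 1
    then show ?case using 3(1)[of] horner_closed[of "d # p" b] by auto
  next
    case 2
    then show ?case using 3(2) by auto
  next
    case 3
    then show ?case using \<open>\<lbrakk>2 \<le> length (d # p); set (d # p) \<subseteq> carrier k; b \<in> carrier k\<rbrakk> \<Longrightarrow> last (pquot b (d # p)) = last (d # p)\<close>
      by (cases p) auto
  }
qed auto

text \<open>Division with remainder, \<open>p = (X - b) q + p(b)\<close>, read on sequences:
  \<open>X - b\<close> turns \<open>y\<close> into the sequence of the
  \<open>y (Suc i) \<ominus> b \<odot> y i\<close>.\<close>

lemma plin_pquot:
  assumes "set p \<subseteq> carrier k" "b \<in> carrier k" "\<And>i. y i \<in> carrier A"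
  shows "plin p y = plin (pquot b p) (\<lambda>i. y (Suc i) \<ominus> b \<odot> y i) \<oplus> horner k p b \<odot> y 0"
  using assms
proof (induction b p arbitrary: y rule: pquot.induct)
  case (1 b)
  then show ?case by (simp add: smult_l_null)
next
  case (2 b c)
  then show ?case by simp
next
  case (3 b c d p)
  let ?v = "horner k (d # p) b" and ?r = "plin (pquot b (d # p)) (\<lambda>i. y (Suc (Suc i)) \<ominus> b \<odot> y (Suc i))"
  have v: "?v \<in> carrier k" using 3 horner_closed[of "d # p" b] by simp
  have r: "?r \<in> carrier A"
    using 3 pquot_props(1)[of "d # p" b] by (intro plin_closed) auto
  have y: "y 0 \<in> carrier A" "y 1 \<in> carrier A" using 3 by auto
  have bc: "b \<in> carrier k" "c \<in> carrier k" using 3 by auto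
  have IH: "plin (d # p) (\<lambda>i. y (Suc i)) = ?r \<oplus> ?v \<odot> y 1"
    using 3(1)[of "\<lambda>i. y (Suc i)"] 3(2-) by simp
  have "plin (c # d # p) y = c \<odot> y 0 \<oplus> (?r \<oplus> ?v \<odot> y 1)"
    unfolding plin.simps(2)[of c] IH ..
  also have "\<dots> = (?v \<odot> (y 1 \<ominus> b \<odot> y 0) \<oplus> ?r) \<oplus> (c \<oplus>\<^bsub>k\<^esub> b \<otimes>\<^bsub>k\<^esub> ?v) \<odot> y 0"
  proof -
    have f1: "(c \<oplus>\<^bsub>k\<^esub> b \<otimes>\<^bsub>k\<^esub> ?v) \<odot> y 0 = c \<odot> y 0 \<oplus> ?v \<odot> (b \<odot> y 0)"
      unfolding R.m_comm[OF bc(1) v] using v y bc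
      by (simp add: smult_l_distr smult_assoc1 del: horner.simps)
    have f2: "?v \<odot> (y 1 \<ominus> b \<odot> y 0) = ?v \<odot> y 1 \<ominus> ?v \<odot> (b \<odot> y 0)"
      using v y bc by (simp add: a_minus_def smult_r_distr smult_r_minus del: horner.simps)
    have cl: "c \<odot> y 0 \<in> carrier A" "?v \<odot> (b \<odot> y 0) \<in> carrier A" "?v \<odot> y 1 \<in> carrier A"
      using v y bc by (auto simp del: horner.simps)
    have gen: "C \<oplus> (q \<oplus> V) = ((V \<ominus> B) \<oplus> q) \<oplus> (C \<oplus> B)"
      if "C \<in> carrier A" "B \<in> carrier A" "V \<in> carrier A" "q \<in> carrier A" for C B V q
      using that by algebra
    show ?thesis unfolding f1 f2 by (rule gen[OF cl r])
  qed
  finally show ?case by (simp add: horner.simps(2)[of k c "d # p"] del: horner.simps)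
qed

lemma plin_snoc:
  assumes "set p \<subseteq> carrier k" "c \<in> carrier k" "\<And>i. y i \<in> carrier A"
  shows "plin (p @ [c]) y = c \<odot> y (length p) \<oplus> plin p y"
  using assms
proof (induction p arbitrary: y)
  case (Cons d p)
  then show ?case using plin_closed[of p "\<lambda>i. y (Suc i)"] by (simp add: M.a_lcomm)
qed simp

lemma plin_lspan:
  assumes "set p \<subseteq> carrier k" "\<And>i. y i \<in> carrier A"
  shows "plin p y \<in> lspan (y ` {..<length p})"
  using assms
proof (induction p arbitrary: y)
  case (Cons c p)
  have "plin p (\<lambda>i. y (Suc i)) \<in> lspan ((\<lambda>i. y (Suc i)) ` {..<length p})" using Cons by simp
  then have "plin p (\<lambda>i. y (Suc i)) \<in> lspan (y ` {..<length (c # p)})" by (rule lspan_mono) auto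
  moreover have "y 0 \<in> y ` {..<length (c # p)}" by simp
  ultimately show ?case using Cons.prems by (auto intro: lspan.step)
qed (simp add: lspan.zero)

lemma lspan_plin:
  assumes "z \<in> lspan (y ` {..<n})" "\<And>i. y i \<in> carrier A"
  shows "\<exists>p. set p \<subseteq> carrier k \<and> length p = n \<and> z = plin p y"
  using assms
proof (induction n arbitrary: z y)
  case 0
  then have "z = \<zero>" by (auto elim: lspan.cases)
  then show ?case by auto
next
  case (Suc n)
  have "y ` {..<Suc n} = insert (y 0) ((\<lambda>i. y (Suc i)) ` {..<n})"
    by (auto simp: lessThan_Suc_eq_insert_0)
  then obtain c v where cv: "c \<in> carrier k" "v \<in> lspan ((\<lambda>i. y (Suc i)) ` {..<n})" "z = c \<odot> y 0 \<oplus> v"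
    using lspan_insertE[of z "y 0" "(\<lambda>i. y (Suc i)) ` {..<n}"] Suc.prems by metis
  then obtain p where "set p \<subseteq> carrier k \<and> length p = n \<and> v = plin p (\<lambda>i. y (Suc i))"
    using Suc.IH[of v "\<lambda>i. y (Suc i)"] Suc.prems(2) by auto
  then show ?case using cv by (intro exI[of _ "c # p"]) auto
qed

text \<open>A monic polynomial of positive degree has a root, and synthetic division keeps the
  leading coefficient one. So one linear factor is absorbed into the sequence and the degree drops
  by one.\<close>

lemma monic_root:
  assumes ac: "algebraically_closed k" and y: "\<And>i. y i \<in> carrier A"
    and z: "z \<in> lspan (y ` {..<Suc n})"
  shows "\<exists>b\<in>carrier k. \<exists>z'\<in>lspan ((\<lambda>i. y (Suc i) \<ominus> b \<odot> y i) ` {..<n}).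
    y (Suc n) \<oplus> z = (y (Suc n) \<ominus> b \<odot> y n) \<oplus> z'"
proof -
  obtain p where p: "set p \<subseteq> carrier k" "length p = Suc n" "z = plin p y"
    using lspan_plin[OF z y] by blast
  let ?P = "p @ [\<one>\<^bsub>k\<^esub>]"
  have P: "set ?P \<subseteq> carrier k" using p by simp
  obtain b where b: "b \<in> carrier k" "horner k ?P b = \<zero>\<^bsub>k\<^esub>"
    using algebraically_closed.horner_root[OF ac P] p by auto
  define y' where "y' = (\<lambda>i. y (Suc i) \<ominus> b \<odot> y i)"
  have y': "y' i \<in> carrier A" for i unfolding y'_def using y b by simp
  have q: "set (pquot b ?P) \<subseteq> carrier k" "length (pquot b ?P) = Suc n" "last (pquot b ?P) = \<one>\<^bsub>k\<^esub>"
    using pquot_props[OF P b(1)] p by auto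
  define q where "q = butlast (pquot b ?P)"
  have qq: "pquot b ?P = q @ [\<one>\<^bsub>k\<^esub>]" using q unfolding q_def
    by (metis append_butlast_last_id list.size(3) nat.distinct(1))
  have q': "set q \<subseteq> carrier k" "length q = n" using q(1,2) unfolding qq by auto
  have "y (Suc n) \<oplus> z = plin ?P y"
    using plin_snoc[OF p(1) _ y, of "\<one>\<^bsub>k\<^esub>"] p y smult_one by simp
  also have "\<dots> = plin (pquot b ?P) y'"
    using plin_pquot[OF P b(1) y] b(2) y plin_closed[OF q(1) y'] unfolding y'_def
    by (simp add: smult_l_null)
  also have "\<dots> = y' n \<oplus> plin q y'"
    unfolding qq using plin_snoc[OF q'(1) _ y', of "\<one>\<^bsub>k\<^esub>"] q' y' smult_one by simp
  finally have "y (Suc n) \<oplus> z = y' n \<oplus> plin q y'" .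
  moreover have "plin q y' \<in> lspan (y' ` {..<n})" using plin_lspan[OF q'(1) y'] q'(2) by simp
  ultimately show ?thesis using b(1) unfolding y'_def by blast
qed

end

section \<open>Leading terms of combinations, and polynomials in \<open>v\<close> by degree\<close>

context kalg
begin

lemma lspan_Un:
  assumes "x \<in> lspan (P \<union> Q)"
  obtains p q where "p \<in> lspan P" "q \<in> lspan Q" "x = p \<oplus> q"
proof -
  have "\<exists>p q. p \<in> lspan P \<and> q \<in> lspan Q \<and> x = p \<oplus> q"
    using assms
  proof (induction rule: lspan.induct)
    case zero
    show ?case using lspan.zero by (intro exI[of _ \<zero>]) auto
  next
    case (step c s v)
    then obtain p q where pq: "p \<in> lspan P" "q \<in> lspan Q" "v = p \<oplus> q" by blast
    have cr: "p \<in> carrier A" "q \<in> carrier A" "c \<odot> s \<in> carrier A"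
      using pq lspan_carrier step by auto
    show ?case
    proof (cases "s \<in> P")
      case True
      then have "c \<odot> s \<oplus> p \<in> lspan P" using step pq by (intro lspan.step)
      moreover have "c \<odot> s \<oplus> v = (c \<odot> s \<oplus> p) \<oplus> q" using pq cr by (simp add: M.a_assoc)
      ultimately show ?thesis using pq by blast
    next
      case False
      then have "c \<odot> s \<oplus> q \<in> lspan Q" using step pq by (intro lspan.step) auto
      moreover have "c \<odot> s \<oplus> v = p \<oplus> (c \<odot> s \<oplus> q)" using pq cr by (simp add: M.a_lcomm)
      ultimately show ?thesis using pq by blast
    qed
  qed
  then show thesis using that by blast
qed

lemma lspan_preimage:
  assumes f: "linmap f" and "x \<in> lspan (f ` S)" "S \<subseteq> carrier A"
  obtains z where "z \<in> lspan S" "x = f z"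
proof -
  have "\<exists>z. z \<in> lspan S \<and> x = f z"
    using assms(2)
  proof (induction rule: lspan.induct)
    case zero
    then show ?case using lspan.zero linmap_zero[OF f] by metis
  next
    case (step c s v)
    then obtain z t where z: "z \<in> lspan S" "v = f z" "t \<in> S" "s = f t" by blast
    have "c \<odot> t \<oplus> z \<in> lspan S" using z step assms(3) by (intro lspan.step) auto
    moreover have "f (c \<odot> t \<oplus> z) = c \<odot> s \<oplus> v"
      using z step assms(3) lspan_carrier[of z S] linmapD[OF f] by auto
    ultimately show ?case by metis
  qed
  then show thesis using that by blast
qed

lemma lspan_top:
  assumes "p \<in> lspan (y ` {..<n::nat})" "\<And>i. y i \<in> carrier A" "p \<noteq> \<zero>"
  shows "\<exists>a<n. \<exists>\<alpha>\<in>carrier k. \<alpha> \<noteq> \<zero>\<^bsub>k\<^esub> \<and> (\<exists>q\<in>lspan (y ` {..<a}). p = \<alpha> \<odot> y a \<oplus> q)"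
  using assms
proof (induction n arbitrary: p)
  case 0
  then show ?case by (auto elim: lspan.cases)
next
  case (Suc n)
  have "y ` {..<Suc n} = insert (y n) (y ` {..<n})" by (auto simp: lessThan_Suc)
  then obtain c v where cv: "c \<in> carrier k" "v \<in> lspan (y ` {..<n})" "p = c \<odot> y n \<oplus> v"
    using lspan_insertE[of p "y n" "y ` {..<n}"] Suc.prems by metis
  show ?case
  proof (cases "c = \<zero>\<^bsub>k\<^esub>")
    case True
    then have "p = v" using cv lspan_carrier[of v] Suc.prems(2) by (simp add: smult_l_null)
    then show ?thesis using Suc.IH[of v] cv(2) Suc.prems(2,3) less_Suc_eq by blast
  next
    case False
    then show ?thesis using cv by blast
  qed
qed

lemma YK_left:
  assumes I: "ideal I A" and u: "u \<in> carrier A" and Y: "Y \<subseteq> carrier A" and v: "v \<in> carrier A"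
    and x: "x \<in> YK Y v I"
  shows "u \<otimes> x \<in> YK ((\<otimes>) u ` Y) v I"
proof (rule lspan_image[OF linmap_mult_left[OF u]])
  show "x \<in> lspan ({y \<otimes> v [^] b | y b. y \<in> Y \<and> b \<in> (UNIV :: nat set)} \<union> I)"
    using x unfolding YK_def .
  fix s assume "s \<in> {y \<otimes> v [^] b | y b. y \<in> Y \<and> b \<in> (UNIV :: nat set)} \<union> I"
  then consider "s \<in> I" | y b where "y \<in> Y" "s = y \<otimes> v [^] (b::nat)" by blast
  then show "u \<otimes> s \<in> YK ((\<otimes>) u ` Y) v I"
  proof cases
    case 1
    then show ?thesis using idealD(2)[OF I _ u] idealD(1)[OF I] by (intro YK_ideal) auto
  next
    case 2
    then have "u \<otimes> s = (u \<otimes> y) \<otimes> v [^] b" using u v Y by (auto simp: A.m_assoc)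
    then show ?thesis using YK_base[of "u \<otimes> y" "(\<otimes>) u ` Y" v b I] 2 u v Y by auto
  qed
qed (rule subsp_YK)

lemma YK_least:
  assumes "x \<in> YK Y v I" "subsp N" "I \<subseteq> N" "\<And>y b. y \<in> Y \<Longrightarrow> y \<otimes> v [^] (b::nat) \<in> N"
  shows "x \<in> N"
proof (rule lspan_least[OF assms(2)])
  show "x \<in> lspan ({y \<otimes> v [^] b | y b. y \<in> Y \<and> b \<in> (UNIV :: nat set)} \<union> I)"
    using assms(1) unfolding YK_def .
  show "({y \<otimes> v [^] b | y b. y \<in> Y \<and> b \<in> (UNIV :: nat set)} \<union> I) \<inter> carrier A \<subseteq> N"
    using assms(3,4) by blast
qed

definition lowp :: "'c \<Rightarrow> nat \<Rightarrow> 'c set" where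
  "lowp v n = lspan ((\<lambda>b. v [^] b) ` {..<n})"

text \<open>A property of elements of the algebra, not of polynomials: the degree is not determined
  by \<open>h\<close>, and even \<open>\<zero>\<close> is monic when \<open>v\<close> is algebraic
  over \<open>k\<close>. Only the existence of a monic expression is ever used.\<close>

definition monic :: "'c \<Rightarrow> 'c \<Rightarrow> bool" where
  "monic v h \<longleftrightarrow> (\<exists>n. \<exists>z\<in>lowp v n. h = v [^] n \<oplus> z)"

context
  fixes v assumes v: "v \<in> carrier A"
begin

lemma lowp_KV: "x \<in> lowp v n \<Longrightarrow> x \<in> KV v"
  unfolding lowp_def KV_def by (erule lspan_mono) auto

lemma lowp_carrier: "x \<in> lowp v n \<Longrightarrow> x \<in> carrier A"
  unfolding lowp_def by (rule lspan_carrier)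

lemma subsp_lowp: "subsp (lowp v n)"
  unfolding lowp_def by (rule subsp_lspan)

lemma lowp_pow: "b < n \<Longrightarrow> v [^] b \<in> lowp v n"
  unfolding lowp_def using v by (intro lspan_base) auto

lemma lowp_mono: "x \<in> lowp v n \<Longrightarrow> n \<le> m \<Longrightarrow> x \<in> lowp v m"
  unfolding lowp_def by (erule lspan_mono) auto

lemma lowp_mult:
  assumes "x \<in> lowp v n" "y \<in> lowp v (Suc m)" shows "x \<otimes> y \<in> lowp v (n + m)"
proof -
  have 1: "v [^] b \<otimes> y \<in> lowp v (n + m)" if b: "b < n" for b :: nat
  proof (rule lspan_image[OF linmap_mult_left])
    show "y \<in> lspan ((\<lambda>b. v [^] b) ` {..<Suc m})" using assms(2) unfolding lowp_def .
    fix s assume "s \<in> (\<lambda>b. v [^] b) ` {..<Suc m}"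
    then obtain c where "c < Suc m" "s = v [^] c" by blast
    then show "v [^] b \<otimes> s \<in> lowp v (n + m)" using lowp_pow[of "b + c" "n + m"] b v
      by (simp add: A.nat_pow_mult)
  qed (use v subsp_lowp in auto)
  show ?thesis
  proof (rule lspan_image[OF linmap_mult_right])
    show "x \<in> lspan ((\<lambda>b. v [^] b) ` {..<n})" using assms(1) unfolding lowp_def .
  qed (use 1 lowp_carrier[OF assms(2)] subsp_lowp in auto)
qed

lemma monic_KV: "monic v h \<Longrightarrow> h \<in> KV v"
  unfolding monic_def by (auto intro!: subspD(3)[OF subsp_KV[OF v] KV_pow[OF v]] dest: lowp_KV)

lemma monic_one: "monic v \<one>"
  unfolding monic_def using v subspD(2)[OF subsp_lowp[of 0]] by (intro exI[of _ 0] bexI[of _ \<zero>]) auto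

lemma monic_mult:
  assumes "monic v g" "monic v h" shows "monic v (g \<otimes> h)"
proof -
  obtain n z where g: "z \<in> lowp v n" "g = v [^] n \<oplus> z" using assms unfolding monic_def by auto
  obtain m w where h: "w \<in> lowp v m" "h = v [^] m \<oplus> w" using assms unfolding monic_def by auto
  have c: "z \<in> carrier A" "w \<in> carrier A" using g h lowp_carrier by auto
  have "h \<in> lowp v (Suc m)"
    unfolding h(2) using subspD(3)[OF subsp_lowp lowp_pow lowp_mono[OF h(1)]] by simp
  then have 1: "z \<otimes> h \<in> lowp v (n + m)" using lowp_mult[OF g(1)] by blast
  have "w \<otimes> v [^] n \<in> lowp v (m + n)" using lowp_mult[OF h(1) lowp_pow] by simp
  then have 2: "v [^] n \<otimes> w \<in> lowp v (n + m)"
    using KV_comm[OF v KV_pow[OF v] lowp_KV[OF h(1)]] by (simp add: add.commute)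
  have "g \<otimes> h = (v [^] n \<otimes> v [^] m \<oplus> v [^] n \<otimes> w) \<oplus> z \<otimes> h"
    unfolding g(2) h(2) using c v by (simp add: A.l_distr A.r_distr M.a_ac)
  then have "g \<otimes> h = v [^] (n + m) \<oplus> (v [^] n \<otimes> w \<oplus> z \<otimes> h)"
    using c v h by (simp add: A.nat_pow_mult M.a_assoc)
  then show ?thesis unfolding monic_def using subspD(3)[OF subsp_lowp 2 1] by blast
qed

lemma monic_pow: "monic v g \<Longrightarrow> monic v (g [^] (n::nat))"
  by (induction n) (auto simp: monic_one monic_mult)

lemma monic_linear:
  assumes "b \<in> carrier k" shows "monic v (v \<ominus> b \<odot> \<one>)"
proof -
  have "\<ominus> (b \<odot> \<one>) \<in> lowp v 1"
    using subsp_uminus[OF subsp_lowp] subspD(4)[OF subsp_lowp assms lowp_pow[of 0 1]] by simp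
  then show ?thesis unfolding monic_def a_minus_def using v
    by (intro exI[of _ 1] bexI[of _ "\<ominus> (b \<odot> \<one>)"]) auto
qed

text \<open>Division with remainder by a monic element that \<open>r\<close> carries into
  \<open>I\<close>: multiplied by \<open>v [^] d\<close>, it rewrites
  \<open>r \<otimes> v [^] (n + d)\<close> through lower powers.\<close>

lemma monic_reduce:
  assumes I: "ideal I A" and z: "z \<in> lowp v n" and r: "r \<in> carrier A"
    and h: "r \<otimes> (v [^] n \<oplus> z) \<in> I"
  shows "r \<otimes> v [^] (m::nat) \<in> lspan ((\<lambda>b. r \<otimes> v [^] b) ` {..<n} \<union> I)"
proof (induction m rule: less_induct)
  case (less m)
  let ?N = "lspan ((\<lambda>b. r \<otimes> v [^] b) ` {..<n} \<union> I)"
  show ?case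
  proof (cases "m < n")
    case True
    then show ?thesis using r v by (intro lspan_base) auto
  next
    case False
    then obtain d where d: "m = n + d" using le_Suc_ex not_less by blast
    have zc: "z \<in> carrier A" using z lowp_carrier by blast
    have "r \<otimes> (v [^] n \<oplus> z) \<otimes> v [^] d \<in> I" using idealD(3)[OF I h] v by simp
    then have 1: "r \<otimes> (v [^] n \<oplus> z) \<otimes> v [^] d \<in> ?N" using idealD(1)[OF I] by (intro lspan_base) auto
    have "z \<otimes> v [^] d \<in> lowp v m" unfolding d using lowp_mult[OF z lowp_pow] by simp
    then have zl: "z \<otimes> v [^] d \<in> lspan ((\<lambda>b. v [^] b) ` {..<m})" unfolding lowp_def .
    have 2: "r \<otimes> (z \<otimes> v [^] d) \<in> ?N"
    proof (rule lspan_image[OF linmap_mult_left[OF r] zl _ subsp_lspan])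
      fix s assume "s \<in> (\<lambda>b. v [^] b) ` {..<m}"
      then obtain b where b: "b < m" "s = v [^] b" by blast
      show "r \<otimes> s \<in> ?N" unfolding b(2) by (rule less.IH[OF b(1)])
    qed
    have "r \<otimes> v [^] m = r \<otimes> (v [^] n \<oplus> z) \<otimes> v [^] d \<ominus> r \<otimes> (z \<otimes> v [^] d)"
      unfolding d using r v zc
      by (simp add: A.nat_pow_mult[symmetric] A.m_assoc[symmetric] A.r_distr A.l_distr a_minus_def M.a_assoc M.r_neg)
    then show ?thesis using subsp_minus[OF subsp_lspan 1 2] by simp
  qed
qed

lemma monic_factor:
  assumes ac: "algebraically_closed k" and z: "z \<in> lowp v (Suc n)"
  shows "\<exists>b\<in>carrier k. \<exists>z'\<in>lowp v n. v [^] Suc n \<oplus> z = (v \<ominus> b \<odot> \<one>) \<otimes> (v [^] n \<oplus> z')"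
proof -
  obtain b x where b: "b \<in> carrier k" and x: "x \<in> lspan ((\<lambda>i. v [^] Suc i \<ominus> b \<odot> v [^] i) ` {..<n})"
    and e: "v [^] Suc n \<oplus> z = (v [^] Suc n \<ominus> b \<odot> v [^] n) \<oplus> x"
    using monic_root[OF ac, of "\<lambda>i. v [^] i" z n] z v unfolding lowp_def by auto
  have s: "v [^] Suc i \<ominus> b \<odot> v [^] i = (v \<ominus> b \<odot> \<one>) \<otimes> v [^] i" for i :: nat
  proof -
    have "v [^] Suc i = v \<otimes> v [^] i" using v A.nat_pow_Suc2 by blast
    then show ?thesis using v b by (simp add: a_minus_def A.l_distr A.l_minus smult_mult_left)
  qed
  have lb: "v \<ominus> b \<odot> \<one> \<in> carrier A" using v b by simp
  have "x \<in> lspan ((\<lambda>y. (v \<ominus> b \<odot> \<one>) \<otimes> y) ` ((\<lambda>i. v [^] i) ` {..<n}))"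
    using x unfolding s image_image .
  then obtain z' where z': "z' \<in> lspan ((\<lambda>i. v [^] i) ` {..<n})" "x = (v \<ominus> b \<odot> \<one>) \<otimes> z'"
    using lspan_preimage[OF linmap_mult_left[OF lb]] v by (metis A.nat_pow_closed image_subsetI)
  have "v [^] Suc n \<oplus> z = (v \<ominus> b \<odot> \<one>) \<otimes> (v [^] n \<oplus> z')"
    unfolding e s z'(2) using lb v lspan_carrier[OF z'(1)] by (simp add: A.r_distr)
  then show ?thesis using z' b unfolding lowp_def by blast
qed

text \<open>Remainders modulo \<open>v - b\<close>. The second part records that the quotient of
  \<open>v [^] Suc n\<close> is monic of degree \<open>n\<close>, which makes the exponent
  \<open>B\<close> drop by exactly one in \<open>primitive_relation\<close>.\<close>

lemma pow_remainder:
  assumes b: "b \<in> carrier k"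
  shows "\<exists>\<beta>\<in>carrier k. \<exists>q\<in>lowp v n. v [^] n = \<beta> \<odot> \<one> \<oplus> (v \<ominus> b \<odot> \<one>) \<otimes> q"
    and "\<exists>\<beta>\<in>carrier k. \<exists>q\<in>lowp v n. v [^] Suc n = \<beta> \<odot> \<one> \<oplus> (v \<ominus> b \<odot> \<one>) \<otimes> (v [^] n \<oplus> q)"
proof -
  have lb: "v \<ominus> b \<odot> \<one> \<in> carrier A" using v b by simp
  have S: "\<exists>\<beta>\<in>carrier k. \<exists>q\<in>lowp v n. v [^] Suc n = \<beta> \<odot> \<one> \<oplus> (v \<ominus> b \<odot> \<one>) \<otimes> (v [^] n \<oplus> q)"
    if rem: "\<exists>\<beta>\<in>carrier k. \<exists>q\<in>lowp v n. v [^] n = \<beta> \<odot> \<one> \<oplus> (v \<ominus> b \<odot> \<one>) \<otimes> q" for n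
  proof -
    obtain \<beta> q where q: "\<beta> \<in> carrier k" "q \<in> lowp v n" "v [^] n = \<beta> \<odot> \<one> \<oplus> (v \<ominus> b \<odot> \<one>) \<otimes> q"
      using rem by blast
    have qc: "q \<in> carrier A" using q lowp_carrier by blast
    have "v [^] Suc n = v \<otimes> v [^] n" using v A.nat_pow_Suc2 by blast
    also have "\<dots> = (v \<ominus> b \<odot> \<one>) \<otimes> v [^] n \<oplus> b \<odot> v [^] n"
      using v b by (simp add: a_minus_def A.l_distr A.l_minus smult_mult_left M.a_assoc M.l_neg)
    also have "b \<odot> v [^] n = (b \<otimes>\<^bsub>k\<^esub> \<beta>) \<odot> \<one> \<oplus> (v \<ominus> b \<odot> \<one>) \<otimes> (b \<odot> q)"
      unfolding q(3) using q b lb qc by (simp add: smult_r_distr smult_assoc1 smult_mult_right)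
    finally have "v [^] Suc n = (b \<otimes>\<^bsub>k\<^esub> \<beta>) \<odot> \<one> \<oplus> (v \<ominus> b \<odot> \<one>) \<otimes> (v [^] n \<oplus> b \<odot> q)"
      using q b lb qc v by (simp add: A.r_distr M.a_lcomm)
    moreover have "b \<odot> q \<in> lowp v n" using subspD(4)[OF subsp_lowp b q(2)] .
    ultimately show ?thesis using q b by blast
  qed
  show 1: "\<exists>\<beta>\<in>carrier k. \<exists>q\<in>lowp v n. v [^] n = \<beta> \<odot> \<one> \<oplus> (v \<ominus> b \<odot> \<one>) \<otimes> q" for n
  proof (induction n)
    case 0
    show ?case using lb subspD(2)[OF subsp_lowp] smult_one[of \<one>]
      by (intro bexI[of _ "\<one>\<^bsub>k\<^esub>"] bexI[of _ \<zero>]) auto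
  next
    case (Suc n)
    obtain \<beta> q where q: "\<beta> \<in> carrier k" "q \<in> lowp v n"
      "v [^] Suc n = \<beta> \<odot> \<one> \<oplus> (v \<ominus> b \<odot> \<one>) \<otimes> (v [^] n \<oplus> q)"
      using S[OF Suc] by blast
    have "v [^] n \<oplus> q \<in> lowp v (Suc n)"
      using subspD(3)[OF subsp_lowp lowp_pow lowp_mono[OF q(2)]] by simp
    then show ?case using q by blast
  qed
  show "\<exists>\<beta>\<in>carrier k. \<exists>q\<in>lowp v n. v [^] Suc n = \<beta> \<odot> \<one> \<oplus> (v \<ominus> b \<odot> \<one>) \<otimes> (v [^] n \<oplus> q)"
    using S[OF 1] .
qed

end

end

section \<open>Finite generation over \<open>k[v]\<close> up to a monic denominator\<close>

context kalg
begin

text \<open>\<open>g\<close> is a denominator: a power of it carries \<open>x\<close> into the right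
  \<open>k[v]\<close>-module generated by \<open>Y\<close>, modulo \<open>I\<close>. The predicate
  \<open>Q\<close> treats two cases at once, arbitrary exponents and exponents at most one; closure
  under maxima gives finite sets a common exponent.\<close>

definition reach :: "(nat \<Rightarrow> bool) \<Rightarrow> 'c set \<Rightarrow> 'c \<Rightarrow> 'c set \<Rightarrow> 'c \<Rightarrow> 'c \<Rightarrow> bool" where
  "reach Q Y v I g x \<longleftrightarrow> (\<exists>n. Q n \<and> x \<otimes> g [^] (n::nat) \<in> YK Y v I)"

definition maxclosed :: "(nat \<Rightarrow> bool) \<Rightarrow> bool" where
  "maxclosed Q \<longleftrightarrow> Q 0 \<and> (\<forall>n m. Q n \<longrightarrow> Q m \<longrightarrow> Q (max n m))"

context
  fixes v assumes v: "v \<in> carrier A"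
begin

lemma YK_pow_mono:
  assumes I: "ideal I A" and Y: "Y \<subseteq> carrier A" and g: "g \<in> KV v" and x: "x \<in> carrier A"
    and n: "x \<otimes> g [^] (n::nat) \<in> YK Y v I" "n \<le> m"
  shows "x \<otimes> g [^] m \<in> YK Y v I"
proof -
  have gc: "g \<in> carrier A" using KV_carrier[OF v g] .
  have "(x \<otimes> g [^] n) \<otimes> g [^] (m - n) \<in> YK Y v I"
    by (rule YK_mult[OF v I Y n(1) KV_nat_pow[OF v g]])
  then show ?thesis using x gc n(2) by (simp add: A.m_assoc A.nat_pow_mult)
qed

lemma reach_finite:
  assumes I: "ideal I A" and Y: "Y \<subseteq> carrier A" and g: "g \<in> KV v" and Q: "maxclosed Q"
    and S: "finite S" "S \<subseteq> carrier A" "\<And>x. x \<in> S \<Longrightarrow> reach Q Y v I g x"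
  shows "\<exists>n. Q n \<and> (\<forall>x\<in>S. x \<otimes> g [^] n \<in> YK Y v I)"
  using S
proof (induction S)
  case empty
  then show ?case using Q unfolding maxclosed_def by auto
next
  case (insert x S)
  then obtain n where n: "Q n" "\<forall>x\<in>S. x \<otimes> g [^] n \<in> YK Y v I" by auto
  obtain m where m: "Q m" "x \<otimes> g [^] m \<in> YK Y v I" using insert.prems(2) unfolding reach_def by blast
  have "Q (max n m)" using Q n m unfolding maxclosed_def by blast
  moreover have "\<forall>y\<in>insert x S. y \<otimes> g [^] (max n m) \<in> YK Y v I"
  proof
    fix y assume y: "y \<in> insert x S"
    then have yc: "y \<in> carrier A" using insert.prems by blast
    show "y \<otimes> g [^] (max n m) \<in> YK Y v I"
    proof (cases "y = x")
      case True
      then show ?thesis using YK_pow_mono[OF I Y g yc, of m "max n m"] m by simp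
    next
      case False
      then show ?thesis using YK_pow_mono[OF I Y g yc, of n "max n m"] n y by simp
    qed
  qed
  ultimately show ?case by blast
qed

lemma reach_span:
  assumes I: "ideal I A" and Y: "Y \<subseteq> carrier A" and g: "g \<in> KV v" and Q: "maxclosed Q"
    and x: "x \<in> lspan (S \<union> I)" and S: "\<And>s. \<lbrakk>s \<in> S; s \<in> carrier A\<rbrakk> \<Longrightarrow> reach Q Y v I g s"
  shows "reach Q Y v I g x"
proof -
  have gc: "g \<in> carrier A" using KV_carrier[OF v g] .
  let ?P = "{x \<in> carrier A. reach Q Y v I g x}"
  have "subsp ?P"
    unfolding subsp_def
  proof (intro conjI ballI)
    show "\<zero> \<in> ?P" using Q gc subspD(2)[OF subsp_YK] unfolding maxclosed_def reach_def
      by (auto intro!: exI[of _ 0])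
    fix x y assume xy: "x \<in> ?P" "y \<in> ?P"
    then obtain n where n: "Q n" "\<forall>z\<in>{x, y}. z \<otimes> g [^] n \<in> YK Y v I"
      using reach_finite[OF I Y g Q, of "{x, y}"] by auto
    then have "(x \<oplus> y) \<otimes> g [^] n \<in> YK Y v I"
      using xy gc subspD(3)[OF subsp_YK] by (simp add: A.l_distr)
    then show "x \<oplus> y \<in> ?P" using xy n unfolding reach_def by auto
  next
    fix c x assume c: "c \<in> carrier k" and x: "x \<in> ?P"
    then obtain n where n: "Q n" "x \<otimes> g [^] n \<in> YK Y v I" unfolding reach_def by blast
    have "(c \<odot> x) \<otimes> g [^] n \<in> YK Y v I"
      using subspD(4)[OF subsp_YK c n(2)] c x gc by (simp add: smult_mult_left)
    then show "c \<odot> x \<in> ?P" using c x n unfolding reach_def by auto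
  qed auto
  moreover have "(S \<union> I) \<inter> carrier A \<subseteq> ?P"
  proof
    fix s assume s: "s \<in> (S \<union> I) \<inter> carrier A"
    have "reach Q Y v I g s" if "s \<in> I"
    proof -
      have "s \<otimes> g [^] (0::nat) \<in> YK Y v I" using that s YK_ideal[of s I] idealD(1)[OF I] by auto
      then show ?thesis using Q unfolding maxclosed_def reach_def by blast
    qed
    then show "s \<in> ?P" using s S by blast
  qed
  ultimately have "x \<in> ?P" using lspan_least[OF _ x] by blast
  then show ?thesis by blast
qed

text \<open>Denominators may be multiplied within the commutative ring \<open>k[v]\<close>. With
  this, finitely many pairs of a denominator and a generating set are merged into one.\<close>

lemma reach_mult:
  assumes I: "ideal I A" and Y: "Y \<subseteq> Y'" "Y' \<subseteq> carrier A" and g: "g \<in> KV v" and d: "d \<in> KV v"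
    and x: "x \<in> carrier A" "reach Q Y v I g x"
  shows "reach Q Y' v I (g \<otimes> d) x"
proof -
  obtain n where n: "Q n" "x \<otimes> g [^] n \<in> YK Y v I" using x unfolding reach_def by blast
  have c: "g \<in> carrier A" "d \<in> carrier A" using KV_carrier[OF v] g d by auto
  have "(x \<otimes> g [^] n) \<otimes> d [^] n \<in> YK Y v I"
    by (rule YK_mult[OF v I _ n(2) KV_nat_pow[OF v d]]) (use Y in auto)
  then have "x \<otimes> (g \<otimes> d) [^] n \<in> YK Y v I"
    using A.pow_mult_distrib[OF KV_comm[OF v g d] c] c x by (simp add: A.m_assoc)
  then show ?thesis using n YK_mono[OF _ Y(1)] unfolding reach_def by blast
qed

lemma reach_gather:
  assumes T: "finite T" "\<And>t m. t \<in> T \<Longrightarrow> f t m \<in> carrier A"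
    and C: "\<And>c. c \<in> C \<Longrightarrow> ideal c A"
    and ex: "\<And>t. t \<in> T \<Longrightarrow> \<exists>g Y. monic v g \<and> finite Y \<and> Y \<subseteq> carrier A \<and>
      (\<forall>c\<in>C. \<forall>m. reach Q Y v c g (f t m))"
  shows "\<exists>g Y. monic v g \<and> finite Y \<and> Y \<subseteq> carrier A \<and> (\<forall>c\<in>C. \<forall>t\<in>T. \<forall>m. reach Q Y v c g (f t m))"
  using T ex
proof (induction T)
  case empty
  show ?case using monic_one[OF v] by (intro exI[of _ \<one>] exI[of _ "{}"]) auto
next
  case (insert t T)
  have "\<exists>g Y. monic v g \<and> finite Y \<and> Y \<subseteq> carrier A \<and> (\<forall>c\<in>C. \<forall>t\<in>T. \<forall>m. reach Q Y v c g (f t m))"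
    using insert by blast
  then obtain g Y where g: "monic v g" "finite Y" "Y \<subseteq> carrier A"
    "\<And>c t m. \<lbrakk>c \<in> C; t \<in> T\<rbrakk> \<Longrightarrow> reach Q Y v c g (f t m)" by blast
  obtain h Z where h: "monic v h" "finite Z" "Z \<subseteq> carrier A"
    "\<And>c m. c \<in> C \<Longrightarrow> reach Q Z v c h (f t m)" using insert.prems(2)[of t] by blast
  note K = monic_KV[OF v]
  have "reach Q (Y \<union> Z) v c (g \<otimes> h) (f s m)" if c: "c \<in> C" and s: "s \<in> insert t T" for c s m
  proof (cases "s = t")
    case True
    have "reach Q (Y \<union> Z) v c (h \<otimes> g) (f t m)"
      by (rule reach_mult[OF C[OF c] _ _ K[OF h(1)] K[OF g(1)] _ h(4)[OF c]])
        (use g h insert.prems(1) in auto)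
    then show ?thesis using True KV_comm[OF v K[OF h(1)] K[OF g(1)]] by simp
  next
    case False
    then have "s \<in> T" using s by blast
    then show ?thesis
      by (intro reach_mult[OF C[OF c] _ _ K[OF g(1)] K[OF h(1)] _ g(4)[OF c]])
        (use g h insert.prems(1) in auto)
  qed
  then show ?case using monic_mult[OF v g(1) h(1)] g h
    by (intro exI[of _ "g \<otimes> h"] exI[of _ "Y \<union> Z"]) auto
qed

text \<open>\<open>g [^] n\<close> clears the denominators of the finitely many
  \<open>a l \<otimes> y\<close>, so \<open>D\<close> operators cost \<open>g [^] (n * D)\<close>,
  and a further \<open>g [^] m\<close> brings \<open>x\<close> into the module. If \<open>Q\<close>
  bounds exponents by one, the total is at most \<open>1 + D\<close> whatever \<open>a\<close> and
  \<open>x\<close> are.\<close>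

lemma stdp_torsion:
  assumes I: "ideal I A" and Y: "finite Y" "Y \<subseteq> carrier A" "card Y * card Y < D"
    and g: "g \<in> KV v" and Q: "maxclosed Q" and r: "\<And>x. x \<in> carrier A \<Longrightarrow> reach Q Y v I g x"
    and a: "\<And>i. a i \<in> carrier A"
  shows "\<exists>n. Q n \<and> (\<forall>x\<in>carrier A. \<exists>m. Q m \<and> A.stdp D a \<otimes> (x \<otimes> g [^] (m + n * D)) \<in> I)"
proof -
  have gc: "g \<in> carrier A" using KV_carrier[OF v g] .
  note Yc = subsetD[OF Y(2)]
  let ?S = "(\<lambda>(l, y). a l \<otimes> y) ` ({..<D} \<times> Y)"
  have "\<exists>n. Q n \<and> (\<forall>x\<in>?S. x \<otimes> g [^] n \<in> YK Y v I)"
    by (rule reach_finite[OF I Y(2) g Q]) (use Y a r Yc in auto)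
  then obtain n where n: "Q n" "\<And>l y. \<lbrakk>l < D; y \<in> Y\<rbrakk> \<Longrightarrow> a l \<otimes> y \<otimes> g [^] n \<in> YK Y v I" by auto
  define z where "z = g [^] n"
  have z: "z \<in> KV v" "z \<in> carrier A" unfolding z_def using KV_nat_pow[OF v g] KV_carrier[OF v] by auto
  define e where "e = A.stdp D a"
  have e: "e \<in> carrier A" unfolding e_def using A.stdp_closed a by blast
  have 1: "e \<otimes> (y \<otimes> z [^] D) \<in> I" if "y \<in> Y" for y
    unfolding e_def by (rule stdp_annihilates[OF v I Y z(1) a _ that]) (use n in \<open>auto simp: z_def\<close>)
  have 2: "e \<otimes> (x \<otimes> z [^] D) \<in> I" if x: "x \<in> YK Y v I" for x
  proof -
    have lm: "linmap (\<lambda>x. e \<otimes> (x \<otimes> z [^] D))"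
      by (rule linmap_comp[OF linmap_mult_left[OF e] linmap_mult_right]) (use z in auto)
    have "subsp {x \<in> carrier A. e \<otimes> (x \<otimes> z [^] D) \<in> I}"
      unfolding subsp_def using subspD[OF ideal_subsp[OF I]] linmapD[OF lm] linmap_zero[OF lm] by auto
    moreover have "I \<subseteq> {x \<in> carrier A. e \<otimes> (x \<otimes> z [^] D) \<in> I}"
      using idealD[OF I] e z by auto
    moreover have "y \<otimes> v [^] b \<in> {x \<in> carrier A. e \<otimes> (x \<otimes> z [^] D) \<in> I}" if y: "y \<in> Y" for y and b :: nat
    proof -
      have zD: "z [^] D \<in> carrier A" "z [^] D \<in> KV v" using z KV_nat_pow[OF v] by auto
      have "e \<otimes> (y \<otimes> z [^] D) \<otimes> v [^] b \<in> I" using idealD(3)[OF I 1[OF y]] v by simp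
      moreover have "e \<otimes> (y \<otimes> z [^] D) \<otimes> v [^] b = e \<otimes> (y \<otimes> (z [^] D \<otimes> v [^] b))"
        using e Yc[OF y] zD v by (simp add: A.m_assoc)
      moreover have "z [^] D \<otimes> v [^] b = v [^] b \<otimes> z [^] D"
        by (rule KV_comm[OF v zD(2) KV_pow[OF v]])
      ultimately show ?thesis using e Yc[OF y] zD v by (simp add: A.m_assoc)
    qed
    ultimately have "x \<in> {x \<in> carrier A. e \<otimes> (x \<otimes> z [^] D) \<in> I}"
      by (intro YK_least[OF x])
    then show ?thesis by blast
  qed
  have "\<exists>m. Q m \<and> e \<otimes> (x \<otimes> g [^] (m + n * D)) \<in> I" if x: "x \<in> carrier A" for x
  proof -
    obtain m where m: "Q m" "x \<otimes> g [^] m \<in> YK Y v I" using r[OF x] unfolding reach_def by blast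
    have "(x \<otimes> g [^] m) \<otimes> z [^] D = x \<otimes> g [^] (m + n * D)"
      unfolding z_def using x gc by (simp add: A.m_assoc A.nat_pow_pow A.nat_pow_mult)
    then show ?thesis using 2[OF m(2)] m(1) by auto
  qed
  then show ?thesis unfolding e_def using n(1) by blast
qed

lemma subsp_Collect_mult: "subsp N \<Longrightarrow> d \<in> carrier A \<Longrightarrow> subsp {x \<in> carrier A. x \<otimes> d \<in> N}"
  unfolding subsp_def by (auto simp: A.l_distr smult_mult_left)

text \<open>The relation makes \<open>p\<^sup>J w C\<close>, for a monic \<open>C\<close> in \<open>v\<close>, a combination of lower powers of \<open>p\<close>;
  iterating, every \<open>p\<^sup>m w\<close> is moved below \<open>p\<^sup>J w\<close> by a power of \<open>C\<close>.\<close>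

lemma relation_reach:
  fixes J B :: nat
  assumes I: "ideal I A" and uw: "u \<in> carrier A" "p \<in> carrier A" "w \<in> carrier A"
    and rel: "p [^] J \<otimes> w \<otimes> v [^] B \<in>
      lspan ({p [^] a \<otimes> w \<otimes> v [^] b | a b. a < J \<or> a = J \<and> b < B} \<union> I)"
  shows "\<exists>g Y. monic v g \<and> finite Y \<and> Y \<subseteq> carrier A \<and>
    (\<forall>c\<in>{I}. \<forall>m. reach (\<lambda>_. True) Y v c g (u \<otimes> p [^] (m::nat) \<otimes> w))"
proof -
  define y where "y a = p [^] a \<otimes> w" for a :: nat
  have yc: "y a \<in> carrier A" for a unfolding y_def using uw by simp
  define W where "W = YK (y ` {..<J}) v I"
  have W: "subsp W" unfolding W_def by (rule subsp_YK)
  have IW: "I \<subseteq> W" unfolding W_def using YK_ideal idealD(1)[OF I] by blast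
  have "{p [^] a \<otimes> w \<otimes> v [^] b | a b. a < J \<or> a = J \<and> b < B} \<union> I
    \<subseteq> (\<lambda>z. y J \<otimes> z) ` ((\<lambda>b. v [^] b) ` {..<B}) \<union> W"
  proof
    fix s assume s: "s \<in> {p [^] a \<otimes> w \<otimes> v [^] b | a b. a < J \<or> a = J \<and> b < B} \<union> I"
    show "s \<in> (\<lambda>z. y J \<otimes> z) ` ((\<lambda>b. v [^] b) ` {..<B}) \<union> W"
    proof (cases "s \<in> I")
      case False
      then obtain a b where ab: "s = y a \<otimes> v [^] b" "a < J \<or> a = J \<and> b < B" using s y_def by auto
      show ?thesis
      proof (cases "a < J")
        case True
        then have "s \<in> W" unfolding W_def ab(1) using YK_base[of "y a" _ v b I] yc v by auto
        then show ?thesis by blast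
      qed (use ab in blast)
    qed (use IW in blast)
  qed
  then have "y J \<otimes> v [^] B \<in> lspan ((\<lambda>z. y J \<otimes> z) ` ((\<lambda>b. v [^] b) ` {..<B}) \<union> W)"
    using lspan_mono[OF rel] unfolding y_def by blast
  then obtain q r where q: "q \<in> lspan ((\<lambda>z. y J \<otimes> z) ` ((\<lambda>b. v [^] b) ` {..<B}))"
    and r: "r \<in> lspan W" and e: "y J \<otimes> v [^] B = q \<oplus> r" by (rule lspan_Un)
  have vc: "(\<lambda>b. v [^] b) ` {..<B} \<subseteq> carrier A" using v by auto
  obtain z where z: "z \<in> lspan ((\<lambda>b. v [^] b) ` {..<B})" "q = y J \<otimes> z"
    using lspan_preimage[OF linmap_mult_left[OF yc] q vc] by blast
  have zc: "z \<in> carrier A" using z lspan_carrier by blast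
  have rW: "r \<in> W" using r lspan_of_subsp[OF W] by simp
  \<comment> \<open>The coefficient of \<open>y J\<close> in the relation, a monic polynomial in
    \<open>v\<close>; all other terms lie in \<open>W\<close>.\<close>
  define C where "C = v [^] B \<oplus> \<ominus> z"
  have C: "monic v C" unfolding monic_def C_def
    using subsp_uminus[OF subsp_lspan z(1)] unfolding lowp_def by blast
  have CK: "C \<in> KV v" using monic_KV[OF v C] .
  have Cc: "C \<in> carrier A" using KV_carrier[OF v CK] .
  have "y J \<otimes> C = y J \<otimes> v [^] B \<ominus> q"
    unfolding C_def z(2) using yc[of J] v zc by (simp add: A.r_distr A.r_minus a_minus_def)
  also have "\<dots> = r" unfolding e using subspD(1)[OF W rW] z yc[of J] zc
    by (simp add: a_minus_def M.a_ac M.r_neg)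
  finally have yJC: "y J \<otimes> C \<in> W" using rW by simp
  have Wmult: "x \<otimes> d \<in> W" if "x \<in> W" "d \<in> KV v" for x d
    unfolding W_def by (rule YK_mult[OF v I]) (use that yc W_def in auto)
  have "\<exists>n. \<forall>a'\<le>a. y a' \<otimes> C [^] (n::nat) \<in> W" for a
  proof (induction a)
    case 0
    show ?case
    proof (cases "0 < J")
      case True
      then have "y 0 \<otimes> C [^] (0::nat) \<in> W" unfolding W_def using YK_gen[of "y 0" _ v I] yc v by auto
      then show ?thesis by (intro exI[of _ "0::nat"]) simp
    next
      case False
      then have "y 0 \<otimes> C [^] (1::nat) \<in> W" using yJC Cc by simp
      then show ?thesis by blast
    qed
  next
    case (Suc a)
    then obtain n where n: "\<And>a'. a' \<le> a \<Longrightarrow> y a' \<otimes> C [^] (n::nat) \<in> W" by blast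
    show ?case
    proof (cases "Suc a < J")
      case True
      then have "y (Suc a) \<in> W" unfolding W_def using YK_gen[of "y (Suc a)" _ v I] yc v by auto
      then have "y (Suc a) \<otimes> C [^] n \<in> W" using Wmult KV_nat_pow[OF v CK] by blast
      then show ?thesis using n le_Suc_eq by metis
    next
      case False
      have sp: "subsp {x \<in> carrier A. x \<otimes> C [^] n \<in> W}"
        using subsp_Collect_mult[OF W] Cc by simp
      \<comment> \<open>Multiplying \<open>y J \<otimes> C\<close> on the left by a power of
        \<open>p\<close> leaves only generators of index at most \<open>a\<close>, to which the
        induction hypothesis applies.\<close>
      have "y (Suc a) = p [^] (Suc a - J) \<otimes> y J"
        unfolding y_def using False uw by (simp add: A.m_assoc[symmetric] A.nat_pow_mult)
      then have "y (Suc a) \<otimes> C = p [^] (Suc a - J) \<otimes> (y J \<otimes> C)"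
        using uw yc Cc by (simp add: A.m_assoc)
      also have "\<dots> \<in> YK ((\<otimes>) (p [^] (Suc a - J)) ` y ` {..<J}) v I"
        by (rule YK_left[OF I _ _ v]) (use uw yc yJC W_def in auto)
      finally have "y (Suc a) \<otimes> C \<in> YK ((\<otimes>) (p [^] (Suc a - J)) ` y ` {..<J}) v I" .
      then have "y (Suc a) \<otimes> C \<in> {x \<in> carrier A. x \<otimes> C [^] n \<in> W}"
      proof (rule YK_least[OF _ sp])
        show "I \<subseteq> {x \<in> carrier A. x \<otimes> C [^] n \<in> W}"
          using idealD[OF I] Cc IW by auto
        fix t and b :: nat assume "t \<in> (\<otimes>) (p [^] (Suc a - J)) ` y ` {..<J}"
        then obtain a' where a': "a' < J" "t = p [^] (Suc a - J) \<otimes> y a'" by blast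
        have t: "t = y (Suc a - J + a')"
          unfolding a'(2) y_def using uw by (simp add: A.m_assoc[symmetric] A.nat_pow_mult)
        have "y (Suc a - J + a') \<otimes> C [^] n \<in> W" using n a'(1) False by simp
        then have "t \<otimes> C [^] n \<otimes> v [^] b \<in> W" using Wmult KV_pow[OF v] t by simp
        then show "t \<otimes> v [^] b \<in> {x \<in> carrier A. x \<otimes> C [^] n \<in> W}"
          using KV_comm[OF v KV_nat_pow[OF v CK, of n] KV_pow[OF v, of b]] t yc v Cc
          by (simp add: A.m_assoc)
      qed
      then have "y (Suc a) \<otimes> C \<otimes> C [^] n \<in> W" by blast
      then have 1: "y (Suc a) \<otimes> C [^] Suc n \<in> W"
        using yc Cc A.nat_pow_Suc2[OF Cc, of n] by (simp add: A.m_assoc)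
      have "y a' \<otimes> C [^] Suc n \<in> W" if "a' \<le> a" for a'
        using Wmult[OF n[OF that] CK] yc Cc by (simp add: A.m_assoc)
      then show ?thesis using 1 le_Suc_eq by metis
    qed
  qed
  then have ex: "\<exists>n. y a \<otimes> C [^] (n::nat) \<in> W" for a by blast
  have "reach (\<lambda>_. True) ((\<otimes>) u ` y ` {..<J}) v I C (u \<otimes> p [^] m \<otimes> w)" for m :: nat
  proof -
    obtain n where n: "y m \<otimes> C [^] (n::nat) \<in> W" using ex by blast
    have "u \<otimes> (y m \<otimes> C [^] n) \<in> YK ((\<otimes>) u ` y ` {..<J}) v I"
      by (rule YK_left[OF I uw(1) _ v]) (use yc n W_def in auto)
    moreover have "u \<otimes> (y m \<otimes> C [^] n) = u \<otimes> p [^] m \<otimes> w \<otimes> C [^] n"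
      unfolding y_def using uw Cc by (simp add: A.m_assoc)
    ultimately show ?thesis unfolding reach_def by auto
  qed
  then show ?thesis using C uw yc by (intro exI[of _ C] exI[of _ "(\<otimes>) u ` y ` {..<J}"]) auto
qed

end

end

section \<open>Denominators of exponent one, by specialising \<open>v\<close> to scalars\<close>

context kalg
begin

text \<open>A relation is stripped of common factors \<open>v - b\<close> by moving them into \<open>g\<close>. Afterwards, for every
  scalar \<open>b\<close>, specialising \<open>v\<close> to \<open>b\<close> leaves a nontrivial relation among the powers of \<open>p\<close>.\<close>

lemma primitive_relation:
  fixes J B :: nat
  assumes v: "v \<in> carrier A" and I: "ideal I A" and g: "monic v g"
    and uc: "\<And>a. u a \<in> carrier A"
    and rel: "u J \<otimes> g \<otimes> v [^] B \<in>
      lspan ({u a \<otimes> g \<otimes> v [^] b | a b. a < J \<or> a = J \<and> b < B} \<union> I)"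
  shows "\<exists>g. monic v g \<and> (\<forall>b\<in>carrier k. \<exists>a\<le>J. u a \<otimes> g \<in>
     lspan ((\<lambda>a. u a \<otimes> g) ` {..<a} \<union> YK (range (\<lambda>a. u a \<otimes> (g \<otimes> (v \<ominus> b \<odot> \<one>)))) v I))"
  using g rel
proof (induction B arbitrary: g rule: less_induct)
  case (less B)
  define y where "y a = u a \<otimes> g" for a
  have gK: "g \<in> KV v" "g \<in> carrier A" using monic_KV[OF v less.prems(1)] KV_carrier[OF v] by auto
  have yc: "y a \<in> carrier A" for a unfolding y_def using uc gK by simp
  show ?case
  proof (cases "\<forall>b\<in>carrier k. \<exists>a\<le>J. u a \<otimes> g \<in>
     lspan ((\<lambda>a. u a \<otimes> g) ` {..<a} \<union> YK (range (\<lambda>a. u a \<otimes> (g \<otimes> (v \<ominus> b \<odot> \<one>)))) v I)")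
    case True
    then show ?thesis using less.prems(1) by blast
  next
    case False
    \<comment> \<open>At this \<open>b\<close> specialisation gives no relation: modulo the
      multiples by \<open>v - b\<close>, no \<open>y a\<close> with \<open>a \<le> J\<close> depends
      on the earlier ones. This independence forces the whole relation to be divisible by
      \<open>v - b\<close>.\<close>
    then obtain b where b: "b \<in> carrier k" and nb: "\<And>a. a \<le> J \<Longrightarrow> y a \<notin>
      lspan (y ` {..<a} \<union> YK (range (\<lambda>a. u a \<otimes> (g \<otimes> (v \<ominus> b \<odot> \<one>)))) v I)"
      unfolding y_def by blast
    define l where "l = v \<ominus> b \<odot> \<one>"
    have lc: "l \<in> carrier A" unfolding l_def using v b by simp
    define g' where "g' = g \<otimes> l"
    have g': "monic v g'" unfolding g'_def l_def by (rule monic_mult[OF v less.prems(1) monic_linear[OF v b]])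
    define y' where "y' a = u a \<otimes> g'" for a
    define M where "M = YK (range y') v I"
    have M: "subsp M" unfolding M_def by (rule subsp_YK)
    have IM: "I \<subseteq> M" unfolding M_def using YK_ideal idealD(1)[OF I] by blast
    have nb': "y a \<notin> lspan (y ` {..<a} \<union> M)" if "a \<le> J" for a
      using nb[OF that] unfolding M_def y'_def g'_def l_def .
    have y': "y' a = y a \<otimes> l" for a unfolding y'_def y_def g'_def using uc gK lc by (simp add: A.m_assoc)
    have y'c: "y' a \<in> carrier A" for a unfolding y' using yc lc by simp
    have y'M: "y' a \<otimes> v [^] c \<in> M" for a and c :: nat
      unfolding M_def by (rule YK_base) (use y'c v in auto)
    have y'q: "y' a \<otimes> q \<in> lspan ((\<lambda>c. y' a \<otimes> v [^] c) ` {..<c})" if "q \<in> lowp v c" for a q and c :: nat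
      using that unfolding lowp_def
      by (rule lspan_image[OF linmap_mult_left[OF y'c] _ _ subsp_lspan])
        (use y'c v in \<open>auto intro!: lspan_base\<close>)
    have ex: "y a \<otimes> (\<beta> \<odot> \<one> \<oplus> l \<otimes> q) = \<beta> \<odot> y a \<oplus> y' a \<otimes> q"
      if "\<beta> \<in> carrier k" "q \<in> carrier A" for a \<beta> q
      unfolding y' using that yc[of a] lc by (simp add: A.r_distr smult_mult_right A.m_assoc)
    have red: "y a \<otimes> v [^] c \<in> lspan (insert (y a) ((\<lambda>c. y' a \<otimes> v [^] c) ` {..<c}))" for a and c :: nat
    proof -
      obtain \<beta> q where q: "\<beta> \<in> carrier k" "q \<in> lowp v c" "v [^] c = \<beta> \<odot> \<one> \<oplus> l \<otimes> q"
        using pow_remainder(1)[OF v b] unfolding l_def by blast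
      have "\<beta> \<odot> y a \<oplus> y' a \<otimes> q \<in> lspan (insert (y a) ((\<lambda>c. y' a \<otimes> v [^] c) ` {..<c}))"
        by (rule lspan.step[OF q(1) _ yc lspan_mono[OF y'q[OF q(2)]]]) auto
      then show ?thesis unfolding q(3) using ex[OF q(1) lowp_carrier[OF v q(2)]] by simp
    qed
    have rel: "y J \<otimes> v [^] B \<in> lspan ({y a \<otimes> v [^] b | a b. a < J \<or> a = J \<and> b < B} \<union> I)"
      using less.prems(2) unfolding y_def .
    \<comment> \<open>For \<open>B = 0\<close> the relation itself would express \<open>y J\<close>
      through earlier ones modulo \<open>M\<close>, against the choice of \<open>b\<close>.\<close>
    obtain B' where B': "B = Suc B'"
    proof (cases B)
      case 0
      have "y J \<otimes> v [^] B \<in> lspan (y ` {..<J} \<union> M)"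
      proof (rule lspan_subset[OF rel], rule subsetI)
        fix s assume s: "s \<in> ({y a \<otimes> v [^] b | a b. a < J \<or> a = J \<and> b < B} \<union> I) \<inter> carrier A"
        show "s \<in> lspan (y ` {..<J} \<union> M)"
        proof (cases "s \<in> I")
          case True
          then show ?thesis using s IM by (intro lspan_base) auto
        next
          case False
          then obtain a and c :: nat where ac: "s = y a \<otimes> v [^] c" "a < J" using s 0 by auto
          show ?thesis unfolding ac(1)
            by (rule lspan_mono[OF red]) (use ac(2) y'M in auto)
        qed
      qed
      then have "y J \<in> lspan (y ` {..<J} \<union> M)" using 0 yc by simp
      then show ?thesis using nb' by blast
    qed (rule that)
    define S where "S = {y' a \<otimes> v [^] b | a b. a < J \<or> a = J \<and> b < B'} \<union> I"
    have SM: "S \<subseteq> M" unfolding S_def using y'M IM by auto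
    have "{y a \<otimes> v [^] b | a b. a < J \<or> a = J \<and> b < B} \<union> I \<subseteq> lspan (y ` {..<Suc J} \<union> S)"
    proof
      fix s assume s: "s \<in> {y a \<otimes> v [^] b | a b. a < J \<or> a = J \<and> b < B} \<union> I"
      show "s \<in> lspan (y ` {..<Suc J} \<union> S)"
      proof (cases "s \<in> I")
        case True
        then show ?thesis unfolding S_def using idealD(1)[OF I] by (intro lspan_base) auto
      next
        case False
        then obtain a c where ac: "s = y a \<otimes> v [^] c" "a < J \<or> a = J \<and> c < B" using s by blast
        have "(\<lambda>c. y' a \<otimes> v [^] c) ` {..<c} \<subseteq> S"
        proof
          fix x assume "x \<in> (\<lambda>c. y' a \<otimes> v [^] c) ` {..<c}"
          then obtain c' where "c' < c" "x = y' a \<otimes> v [^] c'" by blast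
          moreover from this ac(2) B' have "a < J \<or> a = J \<and> c' < B'" by auto
          ultimately show "x \<in> S" unfolding S_def by blast
        qed
        moreover have "y a \<in> y ` {..<Suc J}" using ac(2) by auto
        ultimately show ?thesis unfolding ac(1) by (intro lspan_mono[OF red]) blast
      qed
    qed
    then have yB: "y J \<otimes> v [^] B \<in> lspan (y ` {..<Suc J} \<union> S)"
      using lspan_subset[OF rel] by blast
    obtain \<beta> q where q: "\<beta> \<in> carrier k" "q \<in> lowp v B'" "v [^] Suc B' = \<beta> \<odot> \<one> \<oplus> l \<otimes> (v [^] B' \<oplus> q)"
      using pow_remainder(2)[OF v b] unfolding l_def by blast
    have qc: "q \<in> carrier A" using lowp_carrier[OF v q(2)] .
    have "y J \<otimes> v [^] B = \<beta> \<odot> y J \<oplus> y' J \<otimes> (v [^] B' \<oplus> q)"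
      unfolding B' q(3) using ex[OF q(1), of "v [^] B' \<oplus> q" J] qc v by simp
    also have "\<dots> = y' J \<otimes> v [^] B' \<oplus> (\<beta> \<odot> y J \<oplus> y' J \<otimes> q)"
      using qc v y'c[of J] yc[of J] q(1) by (simp add: A.r_distr M.a_lcomm)
    finally have 1: "y' J \<otimes> v [^] B' \<oplus> (\<beta> \<odot> y J \<oplus> y' J \<otimes> q) \<in> lspan (y ` {..<Suc J} \<union> S)"
      using yB by simp
    have 2: "\<beta> \<odot> y J \<oplus> y' J \<otimes> q \<in> lspan (y ` {..<Suc J} \<union> S)"
    proof (rule lspan.step[OF q(1) _ yc])
      show "y' J \<otimes> q \<in> lspan (y ` {..<Suc J} \<union> S)"
        by (rule lspan_mono[OF y'q[OF q(2)]]) (auto simp: S_def)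
    qed auto
    have "y' J \<otimes> v [^] B' \<in> lspan (y ` {..<Suc J} \<union> S)"
      using subsp_add_mem[OF subsp_lspan _ 1 2] y'c v by simp
    then obtain x s where x: "x \<in> lspan (y ` {..<Suc J})" and s: "s \<in> lspan S" and e: "y' J \<otimes> v [^] B' = x \<oplus> s"
      by (rule lspan_Un)
    have sM: "s \<in> M" using lspan_least[OF M s] SM by blast
    have xc: "x \<in> carrier A" "s \<in> carrier A" using x s lspan_carrier by auto
    have xM: "x \<in> M" using subsp_add_mem[OF M xc(1) _ sM] y'M e by metis
    \<comment> \<open>\<open>x\<close> is the remainder of the relation modulo \<open>v - b\<close>,
      a combination of the \<open>y a\<close> that also lies in \<open>M\<close>; independence
      excludes a leading term. What is left is the quotient relation, with \<open>g'\<close> for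
      \<open>g\<close> and \<open>B'\<close> for \<open>B\<close>.\<close>
    have x0: "x = \<zero>"
    proof (rule ccontr)
      assume "x \<noteq> \<zero>"
      then obtain a \<alpha> r where a: "a < Suc J" "\<alpha> \<in> carrier k" "\<alpha> \<noteq> \<zero>\<^bsub>k\<^esub>" "r \<in> lspan (y ` {..<a})"
        "x = \<alpha> \<odot> y a \<oplus> r"
        using lspan_top[OF x yc] by blast
      have "x \<in> lspan (y ` {..<a} \<union> M)" using xM xc by (intro lspan_base) auto
      then have "\<alpha> \<odot> y a \<in> lspan (y ` {..<a} \<union> M)"
        using subsp_add_mem[OF subsp_lspan _ _ lspan_mono[OF a(4)], of "\<alpha> \<odot> y a" "y ` {..<a} \<union> M"] a yc by simp
      then have "y a \<in> lspan (y ` {..<a} \<union> M)"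
        using subsp_smult_mem[OF subsp_lspan yc a(2,3)] by blast
      then show False using nb' a(1) by simp
    qed
    have "y' J \<otimes> v [^] B' \<in> lspan S" using e x0 s xc by simp
    then have "u J \<otimes> g' \<otimes> v [^] B' \<in>
        lspan ({u a \<otimes> g' \<otimes> v [^] b | a b. a < J \<or> a = J \<and> b < B'} \<union> I)"
      unfolding S_def y'_def .
    then show ?thesis using less.IH[OF _ g', of B'] B' by blast
  qed
qed

text \<open>Hence modulo \<open>I\<close> and modulo a multiple of any monic \<open>h\<close>, the powers below \<open>J\<close> suffice: peel off the
  linear factors of \<open>h\<close> one at a time.\<close>

lemma fibrewise_span:
  fixes J B :: nat
  assumes ac: "algebraically_closed k" and v: "v \<in> carrier A" and I: "ideal I A"
    and p: "p \<in> carrier A" and w: "w \<in> carrier A"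
    and rel: "p [^] J \<otimes> w \<otimes> v [^] B \<in>
      lspan ({p [^] a \<otimes> w \<otimes> v [^] b | a b. a < J \<or> a = J \<and> b < B} \<union> I)"
  shows "\<exists>g. monic v g \<and> (\<forall>h. monic v h \<longrightarrow> (\<forall>m::nat. p [^] m \<otimes> w \<otimes> g \<in>
    lspan (YK ((\<lambda>a. p [^] a \<otimes> w \<otimes> g) ` {..<J}) v I \<union> YK (range (\<lambda>a::nat. p [^] a \<otimes> w \<otimes> (g \<otimes> h))) v I)))"
proof -
  define u where "u a = p [^] a \<otimes> w" for a :: nat
  have uc: "u a \<in> carrier A" for a unfolding u_def using p w by simp
  have "u J \<otimes> \<one> \<otimes> v [^] B \<in> lspan ({u a \<otimes> \<one> \<otimes> v [^] b | a b. a < J \<or> a = J \<and> b < B} \<union> I)"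
    using rel p w unfolding u_def by simp
  from primitive_relation[where u = u, OF v I monic_one[OF v] uc this]
  obtain g where g: "monic v g" and Z: "\<And>b. b \<in> carrier k \<Longrightarrow> \<exists>a\<le>J. u a \<otimes> g \<in>
     lspan ((\<lambda>a. u a \<otimes> g) ` {..<a} \<union> YK (range (\<lambda>a. u a \<otimes> (g \<otimes> (v \<ominus> b \<odot> \<one>)))) v I)" by blast
  define y where "y a = u a \<otimes> g" for a
  have gK: "g \<in> KV v" "g \<in> carrier A" using monic_KV[OF v g] KV_carrier[OF v] by auto
  have yc: "y a \<in> carrier A" for a unfolding y_def using uc gK by simp
  define M where "M h = YK (range (\<lambda>a. u a \<otimes> (g \<otimes> h))) v I" for h
  have Ms: "subsp (M h)" for h unfolding M_def by (rule subsp_YK)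
  have Mmult: "x \<otimes> d \<in> M h" if "x \<in> M h" "d \<in> KV v" "h \<in> carrier A" for x d h
    unfolding M_def by (rule YK_mult[OF v I]) (use that uc gK M_def in auto)
  have IM: "I \<subseteq> M h" for h unfolding M_def using YK_ideal idealD(1)[OF I] by blast
  have pu: "p [^] d \<otimes> u a = u (d + a)" for d a
    unfolding u_def using p w by (simp add: A.m_assoc[symmetric] A.nat_pow_mult)
  have Mleft: "p [^] d \<otimes> x \<in> M h" if x: "x \<in> M h" and h: "h \<in> carrier A" for x h and d :: nat
  proof -
    have "p [^] d \<otimes> x \<in> YK ((\<otimes>) (p [^] d) ` range (\<lambda>a. u a \<otimes> (g \<otimes> h))) v I"
      by (rule YK_left[OF I _ _ v]) (use p uc gK h x M_def in auto)
    moreover have "(\<otimes>) (p [^] d) ` range (\<lambda>a. u a \<otimes> (g \<otimes> h)) \<subseteq> range (\<lambda>a. u a \<otimes> (g \<otimes> h))"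
    proof -
      have "p [^] d \<otimes> (u a \<otimes> (g \<otimes> h)) = u (d + a) \<otimes> (g \<otimes> h)" for a
        unfolding pu[symmetric] using p uc gK h by (simp add: A.m_assoc)
      then show ?thesis by auto
    qed
    ultimately show ?thesis unfolding M_def using YK_mono by blast
  qed
  \<comment> \<open>The case of one linear factor: the relation at \<open>b\<close> has a leading
    \<open>y a\<close> with \<open>a \<le> J\<close>, and its left multiples by powers of
    \<open>p\<close> push every index below \<open>J\<close>.\<close>
  have fib: "y m \<in> lspan (y ` {..<J} \<union> M (v \<ominus> b \<odot> \<one>))" if b: "b \<in> carrier k" for b m
  proof -
    obtain a where a: "a \<le> J" "y a \<in> lspan (y ` {..<a} \<union> M (v \<ominus> b \<odot> \<one>))"
      using Z[OF b] unfolding y_def M_def by blast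
    have lc: "v \<ominus> b \<odot> \<one> \<in> carrier A" using v b by simp
    show ?thesis
    proof (induction m rule: less_induct)
      case (less m)
      show ?case
      proof (cases "m < J")
        case True
        then show ?thesis using yc by (intro lspan_base) auto
      next
        case False
        define d where "d = m - a"
        have m: "m = d + a" unfolding d_def using False a(1) by simp
        have "p [^] d \<otimes> y a \<in> lspan (y ` {..<J} \<union> M (v \<ominus> b \<odot> \<one>))"
        proof (rule lspan_image[OF linmap_mult_left a(2) _ subsp_lspan])
          fix s assume s: "s \<in> y ` {..<a} \<union> M (v \<ominus> b \<odot> \<one>)" "s \<in> carrier A"
          show "p [^] d \<otimes> s \<in> lspan (y ` {..<J} \<union> M (v \<ominus> b \<odot> \<one>))"
          proof (cases "s \<in> M (v \<ominus> b \<odot> \<one>)")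
            case True
            then show ?thesis using Mleft[OF True lc] s p by (intro lspan_base) auto
          next
            case False
            then obtain a' where a': "a' < a" "s = y a'" using s by auto
            have "p [^] d \<otimes> s = y (d + a')"
              unfolding a'(2) y_def pu[symmetric] using p uc gK by (simp add: A.m_assoc)
            then show ?thesis using less.IH[of "d + a'"] a'(1) m by simp
          qed
        qed (use p in simp)
        moreover have "p [^] d \<otimes> y a = y m"
          unfolding m y_def pu[symmetric] using p uc gK by (simp add: A.m_assoc)
        ultimately show ?thesis by simp
      qed
    qed
  qed
  define Y where "Y = YK (y ` {..<J}) v I"
  have Ymult: "x \<otimes> d \<in> Y" if "x \<in> Y" "d \<in> KV v" for x d
    unfolding Y_def by (rule YK_mult[OF v I]) (use that yc Y_def in auto)
  have yY: "y a \<in> Y" if "a < J" for a unfolding Y_def by (rule YK_gen) (use that yc v in auto)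
  have main: "z \<in> lowp v n \<Longrightarrow> y m \<in> lspan (Y \<union> M (v [^] n \<oplus> z))" for n z m
  proof (induction n arbitrary: z m)
    case 0
    then have z: "z = \<zero>" unfolding lowp_def by (auto elim: lspan.cases)
    have "y m \<in> M \<one>" unfolding M_def by (rule YK_gen) (use uc gK v yc in \<open>auto simp: y_def\<close>)
    then show ?case using z yc by (auto intro!: lspan_base)
  next
    case (Suc n)
    obtain b z' where b: "b \<in> carrier k" and z': "z' \<in> lowp v n"
      and e: "v [^] Suc n \<oplus> z = (v \<ominus> b \<odot> \<one>) \<otimes> (v [^] n \<oplus> z')"
      using monic_factor[OF v ac Suc.prems] by blast
    define h where "h = v [^] n \<oplus> z'"
    define l where "l = v \<ominus> b \<odot> \<one>"
    have hK: "h \<in> KV v" unfolding h_def using subspD(3)[OF subsp_KV[OF v] KV_pow[OF v] lowp_KV[OF v z']] .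
    have lK: "l \<in> KV v" unfolding l_def using monic_KV[OF v monic_linear[OF v b]] .
    have hc: "h \<in> carrier A" "l \<in> carrier A" using KV_carrier[OF v] hK lK by auto
    \<comment> \<open>Multiplied by \<open>h\<close>, the statement for the linear factor
      \<open>l\<close> has its error term in \<open>M (l \<otimes> h)\<close>. This rewrites the
      error term in \<open>M h\<close> that the induction hypothesis leaves.\<close>
    have gen: "y a \<otimes> d \<in> lspan (Y \<union> M (l \<otimes> h))" if d: "d = h \<otimes> v [^] c" for a d and c :: nat
    proof (rule lspan_image[OF linmap_mult_right _ _ subsp_lspan])
      show "y a \<in> lspan (y ` {..<J} \<union> M l)" unfolding l_def by (rule fib[OF b])
      show dc: "d \<in> carrier A" using d hc v by simp
      have dK: "d \<in> KV v" unfolding d using KV_mult[OF v hK KV_pow[OF v]] .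
      fix s assume s: "s \<in> y ` {..<J} \<union> M l" "s \<in> carrier A"
      have "s \<otimes> d \<in> M (l \<otimes> h)" if sM: "s \<in> M l"
      proof -
        have "s \<in> {x \<in> carrier A. x \<otimes> d \<in> M (l \<otimes> h)}"
        proof (rule YK_least[OF _ subsp_Collect_mult[OF v Ms dc]])
          show "s \<in> YK (range (\<lambda>a. u a \<otimes> (g \<otimes> l))) v I" using sM unfolding M_def .
          show "I \<subseteq> {x \<in> carrier A. x \<otimes> d \<in> M (l \<otimes> h)}"
            by (auto intro!: subsetD[OF IM] idealD(3)[OF I _ dc] dest: idealD(1)[OF I])
          fix t and c' :: nat assume "t \<in> range (\<lambda>a. u a \<otimes> (g \<otimes> l))"
          then obtain a where t: "t = u a \<otimes> (g \<otimes> l)" by blast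
          have "v [^] c' \<otimes> d = h \<otimes> (v [^] c' \<otimes> v [^] c)"
            unfolding d using KV_comm[OF v KV_pow[OF v, of c'] hK] hc v by (metis A.m_assoc A.nat_pow_closed)
          then have "t \<otimes> v [^] c' \<otimes> d = u a \<otimes> (g \<otimes> (l \<otimes> h)) \<otimes> v [^] (c' + c)"
            unfolding t using uc gK hc v dc by (simp add: A.m_assoc A.nat_pow_mult)
          then have "t \<otimes> v [^] c' \<otimes> d \<in> M (l \<otimes> h)"
            unfolding M_def using YK_base[of "u a \<otimes> (g \<otimes> (l \<otimes> h))" _ v "c' + c" I] uc gK hc v by auto
          then show "t \<otimes> v [^] c' \<in> {x \<in> carrier A. x \<otimes> d \<in> M (l \<otimes> h)}"
            using t uc gK hc v by simp
        qed
        then show ?thesis by blast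
      qed
      moreover have "s \<otimes> d \<in> Y" if "s \<notin> M l" using Ymult[OF yY dK] s that by auto
      ultimately show "s \<otimes> d \<in> lspan (Y \<union> M (l \<otimes> h))" using s dc by (intro lspan_base) auto
    qed
    have "y m \<in> lspan (Y \<union> M h)" unfolding h_def by (rule Suc.IH[OF z'])
    then have "y m \<in> lspan (Y \<union> M (l \<otimes> h))"
    proof (rule lspan_subset, intro subsetI)
      fix s assume s: "s \<in> (Y \<union> M h) \<inter> carrier A"
      show "s \<in> lspan (Y \<union> M (l \<otimes> h))"
      proof (cases "s \<in> Y")
        case True
        then show ?thesis using s by (intro lspan_base) auto
      next
        case False
        then have "s \<in> M h" using s by blast
        then show ?thesis unfolding M_def[of h]
        proof (rule YK_least[OF _ subsp_lspan])
          show "I \<subseteq> lspan (Y \<union> M (l \<otimes> h))" using IM idealD(1)[OF I] by (blast intro: lspan_base)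
          fix t and c :: nat assume "t \<in> range (\<lambda>a. u a \<otimes> (g \<otimes> h))"
          then obtain a where "t = u a \<otimes> (g \<otimes> h)" by blast
          then have "t \<otimes> v [^] c = y a \<otimes> (h \<otimes> v [^] c)"
            unfolding y_def using uc gK hc v by (simp add: A.m_assoc)
          then show "t \<otimes> v [^] c \<in> lspan (Y \<union> M (l \<otimes> h))" using gen by simp
        qed
      qed
    qed
    then show ?case unfolding e h_def l_def .
  qed
  have "p [^] m \<otimes> w \<otimes> g \<in> lspan (YK ((\<lambda>a. p [^] a \<otimes> w \<otimes> g) ` {..<J}) v I
      \<union> YK (range (\<lambda>a::nat. p [^] a \<otimes> w \<otimes> (g \<otimes> h))) v I)" if "monic v h" for h and m :: nat
  proof -
    obtain n z where "z \<in> lowp v n" "h = v [^] n \<oplus> z" using \<open>monic v h\<close> unfolding monic_def by blast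
    then show ?thesis using main[of z n m] unfolding Y_def M_def y_def u_def by simp
  qed
  then show ?thesis using g by blast
qed

text \<open>If \<open>c\<close> contains a monic \<open>h\<close>, the second summand in
  \<open>fibrewise_span\<close> lies in \<open>c\<close>, and a single factor \<open>g\<close>
  brings every \<open>u \<otimes> p [^] m \<otimes> w\<close> into the module. The point is that
  \<open>g\<close> and \<open>Y\<close> are chosen before \<open>c\<close>, whatever the degree of
  \<open>h\<close>.\<close>

lemma relation_reach_bounded:
  fixes J B :: nat
  assumes ac: "algebraically_closed k" and v: "v \<in> carrier A" and I: "ideal I A"
    and uw: "u \<in> carrier A" "p \<in> carrier A" "w \<in> carrier A"
    and rel: "p [^] J \<otimes> w \<otimes> v [^] B \<in>
      lspan ({p [^] a \<otimes> w \<otimes> v [^] b | a b. a < J \<or> a = J \<and> b < B} \<union> I)"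
  shows "\<exists>g Y. monic v g \<and> finite Y \<and> Y \<subseteq> carrier A \<and>
    (\<forall>c\<in>{c. ideal c A \<and> I \<subseteq> c \<and> (\<exists>h\<in>c. monic v h)}. \<forall>m.
      reach (\<lambda>n. n \<le> 1) Y v c g (u \<otimes> p [^] (m::nat) \<otimes> w))"
proof -
  obtain g where g: "monic v g" and sp: "\<And>h m. monic v h \<Longrightarrow> p [^] (m::nat) \<otimes> w \<otimes> g \<in>
    lspan (YK ((\<lambda>a. p [^] a \<otimes> w \<otimes> g) ` {..<J}) v I \<union> YK (range (\<lambda>a::nat. p [^] a \<otimes> w \<otimes> (g \<otimes> h))) v I)"
    using fibrewise_span[OF ac v I uw(2,3) rel] by blast
  have gc: "g \<in> carrier A" using KV_carrier[OF v monic_KV[OF v g]] .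
  let ?Y = "(\<lambda>a. p [^] a \<otimes> w \<otimes> g) ` {..<J}"
  have Yc: "?Y \<subseteq> carrier A" using uw gc by auto
  have "reach (\<lambda>n. n \<le> 1) ((\<otimes>) u ` ?Y) v c g (u \<otimes> p [^] m \<otimes> w)"
    if c: "ideal c A" "I \<subseteq> c" "h \<in> c" "monic v h" for c h and m :: nat
  proof -
    have cc: "c \<subseteq> carrier A" using idealD(1)[OF c(1)] by blast
    have "YK (range (\<lambda>a::nat. p [^] a \<otimes> w \<otimes> (g \<otimes> h))) v I \<subseteq> c"
    proof
      fix x assume x: "x \<in> YK (range (\<lambda>a::nat. p [^] a \<otimes> w \<otimes> (g \<otimes> h))) v I"
      show "x \<in> c"
      proof (rule YK_least[OF x ideal_subsp[OF c(1)] c(2)])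
        fix t and b :: nat assume "t \<in> range (\<lambda>a::nat. p [^] a \<otimes> w \<otimes> (g \<otimes> h))"
        then show "t \<otimes> v [^] b \<in> c"
          using idealD[OF c(1)] c(3) uw gc v by auto
      qed
    qed
    then have "p [^] m \<otimes> w \<otimes> g \<in> YK ?Y v c"
      using lspan_least[OF subsp_YK[of ?Y v c] sp[OF c(4), of m]]
        YK_mono[where Y = ?Y and Y' = ?Y and I = I and I' = c, OF _ _ c(2)] YK_ideal[OF _ cc] by blast
    then have "u \<otimes> (p [^] m \<otimes> w \<otimes> g) \<in> YK ((\<otimes>) u ` ?Y) v c"
      by (rule YK_left[OF c(1) uw(1) Yc v])
    then have "u \<otimes> p [^] m \<otimes> w \<otimes> g [^] (1::nat) \<in> YK ((\<otimes>) u ` ?Y) v c"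
      using uw gc by (simp add: A.m_assoc)
    then show ?thesis unfolding reach_def by blast
  qed
  moreover have "finite ((\<otimes>) u ` ?Y)" "(\<otimes>) u ` ?Y \<subseteq> carrier A" using uw Yc by auto
  ultimately show ?thesis using g by (intro exI[of _ g] exI[of _ "(\<otimes>) u ` ?Y"]) auto
qed

end

section \<open>Algebras spanned by periodic words\<close>

text \<open>The output of the combinatorics of normal words. In \<open>rel\<close>, one product of
  powers of \<open>v\<close> and \<open>v'\<close> depends on those with lexicographically smaller
  exponents; read over \<open>k[v']\<close>, this relation has a monic leading coefficient.\<close>

locale periodic_span = kalg k A for k and A (structure) +
  fixes I T
  assumes ac: "algebraically_closed k" and I: "ideal I A"
    and T: "finite T" "\<And>u v w. (u, v, w) \<in> T \<Longrightarrow> u \<in> carrier A \<and> v \<in> carrier A \<and> w \<in> carrier A"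
    and span: "\<And>x. x \<in> carrier A \<Longrightarrow>
      x \<in> lspan ({u \<otimes> v [^] (m::nat) \<otimes> w | u v w m. (u, v, w) \<in> T} \<union> I)"
    and rel: "\<And>u v w u' v' w'. \<lbrakk>(u, v, w) \<in> T; (u', v', w') \<in> T\<rbrakk> \<Longrightarrow>
      \<exists>(J::nat) (B::nat). v [^] J \<otimes> w \<otimes> v' [^] B \<in>
        lspan ({v [^] a \<otimes> w \<otimes> v' [^] b | a b. a < J \<or> a = J \<and> b < B} \<union> I)"
begin

lemma reach_all:
  assumes s: "(u', v, w') \<in> T" and Q: "maxclosed Q"
    and C: "\<And>c. c \<in> C \<Longrightarrow> ideal c A \<and> I \<subseteq> c"
    and ex: "\<And>u p w. (u, p, w) \<in> T \<Longrightarrow> \<exists>g Y. monic v g \<and> finite Y \<and> Y \<subseteq> carrier A \<and>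
      (\<forall>c\<in>C. \<forall>m. reach Q Y v c g (u \<otimes> p [^] (m::nat) \<otimes> w))"
  shows "\<exists>g Y. monic v g \<and> finite Y \<and> Y \<subseteq> carrier A \<and> (\<forall>c\<in>C. \<forall>x\<in>carrier A. reach Q Y v c g x)"
proof -
  have v: "v \<in> carrier A" using T(2)[OF s] by simp
  define f where "f t m = (case t of (u, p, w) \<Rightarrow> u \<otimes> p [^] (m::nat) \<otimes> w)" for t m
  have fc: "f t m \<in> carrier A" if "t \<in> T" for t m
    using that T(2) unfolding f_def by (cases t) auto
  have "\<exists>g Y. monic v g \<and> finite Y \<and> Y \<subseteq> carrier A \<and> (\<forall>c\<in>C. \<forall>t\<in>T. \<forall>m. reach Q Y v c g (f t m))"
  proof (rule reach_gather[OF v T(1) fc])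
    fix t assume "t \<in> T"
    then show "\<exists>g Y. monic v g \<and> finite Y \<and> Y \<subseteq> carrier A \<and> (\<forall>c\<in>C. \<forall>m. reach Q Y v c g (f t m))"
      using ex unfolding f_def by (cases t) auto
  qed (use C in auto)
  then obtain g Y where g: "monic v g" "finite Y" "Y \<subseteq> carrier A"
    and r: "\<And>c t m. \<lbrakk>c \<in> C; t \<in> T\<rbrakk> \<Longrightarrow> reach Q Y v c g (f t m)" by blast
  have "reach Q Y v c g x" if c: "c \<in> C" and x: "x \<in> carrier A" for c x
  proof (rule reach_span[OF v _ g(3) monic_KV[OF v g(1)] Q])
    show "ideal c A" using C[OF c] by simp
    show "x \<in> lspan ({u \<otimes> v [^] (m::nat) \<otimes> w | u v w m. (u, v, w) \<in> T} \<union> c)"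
      by (rule lspan_mono[OF span[OF x]]) (use C[OF c] in blast)
    fix s assume "s \<in> {u \<otimes> v [^] (m::nat) \<otimes> w | u v w m. (u, v, w) \<in> T}"
    then obtain u p w m where "(u, p, w) \<in> T" "s = f (u, p, w) m" unfolding f_def by auto
    then show "reach Q Y v c g s" using r[OF c] by blast
  qed
  then show ?thesis using g by blast
qed

text \<open>Stated for all large \<open>D\<close>, so that the finitely many \<open>v\<close>
  occurring in \<open>T\<close> can share one degree.\<close>

lemma torsion_eventually:
  assumes s: "(u', v, w') \<in> T"
  shows "\<exists>g. monic v g \<and> (\<forall>\<^sub>F D in sequentially. \<forall>a. (\<forall>i. a i \<in> carrier A) \<longrightarrow>
    (\<forall>x\<in>carrier A. \<exists>n::nat. A.stdp D a \<otimes> (x \<otimes> g [^] n) \<in> I))"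
proof -
  have v: "v \<in> carrier A" using T(2)[OF s] by simp
  have Q: "maxclosed (\<lambda>_. True)" unfolding maxclosed_def by simp
  have "\<exists>g Y. monic v g \<and> finite Y \<and> Y \<subseteq> carrier A \<and>
      (\<forall>c\<in>{I}. \<forall>x\<in>carrier A. reach (\<lambda>_. True) Y v c g x)"
  proof (rule reach_all[OF s Q])
    fix u p w assume t: "(u, p, w) \<in> T"
    obtain J B :: nat where "p [^] J \<otimes> w \<otimes> v [^] B \<in>
        lspan ({p [^] a \<otimes> w \<otimes> v [^] b | a b. a < J \<or> a = J \<and> b < B} \<union> I)"
      using rel[OF t s] by blast
    then show "\<exists>g Y. monic v g \<and> finite Y \<and> Y \<subseteq> carrier A \<and>
        (\<forall>c\<in>{I}. \<forall>m. reach (\<lambda>_. True) Y v c g (u \<otimes> p [^] (m::nat) \<otimes> w))"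
      using T(2)[OF t] by (intro relation_reach[OF v I]) auto
  qed (use I in auto)
  then obtain g Y where g: "monic v g" "finite Y" "Y \<subseteq> carrier A"
    and r: "\<And>x. x \<in> carrier A \<Longrightarrow> reach (\<lambda>_. True) Y v I g x" by blast
  have "\<forall>\<^sub>F D in sequentially. \<forall>a. (\<forall>i. a i \<in> carrier A) \<longrightarrow>
    (\<forall>x\<in>carrier A. \<exists>n::nat. A.stdp D a \<otimes> (x \<otimes> g [^] n) \<in> I)"
    using eventually_gt_at_top[of "card Y * card Y"]
  proof (rule eventually_mono)
    fix D assume "card Y * card Y < D"
    then show "\<forall>a. (\<forall>i. a i \<in> carrier A) \<longrightarrow>
        (\<forall>x\<in>carrier A. \<exists>n::nat. A.stdp D a \<otimes> (x \<otimes> g [^] n) \<in> I)"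
      using stdp_torsion[OF v I g(2,3) _ monic_KV[OF v g(1)] Q r] by blast
  qed
  then show ?thesis using g(1) by blast
qed

text \<open>\<open>h\<close> depends neither on the arguments \<open>a\<close> nor on the ideal
  \<open>c\<close>: denominators of exponent at most one add up to the fixed power
  \<open>g [^] (1 + D)\<close>.\<close>

lemma bounded_torsion_eventually:
  assumes s: "(u', v, w') \<in> T"
  shows "\<forall>\<^sub>F D in sequentially. \<exists>h. monic v h \<and> (\<forall>a c. (\<forall>i. a i \<in> carrier A) \<longrightarrow>
    ideal c A \<longrightarrow> I \<subseteq> c \<longrightarrow> (\<exists>h\<in>c. monic v h) \<longrightarrow> (\<forall>x\<in>carrier A. A.stdp D a \<otimes> (x \<otimes> h) \<in> c))"
proof -
  have v: "v \<in> carrier A" using T(2)[OF s] by simp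
  have Q: "maxclosed (\<lambda>n. n \<le> 1)" unfolding maxclosed_def by simp
  let ?C = "{c. ideal c A \<and> I \<subseteq> c \<and> (\<exists>h\<in>c. monic v h)}"
  have "\<exists>g Y. monic v g \<and> finite Y \<and> Y \<subseteq> carrier A \<and>
      (\<forall>c\<in>?C. \<forall>x\<in>carrier A. reach (\<lambda>n. n \<le> 1) Y v c g x)"
  proof (rule reach_all[OF s Q])
    fix u p w assume t: "(u, p, w) \<in> T"
    obtain J B :: nat where "p [^] J \<otimes> w \<otimes> v [^] B \<in>
        lspan ({p [^] a \<otimes> w \<otimes> v [^] b | a b. a < J \<or> a = J \<and> b < B} \<union> I)"
      using rel[OF t s] by blast
    then show "\<exists>g Y. monic v g \<and> finite Y \<and> Y \<subseteq> carrier A \<and>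
        (\<forall>c\<in>?C. \<forall>m. reach (\<lambda>n. n \<le> 1) Y v c g (u \<otimes> p [^] (m::nat) \<otimes> w))"
      using T(2)[OF t] by (intro relation_reach_bounded[OF ac v I]) auto
  qed auto
  then obtain g Y where g: "monic v g" "finite Y" "Y \<subseteq> carrier A"
    and r: "\<And>c x. \<lbrakk>c \<in> ?C; x \<in> carrier A\<rbrakk> \<Longrightarrow> reach (\<lambda>n. n \<le> 1) Y v c g x" by blast
  have gc: "g \<in> carrier A" using KV_carrier[OF v monic_KV[OF v g(1)]] .
  show ?thesis
    using eventually_gt_at_top[of "card Y * card Y"]
  proof (rule eventually_mono)
    fix D assume D: "card Y * card Y < D"
    have "A.stdp D a \<otimes> (x \<otimes> g [^] (1 + D)) \<in> c"
      if a: "\<forall>i. a i \<in> carrier A" and c: "c \<in> ?C" and x: "x \<in> carrier A" for a c x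
    proof -
      have ci: "ideal c A" using c by blast
      obtain n m where nm: "n \<le> 1" "m \<le> 1" and e: "A.stdp D a \<otimes> (x \<otimes> g [^] (m + n * D)) \<in> c"
        using stdp_torsion[OF v ci g(2,3) D monic_KV[OF v g(1)] Q r[OF c], of a] a x by blast
      have le: "m + n * D \<le> 1 + D" using nm mult_right_mono[of n 1 D] by linarith
      have sc: "A.stdp D a \<in> carrier A" using a A.stdp_closed by blast
      have "A.stdp D a \<otimes> (x \<otimes> g [^] (m + n * D)) \<otimes> g [^] (1 + D - (m + n * D)) \<in> c"
        using idealD(3)[OF ci e] gc by simp
      moreover have "g [^] (m + n * D) \<otimes> g [^] (1 + D - (m + n * D)) = g [^] (1 + D)"
        using A.nat_pow_mult[OF gc, of "m + n * D" "1 + D - (m + n * D)"] le by simp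
      ultimately show ?thesis using sc x gc by (simp add: A.m_assoc del: A.nat_pow_Suc)
    qed
    then show "\<exists>h. monic v h \<and> (\<forall>a c. (\<forall>i. a i \<in> carrier A) \<longrightarrow>
      ideal c A \<longrightarrow> I \<subseteq> c \<longrightarrow> (\<exists>h\<in>c. monic v h) \<longrightarrow> (\<forall>x\<in>carrier A. A.stdp D a \<otimes> (x \<otimes> h) \<in> c))"
      using monic_pow[OF v g(1), of "1 + D"] by (intro exI[of _ "g [^] (1 + D)"]) blast
  qed
qed

text \<open>A monic relation for each triple cuts the family
  \<open>r \<otimes> u \<otimes> v [^] m \<otimes> w\<close> down to finitely many members. How many
  depends on \<open>N\<close> and \<open>T\<close>, not on \<open>r\<close> or
  \<open>c\<close>.\<close>

lemma span_reduce:
  assumes c: "ideal c A" "I \<subseteq> c" and r: "r \<in> carrier A"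
    and N: "\<And>u v w. (u, v, w) \<in> T \<Longrightarrow> \<exists>z\<in>lowp v (N (u, v, w)). r \<otimes> u \<otimes> (v [^] N (u, v, w) \<oplus> z) \<in> c"
    and x: "x \<in> carrier A"
  shows "r \<otimes> x \<in> lspan ((\<lambda>y. r \<otimes> y) ` {u \<otimes> v [^] b \<otimes> w | u v w b. (u, v, w) \<in> T \<and> b < N (u, v, w)} \<union> c)"
    (is "_ \<in> lspan (?G \<union> c)")
proof (rule lspan_image[OF linmap_mult_left[OF r] span[OF x] _ subsp_lspan])
  fix s assume s: "s \<in> {u \<otimes> v [^] (m::nat) \<otimes> w | u v w m. (u, v, w) \<in> T} \<union> I" "s \<in> carrier A"
  show "r \<otimes> s \<in> lspan (?G \<union> c)"
  proof (cases "s \<in> I")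
    case True
    then show ?thesis using c(2) idealD(1,2)[OF c(1)] r by (intro lspan_base) auto
  next
    case False
    then obtain u v w m where t: "(u, v, w) \<in> T" and sm: "s = u \<otimes> v [^] (m::nat) \<otimes> w" using s(1) by blast
    have uc: "u \<in> carrier A" "v \<in> carrier A" "w \<in> carrier A" using T(2)[OF t] by auto
    obtain z where z: "z \<in> lowp v (N (u, v, w))" "r \<otimes> u \<otimes> (v [^] N (u, v, w) \<oplus> z) \<in> c" using N[OF t] by blast
    have "r \<otimes> u \<otimes> v [^] m \<in> lspan ((\<lambda>b. r \<otimes> u \<otimes> v [^] b) ` {..<N (u, v, w)} \<union> c)"
      by (rule monic_reduce[OF uc(2) c(1) z(1) _ z(2)]) (use r uc in simp)
    then have "r \<otimes> u \<otimes> v [^] m \<otimes> w \<in> lspan (?G \<union> c)"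
    proof (rule lspan_image[OF linmap_mult_right[OF uc(3)] _ _ subsp_lspan])
      fix q assume q: "q \<in> (\<lambda>b. r \<otimes> u \<otimes> v [^] b) ` {..<N (u, v, w)} \<union> c"
      show "q \<otimes> w \<in> lspan (?G \<union> c)"
      proof (cases "q \<in> c")
        case True
        then show ?thesis using idealD(1,3)[OF c(1)] uc by (intro lspan_base) auto
      next
        case False
        then obtain b where b: "b < N (u, v, w)" "q = r \<otimes> u \<otimes> v [^] b" using q by blast
        have e: "q \<otimes> w = r \<otimes> (u \<otimes> v [^] b \<otimes> w)" unfolding b(2) using r uc by (simp add: A.m_assoc)
        have "r \<otimes> (u \<otimes> v [^] b \<otimes> w) \<in> ?G" using t b(1) by blast
        then show ?thesis unfolding e by (rule lspan_base[OF UnI1]) (use r uc in simp)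
      qed
    qed
    then show ?thesis unfolding sm using r uc by (simp add: A.m_assoc)
  qed
qed

lemma finite_monomials: "finite {u \<otimes> v [^] (b::nat) \<otimes> w | u v w b. (u, v, w) \<in> T \<and> b < N (u, v, w)}"
proof (rule finite_subset)
  show "{u \<otimes> v [^] (b::nat) \<otimes> w | u v w b. (u, v, w) \<in> T \<and> b < N (u, v, w)}
     \<subseteq> (\<lambda>((u, v, w), b). u \<otimes> v [^] b \<otimes> w) ` (SIGMA t:T. {..<N t})" by force
  show "finite ((\<lambda>((u, v, w), b). u \<otimes> v [^] b \<otimes> w) ` (SIGMA t:T. {..<N t}))"
    using T(1) by auto
qed

lemma monomials_carrier:
  "{u \<otimes> v [^] (b::nat) \<otimes> w | u v w b. (u, v, w) \<in> T \<and> b < N (u, v, w)} \<subseteq> carrier A"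
  using T(2) by auto

text \<open>A first standard polynomial \<open>e\<close> makes \<open>eA\<close> finite-dimensional modulo \<open>I\<close>, without control of
  the dimension. The annihilator \<open>c\<close> of \<open>eA\<close> modulo \<open>I\<close> then contains a monic polynomial in each \<open>v\<close>,
  and a second one, \<open>b\<close>, makes \<open>bA\<close> finite-dimensional modulo \<open>c\<close> with a uniform bound, so that
  matrices of bounded size act on it and a third one kills it.\<close>

theorem stdp_product_mem:
  "\<exists>D E. \<forall>a b c. (\<forall>i. a i \<in> carrier A) \<longrightarrow> (\<forall>i. b i \<in> carrier A) \<longrightarrow> (\<forall>i. c i \<in> carrier A) \<longrightarrow>
     A.stdp D a \<otimes> (A.stdp D b \<otimes> A.rstdp E c) \<in> I"
proof -
  have "\<forall>t\<in>T. \<exists>g. monic (fst (snd t)) g \<and> (\<forall>\<^sub>F D in sequentially. \<forall>a. (\<forall>i. a i \<in> carrier A) \<longrightarrow>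
    (\<forall>x\<in>carrier A. \<exists>n::nat. A.stdp D a \<otimes> (x \<otimes> g [^] n) \<in> I))"
    using torsion_eventually by auto
  from bchoice[OF this] obtain g where g: "\<forall>t\<in>T. monic (fst (snd t)) (g t) \<and>
    (\<forall>\<^sub>F D in sequentially. \<forall>a. (\<forall>i. a i \<in> carrier A) \<longrightarrow>
    (\<forall>x\<in>carrier A. \<exists>n::nat. A.stdp D a \<otimes> (x \<otimes> g t [^] n) \<in> I))" by (rule exE)
  have "\<forall>\<^sub>F D in sequentially. \<forall>t\<in>T. \<forall>a. (\<forall>i. a i \<in> carrier A) \<longrightarrow>
    (\<forall>x\<in>carrier A. \<exists>n::nat. A.stdp D a \<otimes> (x \<otimes> g t [^] n) \<in> I)"
    by (rule eventually_ball_finite[OF T(1)]) (use g in blast)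
  moreover have "\<forall>\<^sub>F D in sequentially. \<forall>t\<in>T. \<exists>h. monic (fst (snd t)) h \<and> (\<forall>a c. (\<forall>i. a i \<in> carrier A) \<longrightarrow>
    ideal c A \<longrightarrow> I \<subseteq> c \<longrightarrow> (\<exists>h\<in>c. monic (fst (snd t)) h) \<longrightarrow> (\<forall>x\<in>carrier A. A.stdp D a \<otimes> (x \<otimes> h) \<in> c))"
    by (rule eventually_ball_finite[OF T(1)]) (use bounded_torsion_eventually in auto)
  ultimately have "\<forall>\<^sub>F D in sequentially. (\<forall>t\<in>T. \<forall>a. (\<forall>i. a i \<in> carrier A) \<longrightarrow>
      (\<forall>x\<in>carrier A. \<exists>n::nat. A.stdp D a \<otimes> (x \<otimes> g t [^] n) \<in> I)) \<and>
    (\<forall>t\<in>T. \<exists>h. monic (fst (snd t)) h \<and> (\<forall>a c. (\<forall>i. a i \<in> carrier A) \<longrightarrow>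
    ideal c A \<longrightarrow> I \<subseteq> c \<longrightarrow> (\<exists>h\<in>c. monic (fst (snd t)) h) \<longrightarrow> (\<forall>x\<in>carrier A. A.stdp D a \<otimes> (x \<otimes> h) \<in> c)))"
    by (rule eventually_conj)
  then obtain D where "(\<forall>t\<in>T. \<forall>a. (\<forall>i. a i \<in> carrier A) \<longrightarrow>
      (\<forall>x\<in>carrier A. \<exists>n::nat. A.stdp D a \<otimes> (x \<otimes> g t [^] n) \<in> I)) \<and>
    (\<forall>t\<in>T. \<exists>h. monic (fst (snd t)) h \<and> (\<forall>a c. (\<forall>i. a i \<in> carrier A) \<longrightarrow>
    ideal c A \<longrightarrow> I \<subseteq> c \<longrightarrow> (\<exists>h\<in>c. monic (fst (snd t)) h) \<longrightarrow> (\<forall>x\<in>carrier A. A.stdp D a \<otimes> (x \<otimes> h) \<in> c)))"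
    by (rule eventually_happens'[OF sequentially_bot, THEN exE])
  then have D1: "\<And>t a x. \<lbrakk>t \<in> T; \<And>i. a i \<in> carrier A; x \<in> carrier A\<rbrakk> \<Longrightarrow>
      \<exists>n::nat. A.stdp D a \<otimes> (x \<otimes> g t [^] n) \<in> I"
    and "\<forall>t\<in>T. \<exists>h. monic (fst (snd t)) h \<and> (\<forall>a c. (\<forall>i. a i \<in> carrier A) \<longrightarrow>
    ideal c A \<longrightarrow> I \<subseteq> c \<longrightarrow> (\<exists>h\<in>c. monic (fst (snd t)) h) \<longrightarrow> (\<forall>x\<in>carrier A. A.stdp D a \<otimes> (x \<otimes> h) \<in> c))"
    by simp_all
  from bchoice[OF this(2)] obtain h where h: "\<forall>t\<in>T. monic (fst (snd t)) (h t) \<and> (\<forall>a c. (\<forall>i. a i \<in> carrier A) \<longrightarrow>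
    ideal c A \<longrightarrow> I \<subseteq> c \<longrightarrow> (\<exists>h\<in>c. monic (fst (snd t)) h) \<longrightarrow> (\<forall>x\<in>carrier A. A.stdp D a \<otimes> (x \<otimes> h t) \<in> c))"
    by (rule exE)
  have "\<forall>t\<in>T. \<exists>n. \<exists>z\<in>lowp (fst (snd t)) n. h t = fst (snd t) [^] n \<oplus> z"
    using h unfolding monic_def by blast
  from bchoice[OF this] obtain N where N: "\<forall>t\<in>T. \<exists>z\<in>lowp (fst (snd t)) (N t). h t = fst (snd t) [^] N t \<oplus> z"
    by (rule exE)
  \<comment> \<open>The degrees \<open>N\<close> were fixed before the arguments of the polynomials,
    so the size of \<open>G\<close>, and with it \<open>E\<close>, is uniform.\<close>
  define G where "G = {u \<otimes> v [^] b \<otimes> w | u v w b. (u, v, w) \<in> T \<and> b < N (u, v, w)}"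
  have G: "finite G" "G \<subseteq> carrier A" unfolding G_def by (rule finite_monomials, rule monomials_carrier)
  define E where "E = Suc (card G * card G)"
  have "A.stdp D a \<otimes> (A.stdp D b \<otimes> A.rstdp E c) \<in> I"
    if a: "\<forall>i. a i \<in> carrier A" and b: "\<forall>i. b i \<in> carrier A" and c: "\<forall>i. c i \<in> carrier A" for a b c
  proof -
    define e where "e = A.stdp D a"
    define f where "f = A.stdp D b"
    have ec: "e \<in> carrier A" "f \<in> carrier A" unfolding e_def f_def using a b A.stdp_closed by blast+
    \<comment> \<open>\<open>L\<close> is the annihilator called \<open>c\<close> in the description
      above, and \<open>f\<close> is the second value called \<open>b\<close> there; the sequence
      \<open>c\<close> supplies the arguments of the third polynomial.\<close>
    define L where "L = {x \<in> carrier A. \<forall>r\<in>carrier A. e \<otimes> r \<otimes> x \<in> I}"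
    note Is = subspD[OF ideal_subsp[OF I]]
    have L: "ideal L A"
    proof (rule idealI[OF A.ring_axioms])
      show "subgroup L (add_monoid A)"
      proof (rule M.add.subgroupI)
        show "L \<noteq> {}" using Is(2) ec unfolding L_def by (auto intro!: exI[of _ \<zero>])
        fix x y assume x: "x \<in> L"
        show "\<ominus> x \<in> L" using x subsp_uminus[OF ideal_subsp[OF I]] ec
          unfolding L_def by (auto simp: A.r_minus)
        assume "y \<in> L"
        then show "x \<oplus> y \<in> L" using x Is(3) ec unfolding L_def by (auto simp: A.r_distr)
      qed (auto simp: L_def)
      fix x y assume xy: "x \<in> L" "y \<in> carrier A"
      have "e \<otimes> r \<otimes> (y \<otimes> x) \<in> I" if "r \<in> carrier A" for r
      proof -
        have "e \<otimes> (r \<otimes> y) \<otimes> x \<in> I" using xy that unfolding L_def by blast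
        then show ?thesis using xy that ec by (simp add: A.m_assoc L_def)
      qed
      then show "y \<otimes> x \<in> L" using xy unfolding L_def by simp
      have "e \<otimes> r \<otimes> (x \<otimes> y) \<in> I" if "r \<in> carrier A" for r
      proof -
        have "e \<otimes> r \<otimes> x \<otimes> y \<in> I" using xy that idealD(3)[OF I] unfolding L_def by blast
        then show ?thesis using xy that ec by (simp add: A.m_assoc L_def)
      qed
      then show "x \<otimes> y \<in> L" using xy unfolding L_def by simp
    qed
    have IL: "I \<subseteq> L" unfolding L_def using idealD[OF I] ec by auto
    have eu: "\<exists>m. \<exists>z\<in>lowp v m. e \<otimes> u \<otimes> (v [^] m \<oplus> z) \<in> I" if t: "(u, v, w) \<in> T" for u v w
    proof -
      have uc: "u \<in> carrier A" "v \<in> carrier A" using T(2)[OF t] by auto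
      have m: "monic v (g (u, v, w))" using g t by auto
      obtain n where "e \<otimes> (u \<otimes> g (u, v, w) [^] (n::nat)) \<in> I"
        using D1[OF t, of a u] a uc unfolding e_def by blast
      then have "e \<otimes> u \<otimes> g (u, v, w) [^] n \<in> I"
        using ec uc KV_carrier[OF uc(2) monic_KV[OF uc(2) m]] by (simp add: A.m_assoc)
      moreover obtain m z where "z \<in> lowp v m" "g (u, v, w) [^] n = v [^] m \<oplus> z"
        using monic_pow[OF uc(2) m, of n] unfolding monic_def by blast
      ultimately show ?thesis by auto
    qed
    then have "\<forall>t\<in>T. \<exists>m. \<exists>z\<in>lowp (fst (snd t)) m. e \<otimes> fst t \<otimes> (fst (snd t) [^] m \<oplus> z) \<in> I"
      by auto
    from bchoice[OF this] obtain K where K: "\<forall>t\<in>T. \<exists>z\<in>lowp (fst (snd t)) (K t). e \<otimes> fst t \<otimes> (fst (snd t) [^] K t \<oplus> z) \<in> I"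
      by (rule exE)
    \<comment> \<open>The degrees \<open>K\<close> depend on \<open>a\<close>, so the size of
      \<open>F\<close> is not under control. Only its finiteness is used, to find one power of each
      denominator that lies in \<open>L\<close>.\<close>
    define F where "F = {u \<otimes> v [^] b \<otimes> w | u v w b. (u, v, w) \<in> T \<and> b < K (u, v, w)}"
    have F: "finite F" "F \<subseteq> carrier A" unfolding F_def by (rule finite_monomials, rule monomials_carrier)
    have eF: "e \<otimes> x \<in> lspan ((\<lambda>y. e \<otimes> y) ` F \<union> I)" if x: "x \<in> carrier A" for x
      unfolding F_def by (rule span_reduce[OF I _ ec(1) _ x]) (use K in force)+
    have mon: "\<exists>q\<in>L. monic v q" if t: "(u, v, w) \<in> T" for u v w
    proof -
      have uc: "u \<in> carrier A" "v \<in> carrier A" using T(2)[OF t] by auto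
      have m: "monic v (g (u, v, w))" using g t by auto
      have gc: "g (u, v, w) \<in> carrier A" using KV_carrier[OF uc(2) monic_KV[OF uc(2) m]] .
      have "\<forall>x\<in>F. \<exists>n::nat. e \<otimes> (x \<otimes> g (u, v, w) [^] n) \<in> I"
        using D1[OF t, of a] a F(2) unfolding e_def by blast
      from bchoice[OF this] obtain n where n: "\<forall>x\<in>F. e \<otimes> (x \<otimes> g (u, v, w) [^] (n x :: nat)) \<in> I"
        by (rule exE)
      define M where "M = sum n F"
      define q where "q = g (u, v, w) [^] M"
      have qc: "q \<in> carrier A" unfolding q_def using gc by simp
      have Fq: "e \<otimes> x \<otimes> q \<in> I" if x: "x \<in> F" for x
      proof -
        have xc: "x \<in> carrier A" using x F by blast
        have "n x \<le> M" unfolding M_def by (rule member_le_sum[OF x]) (use F in auto)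
        then have "q = g (u, v, w) [^] n x \<otimes> g (u, v, w) [^] (M - n x)"
          unfolding q_def using gc by (simp add: A.nat_pow_mult)
        moreover have "e \<otimes> (x \<otimes> g (u, v, w) [^] n x) \<otimes> g (u, v, w) [^] (M - n x) \<in> I"
          using n x idealD(3)[OF I] gc by auto
        ultimately show ?thesis using ec xc gc by (simp add: A.m_assoc)
      qed
      have "e \<otimes> r \<otimes> q \<in> I" if r: "r \<in> carrier A" for r
        by (rule lspan_image[OF linmap_mult_right[OF qc] eF[OF r] _ ideal_subsp[OF I]])
          (use Fq idealD(3)[OF I] qc in auto)
      then have "q \<in> L" unfolding L_def using qc by simp
      then show ?thesis using monic_pow[OF uc(2) m, of M] unfolding q_def by blast
    qed
    have fN: "\<exists>z\<in>lowp v (N (u, v, w)). f \<otimes> u \<otimes> (v [^] N (u, v, w) \<oplus> z) \<in> L" if t: "(u, v, w) \<in> T" for u v w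
    proof -
      have uc: "u \<in> carrier A" "v \<in> carrier A" using T(2)[OF t] by auto
      obtain z where z: "z \<in> lowp v (N (u, v, w))" "h (u, v, w) = v [^] N (u, v, w) \<oplus> z"
        using bspec[OF N t] by auto
      have "f \<otimes> (u \<otimes> h (u, v, w)) \<in> L"
        using bspec[OF h t] b L IL mon[OF t] uc unfolding f_def by auto
      then have "f \<otimes> u \<otimes> h (u, v, w) \<in> L"
        using uc ec lowp_carrier[OF uc(2) z(1)] z(2) by (simp add: A.m_assoc)
      then show ?thesis using z by auto
    qed
    let ?Y = "(\<lambda>y. f \<otimes> y) ` G"
    have fG: "f \<otimes> x \<in> lspan (?Y \<union> L)" if x: "x \<in> carrier A" for x
      unfolding G_def by (rule span_reduce[OF L IL ec(2) fN x])
    have rc: "A.rstdp E c \<in> carrier A" using A.rstdp_closed c by blast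
    have kill: "y \<otimes> A.rstdp E c \<in> L" if y: "y \<in> ?Y" for y
    proof (rule rstdp_annihilates[OF L _ _ _ _ _ y])
      have "card ?Y \<le> card G" using G(1) by (rule card_image_le)
      then show "card ?Y * card ?Y < E" unfolding E_def using mult_le_mono by (simp add: less_Suc_eq_le)
      fix l y' assume "y' \<in> ?Y"
      then obtain x where x: "x \<in> G" "y' = f \<otimes> x" by blast
      then have xc: "x \<in> carrier A" using G by blast
      have cl: "c l \<in> carrier A" using c by blast
      show "y' \<otimes> c l \<in> lspan (?Y \<union> L)"
        using fG[of "x \<otimes> c l"] xc cl ec x(2) by (simp add: A.m_assoc)
    qed (use G ec c in auto)
    have "f \<otimes> A.rstdp E c \<in> L"
    proof (rule lspan_image[OF linmap_mult_right[OF rc] _ _ ideal_subsp[OF L]])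
      show "f \<in> lspan (?Y \<union> L)" using fG[of \<one>] ec by simp
      fix s assume "s \<in> ?Y \<union> L"
      then show "s \<otimes> A.rstdp E c \<in> L" using kill idealD(3)[OF L _ rc] by blast
    qed
    then have "e \<otimes> \<one> \<otimes> (f \<otimes> A.rstdp E c) \<in> I" unfolding L_def by blast
    then show ?thesis using ec unfolding e_def f_def by simp
  qed
  then show ?thesis by blast
qed

end

section \<open>Words with few factors\<close>

text \<open>A walk whose graph has at most as many edges as vertices is a path, then a cycle, then a path:
  all edges but one are first entries into a vertex.\<close>

lemma walk_eventually_periodic:
  fixes x :: "nat \<Rightarrow> 'v" and M :: nat
  defines "n \<equiv> card (x ` {..M})"
  assumes E: "card ((\<lambda>t. (x (t - 1), x t)) ` {1..M}) \<le> n"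
  shows "\<exists>\<tau> \<nu> p. 1 \<le> p \<and> p \<le> \<tau> \<and> \<tau> \<le> n \<and> \<nu> \<le> Suc M \<and> Suc M \<le> \<nu> + n \<and>
    (\<forall>t. \<tau> \<le> t \<longrightarrow> t < \<nu> \<longrightarrow> x t = x (t - p))"
proof -
  define F where "F t = (x (t - 1), x t)" for t
  \<comment> \<open>\<open>new t\<close> marks a first visit. First visits reach distinct vertices,
    and up to time \<open>M\<close> there are \<open>n\<close> of them, counting time 0.\<close>
  define new where "new t \<longleftrightarrow> x t \<notin> x ` {..<t}" for t
  define Nw where "Nw = {t \<in> {1..M}. new t}"
  have n1: "1 \<le> n" unfolding n_def by (simp add: Suc_le_eq card_gt_0_iff)
  have newD: "x s \<noteq> x t" if "new t" "s < t" for s t using that unfolding new_def by (metis imageI lessThan_iff)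
  have inj_new: "inj_on x S" if "\<And>t. t \<in> S \<Longrightarrow> new t" for S
    using newD that by (metis inj_onI linorder_neqE_nat)
  have first: "\<exists>s\<le>t. new s \<and> x s = x t" for t
  proof -
    define s where "s = (LEAST s. x s = x t)"
    have "x s = x t" "s \<le> t" unfolding s_def by (rule LeastI, simp) (rule Least_le, simp)
    moreover have "new s" unfolding new_def
    proof
      assume "x s \<in> x ` {..<s}"
      then obtain r where "r < s" "x r = x t" using \<open>x s = x t\<close> by auto
      then show False unfolding s_def using not_less_Least by blast
    qed
    ultimately show ?thesis by blast
  qed
  have "x ` {..M} = x ` insert 0 Nw"
  proof
    show "x ` {..M} \<subseteq> x ` insert 0 Nw"
    proof
      fix y assume "y \<in> x ` {..M}"
      then obtain t where t: "t \<le> M" "y = x t" by auto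
      obtain s where "s \<le> t" "new s" "x s = x t" using first by blast
      then show "y \<in> x ` insert 0 Nw" using t unfolding Nw_def by (intro image_eqI[of _ _ s]) auto
    qed
  qed (auto simp: Nw_def)
  moreover have "inj_on x (insert 0 Nw)"
    by (rule inj_new) (auto simp: Nw_def new_def)
  moreover have "0 \<notin> Nw" "finite Nw" unfolding Nw_def by auto
  ultimately have n: "n = Suc (card Nw)" unfolding n_def by (simp add: card_image)
  have "inj_on F Nw"
    using inj_new[of Nw] unfolding Nw_def F_def inj_on_def by auto
  then have cF: "card (F ` Nw) = card Nw" by (rule card_image)
  have FE: "F ` Nw \<subseteq> F ` {1..M}" unfolding Nw_def by auto
  \<comment> \<open>The \<open>n - 1\<close> first entries after time 0 use distinct edges, so at
    most one edge is left over.\<close>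
  have "card (F ` {1..M} - F ` Nw) \<le> 1"
    using E n cF card_Diff_subset[of "F ` Nw" "F ` {1..M}"] FE \<open>finite Nw\<close> unfolding F_def by auto
  then have le: "card (F ` {1..M} - F ` Nw) \<le> Suc 0" by (simp only: One_nat_def)
  have "finite (F ` {1..M} - F ` Nw)" by (intro finite_Diff finite_imageI finite_atLeastAtMost)
  from card_le_Suc0_iff_eq[OF this] le
  have "\<forall>a\<in>F ` {1..M} - F ` Nw. \<forall>b\<in>F ` {1..M} - F ` Nw. a = b" by (rule iffD1)
  then have uniq: "a = b" if "a \<in> F ` {1..M} - F ` Nw" "b \<in> F ` {1..M} - F ` Nw" for a b
    using that by blast
  show ?thesis
  proof (cases "\<forall>t\<in>{..M}. new t")
    case True
    then have "inj_on x {..M}" using inj_new by blast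
    then have "n = Suc M" unfolding n_def by (simp add: card_image)
    then show ?thesis using n1 by (intro exI[of _ 1] exI[of _ 0]) auto
  next
    case False
    \<comment> \<open>The first return to an old vertex. The edge used there turns out to be the one
      exceptional edge.\<close>
    define \<tau> where "\<tau> = (LEAST t. t \<le> M \<and> \<not> new t)"
    have "\<tau> \<le> M \<and> \<not> new \<tau>" unfolding \<tau>_def by (rule LeastI_ex) (use False in auto)
    then have \<tau>: "\<tau> \<le> M" "\<not> new \<tau>" by auto
    have ltau: "new t" if "t < \<tau>" for t
      using not_less_Least[of t "\<lambda>t. t \<le> M \<and> \<not> new t"] that \<tau>(1) unfolding \<tau>_def by auto
    have t1: "1 \<le> \<tau>" using \<tau>(2) by (cases \<tau>) (auto simp: new_def)
    have injt: "inj_on x {..<\<tau>}" by (rule inj_new) (use ltau in simp)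
    have "\<tau> = card (x ` {..<\<tau>})" using injt by (simp add: card_image)
    also have "\<dots> \<le> n" unfolding n_def using \<tau>(1) by (intro card_mono) auto
    finally have tn: "\<tau> \<le> n" .
    obtain \<sigma> where \<sigma>: "\<sigma> < \<tau>" "x \<sigma> = x \<tau>" using \<tau>(2) unfolding new_def by force
    have Ft: "F \<tau> \<notin> F ` Nw"
    proof
      assume "F \<tau> \<in> F ` Nw"
      then obtain s where s: "new s" "1 \<le> s" "x (s - 1) = x (\<tau> - 1)" "x s = x \<tau>"
        unfolding Nw_def F_def by auto
      then have "s < \<tau>" using newD[of s \<tau>] \<tau>(2) by (metis linorder_neqE_nat)
      then have "s - 1 = \<tau> - 1" using inj_onD[OF injt s(3)] t1 by simp
      then show False using \<open>s < \<tau>\<close> s(2) by simp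
    qed
    have edge: "\<exists>s. (new s \<or> s = \<tau>) \<and> 1 \<le> s \<and> x (s - 1) = x (t - 1) \<and> x s = x t" if t: "1 \<le> t" "t \<le> M" for t
    proof (cases "F t \<in> F ` Nw")
      case True
      then show ?thesis unfolding Nw_def F_def by auto
    next
      case False
      have "F t = F \<tau>"
      proof (rule uniq)
        show "F t \<in> F ` {1..M} - F ` Nw" by (intro DiffI imageI False) (use t in simp)
        show "F \<tau> \<in> F ` {1..M} - F ` Nw" by (intro DiffI imageI Ft) (use \<tau>(1) t1 in simp)
      qed
      then show ?thesis using t1 unfolding F_def by auto
    qed
    \<comment> \<open>The first new vertex after the return, or the end of the walk. Before it the
      walk only uses edges of times up to \<open>\<tau>\<close>; their sources are distinct, so each
      vertex determines its successor and the walk is periodic.\<close>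
    define \<nu> where "\<nu> = (LEAST t. \<tau> < t \<and> (new t \<or> t = Suc M))"
    have "\<tau> < \<nu> \<and> (new \<nu> \<or> \<nu> = Suc M)" unfolding \<nu>_def by (rule LeastI[of _ "Suc M"]) (use \<tau> in auto)
    then have \<nu>: "\<tau> < \<nu>" "new \<nu> \<or> \<nu> = Suc M" by auto
    have nuM: "\<nu> \<le> Suc M" unfolding \<nu>_def by (rule Least_le) (use \<tau> in auto)
    have old: "\<not> new t" if "\<tau> \<le> t" "t < \<nu>" for t
      using not_less_Least[of t "\<lambda>t. \<tau> < t \<and> (new t \<or> t = Suc M)"] that \<tau>(2) unfolding \<nu>_def
      by (cases "t = \<tau>") auto
    have edge': "\<exists>s. 1 \<le> s \<and> s \<le> \<tau> \<and> x (s - 1) = x (t - 1) \<and> x s = x t" if t: "1 \<le> t" "t < \<nu>" for t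
    proof -
      obtain s where s: "new s \<or> s = \<tau>" "1 \<le> s" "x (s - 1) = x (t - 1)" "x s = x t"
        using edge[of t] t nuM by auto
      have "s \<le> \<tau>"
      proof (rule ccontr)
        assume "\<not> s \<le> \<tau>"
        then have ns: "new s" "\<tau> < s" using s(1) by auto
        then have "\<not> s < \<nu>" using old[of s] by auto
        then show False using newD[OF ns(1), of t] s(4) t by auto
      qed
      then show ?thesis using s by blast
    qed
    have det: "x a = x b" if ab: "1 \<le> a" "a < \<nu>" "1 \<le> b" "b < \<nu>" "x (a - 1) = x (b - 1)" for a b
    proof -
      obtain s where s: "1 \<le> s" "s \<le> \<tau>" "x (s - 1) = x (a - 1)" "x s = x a" using edge' ab by blast
      obtain r where r: "1 \<le> r" "r \<le> \<tau>" "x (r - 1) = x (b - 1)" "x r = x b" using edge' ab by blast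
      have "s - 1 = r - 1" using inj_onD[OF injt, of "s - 1" "r - 1"] s r ab(5) by auto
      then show ?thesis using s r by (metis le_add_diff_inverse)
    qed
    define p where "p = \<tau> - \<sigma>"
    have per: "x t = x (t - p)" if "\<tau> \<le> t" "t < \<nu>" for t
      using that
    proof (induction t rule: dec_induct)
      case base
      then show ?case using \<sigma> unfolding p_def by simp
    next
      case (step t)
      have "x (Suc t) = x (Suc t - p)"
      proof (rule det)
        have e: "Suc t - p - 1 = t - p" by simp
        show "x (Suc t - 1) = x (Suc t - p - 1)" unfolding e using step by simp
      qed (use step \<sigma> t1 in \<open>auto simp: p_def\<close>)
      then show ?case .
    qed
    \<comment> \<open>An edge leaving a vertex first visited after \<open>\<tau>\<close> cannot
      occur earlier and is not the exceptional one; so it enters a new vertex again, up to the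
      end.\<close>
    have tail: "new t" if "\<nu> \<le> t" "t \<le> M" for t
      using that
    proof (induction t rule: less_induct)
      case (less t)
      show ?case
      proof (cases "t = \<nu>")
        case True
        then show ?thesis using \<nu> less.prems by auto
      next
        case False
        then have tn: "new (t - 1)" using less by auto
        obtain s where s: "new s \<or> s = \<tau>" "1 \<le> s" "x (s - 1) = x (t - 1)" "x s = x t"
          using edge[of t] less.prems \<nu>(1) by auto
        have "\<not> s - 1 < t - 1" using newD[OF tn, of "s - 1"] s(3) by auto
        then have "t \<le> s" using s(2) by auto
        then have "new s" using s(1) less.prems \<nu>(1) by auto
        moreover have "\<not> t < s" using newD[of s t] s(4) \<open>new s\<close> by auto
        ultimately show ?thesis using \<open>t \<le> s\<close> by (simp add: order_class.le_less)
      qed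
    qed
    have "Suc M - \<nu> = card (x ` {\<nu>..M})" using inj_new[of "{\<nu>..M}"] tail by (simp add: card_image)
    also have "\<dots> \<le> n" unfolding n_def by (intro card_mono) auto
    finally have "Suc M \<le> \<nu> + n" by simp
    then show ?thesis using per tn nuM \<sigma> by (intro exI[of _ \<tau>] exI[of _ \<nu>] exI[of _ p]) (auto simp: p_def)
  qed
qed

lemma periodic_take:
  assumes "\<And>t. \<lbrakk>p \<le> t; t < L\<rbrakk> \<Longrightarrow> xs ! t = xs ! (t - p)" "m * p \<le> L" "L \<le> length xs"
  shows "take (m * p) xs = concat (replicate m (take p xs))"
  using assms(2)
proof (induction m)
  case (Suc m)
  have "take (m * p) (drop p xs) = take (m * p) xs"
  proof (rule nth_equalityI)
    show "length (take (m * p) (drop p xs)) = length (take (m * p) xs)" using Suc.prems assms(3) by auto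
    fix i assume "i < length (take (m * p) (drop p xs))"
    then have i: "i < m * p" "p + i < L" using Suc.prems assms(3) by auto
    then show "take (m * p) (drop p xs) ! i = take (m * p) xs ! i"
      using assms(1)[of "p + i"] assms(3) by simp
  qed
  then show ?case using Suc by (simp add: take_add)
qed simp

text \<open>By truncated subtraction this is \<open>{w}\<close> when \<open>j\<close> exceeds the
  length of \<open>w\<close>; below, \<open>j\<close> is at most that length.\<close>

definition factors :: "nat \<Rightarrow> 'b list \<Rightarrow> 'b list set" where
  "factors j w = (\<lambda>t. take j (drop t w)) ` {..length w - j}"

text \<open>As in the Morse--Hedlund theorem, at most \<open>d\<close> factors of length \<open>d\<close> force some \<open>j < d\<close> with no more
  factors of length \<open>Suc j\<close> than of length \<open>j\<close>.\<close>

lemma few_factors_periodic: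
  fixes L :: "'b set" and d :: nat
  assumes "finite L" and w: "set w \<subseteq> L" and d: "card (factors d w) \<le> d" "d \<le> length w"
  defines "C \<equiv> card {z. set z \<subseteq> L \<and> length z \<le> d}"
  shows "\<exists>u v x m. w = u @ concat (replicate m v) @ x \<and> length u \<le> C \<and> length v \<le> C \<and> length x \<le> 2 * C + d"
proof -
  have "factors 0 w = {[]}" by (auto simp: factors_def)
  then have d0: "d \<noteq> 0" using d(1) by (cases "d = 0") auto
  show ?thesis
  proof (cases "card (set w) \<le> 1")
    case True
    show ?thesis
    proof (cases w)
      case Nil
      then show ?thesis by (intro exI[of _ "[]"] exI[of _ 0]) auto
    next
      case (Cons a ws)
      have "y = a" if "y \<in> set w" for y
        using True that Cons card_le_Suc0_iff_eq[of "set w"] by auto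
      then have "w = replicate (length w) a" by (metis replicate_eqI)
      also have "\<dots> = concat (replicate (length w) [a])" by (induction "length w" arbitrary: w) auto
      finally have e: "w = [] @ concat (replicate (length w) [a]) @ []" by simp
      have "finite {z. set z \<subseteq> L \<and> length z \<le> d}" using assms(1) by (rule finite_lists_length_le)
      moreover have "[a] \<in> {z. set z \<subseteq> L \<and> length z \<le> d}" using w Cons d0 by auto
      ultimately have "1 \<le> C" unfolding C_def by (metis One_nat_def Suc_leI card_gt_0_iff empty_iff)
      then show ?thesis using e by (intro exI[of _ "[]"] exI[of _ "[a]"] exI[of _ "length w"]) auto
    qed
  next
    case False
    have f1: "card (set w) \<le> card (factors 1 w)"
    proof -
      have "(\<lambda>z. [z]) ` set w \<subseteq> factors 1 w"
      proof
        fix z assume "z \<in> (\<lambda>z. [z]) ` set w"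
        then obtain i where i: "i < length w" "z = [w ! i]" by (auto simp: in_set_conv_nth)
        then have "z = take 1 (drop i w)" by (simp add: take_Suc hd_drop_conv_nth)
        then show "z \<in> factors 1 w" using i unfolding factors_def by auto
      qed
      then have "card ((\<lambda>z. [z]) ` set w) \<le> card (factors 1 w)"
        by (intro card_mono) (auto simp: factors_def)
      then show ?thesis by (simp add: card_image inj_on_def)
    qed
    \<comment> \<open>Otherwise the number of factors, which is at least two at length one because
      words in one letter were treated apart, would grow strictly and exceed \<open>d\<close> at
      length \<open>d\<close>.\<close>
    have "\<exists>j. 1 \<le> j \<and> j < d \<and> card (factors (Suc j) w) \<le> card (factors j w)"
    proof (rule ccontr)
      assume "\<not> ?thesis"
      then have inc: "card (factors j w) < card (factors (Suc j) w)" if "1 \<le> j" "j < d" for j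
        using that by (meson not_le)
      have "j < card (factors j w)" if "1 \<le> j" "j \<le> d" for j
        using that
      proof (induction j rule: dec_induct)
        case base
        then show ?case using f1 False by simp
      next
        case (step j)
        then show ?case using inc[of j] by simp
      qed
      then show False using d(1) d0 by (metis One_nat_def Suc_leI le_refl neq0_conv not_less)
    qed
    then obtain j where j: "1 \<le> j" "j < d" and cj: "card (factors (Suc j) w) \<le> card (factors j w)" by blast
    define M where "M = length w - j"
    \<comment> \<open>The walk through the factors of length \<open>j\<close>: its edges are given
      by factors of length \<open>Suc j\<close>.\<close>
    define x where "x t = take j (drop t w)" for t
    define n where "n = card (x ` {..M})"
    have xf: "x ` {..M} = factors j w" unfolding x_def M_def factors_def ..
    have "(\<lambda>t. (x (t - 1), x t)) ` {1..M} \<subseteq> (\<lambda>z. (take j z, drop 1 z)) ` factors (Suc j) w"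
    proof
      fix e assume "e \<in> (\<lambda>t. (x (t - 1), x t)) ` {1..M}"
      then obtain t where t: "1 \<le> t" "t \<le> M" "e = (x (t - 1), x t)" by auto
      let ?z = "take (Suc j) (drop (t - 1) w)"
      have "e = (take j ?z, drop 1 ?z)" unfolding t(3) x_def using t(1) by (simp add: drop_take)
      moreover have "?z \<in> factors (Suc j) w" using t unfolding factors_def M_def by auto
      ultimately show "e \<in> (\<lambda>z. (take j z, drop 1 z)) ` factors (Suc j) w" by blast
    qed
    then have "card ((\<lambda>t. (x (t - 1), x t)) ` {1..M}) \<le> card (factors (Suc j) w)"
      by (rule surj_card_le[rotated]) (auto simp: factors_def)
    then have "card ((\<lambda>t. (x (t - 1), x t)) ` {1..M}) \<le> card (x ` {..M})" using cj xf by simp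
    from walk_eventually_periodic[OF this] obtain \<tau> \<nu> p where
      p: "1 \<le> p" "p \<le> \<tau>" "\<tau> \<le> n" "\<nu> \<le> Suc M" "Suc M \<le> \<nu> + n"
      and per: "\<And>t. \<lbrakk>\<tau> \<le> t; t < \<nu>\<rbrakk> \<Longrightarrow> x t = x (t - p)" unfolding n_def by blast
    have nC: "n \<le> C"
    proof -
      have "x ` {..M} \<subseteq> {z. set z \<subseteq> L \<and> length z \<le> d}"
      proof
      fix z assume "z \<in> x ` {..M}"
      then obtain t where t: "z = take j (drop t w)" unfolding x_def by blast
      have "set z \<subseteq> set w" unfolding t by (meson order_trans set_take_subset set_drop_subset)
      then show "z \<in> {z. set z \<subseteq> L \<and> length z \<le> d}" using w j(2) t by auto
    qed
      then show ?thesis unfolding n_def C_def using finite_lists_length_le[OF assms(1)] by (rule card_mono[rotated])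
    qed
    have Mw: "M + j = length w" unfolding M_def using j d(2) by simp
    have letter: "w ! t = w ! (t - p)" if "\<tau> \<le> t" "t < \<nu>" for t
    proof -
      have "hd (x t) = hd (x (t - p))" using per[OF that] by simp
      moreover have "t < length w" "t - p < length w" using that p(4) Mw j by auto
      ultimately show ?thesis unfolding x_def using j(1)
        by (simp add: hd_take hd_drop_conv_nth)
    qed
    show ?thesis
    proof (cases "\<tau> \<le> \<nu>")
      case False
      then have "length w \<le> 2 * C + d" using p nC Mw j(2) by simp
      then show ?thesis by (intro exI[of _ "[]"] exI[of _ "[]"] exI[of _ w]) auto
    next
      case True
      \<comment> \<open>The repetition begins one period before the first return. What follows it is
        an incomplete period and a tail of length less than \<open>n + j\<close> from
        \<open>\<nu>\<close> on, whence the bound \<open>2 * C + d\<close>.\<close>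
      define s where "s = \<tau> - p"
      define xs where "xs = drop s w"
      define m where "m = (\<nu> - s) div p"
      have nw: "\<nu> \<le> length w" using p(4) Mw j by simp
      have "take (m * p) xs = concat (replicate m (take p xs))"
      proof (rule periodic_take)
        show "m * p \<le> \<nu> - s" unfolding m_def by (rule div_times_less_eq_dividend)
        show "\<nu> - s \<le> length xs" unfolding xs_def using nw by simp
        fix t assume t: "p \<le> t" "t < \<nu> - s"
        have "w ! (s + t) = w ! (s + t - p)" using letter[of "s + t"] t p(2) unfolding s_def by simp
        moreover have "s + t - p = s + (t - p)" using t by simp
        moreover have "s \<le> length w" using True nw unfolding s_def by simp
        then have "xs ! t = w ! (s + t)" "xs ! (t - p) = w ! (s + (t - p))" unfolding xs_def by simp_all
        ultimately show "xs ! t = xs ! (t - p)" by argo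
      qed
      then have "w = take s w @ concat (replicate m (take p xs)) @ drop (m * p) xs"
        unfolding xs_def by (metis append_take_drop_id)
      moreover have "length (take s w) \<le> C" using p nC unfolding s_def by simp
      moreover have "length (take p xs) \<le> C" using p nC by simp
      moreover have "length (drop (m * p) xs) \<le> 2 * C + d"
      proof -
        have "\<nu> - s < m * p + p" unfolding m_def using p(1) dividend_less_div_times[of p "\<nu> - s"] by simp
        moreover have "length (drop (m * p) xs) = length w - s - m * p" unfolding xs_def by simp
        moreover have "length w < \<nu> + n + j" using p(5) Mw by simp
        moreover have "s \<le> \<nu>" using True unfolding s_def by simp
        ultimately show ?thesis using p(2,3) nC j(2) by simp
      qed
      ultimately show ?thesis by blast
    qed
  qed
qed

section \<open>Normal words and growth\<close>

locale word_algebra = kalg k A for k :: "'a ring" and A :: "('a, 'c) module" (structure) +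
  fixes g :: "nat \<Rightarrow> 'c" and N :: nat
  assumes g_carrier: "\<And>i. g i \<in> carrier A"
begin

definition wval :: "nat list \<Rightarrow> 'c" where
  "wval ws = word_val A (map g ws)"

definition lower :: "nat list \<Rightarrow> 'c set" where
  "lower w = wval ` {w'. set w' \<subseteq> {..<N} \<and> (w', w) \<in> lenlex less_than}"

text \<open>Irreducible words for the degree-lexicographic order, as in Groebner basis theory:
  modulo \<open>I\<close> their values are independent and span the subalgebra generated by the
  letters.\<close>

definition normal :: "'c set \<Rightarrow> nat list \<Rightarrow> bool" where
  "normal I w \<longleftrightarrow> set w \<subseteq> {..<N} \<and> wval w \<notin> lspan (lower w \<union> I)"

lemma wval_closed [simp]: "wval w \<in> carrier A"
  unfolding wval_def using g_carrier by (intro A.word_val_closed) auto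

lemma wval_append: "wval (u @ w) = wval u \<otimes> wval w"
  unfolding wval_def using g_carrier by (simp add: A.word_val_append image_subset_iff)

lemma wval_Nil: "wval [] = \<one>"
  unfolding wval_def by simp

lemma wval_power: "wval (concat (replicate m v)) = wval v [^] m"
proof (induction m)
  case (Suc m)
  then show ?case using A.nat_pow_Suc2[of "wval v" m] by (simp add: wval_append)
qed (simp add: wval_Nil)

text \<open>\<open>lenlex\<close> is compatible with concatenation on both sides, so a reduction of
  \<open>w\<close> would reduce the longer word.\<close>

lemma normal_factor:
  assumes I: "ideal I A" and n: "normal I (u @ w @ v)"
  shows "normal I w"
proof (rule ccontr)
  assume "\<not> normal I w"
  then have w: "wval w \<in> lspan (lower w \<union> I)" using n unfolding normal_def by auto
  have lm: "linmap (\<lambda>x. wval u \<otimes> (x \<otimes> wval v))"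
    by (rule linmap_comp[OF linmap_mult_left linmap_mult_right]) auto
  have "wval u \<otimes> (wval w \<otimes> wval v) \<in> lspan (lower (u @ w @ v) \<union> I)"
  proof (rule lspan_image[OF lm w _ subsp_lspan])
    fix s assume s: "s \<in> lower w \<union> I" "s \<in> carrier A"
    show "wval u \<otimes> (s \<otimes> wval v) \<in> lspan (lower (u @ w @ v) \<union> I)"
    proof (cases "s \<in> I")
      case True
      then show ?thesis using idealD[OF I] by (intro lspan_base) auto
    next
      case False
      then obtain w' where w': "set w' \<subseteq> {..<N}" "(w', w) \<in> lenlex less_than" "s = wval w'"
        using s(1) unfolding lower_def by auto
      have "(w' @ v, w @ v) \<in> lenlex less_than" using w'(2) by (rule lenlex_append1) simp
      then have "(u @ w' @ v, u @ w @ v) \<in> lenlex less_than" by (simp add: irrefl_def)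
      moreover have "set (u @ w' @ v) \<subseteq> {..<N}" using w'(1) n unfolding normal_def by auto
      ultimately have "wval (u @ w' @ v) \<in> lower (u @ w @ v)" unfolding lower_def by blast
      then have "wval (u @ w' @ v) \<in> lspan (lower (u @ w @ v) \<union> I)" by (intro lspan_base) auto
      then show ?thesis unfolding w'(3) by (simp add: wval_append)
    qed
  qed
  then show False using n unfolding normal_def by (simp add: wval_append)
qed

lemma normal_span:
  "set w \<subseteq> {..<N} \<Longrightarrow> wval w \<in> lspan (wval ` {w'. normal I w' \<and> length w' \<le> length w} \<union> I)"
proof (induction w rule: wf_induct[of "lenlex less_than"])
  case 1
  show ?case by (rule wf_lenlex) simp
next
  case (2 w)
  have IH: "wval w' \<in> lspan (wval ` {x. normal I x \<and> length x \<le> length w'} \<union> I)"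
    if "(w', w) \<in> lenlex less_than" "set w' \<subseteq> {..<N}" for w'
    using 2(1) that by blast
  show ?case
  proof (cases "normal I w")
    case True
    then show ?thesis by (intro lspan_base) auto
  next
    case False
    then have "wval w \<in> lspan (lower w \<union> I)" using 2(2) unfolding normal_def by blast
    then show ?thesis
    proof (rule lspan_subset, intro subsetI)
      fix s assume s: "s \<in> (lower w \<union> I) \<inter> carrier A"
      show "s \<in> lspan (wval ` {w'. normal I w' \<and> length w' \<le> length w} \<union> I)"
      proof (cases "s \<in> I")
        case True
        then show ?thesis using s by (intro lspan_base) auto
      next
        case False
        then obtain w' where w': "set w' \<subseteq> {..<N}" "(w', w) \<in> lenlex less_than" "s = wval w'"
          using s unfolding lower_def by auto
        have "length w' \<le> length w" using w'(2) by (rule lenlex_length)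
        then have "wval ` {x. normal I x \<and> length x \<le> length w'} \<subseteq> wval ` {x. normal I x \<and> length x \<le> length w}"
          by auto
        moreover have "wval w' \<in> lspan (wval ` {x. normal I x \<and> length x \<le> length w'} \<union> I)"
          by (rule IH[OF w'(2,1)])
        ultimately show ?thesis unfolding w'(3) by (meson Un_mono lspan_mono order_refl)
      qed
    qed
  qed
qed

definition words :: "nat \<Rightarrow> nat list set" where
  "words n = {w. set w \<subseteq> {..<N} \<and> length w \<le> n}"

lemma finite_words [simp]: "finite (words n)"
  unfolding words_def by (rule finite_lists_length_le) simp

text \<open>The factors of a normal word are normal, so each has at most \<open>d\<close> factors of
  length \<open>d\<close> and is, up to finitely many choices of its parts, a power between two
  words. Hence normal words of length at most \<open>L\<close> grow linearly in \<open>L\<close>,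
  too slowly for the \<open>n * n\<close> products
  \<open>v [^] a \<otimes> w \<otimes> v' [^] b\<close> with \<open>a\<close> and \<open>b\<close>
  below \<open>n\<close> to be independent.\<close>

lemma few_normal_words_periodic_span:
  assumes ac: "algebraically_closed k" and I: "ideal I A"
    and gen: "\<And>x. x \<in> carrier A \<Longrightarrow> x \<in> lspan (wval ` {w. set w \<subseteq> {..<N}})"
    and d: "card {w. normal I w \<and> length w = d} \<le> d"
  shows "\<exists>T. periodic_span k A I T"
proof -
  define C where "C = card (words d)"
  define c where "c = 2 * C + d"
  define T where "T = (\<lambda>(u, v, w). (wval u, wval v, wval w)) ` (words c \<times> words c \<times> words c)"
  have per: "\<exists>u v x m. w = u @ concat (replicate m v) @ x \<and> u \<in> words c \<and> v \<in> words c \<and> x \<in> words c \<and> m \<le> length w"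
    if w: "normal I w" for w
  proof -
    have sw: "set w \<subseteq> {..<N}" using w unfolding normal_def by blast
    show ?thesis
    proof (cases "d \<le> length w")
      case False
      then show ?thesis using sw unfolding words_def c_def
        by (intro exI[of _ w] exI[of _ "[]"] exI[of _ 0]) auto
    next
      case True
      have "factors d w \<subseteq> {w. normal I w \<and> length w = d}"
      proof
        fix z assume "z \<in> factors d w"
        then obtain t where t: "t \<le> length w - d" "z = take d (drop t w)" unfolding factors_def by auto
        have "w = take t w @ z @ drop d (drop t w)" unfolding t(2) by (metis append_take_drop_id)
        then have "normal I z" using normal_factor[OF I] w by metis
        then show "z \<in> {w. normal I w \<and> length w = d}" using t True by simp
      qed
      moreover have "finite {w. normal I w \<and> length w = d}"
        by (rule finite_subset[OF _ finite_words[of d]]) (auto simp: normal_def words_def)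
      ultimately have "card (factors d w) \<le> d" using d card_mono by (meson le_trans)
      from few_factors_periodic[OF finite_lessThan sw this True]
      obtain u v x m where e: "w = u @ concat (replicate m v) @ x" and l: "length u \<le> C" "length v \<le> C" "length x \<le> 2 * C + d"
        unfolding C_def words_def by blast
      \<comment> \<open>For an empty \<open>v\<close> any exponent would do; choosing 0 secures
        \<open>m' \<le> length w\<close>, on which the linear count rests.\<close>
      define m' where "m' = (if v = [] then 0 else m)"
      have e': "w = u @ concat (replicate m' v) @ x" unfolding e m'_def by simp
      have lc: "length (concat (replicate j v)) = j * length v" for j by (induction j) auto
      have "m' \<le> length w"
      proof (cases "v = []")
        case False
        then have "m' * 1 \<le> m' * length v" by (intro mult_le_mono) (auto simp: Suc_le_eq)
        also have "\<dots> \<le> length w" using arg_cong[OF e', of length] lc by simp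
        finally show ?thesis by simp
      qed (simp add: m'_def)
      moreover have "set u \<subseteq> set w" "set x \<subseteq> set w" unfolding e by auto
      moreover have "u \<in> words c" "x \<in> words c" using calculation l sw unfolding words_def c_def by auto
      moreover have "\<exists>v'\<in>words c. concat (replicate m' v) = concat (replicate m' v')"
      proof (cases "m' = 0")
        case True
        then show ?thesis by (intro bexI[of _ "[]"]) (auto simp: words_def)
      next
        case False
        then have "set v \<subseteq> set w" unfolding e' by (cases m') auto
        then show ?thesis using l sw unfolding words_def c_def by (intro bexI[of _ v]) auto
      qed
      ultimately show ?thesis using e' by metis
    qed
  qed
  define K where "K = card (words c \<times> words c \<times> words c)"
  have cn: "card {w. normal I w \<and> length w \<le> L} \<le> K * Suc L" for L
  proof -
    have "{w. normal I w \<and> length w \<le> L} \<subseteq>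
      (\<lambda>((u, v, x), m). u @ concat (replicate m v) @ x) ` ((words c \<times> words c \<times> words c) \<times> {..L})"
    proof
      fix w assume w: "w \<in> {w. normal I w \<and> length w \<le> L}"
      then obtain u v x m where "w = u @ concat (replicate m v) @ x" "u \<in> words c" "v \<in> words c"
        "x \<in> words c" "m \<le> length w" using per by blast
      then show "w \<in> (\<lambda>((u, v, x), m). u @ concat (replicate m v) @ x) ` ((words c \<times> words c \<times> words c) \<times> {..L})"
        using w by (intro image_eqI[of _ _ "((u, v, x), m)"]) auto
    qed
    then have "card {w. normal I w \<and> length w \<le> L} \<le> card ((words c \<times> words c \<times> words c) \<times> {..L})"
      by (rule surj_card_le[rotated]) simp
    then show ?thesis unfolding K_def by (simp only: card_cartesian_product card_atMost)
  qed
  have fin: "finite {w. normal I w \<and> length w \<le> L}" for L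
    by (rule finite_subset[OF _ finite_words[of L]]) (auto simp: normal_def words_def)
  note Ic = idealD(1)[OF I]
  have "periodic_span k A I T"
  proof (intro periodic_span.intro periodic_span_axioms.intro)
    show "kalg k A" by (rule kalg_axioms)
    show "algebraically_closed k" "ideal I A" using ac I by blast+
    show "finite T" unfolding T_def by simp
    show "u \<in> carrier A \<and> v \<in> carrier A \<and> w \<in> carrier A" if "(u, v, w) \<in> T" for u v w
      using that unfolding T_def by auto
    show "x \<in> lspan ({u \<otimes> v [^] (m::nat) \<otimes> w | u v w m. (u, v, w) \<in> T} \<union> I)" if x: "x \<in> carrier A" for x
    proof (rule lspan_subset[OF gen[OF x]], rule subsetI)
      fix s assume "s \<in> wval ` {w. set w \<subseteq> {..<N}} \<inter> carrier A"
      then obtain w where w: "set w \<subseteq> {..<N}" "s = wval w" by blast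
      show "s \<in> lspan ({u \<otimes> v [^] (m::nat) \<otimes> w | u v w m. (u, v, w) \<in> T} \<union> I)"
        unfolding w(2)
      proof (rule lspan_mono[OF normal_span[OF w(1), of I]], rule Un_mono[OF subsetI])
        fix t assume "t \<in> wval ` {w'. normal I w' \<and> length w' \<le> length w}"
        then obtain w' where w': "normal I w'" "t = wval w'" by blast
        obtain u v x m where "w' = u @ concat (replicate m v) @ x" and uvx: "u \<in> words c" "v \<in> words c" "x \<in> words c"
          using per[OF w'(1)] by blast
        then have "t = wval u \<otimes> wval v [^] m \<otimes> wval x"
          unfolding w'(2) by (simp add: wval_append wval_power A.m_assoc)
        moreover have "(wval u, wval v, wval x) \<in> T" using uvx unfolding T_def by force
        ultimately show "t \<in> {u \<otimes> v [^] (m::nat) \<otimes> w | u v w m. (u, v, w) \<in> T}" by blast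
      qed simp
    qed
    show "\<exists>(J::nat) (B::nat). v [^] J \<otimes> w \<otimes> v' [^] B \<in>
        lspan ({v [^] a \<otimes> w \<otimes> v' [^] b | a b. a < J \<or> a = J \<and> b < B} \<union> I)"
      if t: "(u, v, w) \<in> T" "(u', v', w') \<in> T" for u v w u' v' w'
    proof -
      obtain p q p' where pq: "p \<in> words c" "q \<in> words c" "p' \<in> words c" "v = wval p" "w = wval q" "v' = wval p'"
        using t unfolding T_def by auto
      \<comment> \<open>Chosen so that the number
        \<open>K * Suc L = n * (2 * K * c) + K * c + K\<close> of available normal words stays below
        \<open>n * n\<close>.\<close>
      define n where "n = 2 * K * c + 2 * K + 2"
      define L where "L = (2 * n + 1) * c"
      define S where "S = wval ` {w. normal I w \<and> length w \<le> L}"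
      \<comment> \<open>Division with remainder by \<open>n\<close> lists the pairs of exponents in
        lexicographic order, so dependence on predecessors is exactly the form that
        \<open>rel\<close> demands.\<close>
      define y where "y i = v [^] (i div n) \<otimes> w \<otimes> v' [^] (i mod n)" for i
      have n0: "n > 0" unfolding n_def by simp
      have "card S \<le> K * Suc L" unfolding S_def using card_image_le[OF fin[of L], of wval] cn[of L] by simp
      also have "K * Suc L = n * (2 * K * c) + K * c + K" unfolding L_def by (simp add: algebra_simps)
      also have "\<dots> \<le> n * n - 1"
      proof -
        have "n * (2 * K * c) + K * c + K + 1 \<le> n * n"
          unfolding n_def by (simp add: algebra_simps)
        then show ?thesis by simp
      qed
      finally have cS: "card S \<le> n * n - 1" .
      have "\<exists>m\<le>n * n - 1. y m \<in> lspan (y ` {..<m} \<union> I)"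
      proof (rule lspan_dependent[OF _ cS])
        show "finite S" unfolding S_def using fin by simp
        show "S \<subseteq> carrier A" unfolding S_def by auto
        show "I \<subseteq> carrier A" using Ic by blast
        fix i assume "i \<le> n * n - 1"
        then have i: "i < n * n" using n0 by (metis Suc_pred' le_imp_less_Suc nat_0_less_mult_iff)
        define z where "z = concat (replicate (i div n) p) @ q @ concat (replicate (i mod n) p')"
        have lc: "length (concat (replicate j a)) = j * length a" for j and a :: "nat list" by (induction j) auto
        have "i div n < n" using i by (simp add: less_mult_imp_div_less)
        then have "i div n * length p \<le> n * c" "i mod n * length p' \<le> n * c" "length q \<le> c"
          using pq(1-3) mod_less_divisor[OF n0, of i] mult_le_mono[of "i div n" n "length p" c]
            mult_le_mono[of "i mod n" n "length p'" c] unfolding words_def by simp_all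
        then have "length z \<le> L" unfolding z_def L_def by (simp add: lc algebra_simps)
        moreover have "set z \<subseteq> {..<N}" using pq(1-3) unfolding z_def words_def by (auto dest: in_set_replicate[THEN iffD1])
        ultimately have "wval z \<in> lspan (S \<union> I)"
          unfolding S_def by (intro lspan_mono[OF normal_span[of z I]]) auto
        moreover have "wval z = y i" unfolding z_def y_def pq(4-6)
          by (simp add: wval_append wval_power A.m_assoc)
        ultimately show "y i \<in> lspan (S \<union> I)" by simp
      qed
      then obtain m where m: "y m \<in> lspan (y ` {..<m} \<union> I)" by blast
      have "y ` {..<m} \<subseteq> {v [^] a \<otimes> w \<otimes> v' [^] b | a b. a < m div n \<or> a = m div n \<and> b < m mod n}"
      proof
        fix s assume "s \<in> y ` {..<m}"
        then obtain i where i: "i < m" "s = y i" by blast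
        have "i div n < m div n \<or> i div n = m div n \<and> i mod n < m mod n"
          using i(1) div_le_mono[of i m n] by (metis div_mult_mod_eq le_neq_implies_less less_imp_le_nat nat_add_left_cancel_less)
        then show "s \<in> {v [^] a \<otimes> w \<otimes> v' [^] b | a b. a < m div n \<or> a = m div n \<and> b < m mod n}"
          unfolding i(2) y_def by blast
      qed
      then have "y m \<in> lspan ({v [^] a \<otimes> w \<otimes> v' [^] b | a b. a < m div n \<or> a = m div n \<and> b < m mod n} \<union> I)"
        by (intro lspan_mono[OF m]) blast
      then show ?thesis unfolding y_def by blast
    qed
  qed
  then show ?thesis by blast
qed

end

section \<open>Dimensions of spans and dependence along a well-founded order\<close>

context kalg
begin

lemma submodule_subsp: "subsp N \<Longrightarrow> submodule k N A"
  using module_axioms unfolding submodule_def subsp_def by auto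

lemma span_eq_lspan:
  assumes "S \<subseteq> carrier A" shows "span S = lspan S"
proof
  have "S \<subseteq> lspan S" using assms by (auto intro: lspan_base)
  then show "span S \<subseteq> lspan S" by (rule span_is_subset[OF _ submodule_subsp[OF subsp_lspan]])
  have "submodule k (span S) A" using assms by (rule span_is_submodule)
  then have "subsp (span S)" unfolding subsp_def submodule_def by auto
  moreover have "S \<subseteq> span S" using assms by (rule in_own_span)
  ultimately show "lspan S \<subseteq> span S" using lspan_least by blast
qed

text \<open>The library takes as dimension the least size of a finite generating set; a set of that
  size is the \<open>B\<close> of the second part, and no linear independence is needed to compare
  dimensions with it.\<close>

lemma lspan_dim:
  assumes S: "finite S" "S \<subseteq> carrier A"
  shows "vectorspace.fin_dim k (A\<lparr>carrier := lspan S\<rparr>)"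
    and "\<exists>B. finite B \<and> B \<subseteq> carrier A \<and> card B = vectorspace.dim k (A\<lparr>carrier := lspan S\<rparr>) \<and> lspan S \<subseteq> lspan B"
proof -
  have sm: "submodule k (lspan S) A" by (rule submodule_subsp[OF subsp_lspan])
  interpret W: vectorspace k "A\<lparr>carrier := lspan S\<rparr>"
    using subspace_is_vs[of "lspan S"] sm vectorspace_axioms unfolding VectorSpace.subspace_def by blast
  have gen: "W.span B = lspan B" if "B \<subseteq> lspan S" for B
  proof -
    have "B \<subseteq> carrier A" using that lspan_carrier by blast
    then show ?thesis using span_li_not_depend(1)[OF that sm] span_eq_lspan by simp
  qed
  have SS: "S \<subseteq> lspan S" using S by (auto intro: lspan_base)
  then show "W.fin_dim" unfolding W.fin_dim_def using S gen by auto
  then have "\<exists>n B. finite B \<and> card B = n \<and> B \<subseteq> carrier (A\<lparr>carrier := lspan S\<rparr>) \<and> W.gen_set B"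
    unfolding W.fin_dim_def by blast
  then have "\<exists>B. finite B \<and> card B = W.dim \<and> B \<subseteq> carrier (A\<lparr>carrier := lspan S\<rparr>) \<and> W.gen_set B"
    unfolding W.dim_def by (rule LeastI_ex)
  then obtain B where B: "finite B" "card B = W.dim" "B \<subseteq> lspan S" "W.span B = lspan S" by auto
  then show "\<exists>B. finite B \<and> B \<subseteq> carrier A \<and> card B = W.dim \<and> lspan S \<subseteq> lspan B"
    using gen[OF B(3)] lspan_carrier by (intro exI[of _ B]) auto
qed

lemma lspan_mult:
  assumes "x \<in> lspan P" "y \<in> lspan Q" "P \<subseteq> carrier A" "Q \<subseteq> carrier A"
    and "\<And>p q. \<lbrakk>p \<in> P; q \<in> Q\<rbrakk> \<Longrightarrow> p \<otimes> q \<in> lspan R"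
  shows "x \<otimes> y \<in> lspan R"
proof (rule lspan_image[OF linmap_mult_right assms(1) _ subsp_lspan])
  show "y \<in> carrier A" using assms(2) lspan_carrier by blast
  fix p assume p: "p \<in> P" "p \<in> carrier A"
  show "p \<otimes> y \<in> lspan R"
    by (rule lspan_image[OF linmap_mult_left[OF p(2)] assms(2) _ subsp_lspan]) (use p assms(5) in blast)
qed

lemma wf_enumeration:
  assumes "finite P" "wf r" "total_on P r"
  shows "\<exists>x. x ` {..<card P} = P \<and> (\<forall>i j. i < j \<longrightarrow> j < card P \<longrightarrow> (x i, x j) \<in> r)"
  using assms(1,3)
proof (induction "card P" arbitrary: P)
  case 0
  then show ?case by auto
next
  case (Suc n)
  then have "P \<noteq> {}" by auto
  then obtain m where m: "m \<in> P" "\<And>y. (y, m) \<in> r \<Longrightarrow> y \<notin> P"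
    using wfE_min'[OF assms(2)] by metis
  have c: "card (P - {m}) = n" using Suc m by simp
  have "total_on (P - {m}) r" using Suc.prems(2) unfolding total_on_def by blast
  then obtain x where x: "x ` {..<n} = P - {m}" "\<And>i j. \<lbrakk>i < j; j < n\<rbrakk> \<Longrightarrow> (x i, x j) \<in> r"
    using Suc.hyps(1)[of "P - {m}"] c Suc.prems by auto
  let ?x = "case_nat m x"
  have "?x ` {..<card P} = insert m (x ` {..<n})"
    unfolding Suc.hyps(2)[symmetric] lessThan_Suc_eq_insert_0 by (simp add: image_image)
  then have 1: "?x ` {..<card P} = P" using x(1) m(1) by auto
  have "(?x i, ?x j) \<in> r" if ij: "i < j" "j < card P" for i j
  proof -
    obtain j' where j': "j = Suc j'" using ij by (cases j) auto
    show ?thesis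
    proof (cases i)
      case 0
      have "x j' \<in> x ` {..<n}" using ij(2) j' \<open>Suc n = card P\<close> by simp
      then have "x j' \<in> P - {m}" unfolding x(1) .
      then show ?thesis using 0 j' m Suc.prems(2) unfolding total_on_def by auto
    next
      case (Suc i')
      then show ?thesis using x(2)[of i' j'] ij j' \<open>Suc n = card P\<close> by simp
    qed
  qed
  then show ?case using 1 by blast
qed

lemma lspan_dependent_wf:
  assumes P: "finite P" "card S < card P" and S: "finite S" "S \<subseteq> carrier A"
    and f: "\<And>p. p \<in> P \<Longrightarrow> f p \<in> lspan S" and r: "wf r" "total_on P r"
  shows "\<exists>p\<in>P. f p \<in> lspan (f ` {q \<in> P. (q, p) \<in> r})"
proof -
  obtain x where x: "x ` {..<card P} = P" "\<And>i j. \<lbrakk>i < j; j < card P\<rbrakk> \<Longrightarrow> (x i, x j) \<in> r"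
    using wf_enumeration[OF P(1) r] by blast
  have "\<exists>m\<le>card S. (f \<circ> x) m \<in> lspan ((f \<circ> x) ` {..<m} \<union> {})"
  proof (rule lspan_dependent[OF S(1) le_refl S(2)])
    fix i assume "i \<le> card S"
    then have "x i \<in> P" using x(1) P(2) by auto
    then show "(f \<circ> x) i \<in> lspan (S \<union> {})" using f by simp
  qed simp
  then obtain m where m: "m \<le> card S" "f (x m) \<in> lspan ((f \<circ> x) ` {..<m})" by auto
  have "(f \<circ> x) ` {..<m} \<subseteq> f ` {q \<in> P. (q, x m) \<in> r}"
  proof
    fix y assume "y \<in> (f \<circ> x) ` {..<m}"
    then obtain i where "i < m" "y = f (x i)" by auto
    moreover have "x i \<in> P" using x(1) \<open>i < m\<close> m(1) P(2) by auto
    ultimately show "y \<in> f ` {q \<in> P. (q, x m) \<in> r}" using x(2)[of i m] m(1) P(2) by auto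
  qed
  moreover have "x m \<in> P" using x(1) m(1) P(2) by auto
  ultimately show ?thesis using lspan_mono[OF m(2)] by blast
qed

end

section \<open>Normal words modulo an ideal against the growth of the algebra\<close>

context word_algebra
begin

lemma growth_basis:
  defines "V \<equiv> lspan (g ` {..<N})"
  shows "VectorSpace.subspace k V A" "vectorspace.fin_dim k (A\<lparr>carrier := V\<rparr>)"
    and "\<exists>B. finite B \<and> B \<subseteq> carrier A \<and> card B = subspace_growth k A V n \<and> (\<forall>w\<in>words n. wval w \<in> lspan B)"
proof -
  show "VectorSpace.subspace k V A"
    unfolding VectorSpace.subspace_def V_def using submodule_subsp[OF subsp_lspan] vectorspace_axioms by blast
  show "vectorspace.fin_dim k (A\<lparr>carrier := V\<rparr>)"
    unfolding V_def using g_carrier by (intro lspan_dim(1)) auto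
  have gV: "g i \<in> V" if "i < N" for i unfolding V_def using that g_carrier by (intro lspan_base) auto
  have prod: "word_val A ws \<in> lspan (wval ` words (length ws))" if "set ws \<subseteq> V" for ws
    using that
  proof (induction ws)
    case Nil
    have "wval [] \<in> lspan (wval ` words 0)" by (rule lspan_base) (auto simp: words_def)
    then show ?case by (simp add: wval_Nil)
  next
    case (Cons x ws)
    have "x \<otimes> word_val A ws \<in> lspan (wval ` words (length (x # ws)))"
    proof (rule lspan_mult)
      show "x \<in> lspan (g ` {..<N})" using Cons.prems V_def by simp
      show "word_val A ws \<in> lspan (wval ` words (length ws))" using Cons by simp
      fix p q assume "p \<in> g ` {..<N}" "q \<in> wval ` words (length ws)"
      then obtain i w where "i < N" "p = g i" "w \<in> words (length ws)" "q = wval w" by auto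
      then have "i # w \<in> words (length (x # ws))" "p \<otimes> q = wval (i # w)"
        unfolding words_def wval_def by auto
      then show "p \<otimes> q \<in> lspan (wval ` words (length (x # ws)))" by (intro lspan_base) auto
    qed (use g_carrier in auto)
    then show ?case by simp
  qed
  let ?Z = "{word_val A ws | ws. set ws \<subseteq> V \<and> length ws \<le> n}"
  have Vc: "V \<subseteq> carrier A" unfolding V_def using lspan_carrier by blast
  have Zc: "?Z \<subseteq> carrier A" using A.word_val_closed Vc by blast
  have wZ: "wval w \<in> ?Z" if "w \<in> words n" for w
  proof -
    have "set (map g w) \<subseteq> V \<and> length (map g w) \<le> n" using that gV unfolding words_def by auto
    then show ?thesis unfolding wval_def by blast
  qed
  have "lspan ?Z = lspan (wval ` words n)"
  proof
    show "lspan ?Z \<subseteq> lspan (wval ` words n)"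
    proof (rule subsetI, erule lspan_subset, rule subsetI)
      fix s assume "s \<in> ?Z \<inter> carrier A"
      then obtain ws where ws: "s = word_val A ws" "set ws \<subseteq> V" "length ws \<le> n" by blast
      show "s \<in> lspan (wval ` words n)"
        unfolding ws(1) by (rule lspan_mono[OF prod[OF ws(2)]]) (use ws(3) in \<open>auto simp: words_def\<close>)
    qed
    show "lspan (wval ` words n) \<subseteq> lspan ?Z" using wZ lspan_mono by blast
  qed
  then have "subspace_growth k A V n = vectorspace.dim k (A\<lparr>carrier := lspan (wval ` words n)\<rparr>)"
    unfolding subspace_growth_def span_eq_lspan[OF Zc] by simp
  moreover have "finite (wval ` words n)" "wval ` words n \<subseteq> carrier A" by auto
  from lspan_dim(2)[OF this] obtain B where "finite B \<and> B \<subseteq> carrier A \<and>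
      card B = vectorspace.dim k (A\<lparr>carrier := lspan (wval ` words n)\<rparr>) \<and> lspan (wval ` words n) \<subseteq> lspan B"
    by (rule exE)
  moreover have "wval w \<in> lspan (wval ` words n)" if "w \<in> words n" for w
    using that by (intro lspan_base) auto
  ultimately show "\<exists>B. finite B \<and> B \<subseteq> carrier A \<and> card B = subspace_growth k A V n \<and> (\<forall>w\<in>words n. wval w \<in> lspan B)"
    by (intro exI[of _ B]) auto
qed

text \<open>If \<open>x\<close> in \<open>I\<close> is a nonzerodivisor, the elements \<open>w x\<^sup>s\<close> with \<open>w\<close> normal modulo \<open>I\<close> are linearly independent.\<close>

lemma normal_words_growth:
  assumes I: "ideal I A" and x: "x \<in> I" and reg: "\<And>s. \<lbrakk>s \<in> carrier A; s \<otimes> x = \<zero>\<rbrakk> \<Longrightarrow> s = \<zero>"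
    and xm: "x \<in> lspan (wval ` words m)"
  shows "Suc n * card {w. normal I w \<and> length w \<le> n} \<le> subspace_growth k A (lspan (g ` {..<N})) (n + n * m)"
proof (rule ccontr)
  let ?G = "subspace_growth k A (lspan (g ` {..<N})) (n + n * m)"
  define NW where "NW = {w. normal I w \<and> length w \<le> n}"
  have fNW: "finite NW" unfolding NW_def
    by (rule finite_subset[OF _ finite_words[of n]]) (auto simp: normal_def words_def)
  assume "\<not> Suc n * card {w. normal I w \<and> length w \<le> n} \<le> ?G"
  then have big: "?G < card ({..n} \<times> NW)" unfolding NW_def by (simp add: card_cartesian_product)
  obtain B where "finite B \<and> B \<subseteq> carrier A \<and> card B = ?G \<and> (\<forall>w\<in>words (n + n * m). wval w \<in> lspan B)"
    using growth_basis(3)[of "n + n * m"] by (rule exE)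
  then have B: "finite B" "B \<subseteq> carrier A" "card B = ?G" "\<And>w. w \<in> words (n + n * m) \<Longrightarrow> wval w \<in> lspan B"
    by simp_all
  have xc: "x \<in> carrier A" using x idealD(1)[OF I] by blast
  have pow: "x [^] s \<in> lspan (wval ` words (s * m))" for s :: nat
  proof (induction s)
    case 0
    have "wval [] \<in> lspan (wval ` words 0)" by (rule lspan_base) (auto simp: words_def)
    then show ?case by (simp add: wval_Nil)
  next
    case (Suc s)
    have "x [^] s \<otimes> x \<in> lspan (wval ` words (Suc s * m))"
    proof (rule lspan_mult[OF Suc xm])
      fix p q assume "p \<in> wval ` words (s * m)" "q \<in> wval ` words m"
      then obtain u w where "u \<in> words (s * m)" "w \<in> words m" "p = wval u" "q = wval w" by auto
      then have "u @ w \<in> words (Suc s * m)" "p \<otimes> q = wval (u @ w)" unfolding words_def by (auto simp: wval_append)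
      then show "p \<otimes> q \<in> lspan (wval ` words (Suc s * m))" by (intro lspan_base) auto
    qed auto
    then show ?case by simp
  qed
  define f where "f = (\<lambda>(s, w). wval w \<otimes> x [^] (s::nat))"
  \<comment> \<open>Higher powers of \<open>x\<close> count as smaller. The leading term of a
    dependence then carries the lowest power \<open>x [^] s\<close>, which can be cancelled on the
    right from all terms; those with a higher power keep a factor in \<open>I\<close>.\<close>
  define r where "r = inv_image (less_than <*lex*> lenlex less_than) (\<lambda>(s::nat, w::nat list). (n - s, w))"
  have "wf r" unfolding r_def by (intro wf_inv_image wf_lex_prod wf_less_than wf_lenlex)
  moreover have "total_on ({..n} \<times> NW) r"
    unfolding r_def total_on_def
  proof (intro ballI impI)
    fix p q assume p: "p \<in> {..n} \<times> NW" "q \<in> {..n} \<times> NW" "p \<noteq> q"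
    obtain s w s' w' where e: "p = (s, w)" "q = (s', w')" by (cases p, cases q)
    have "total (lenlex less_than)" by (rule total_lenlex) (simp add: total_less_than)
    then have "w \<noteq> w' \<Longrightarrow> (w, w') \<in> lenlex less_than \<or> (w', w) \<in> lenlex less_than" unfolding total_on_def by blast
    moreover have "s \<le> n" "s' \<le> n" using p e by auto
    ultimately show "(p, q) \<in> inv_image (less_than <*lex*> lenlex less_than) (\<lambda>(s, w). (n - s, w)) \<or>
        (q, p) \<in> inv_image (less_than <*lex*> lenlex less_than) (\<lambda>(s, w). (n - s, w))"
      using p(3) unfolding e by (cases "s = s'") (auto simp: in_lex_prod)
  qed
  moreover have "f p \<in> lspan B" if p: "p \<in> {..n} \<times> NW" for p
  proof -
    obtain s w where e: "p = (s, w)" by (cases p)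
    have sw: "s \<le> n" "w \<in> words n" using p unfolding e NW_def words_def normal_def by auto
    have "wval w \<otimes> x [^] s \<in> lspan (wval ` words (n + n * m))"
    proof (rule lspan_mult[OF _ pow])
      show "wval w \<in> lspan {wval w}" by (rule lspan_base) auto
      fix a b assume "a \<in> {wval w}" "b \<in> wval ` words (s * m)"
      then obtain u where u: "a = wval w" "u \<in> words (s * m)" "b = wval u" by auto
      have "length u \<le> s * m" using u(2) unfolding words_def by simp
      also have "\<dots> \<le> n * m" using sw(1) by (rule mult_le_mono1)
      finally have "length u \<le> n * m" .
      then have "w @ u \<in> words (n + n * m)" using sw(2) u(2) unfolding words_def by auto
      moreover have "a \<otimes> b = wval (w @ u)" unfolding u by (simp add: wval_append)
      ultimately show "a \<otimes> b \<in> lspan (wval ` words (n + n * m))" by (intro lspan_base) auto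
    qed auto
    then have "wval w \<otimes> x [^] s \<in> lspan B" using lspan_subset B(4) by blast
    then show ?thesis unfolding e f_def by simp
  qed
  ultimately obtain p where p: "p \<in> {..n} \<times> NW" "f p \<in> lspan (f ` {q \<in> {..n} \<times> NW. (q, p) \<in> r})"
    using lspan_dependent_wf[of "{..n} \<times> NW" B f r] fNW B(1-3) big by auto
  obtain s w where e: "p = (s, w)" by (cases p)
  have w: "normal I w" using p(1) unfolding e NW_def by blast
  define S' where "S' = lower w \<union> I"
  have "f ` {q \<in> {..n} \<times> NW. (q, p) \<in> r} \<subseteq> (\<lambda>z. z \<otimes> x [^] s) ` (S' \<inter> carrier A)"
  proof
    fix y assume "y \<in> f ` {q \<in> {..n} \<times> NW. (q, p) \<in> r}"
    then obtain s' w' where q: "s' \<le> n" "w' \<in> NW" "((s', w'), (s, w)) \<in> r" "y = wval w' \<otimes> x [^] s'"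
      unfolding e f_def by auto
    have sn: "s \<le> n" using p(1) unfolding e by auto
    from q(3) consider "s < s'" | "s' = s" "(w', w) \<in> lenlex less_than"
      unfolding r_def using sn q(1) by (auto simp: in_lex_prod)
    then show "y \<in> (\<lambda>z. z \<otimes> x [^] s) ` (S' \<inter> carrier A)"
    proof cases
      case 1
      have "x [^] (s' - s) \<in> I"
      proof -
        obtain t where "s' - s = Suc t" using 1 by (metis Suc_diff_Suc)
        then show ?thesis using idealD(2)[OF I x, of "x [^] t"] xc by simp
      qed
      then have "wval w' \<otimes> x [^] (s' - s) \<in> S' \<inter> carrier A" unfolding S'_def using idealD[OF I] by auto
      moreover have "y = wval w' \<otimes> x [^] (s' - s) \<otimes> x [^] s"
        unfolding q(4) using 1 xc by (simp add: A.m_assoc A.nat_pow_mult)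
      ultimately show ?thesis by blast
    next
      case 2
      have "set w' \<subseteq> {..<N}" using q(2) unfolding NW_def normal_def by blast
      then have "wval w' \<in> S' \<inter> carrier A" unfolding S'_def lower_def using 2 by auto
      then show ?thesis unfolding q(4) using 2 by blast
    qed
  qed
  then have fp: "wval w \<otimes> x [^] s \<in> lspan ((\<lambda>z. z \<otimes> x [^] s) ` (S' \<inter> carrier A))"
    using lspan_mono[OF p(2)] unfolding e f_def by auto
  have xs: "x [^] s \<in> carrier A" using xc by simp
  obtain z where z: "z \<in> lspan (S' \<inter> carrier A)" "wval w \<otimes> x [^] s = z \<otimes> x [^] s"
    using lspan_preimage[OF linmap_mult_right[OF xs] fp] by blast
  have zc: "z \<in> carrier A" using z lspan_carrier by blast
  have regp: "t = \<zero>" if "t \<in> carrier A" "t \<otimes> x [^] s = \<zero>" for t and s :: nat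
    using that
  proof (induction s)
    case (Suc s)
    then have "(t \<otimes> x [^] s) \<otimes> x = \<zero>" using xc by (simp add: A.m_assoc)
    then have "t \<otimes> x [^] s = \<zero>" using reg[of "t \<otimes> x [^] s"] Suc.prems xc by simp
    then show ?case using Suc by blast
  qed simp
  have "(wval w \<ominus> z) \<otimes> x [^] s = wval w \<otimes> x [^] s \<ominus> z \<otimes> x [^] s"
    using zc xs by (simp add: a_minus_def A.l_distr A.l_minus)
  also have "\<dots> = \<zero>" unfolding z(2) using zc xs by (simp add: a_minus_def M.r_neg)
  finally have "wval w \<ominus> z = \<zero>" by (rule regp[rotated]) (use zc in simp)
  then have "wval w = z" using zc by simp
  then have "wval w \<in> lspan (lower w \<union> I)" using lspan_mono[OF z(1)] unfolding S'_def by blast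
  then show False using w unfolding normal_def by blast
qed

text \<open>More than \<open>d\<close> normal words of length \<open>d\<close> for every
  \<open>d\<close> would give at least half of \<open>(n + 1)^2\<close> normal words of length at
  most \<open>n\<close>. Together with \<open>n + 1\<close> powers of the nonzerodivisor
  \<open>x\<close> they would force cubic growth.\<close>

lemma few_normal_words:
  assumes I: "ideal I A" and x: "x \<in> I" and reg: "\<And>s. \<lbrakk>s \<in> carrier A; s \<otimes> x = \<zero>\<rbrakk> \<Longrightarrow> s = \<zero>"
    and gen: "\<And>x. x \<in> carrier A \<Longrightarrow> x \<in> lspan (wval ` {w. set w \<subseteq> {..<N}})"
    and gk: "GKdim k A < 3"
  shows "\<exists>d. card {w. normal I w \<and> length w = d} \<le> d"
proof (rule ccontr)
  assume "\<not> ?thesis"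
  then have many: "Suc d \<le> card {w. normal I w \<and> length w = d}" for d by (meson not_less_eq_eq)
  have fin: "finite {w. normal I w \<and> length w \<le> n}" for n
    by (rule finite_subset[OF _ finite_words[of n]]) (auto simp: normal_def words_def)
  have h: "Suc n * Suc n \<le> 2 * card {w. normal I w \<and> length w \<le> n}" for n
  proof (induction n)
    case 0
    then show ?case using many[of 0] by simp
  next
    case (Suc n)
    have "{w. normal I w \<and> length w \<le> Suc n} = {w. normal I w \<and> length w \<le> n} \<union> {w. normal I w \<and> length w = Suc n}"
      by (auto simp: le_Suc_eq)
    moreover have "finite {w. normal I w \<and> length w = Suc n}"
      by (rule finite_subset[OF _ fin[of "Suc n"]]) auto
    ultimately have "card {w. normal I w \<and> length w \<le> Suc n} =
        card {w. normal I w \<and> length w \<le> n} + card {w. normal I w \<and> length w = Suc n}"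
      using fin by (simp add: card_Un_disjoint disjoint_iff)
    then show ?case using Suc many[of "Suc n"] by simp
  qed
  have "\<exists>m. x \<in> lspan (wval ` words m)"
  proof -
    have "x \<in> lspan (wval ` {w. set w \<subseteq> {..<N}})" using gen x idealD(1)[OF I] by blast
    then show ?thesis
    proof (induction rule: lspan.induct)
      case zero
      then show ?case using lspan.zero by blast
    next
      case (step c s v)
      obtain m where m: "v \<in> lspan (wval ` words m)" using step by blast
      obtain w where w: "set w \<subseteq> {..<N}" "s = wval w" using step by blast
      have "words m \<subseteq> words (m + length w)" "w \<in> words (m + length w)" using w unfolding words_def by auto
      then have "c \<odot> s \<oplus> v \<in> lspan (wval ` words (m + length w))"
        using step w(2) lspan_mono[OF m image_mono] by (intro lspan.step) auto
      then show ?case by blast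
    qed
  qed
  then obtain m where m: "x \<in> lspan (wval ` words m)" by blast
  let ?V = "lspan (g ` {..<N})"
  define \<gamma> where "\<gamma> n = subspace_growth k A ?V n" for n
  have gam: "real (Suc n) ^ 3 \<le> 2 * real (\<gamma> (Suc m * n))" for n
  proof -
    have "Suc n * (Suc n * Suc n) \<le> Suc n * (2 * card {w. normal I w \<and> length w \<le> n})"
      by (intro mult_le_mono2 h)
    also have "\<dots> \<le> 2 * \<gamma> (n + n * m)"
      using normal_words_growth[OF I x reg m, of n] unfolding \<gamma>_def by simp
    finally have "Suc n ^ 3 \<le> 2 * \<gamma> (Suc m * n)" by (simp add: power3_eq_cube mult.assoc mult.commute)
    then show ?thesis by (metis of_nat_le_iff of_nat_mult of_nat_numeral of_nat_power)
  qed
  have "limsup (\<lambda>n. ereal (ln (real (\<gamma> n)) / ln (real n))) \<le> GKdim k A"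
    unfolding GKdim_def \<gamma>_def by (rule SUP_upper) (use growth_basis(1,2) in simp)
  then have "limsup (\<lambda>n. ereal (ln (real (\<gamma> n)) / ln (real n))) < ereal 3" using gk by simp
  \<comment> \<open>A real exponent strictly between the upper limit and 3. Passing to the multiples
    \<open>Suc m * n\<close> costs only a constant, which loses against
    \<open>(3 - y) * ln (real n)\<close>.\<close>
  then obtain y where y: "limsup (\<lambda>n. ereal (ln (real (\<gamma> n)) / ln (real n))) < ereal y" "y < 3"
    using ereal_dense2[of "limsup (\<lambda>n. ereal (ln (real (\<gamma> n)) / ln (real n)))" "ereal 3"] by auto
  have "eventually (\<lambda>n. ereal (ln (real (\<gamma> n)) / ln (real n)) < ereal y) sequentially"
    by (rule Limsup_lessD[OF y(1)])
  then obtain n0 where n0: "\<And>n. n \<ge> n0 \<Longrightarrow> ln (real (\<gamma> n)) / ln (real n) < y"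
    unfolding eventually_sequentially by auto
  have bound: "(3 - y) * ln (real n) < ln 2 + y * ln (real (Suc m))" if n: "n \<ge> n0 + 2" for n
  proof -
    have N: "Suc m * n \<ge> n0" "Suc m * n \<ge> 2" using n by simp_all
    have "real (Suc m * n) > 1" using N(2) by linarith
    then have lp: "ln (real (Suc m * n)) > 0" by (rule ln_gt_zero)
    have "ln (real (\<gamma> (Suc m * n))) < y * ln (real (Suc m * n))"
      using n0[OF N(1)] lp by (simp only: pos_divide_less_eq)
    moreover have "ln (real (Suc m * n)) = ln (real (Suc m)) + ln (real n)"
      unfolding of_nat_mult by (rule ln_mult_pos) (use n in auto)
    moreover have "3 * ln (real n) \<le> ln 2 + ln (real (\<gamma> (Suc m * n)))"
    proof -
      have g0: "real (\<gamma> (Suc m * n)) > 0"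
        using gam[of n] zero_less_power[of "real (Suc n)" 3] by linarith
      have "real n ^ 3 \<le> real (Suc n) ^ 3" by (intro power_mono) auto
      then have "real n ^ 3 \<le> 2 * real (\<gamma> (Suc m * n))" using gam[of n] by linarith
      then have "ln (real n ^ 3) \<le> ln (2 * real (\<gamma> (Suc m * n)))" using n g0 by (intro ln_mono) auto
      then show ?thesis using n g0 by (simp add: ln_realpow ln_mult)
    qed
    ultimately show ?thesis by (simp add: algebra_simps)
  qed
  have "filterlim (\<lambda>n. (3 - y) * ln (real n)) at_top sequentially"
    using y(2) by (intro filterlim_tendsto_pos_mult_at_top[OF tendsto_const] filterlim_compose[OF ln_at_top filterlim_real_sequentially]) simp
  then have "eventually (\<lambda>n. (3 - y) * ln (real n) \<ge> ln 2 + y * ln (real (Suc m))) sequentially"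
    unfolding filterlim_at_top by blast
  then obtain n1 where "\<And>n. n \<ge> n1 \<Longrightarrow> (3 - y) * ln (real n) \<ge> ln 2 + y * ln (real (Suc m))"
    unfolding eventually_sequentially by blast
  from this[of "max n1 (n0 + 2)"] bound[of "max n1 (n0 + 2)"] show False by simp
qed

end

section \<open>Regular elements in ideals\<close>

context ring
begin

lemma idealI_elements:
  assumes "I \<subseteq> carrier R" "\<zero> \<in> I" "\<And>x y. \<lbrakk>x \<in> I; y \<in> I\<rbrakk> \<Longrightarrow> x \<oplus> y \<in> I"
    "\<And>x a. \<lbrakk>x \<in> I; a \<in> carrier R\<rbrakk> \<Longrightarrow> a \<otimes> x \<in> I" "\<And>x a. \<lbrakk>x \<in> I; a \<in> carrier R\<rbrakk> \<Longrightarrow> x \<otimes> a \<in> I"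
  shows "ideal I R"
proof (rule idealI[OF ring_axioms])
  show "subgroup I (add_monoid R)"
  proof (rule add.subgroupI)
    fix x y assume x: "x \<in> I"
    have "\<ominus> \<one> \<otimes> x \<in> I" using assms(4)[OF x] by simp
    then show "\<ominus> x \<in> I" using x assms(1) by (auto simp: l_minus)
    assume "y \<in> I"
    then show "x \<oplus> y \<in> I" using x assms(3) by blast
  qed (use assms in auto)
qed (use assms in auto)

text \<open>\<open>J\<close> consists of the elements killed by \<open>aR\<close> and
  \<open>I\<close> of the \<open>x\<close> with \<open>xRJ = 0\<close>. Both are ideals, their
  product is zero, and they contain \<open>b\<close> and \<open>a\<close>.\<close>

lemma prime_ringD:
  assumes "prime_ring R" and a: "a \<in> carrier R" and b: "b \<in> carrier R"
    and ab: "\<And>r. r \<in> carrier R \<Longrightarrow> a \<otimes> r \<otimes> b = \<zero>"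
  shows "a = \<zero> \<or> b = \<zero>"
proof -
  define J where "J = {y \<in> carrier R. \<forall>r\<in>carrier R. a \<otimes> r \<otimes> y = \<zero>}"
  define I where "I = {x \<in> carrier R. \<forall>y\<in>J. \<forall>r\<in>carrier R. x \<otimes> r \<otimes> y = \<zero>}"
  have Jc: "J \<subseteq> carrier R" unfolding J_def by blast
  have J: "ideal J R"
  proof (rule idealI_elements)
    fix x s assume x: "x \<in> J" and s: "s \<in> carrier R"
    have "a \<otimes> r \<otimes> (s \<otimes> x) = \<zero>" if r: "r \<in> carrier R" for r
    proof -
      have "a \<otimes> (r \<otimes> s) \<otimes> x = \<zero>" using x s r unfolding J_def by blast
      then show ?thesis using x s r a unfolding J_def by (simp add: m_assoc)
    qed
    then show "s \<otimes> x \<in> J" using x s unfolding J_def by simp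
    have "a \<otimes> r \<otimes> (x \<otimes> s) = \<zero>" if r: "r \<in> carrier R" for r
    proof -
      have "a \<otimes> r \<otimes> x \<otimes> s = \<zero>" using x s r unfolding J_def by simp
      then show ?thesis using x s r a unfolding J_def by (simp add: m_assoc)
    qed
    then show "x \<otimes> s \<in> J" using x s unfolding J_def by simp
  qed (use a in \<open>auto simp: J_def r_distr\<close>)
  have I: "ideal I R"
  proof (rule idealI_elements)
    fix x s assume x: "x \<in> I" and s: "s \<in> carrier R"
    have xc: "x \<in> carrier R" using x unfolding I_def by blast
    have "s \<otimes> x \<otimes> r \<otimes> y = \<zero>" if y: "y \<in> J" and r: "r \<in> carrier R" for r y
    proof -
      have "s \<otimes> (x \<otimes> r \<otimes> y) = \<zero>" using x y s r unfolding I_def by simp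
      then show ?thesis using xc s r y Jc by (auto simp: m_assoc)
    qed
    then show "s \<otimes> x \<in> I" using xc s unfolding I_def by simp
    have "x \<otimes> s \<otimes> r \<otimes> y = \<zero>" if y: "y \<in> J" and r: "r \<in> carrier R" for r y
    proof -
      have "x \<otimes> (s \<otimes> r) \<otimes> y = \<zero>" using x y s r unfolding I_def by simp
      then show ?thesis using xc s r y Jc by (auto simp: m_assoc)
    qed
    then show "x \<otimes> s \<in> I" using xc s unfolding I_def by simp
  qed (use Jc in \<open>auto simp: I_def l_distr subset_iff\<close>)
  have p: "z = \<zero>" if "z \<in> ideal_prod R I J" for z
    using that
  proof (induction rule: ideal_prod.induct)
    case (prod i j)
    then have "i \<otimes> \<one> \<otimes> j = \<zero>" unfolding I_def by blast
    then show ?case using prod unfolding I_def by simp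
  qed simp
  have "\<zero> \<otimes> \<zero> \<in> ideal_prod R I J"
    by (rule ideal_prod.prod) (use I J in \<open>auto simp: additive_subgroup.zero_closed ideal_def\<close>)
  then have "ideal_prod R I J = {\<zero>}" by (intro equalityI subsetI) (simp_all add: p)
  then have "I = {\<zero>} \<or> J = {\<zero>}" using assms(1) I J unfolding prime_ring_def by blast
  moreover have "b \<in> J" unfolding J_def using b ab by blast
  moreover have "a \<in> I" unfolding I_def J_def using a by blast
  ultimately show ?thesis by blast
qed

definition lann :: "'a \<Rightarrow> 'a set" where
  "lann b = left_annihilator R {b}"

lemma lann_iff: "x \<in> lann b \<longleftrightarrow> x \<in> carrier R \<and> x \<otimes> b = \<zero>"
  unfolding lann_def left_annihilator_def by simp

lemma lann_mult: "\<lbrakk>b \<in> carrier R; u \<in> carrier R\<rbrakk> \<Longrightarrow> lann b \<subseteq> lann (b \<otimes> u)"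
  by (auto simp: lann_iff m_assoc[symmetric])

lemma lann_stable:
  assumes "left_goldie R" "\<And>n. s n \<in> carrier R" "\<And>n. lann (s n) \<subseteq> lann (s (Suc n))"
  shows "\<exists>N. \<forall>n\<ge>N. lann (s n) = lann (s N)"
proof -
  have "\<forall>S. (\<forall>n. S n \<subseteq> carrier R \<and> left_annihilator R (S n) \<subseteq> left_annihilator R (S (Suc n)))
        \<longrightarrow> (\<exists>N. \<forall>n\<ge>N. left_annihilator R (S n) = left_annihilator R (S N))"
    using assms(1) unfolding left_goldie_def by blast
  from this[rule_format, of "\<lambda>n. {s n}"] show ?thesis using assms(2,3) unfolding lann_def by auto
qed

lemma lann_maximal:
  assumes g: "left_goldie R" and P: "P \<subseteq> carrier R" "a \<in> P"
  shows "\<exists>a\<in>P. \<forall>b\<in>P. lann a \<subseteq> lann b \<longrightarrow> lann b = lann a"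
proof (rule ccontr)
  assume "\<not> ?thesis"
  then have step: "\<exists>y. y \<in> P \<and> lann x \<subset> lann y" if "x \<in> P" for x using that by blast
  have "\<exists>s. \<forall>n::nat. s n \<in> P \<and> lann (s n) \<subset> lann (s (Suc n))"
    by (rule dependent_nat_choice) (use P(2) in blast, erule step)
  then obtain s where s: "\<And>n::nat. s n \<in> P" "\<And>n. lann (s n) \<subset> lann (s (Suc n))" by blast
  obtain N where "\<And>n. n \<ge> N \<Longrightarrow> lann (s n) = lann (s N)"
    using lann_stable[OF g, of s] s P(1) by blast
  then show False using s(2)[of N] by (metis le_add2 plus_1_eq_Suc psubset_eq)
qed

lemma nilpotent_swap:
  assumes "x \<in> carrier R" "u \<in> carrier R"
  shows "(x \<otimes> u) [^] Suc n = x \<otimes> (u \<otimes> x) [^] (n::nat) \<otimes> u"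
proof (induction n)
  case (Suc n)
  have "(x \<otimes> u) [^] Suc (Suc n) = x \<otimes> (u \<otimes> x) [^] n \<otimes> u \<otimes> (x \<otimes> u)" using Suc by simp
  also have "\<dots> = x \<otimes> (u \<otimes> x) [^] Suc n \<otimes> u" using assms by (simp add: m_assoc)
  finally show ?case .
qed (use assms in simp)

text \<open>Levitzki: a prime ring with the ascending chain condition on left annihilators has no nonzero nil
  left ideal. An element \<open>a\<close> with \<open>Ra\<close> nil and maximal left annihilator would satisfy \<open>aRa = 0\<close>.\<close>

lemma exists_nonnilpotent_multiple:
  assumes g: "left_goldie R" and pr: "prime_ring R" and a: "a \<in> carrier R" "a \<noteq> \<zero>"
  shows "\<exists>r\<in>carrier R. \<forall>n::nat. (r \<otimes> a) [^] n \<noteq> \<zero>"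
proof (rule ccontr)
  assume n: "\<not> ?thesis"
  define P where "P = {a \<in> carrier R. a \<noteq> \<zero> \<and> (\<forall>r\<in>carrier R. \<exists>n::nat. (r \<otimes> a) [^] n = \<zero>)}"
  have aP: "a \<in> P" unfolding P_def using a n by blast
  have "P \<subseteq> carrier R" unfolding P_def by blast
  from lann_maximal[OF g this aP]
  obtain a where aP: "a \<in> P" and mx: "\<And>b. \<lbrakk>b \<in> P; lann a \<subseteq> lann b\<rbrakk> \<Longrightarrow> lann b = lann a"
    by blast
  have a: "a \<in> carrier R" "a \<noteq> \<zero>" using aP unfolding P_def by auto
  have "a \<otimes> r \<otimes> a = \<zero>" if r: "r \<in> carrier R" for r
  proof -
    obtain n0 where "(r \<otimes> a) [^] (n0::nat) = \<zero>" using aP r unfolding P_def by blast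
    then have ex: "a \<otimes> (r \<otimes> a) [^] n0 = \<zero>" using a by simp
    \<comment> \<open>Minimality makes \<open>a \<otimes> u\<close> nonzero. It belongs to
      \<open>P\<close> again, so by maximality it has the same left annihilator as \<open>a\<close>;
      as \<open>a \<otimes> r\<close> kills \<open>a \<otimes> u\<close>, it kills
      \<open>a\<close>.\<close>
    define n where "n = (LEAST n. a \<otimes> (r \<otimes> a) [^] (n::nat) = \<zero>)"
    have n: "a \<otimes> (r \<otimes> a) [^] n = \<zero>" unfolding n_def using ex by (rule LeastI)
    have "n \<noteq> 0" using n a by (cases "n = 0") auto
    then obtain m where m: "n = Suc m" by (cases n) auto
    have "m < n" using m by simp
    then have nz: "a \<otimes> (r \<otimes> a) [^] m \<noteq> \<zero>" unfolding n_def by (rule not_less_Least)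
    define u where "u = (r \<otimes> a) [^] m"
    have uc: "u \<in> carrier R" unfolding u_def using a r by simp
    have "\<exists>n::nat. (s \<otimes> (a \<otimes> u)) [^] n = \<zero>" if s: "s \<in> carrier R" for s
    proof -
      have "u \<otimes> s \<in> carrier R" using uc s by simp
      then obtain l where "(u \<otimes> s \<otimes> a) [^] (l::nat) = \<zero>" using aP unfolding P_def by blast
      then have "(s \<otimes> a \<otimes> u) [^] Suc l = \<zero>"
        using nilpotent_swap[of "s \<otimes> a" u l] s a uc by (simp add: m_assoc)
      then show ?thesis using s a uc by (metis m_assoc)
    qed
    then have "a \<otimes> u \<in> P" unfolding P_def using a uc nz u_def by simp
    then have e: "lann (a \<otimes> u) = lann a" using mx lann_mult[OF a(1) uc] by blast
    have "a \<otimes> r \<otimes> (a \<otimes> u) = a \<otimes> (r \<otimes> a) [^] n"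
      unfolding m u_def using a r nat_pow_Suc2[of "r \<otimes> a" m] by (simp add: m_assoc)
    then have "a \<otimes> r \<in> lann (a \<otimes> u)" unfolding lann_iff using n a r by simp
    then show ?thesis unfolding e lann_iff by simp
  qed
  then show False using prime_ringD[OF pr a(1) a(1)] a(2) by blast
qed

text \<open>The left annihilators of the powers of a non-nilpotent element of \<open>L\<close>
  become stationary, which yields \<open>c\<close>. The equality says that \<open>Rc\<close> meets
  the left annihilator of \<open>c\<close> only in zero, and this is what makes direct sums
  possible.\<close>

lemma exists_square_annihilator:
  assumes g: "left_goldie R" and pr: "prime_ring R" and L: "left_ideal L R" "L \<noteq> {\<zero>}"
  shows "\<exists>c\<in>L. c \<noteq> \<zero> \<and> lann (c \<otimes> c) = lann c"
proof -
  have L0: "\<zero> \<in> L" and Lc: "L \<subseteq> carrier R"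
    using L additive_subgroup.zero_closed additive_subgroup.a_subset unfolding left_ideal_def by blast+
  obtain a where a: "a \<in> L" "a \<noteq> \<zero>" using L L0 by blast
  obtain r where r: "r \<in> carrier R" "\<And>n::nat. (r \<otimes> a) [^] n \<noteq> \<zero>"
    using exists_nonnilpotent_multiple[OF g pr _ a(2)] a Lc by blast
  define b where "b = r \<otimes> a"
  have bc: "b \<in> carrier R" unfolding b_def using r a Lc by auto
  have bL: "b \<in> L" unfolding b_def using L(1) a r unfolding left_ideal_def by blast
  have "\<exists>N::nat. \<forall>n\<ge>N. lann (b [^] n) = lann (b [^] N)"
    using lann_stable[OF g, of "\<lambda>n. b [^] n"] bc lann_mult by auto
  then obtain N where N: "\<And>n::nat. n \<ge> N \<Longrightarrow> lann (b [^] n) = lann (b [^] N)" by blast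
  define c where "c = b [^] Suc N"
  have "c \<otimes> c = b [^] (Suc N + Suc N)" unfolding c_def by (rule nat_pow_mult[OF bc])
  then have "lann (c \<otimes> c) = lann c" using N[of "Suc N + Suc N"] N[of "Suc N"] unfolding c_def by simp
  moreover have "c \<in> L" unfolding c_def using L(1) bL bc unfolding left_ideal_def by simp
  moreover have "c \<noteq> \<zero>" unfolding c_def b_def using r(2) by blast
  ultimately show ?thesis by blast
qed

text \<open>Right multiplication by the \<open>f m\<close> of least index kills all other terms;
  then \<open>t m\<close> annihilates the square of \<open>f m\<close>, hence \<open>f m\<close>
  itself, and induction does the rest.\<close>

lemma triangular_sum_zero:
  fixes f t :: "nat \<Rightarrow> 'a"
  assumes "finite F" and f: "\<And>i. i \<in> F \<Longrightarrow> f i \<in> carrier R" "\<And>i. i \<in> F \<Longrightarrow> t i \<in> carrier R"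
    and sq: "\<And>i. i \<in> F \<Longrightarrow> lann (f i \<otimes> f i) = lann (f i)"
    and tri: "\<And>i j. \<lbrakk>i \<in> F; j \<in> F; i < j\<rbrakk> \<Longrightarrow> f j \<otimes> f i = \<zero>"
    and z: "finsum R (\<lambda>i. t i \<otimes> f i) F = \<zero>"
  shows "\<forall>i\<in>F. t i \<otimes> f i = \<zero>"
  using assms
proof (induction "card F" arbitrary: F)
  case 0
  then show ?case by simp
next
  case (Suc n)
  define m where "m = Min F"
  have F: "F \<noteq> {}" using Suc by auto
  have m: "m \<in> F" "\<And>i. i \<in> F \<Longrightarrow> m \<le> i" unfolding m_def using Suc(3) F by auto
  let ?G = "F - {m}"
  have mc: "f m \<in> carrier R" "t m \<in> carrier R" using m Suc by auto
  have Gc: "finsum R (\<lambda>i. t i \<otimes> f i) ?G \<in> carrier R" using Suc by (intro finsum_closed) auto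
  have s: "finsum R (\<lambda>i. t i \<otimes> f i) F = t m \<otimes> f m \<oplus> finsum R (\<lambda>i. t i \<otimes> f i) ?G"
  proof -
    have "finsum R (\<lambda>i. t i \<otimes> f i) (insert m ?G) = t m \<otimes> f m \<oplus> finsum R (\<lambda>i. t i \<otimes> f i) ?G"
      by (rule finsum_insert) (use Suc mc in auto)
    then show ?thesis using m(1) by (simp add: insert_absorb)
  qed
  have "finsum R (\<lambda>i. t i \<otimes> f i) ?G \<otimes> f m = finsum R (\<lambda>i. t i \<otimes> f i \<otimes> f m) ?G"
    using Suc mc by (intro finsum_ldistr) auto
  also have "\<dots> = finsum R (\<lambda>_. \<zero>) ?G"
  proof (rule finsum_cong')
    fix i assume i: "i \<in> ?G"
    then have "f i \<otimes> f m = \<zero>" using Suc.prems(5)[of m i] m by force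
    then show "t i \<otimes> f i \<otimes> f m = \<zero>" using i Suc mc by (simp add: m_assoc)
  qed auto
  finally have G0: "finsum R (\<lambda>i. t i \<otimes> f i) ?G \<otimes> f m = \<zero>" by simp
  have "\<zero> \<otimes> f m = (t m \<otimes> f m \<oplus> finsum R (\<lambda>i. t i \<otimes> f i) ?G) \<otimes> f m" using s Suc.prems(6) by simp
  then have "t m \<otimes> (f m \<otimes> f m) = \<zero>" using mc Gc G0 by (simp add: l_distr m_assoc)
  then have "t m \<in> lann (f m \<otimes> f m)" unfolding lann_iff using mc by simp
  then have "t m \<in> lann (f m)" using Suc.prems(4)[OF m(1)] by simp
  then have tm: "t m \<otimes> f m = \<zero>" unfolding lann_iff by blast
  then have "finsum R (\<lambda>i. t i \<otimes> f i) ?G = \<zero>" using s Suc.prems(6) Gc by simp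
  moreover have "n = card ?G" using Suc m(1) by simp
  ultimately have "\<forall>i\<in>?G. t i \<otimes> f i = \<zero>" using Suc.prems by (intro Suc.hyps(1)) auto
  then show ?case using tm by blast
qed

text \<open>Inside \<open>I\<close>, elements \<open>f n\<close> are chosen one after another in the
  left annihilator of the earlier ones, so that the \<open>R f n\<close> form a direct sum. Finite
  uniform dimension stops the choice, and at that stage the sum of the chosen elements is
  regular.\<close>

lemma ideal_contains_regular:
  assumes g: "left_goldie R" and pr: "prime_ring R" and I: "ideal I R" "I \<noteq> {\<zero>}"
  shows "\<exists>x\<in>I. \<forall>s\<in>carrier R. s \<otimes> x = \<zero> \<longrightarrow> s = \<zero>"
proof (rule ccontr)
  assume nreg: "\<not> ?thesis"
  interpret I: ideal I R by fact
  define Q where "Q f n r \<longleftrightarrow> r \<in> I \<and> r \<noteq> \<zero> \<and> lann (r \<otimes> r) = lann r \<and> (\<forall>i<n. r \<otimes> f i = \<zero>)"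
    for f :: "nat \<Rightarrow> 'a" and n :: nat and r
  obtain y0 where y0: "y0 \<in> I" "y0 \<noteq> \<zero>" using I(2) I.zero_closed by blast
  have "\<exists>f. \<forall>n. Q f n (f n)"
  proof (rule dependent_wf_choice[OF wf_less_than])
    show "Q f n r = Q h n r" if "\<And>z. (z, n) \<in> less_than \<Longrightarrow> f z = h z" for f h n r
      using that unfolding Q_def by auto
    fix n f assume "\<And>y. (y, n) \<in> less_than \<Longrightarrow> Q f y (f y)"
    then have f: "\<And>i. i < n \<Longrightarrow> f i \<in> I" "\<And>i. i < n \<Longrightarrow> lann (f i \<otimes> f i) = lann (f i)"
      "\<And>i j. \<lbrakk>j < n; i < j\<rbrakk> \<Longrightarrow> f j \<otimes> f i = \<zero>" unfolding Q_def by auto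
    have fc: "\<And>i. i < n \<Longrightarrow> f i \<in> carrier R" using f(1) I.a_Hcarr by blast
    define L where "L = {y \<in> I. \<forall>i<n. y \<otimes> f i = \<zero>}"
    have L: "left_ideal L R"
      unfolding left_ideal_def
    proof (intro conjI ballI)
      have "subgroup L (add_monoid R)"
      proof (rule add.subgroupI)
        show "L \<noteq> {}" unfolding L_def using I.zero_closed fc by (auto intro!: exI[of _ \<zero>])
        fix x y assume x: "x \<in> L"
        then show "\<ominus> x \<in> L" unfolding L_def using fc I.a_inv_closed I.a_Hcarr by (auto simp: l_minus)
        assume "y \<in> L"
        then show "x \<oplus> y \<in> L" using x unfolding L_def using fc I.a_closed I.a_Hcarr by (auto simp: l_distr)
      qed (use I.a_Hcarr in \<open>auto simp: L_def\<close>)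
      then show "additive_subgroup L R" by (rule additive_subgroupI)
      fix a x assume "a \<in> carrier R" "x \<in> L"
      then show "a \<otimes> x \<in> L" unfolding L_def using fc I.I_l_closed I.a_Hcarr by (auto simp: m_assoc)
    qed
    have "L \<noteq> {\<zero>}"
    proof
      assume L0: "L = {\<zero>}"
      \<comment> \<open>If \<open>s\<close> kills this sum, it kills every \<open>f i\<close>; then
        \<open>y0 \<otimes> r \<otimes> s\<close> lies in \<open>L\<close> for every
        \<open>r\<close>, and primeness gives \<open>s = \<zero>\<close>.\<close>
      define x where "x = finsum R f {..<n}"
      have "x \<in> I" unfolding x_def by (rule finsum_mem[OF I.additive_subgroup_axioms]) (use f in auto)
      moreover have "s = \<zero>" if s: "s \<in> carrier R" "s \<otimes> x = \<zero>" for s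
      proof -
        have "finsum R (\<lambda>i. s \<otimes> f i) {..<n} = \<zero>"
          using finsum_rdistr[of "{..<n}" s f] s fc unfolding x_def by auto
        then have "\<forall>i\<in>{..<n}. s \<otimes> f i = \<zero>"
          by (intro triangular_sum_zero[of _ f "\<lambda>_. s"]) (use s f fc in auto)
        then have "y0 \<otimes> r \<otimes> s \<in> L" if "r \<in> carrier R" for r
          unfolding L_def using that y0 s fc I.I_r_closed I.a_Hcarr by (auto simp: m_assoc)
        then show ?thesis using prime_ringD[OF pr _ s(1)] y0 I.a_Hcarr unfolding L0 by blast
      qed
      ultimately show False using nreg by blast
    qed
    then obtain c where "c \<in> L" "c \<noteq> \<zero>" "lann (c \<otimes> c) = lann c"
      using exists_square_annihilator[OF g pr L] by blast
    then show "\<exists>r. Q f n r" unfolding Q_def L_def by blast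
  qed
  then obtain f where "\<And>n. Q f n (f n)" by blast
  then have f: "\<And>i. f i \<in> I" "\<And>i. f i \<noteq> \<zero>" "\<And>i. lann (f i \<otimes> f i) = lann (f i)"
    "\<And>i j. i < j \<Longrightarrow> f j \<otimes> f i = \<zero>" unfolding Q_def by auto
  have fc: "\<And>i. f i \<in> carrier R" using f(1) I.a_Hcarr by blast
  define L where "L n = (\<lambda>r. r \<otimes> f n) ` carrier R" for n
  have "left_ideal (L n) R" for n
    unfolding left_ideal_def
  proof (intro conjI ballI)
    have "subgroup (L n) (add_monoid R)"
    proof (rule add.subgroupI)
      fix x y assume x: "x \<in> L n"
      then obtain r where r: "r \<in> carrier R" "x = r \<otimes> f n" unfolding L_def by blast
      then show "\<ominus> x \<in> L n" unfolding L_def using fc by (intro image_eqI[of _ _ "\<ominus> r"]) (auto simp: l_minus)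
      assume "y \<in> L n"
      then obtain s where "s \<in> carrier R" "y = s \<otimes> f n" unfolding L_def by blast
      then show "x \<oplus> y \<in> L n" unfolding L_def using fc r by (intro image_eqI[of _ _ "r \<oplus> s"]) (auto simp: l_distr)
    qed (use fc in \<open>auto simp: L_def\<close>)
    then show "additive_subgroup (L n) R" by (rule additive_subgroupI)
    fix a x assume a: "a \<in> carrier R" and "x \<in> L n"
    then obtain r where "r \<in> carrier R" "x = r \<otimes> f n" unfolding L_def by blast
    then show "a \<otimes> x \<in> L n" unfolding L_def using fc a by (intro image_eqI[of _ _ "a \<otimes> r"]) (auto simp: m_assoc)
  qed
  moreover have "L n \<noteq> {\<zero>}" for n
  proof -
    have "f n \<in> L n" unfolding L_def using fc by (intro image_eqI[of _ _ \<one>]) auto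
    then show ?thesis using f(2) by blast
  qed
  moreover have "independent_sequence L R"
    unfolding independent_sequence_def
  proof (intro allI impI)
    fix F :: "nat set" and x assume h: "finite F \<and> (\<forall>i\<in>F. x i \<in> L i) \<and> finsum R x F = \<zero>"
    then have "\<forall>i\<in>F. \<exists>r. r \<in> carrier R \<and> x i = r \<otimes> f i" unfolding L_def by blast
    from bchoice[OF this] obtain t where t: "\<forall>i\<in>F. t i \<in> carrier R \<and> x i = t i \<otimes> f i" by blast
    have "finsum R (\<lambda>i. t i \<otimes> f i) F = finsum R x F"
      using t fc by (intro finsum_cong') auto
    then have "\<forall>i\<in>F. t i \<otimes> f i = \<zero>"
      using h t fc f(3,4) by (intro triangular_sum_zero) auto
    then show "\<forall>i\<in>F. x i = \<zero>" using t by simp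
  qed
  ultimately show False using g unfolding left_goldie_def by blast
qed

end

text \<open>The constants of the statement fix the types of both records.\<close>

locale plain_kalg = kalg k A for k :: "'a ring" and A :: "('a, 'c) module" (structure)

lemma (in plain_kalg) affine_spanned:
  assumes S: "S \<subseteq> carrier A" "\<forall>B. subalgebra_of k B A \<and> S \<subseteq> B \<longrightarrow> B = carrier A"
    and x: "x \<in> carrier A"
  shows "x \<in> lspan (word_val A ` lists S)"
proof -
  let ?B = "lspan (word_val A ` lists S)"
  have wc: "word_val A w \<in> carrier A" if "w \<in> lists S" for w
    by (rule A.word_val_closed) (use that S in auto)
  have "subring ?B A"
  proof (rule A.subringI)
    show "?B \<subseteq> carrier A" using lspan_carrier by blast
    have "word_val A [] \<in> word_val A ` lists S" by (rule imageI) simp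
    then have "word_val A [] \<in> ?B" by (rule lspan_base) simp
    then show "\<one> \<in> ?B" by simp
    fix a b assume a: "a \<in> ?B"
    show "\<ominus> a \<in> ?B" by (rule subsp_uminus[OF subsp_lspan a])
    assume b: "b \<in> ?B"
    show "a \<oplus> b \<in> ?B" by (rule lspan_add[OF a b])
    show "a \<otimes> b \<in> ?B"
    proof (rule lspan_mult[OF a b])
      fix p q assume "p \<in> word_val A ` lists S" "q \<in> word_val A ` lists S"
      then obtain u w where u: "u \<in> lists S" "w \<in> lists S" "p = word_val A u" "q = word_val A w" by blast
      then have "p \<otimes> q = word_val A (u @ w)" using S(1) by (subst A.word_val_append) auto
      moreover have uw: "u @ w \<in> lists S" using u by simp
      have "word_val A (u @ w) \<in> ?B" using uw wc[OF uw] by (intro lspan_base imageI)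
      ultimately show "p \<otimes> q \<in> ?B" by simp
    qed (use wc in auto)
  qed
  then have "subalgebra_of k ?B A" unfolding subalgebra_of_def using lspan_smult by blast
  moreover have "S \<subseteq> ?B"
  proof
    fix s assume s: "s \<in> S"
    have "word_val A [s] \<in> word_val A ` lists S" by (rule imageI) (use s in simp)
    then have "word_val A [s] \<in> ?B" by (rule lspan_base) (use s S(1) in auto)
    then show "s \<in> ?B" using s S(1) by auto
  qed
  ultimately show ?thesis using S(2) x by blast
qed

theorem quotient_identity:
  fixes k :: "'a ring" and A :: "('a, 'c) module"
  assumes "kalg k A" and ac: "algebraically_closed k" and aff: "affine_algebra k A"
    and pr: "prime_ring A" and g: "left_goldie A" and gk: "GKdim k A < 3"
    and I: "ideal I A" "I \<noteq> {\<zero>\<^bsub>A\<^esub>}"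
  shows "\<exists>D E. \<forall>a b c. (\<forall>i. a i \<in> carrier A) \<longrightarrow> (\<forall>i. b i \<in> carrier A) \<longrightarrow> (\<forall>i. c i \<in> carrier A) \<longrightarrow>
     ring.stdp A D a \<otimes>\<^bsub>A\<^esub> (ring.stdp A D b \<otimes>\<^bsub>A\<^esub> ring.rstdp A E c) \<in> I"
proof -
  interpret plain_kalg k A by (rule plain_kalg.intro) fact
  obtain S where S: "finite S" "S \<subseteq> carrier A" "\<forall>B. subalgebra_of k B A \<and> S \<subseteq> B \<longrightarrow> B = carrier A"
    using aff unfolding affine_algebra_def by blast
  obtain h where h: "bij_betw h {0..<card S} S" using ex_bij_betw_nat_finite[OF S(1)] by blast
  \<comment> \<open>The generators become the letters below \<open>card S\<close>. Other indices get
    the value zero, which is harmless because words use these letters only.\<close>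
  define g where "g i = (if i < card S then h i else \<zero>\<^bsub>A\<^esub>)" for i
  have gS: "g ` {..<card S} = S"
    using bij_betw_imp_surj_on[OF h] unfolding g_def by (auto simp: lessThan_atLeast0)
  have "g i \<in> carrier A" for i using gS S(2) by (cases "i < card S") (auto simp: g_def)
  then interpret word_algebra k A g "card S" by unfold_locales
  have "lists (g ` {..<card S}) = map g ` lists {..<card S}" by (rule lists_image)
  then have "lists S = map g ` lists {..<card S}" unfolding gS .
  then have "word_val A ` lists S = wval ` {w. set w \<subseteq> {..<card S}}"
    unfolding wval_def image_image lists_eq_set[symmetric] by (simp add: image_image)
  then have gen: "x \<in> lspan (wval ` {w. set w \<subseteq> {..<card S}})" if "x \<in> carrier A" for x
    using affine_spanned[OF S(2,3) that] by simp
  obtain x where "x \<in> I" "\<And>s. \<lbrakk>s \<in> carrier A; s \<otimes>\<^bsub>A\<^esub> x = \<zero>\<^bsub>A\<^esub>\<rbrakk> \<Longrightarrow> s = \<zero>\<^bsub>A\<^esub>"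
    using A.ideal_contains_regular[OF \<open>left_goldie A\<close> pr I] by blast
  from few_normal_words[OF I(1) this gen gk] obtain d where
    "card {w. normal I w \<and> length w = d} \<le> d" by blast
  from few_normal_words_periodic_span[OF ac I(1) gen this] obtain T where "periodic_span k A I T" by blast
  then show ?thesis by (rule periodic_span.stdp_product_mem)
qed

section \<open>Polynomial identities\<close>

context ring
begin

definition signed :: "bool \<Rightarrow> 'a \<Rightarrow> 'a" where
  "signed s x = (if s then x else \<ominus> x)"

lemma signed_closed: "x \<in> carrier R \<Longrightarrow> signed s x \<in> carrier R"
  unfolding signed_def by simp

lemma signed_mult: "\<lbrakk>x \<in> carrier R; y \<in> carrier R\<rbrakk> \<Longrightarrow> signed s x \<otimes> signed t y = signed (s = t) (x \<otimes> y)"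
  unfolding signed_def by (auto simp: l_minus r_minus)

lemma finsum_Times:
  assumes "finite P" "finite Q" "\<And>p q. \<lbrakk>p \<in> P; q \<in> Q\<rbrakk> \<Longrightarrow> f p q \<in> carrier R"
  shows "finsum R (\<lambda>(p, q). f p q) (P \<times> Q) = finsum R (\<lambda>p. finsum R (f p) Q) P"
  using assms(1,3)
proof (induction P)
  case (insert p P)
  have c1: "(\<lambda>(p, q). f p q) \<in> {p} \<times> Q \<rightarrow> carrier R" "(\<lambda>(p, q). f p q) \<in> P \<times> Q \<rightarrow> carrier R"
    using insert by auto
  have "finsum R (\<lambda>(p, q). f p q) ({p} \<times> Q) = finsum R (\<lambda>(p, q). f p q) (Pair p ` Q)"
    by (rule arg_cong[of _ _ "finsum R _"]) auto
  also have "\<dots> = finsum R (f p) Q"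
    by (subst finsum_reindex) (use insert in \<open>auto simp: inj_on_def\<close>)
  finally have e: "finsum R (\<lambda>(p, q). f p q) ({p} \<times> Q) = finsum R (f p) Q" .
  have "insert p P \<times> Q = {p} \<times> Q \<union> P \<times> Q" by auto
  then have "finsum R (\<lambda>(p, q). f p q) (insert p P \<times> Q) =
      finsum R (\<lambda>(p, q). f p q) ({p} \<times> Q) \<oplus> finsum R (\<lambda>(p, q). f p q) (P \<times> Q)"
    using insert c1 assms(2) by (simp, subst finsum_Un_disjoint) auto
  also have "\<dots> = finsum R (f p) Q \<oplus> finsum R (\<lambda>p. finsum R (f p) Q) P"
    unfolding e using insert by simp
  also have "\<dots> = finsum R (\<lambda>p. finsum R (f p) Q) (insert p P)"
    by (rule finsum_insert[symmetric]) (use insert in \<open>auto intro!: finsum_closed\<close>)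
  finally show ?case .
qed simp

lemma finsum_mult:
  assumes "finite P" "finite Q" "\<And>p. p \<in> P \<Longrightarrow> f p \<in> carrier R" "\<And>q. q \<in> Q \<Longrightarrow> h q \<in> carrier R"
  shows "finsum R f P \<otimes> finsum R h Q = finsum R (\<lambda>(p, q). f p \<otimes> h q) (P \<times> Q)"
proof -
  have hc: "finsum R h Q \<in> carrier R" using assms by (intro finsum_closed) auto
  have "finsum R f P \<otimes> finsum R h Q = finsum R (\<lambda>p. f p \<otimes> finsum R h Q) P"
    by (rule finsum_ldistr) (use assms hc in auto)
  also have "\<dots> = finsum R (\<lambda>p. finsum R (\<lambda>q. f p \<otimes> h q) Q) P"
    by (rule finsum_cong') (use assms in \<open>auto simp: finsum_rdistr intro!: finsum_closed\<close>)
  also have "\<dots> = finsum R (\<lambda>(p, q). f p \<otimes> h q) (P \<times> Q)"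
    by (rule finsum_Times[symmetric]) (use assms in auto)
  finally show ?thesis .
qed

lemma alt_signed:
  assumes F: "\<And>p. p permutes {..<D} \<Longrightarrow> F p \<in> carrier R"
  shows "alt D F = finsum R (\<lambda>p. signed (evenperm p) (F p)) {p. p permutes {..<D}}"
proof -
  let ?E = "{p. p permutes {..<D} \<and> evenperm p}" and ?O = "{p. p permutes {..<D} \<and> \<not> evenperm p}"
  let ?s = "\<lambda>p. signed (evenperm p) (F p)"
  have "finsum R ?s (?E \<union> ?O) = finsum R ?s ?E \<oplus> finsum R ?s ?O"
    by (rule finsum_Un_disjoint) (use F in \<open>auto simp: signed_closed\<close>)
  moreover have "finsum R ?s ?E = finsum R F ?E"
    using F by (intro finsum_cong') (auto simp: signed_def)
  moreover have "finsum R ?s ?O = \<ominus> finsum R F ?O"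
  proof -
    have "finsum R ?s ?O = finsum R (\<lambda>p. \<ominus> F p) ?O"
      using F by (intro finsum_cong') (auto simp: signed_def)
    also have "\<dots> = \<ominus> finsum R F ?O"
      by (rule additive_finsum[symmetric]) (use F in \<open>auto simp: minus_add\<close>)
    finally show ?thesis .
  qed
  moreover have "?E \<union> ?O = {p. p permutes {..<D}}" by auto
  ultimately show ?thesis unfolding alt_def a_minus_def by simp
qed

text \<open>The polynomial is the product of three standard polynomials in disjoint sets of variables: a
  monomial of the product determines the three permutations it comes from.\<close>

definition triple_word :: "nat \<Rightarrow> nat \<Rightarrow> (nat \<Rightarrow> nat) \<times> (nat \<Rightarrow> nat) \<times> (nat \<Rightarrow> nat) \<Rightarrow> nat list" where
  "triple_word D E = (\<lambda>(p, q, r). map p [0..<D] @ map (\<lambda>i. D + q i) [0..<D] @ map (\<lambda>i. 2 * D + r i) (rev [0..<E]))"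

lemma permutes_eq_on:
  assumes "p permutes {..<n}" "q permutes {..<n}" "map p [0..<n] = map q [0..<n]"
  shows "p = q"
proof
  fix i show "p i = q i"
    using assms(3) permutes_not_in[OF assms(1), of i] permutes_not_in[OF assms(2), of i]
    by (cases "i < n") (auto simp: map_eq_conv)
qed

lemma inj_on_triple_word:
  "inj_on (triple_word D E) ({p. p permutes {..<D}} \<times> {q. q permutes {..<D}} \<times> {r. r permutes {..<E}})"
proof (rule inj_onI)
  fix s t assume s: "s \<in> {p. p permutes {..<D}} \<times> {q. q permutes {..<D}} \<times> {r. r permutes {..<E}}"
    and t: "t \<in> {p. p permutes {..<D}} \<times> {q. q permutes {..<D}} \<times> {r. r permutes {..<E}}"
    and e: "triple_word D E s = triple_word D E t"
  obtain p q r where s': "s = (p, q, r)" by (cases s)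
  obtain p' q' r' where t': "t = (p', q', r')" by (cases t)
  have "map p [0..<D] = map p' [0..<D]" "map q [0..<D] = map q' [0..<D]" "map r [0..<E] = map r' [0..<E]"
    using e unfolding s' t' triple_word_def by (auto simp: map_eq_conv)
  then show "s = t" using s t permutes_eq_on unfolding s' t' by auto
qed

text \<open>All nonzero coefficients are one or minus one, so the scalar action enters only through
  these two values of \<open>sm\<close>. The lemma thus applies to quotient records that have not
  been shown to be modules.\<close>

lemma stdp_identity_PI:
  fixes k :: "'k ring" and sm :: "'k \<Rightarrow> 'a \<Rightarrow> 'a"
  assumes k: "field k"
    and sm: "\<And>x. x \<in> carrier R \<Longrightarrow> sm \<one>\<^bsub>k\<^esub> x = x" "\<And>x. x \<in> carrier R \<Longrightarrow> sm (\<ominus>\<^bsub>k\<^esub> \<one>\<^bsub>k\<^esub>) x = \<ominus> x"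
    and id: "\<And>a b c. \<lbrakk>\<And>i. a i \<in> carrier R; \<And>i. b i \<in> carrier R; \<And>i. c i \<in> carrier R\<rbrakk> \<Longrightarrow>
      stdp D a \<otimes> (stdp D b \<otimes> rstdp E c) = \<zero>"
  shows "\<exists>f\<in>nc_polys k. (\<exists>w. f w \<noteq> \<zero>\<^bsub>k\<^esub>) \<and>
    (\<forall>x. range x \<subseteq> carrier R \<longrightarrow>
      finsum R (\<lambda>w. sm (f w) (word_val R (map x w))) {w. f w \<noteq> \<zero>\<^bsub>k\<^esub>} = \<zero>)"
proof -
  interpret k: field k by fact
  let ?S = "\<lambda>n. {p. p permutes {..<n::nat}}"
  define P where "P = ?S D \<times> ?S D \<times> ?S E"
  \<comment> \<open>The nested equivalence of truth values is the product of the three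
    signs.\<close>
  define sg where "sg = (\<lambda>(p :: nat \<Rightarrow> nat, q :: nat \<Rightarrow> nat, r :: nat \<Rightarrow> nat). evenperm p = (evenperm q = evenperm r))"
  define W where "W = triple_word D E"
  have inj: "inj_on W P" unfolding W_def P_def by (rule inj_on_triple_word)
  have finP: "finite P" unfolding P_def by (simp add: finite_permutations)
  define f where "f w = (if w \<in> W ` P then (if sg (inv_into P W w) then \<one>\<^bsub>k\<^esub> else \<ominus>\<^bsub>k\<^esub> \<one>\<^bsub>k\<^esub>) else \<zero>\<^bsub>k\<^esub>)" for w
  have one: "\<ominus>\<^bsub>k\<^esub> \<one>\<^bsub>k\<^esub> \<noteq> \<zero>\<^bsub>k\<^esub>" using k.one_not_zero k.minus_minus[of "\<one>\<^bsub>k\<^esub>"] by (metis k.minus_zero k.one_closed)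
  have supp: "{w. f w \<noteq> \<zero>\<^bsub>k\<^esub>} = W ` P" unfolding f_def using one by auto
  have fW: "f (W t) = (if sg t then \<one>\<^bsub>k\<^esub> else \<ominus>\<^bsub>k\<^esub> \<one>\<^bsub>k\<^esub>)" if "t \<in> P" for t
    unfolding f_def using that inv_into_f_f[OF inj that] by auto
  have "f \<in> nc_polys k" unfolding nc_polys_def using supp finP by (auto simp: f_def)
  moreover have "\<exists>w. f w \<noteq> \<zero>\<^bsub>k\<^esub>"
  proof -
    have "(id, id, id) \<in> P" unfolding P_def by (auto simp: permutes_id)
    then show ?thesis using supp by blast
  qed
  moreover have "finsum R (\<lambda>w. sm (f w) (word_val R (map x w))) {w. f w \<noteq> \<zero>\<^bsub>k\<^esub>} = \<zero>"
    if x: "range x \<subseteq> carrier R" for x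
  proof -
    have xc: "x i \<in> carrier R" for i using x by blast
    define a b c where "a = x" and "b i = x (D + i)" and "c i = x (2 * D + i)" for i
    define A where "A p = word_val R (map (a \<circ> p) [0..<D])" for p
    define B where "B p = word_val R (map (b \<circ> p) [0..<D])" for p
    define C where "C p = word_val R (map (c \<circ> p) (rev [0..<E]))" for p
    have cl: "A p \<in> carrier R" "B p \<in> carrier R" "C p \<in> carrier R" for p
      unfolding A_def B_def C_def a_def b_def c_def using xc by (auto intro!: word_val_closed)
    have wv: "word_val R (map x (W (p, q, r))) = A p \<otimes> (B q \<otimes> C r)" for p q r
    proof -
      have "map x (W (p, q, r)) = map (a \<circ> p) [0..<D] @ map (b \<circ> q) [0..<D] @ map (c \<circ> r) (rev [0..<E])"
        unfolding W_def triple_word_def a_def b_def c_def by simp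
      then show ?thesis unfolding A_def B_def C_def using xc
        by (simp add: word_val_append image_subset_iff a_def b_def c_def)
    qed
    have wc: "word_val R (map x w) \<in> carrier R" for w using xc by (intro word_val_closed) auto
    have "finsum R (\<lambda>w. sm (f w) (word_val R (map x w))) (W ` P) = finsum R (\<lambda>t. sm (f (W t)) (word_val R (map x (W t)))) P"
      by (rule finsum_reindex[OF _ inj]) (use fW sm wc in auto)
    also have "\<dots> = finsum R (\<lambda>t. signed (sg t) (word_val R (map x (W t)))) P"
      by (rule finsum_cong') (use fW sm wc in \<open>auto simp: signed_def\<close>)
    also have "\<dots> = finsum R (\<lambda>(p, q, r). signed (evenperm p) (A p) \<otimes> (signed (evenperm q) (B q) \<otimes> signed (evenperm r) (C r))) P"
      by (rule finsum_cong') (use cl in \<open>auto simp: sg_def wv signed_mult signed_closed\<close>)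
    also have "\<dots> = stdp D a \<otimes> (stdp D b \<otimes> rstdp E c)"
    proof -
      have "stdp D b \<otimes> rstdp E c =
          finsum R (\<lambda>(q, r). signed (evenperm q) (B q) \<otimes> signed (evenperm r) (C r)) (?S D \<times> ?S E)"
        unfolding stdp_def rstdp_def B_def[symmetric] C_def[symmetric] using cl
        by (subst (1 2) alt_signed) (auto intro!: finsum_mult simp: finite_permutations signed_closed)
      moreover have "stdp D a = finsum R (\<lambda>p. signed (evenperm p) (A p)) (?S D)"
        unfolding stdp_def A_def[symmetric] using cl by (subst alt_signed) auto
      ultimately have "stdp D a \<otimes> (stdp D b \<otimes> rstdp E c) =
        finsum R (\<lambda>(p, t). signed (evenperm p) (A p) \<otimes>
          (case t of (q, r) \<Rightarrow> signed (evenperm q) (B q) \<otimes> signed (evenperm r) (C r))) (?S D \<times> (?S D \<times> ?S E))"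
        using cl by (simp, intro finsum_mult) (auto simp: finite_permutations signed_closed)
      then show ?thesis unfolding P_def by (simp add: case_prod_unfold)
    qed
    also have "\<dots> = \<zero>" using xc by (intro id) (auto simp: a_def b_def c_def)
    finally show ?thesis unfolding supp .
  qed
  ultimately show ?thesis by blast
qed

end

section \<open>The extended centroid\<close>

lemma uncountable_UN:
  fixes V :: "nat \<Rightarrow> 'b set"
  assumes "uncountable S" "S \<subseteq> (\<Union>n. V n)" shows "\<exists>n. uncountable (V n)"
proof (rule ccontr)
  assume "\<not> ?thesis"
  then have "countable (\<Union>n. V n)" by (intro countable_UN) auto
  then show False using assms countable_subset by blast
qed

context kalg
begin

text \<open>If \<open>a s b = b s a\<close> for all \<open>s\<close>, then \<open>b = \<lambda>a\<close> for some \<open>\<lambda>\<close> in the extended centroid, and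
  \<open>twisted a b u u'\<close> says that \<open>u' = \<lambda>u\<close>.\<close>

definition twisted :: "'c \<Rightarrow> 'c \<Rightarrow> 'c \<Rightarrow> 'c \<Rightarrow> bool" where
  "twisted a b u u' \<longleftrightarrow> (\<forall>r\<in>carrier A. a \<otimes> r \<otimes> u' = b \<otimes> r \<otimes> u)"

context
  fixes a b
  assumes ac: "algebraically_closed k" and pr: "prime_ring A"
    and ab: "a \<in> carrier A" "b \<in> carrier A" and a0: "a \<noteq> \<zero>"
    and comm: "\<And>s. s \<in> carrier A \<Longrightarrow> a \<otimes> s \<otimes> b = b \<otimes> s \<otimes> a"
    and nprop: "\<And>q. q \<in> carrier k \<Longrightarrow> b \<noteq> q \<odot> a"
begin

lemma twisted_add:
  assumes "twisted a b u u'" "twisted a b v v'" "u \<in> carrier A" "u' \<in> carrier A" "v \<in> carrier A" "v' \<in> carrier A"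
  shows "twisted a b (u \<oplus> v) (u' \<oplus> v')"
  using assms ab unfolding twisted_def by (simp add: A.r_distr)

lemma twisted_smult:
  assumes "twisted a b u u'" "c \<in> carrier k" "u \<in> carrier A" "u' \<in> carrier A"
  shows "twisted a b (c \<odot> u) (c \<odot> u')"
  using assms ab unfolding twisted_def by (simp add: smult_mult_right)

lemma twisted_zero: "twisted a b \<zero> \<zero>"
  using ab unfolding twisted_def by simp

text \<open>Primeness makes multiplication by \<open>\<lambda>\<close> single-valued, since
  \<open>a\<close> is nonzero and \<open>aR\<close> kills the difference.\<close>

lemma twisted_unique:
  assumes "twisted a b u v" "twisted a b u w" "v \<in> carrier A" "w \<in> carrier A"
  shows "v = w"
proof -
  have "a \<otimes> r \<otimes> (v \<ominus> w) = \<zero>" if "r \<in> carrier A" for r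
  proof -
    have "a \<otimes> r \<otimes> v = a \<otimes> r \<otimes> w" using assms that unfolding twisted_def by simp
    then show ?thesis using assms(3,4) that ab by (simp add: a_minus_def A.r_distr A.r_minus M.r_neg)
  qed
  then have "v \<ominus> w = \<zero>" using A.prime_ringD[OF pr ab(1), of "v \<ominus> w"] assms(3,4) a0 by simp
  then show ?thesis using assms(3,4) by simp
qed

text \<open>An eigenvector \<open>u\<close> for \<open>q\<close> satisfies
  \<open>(b - qa) r u = 0\<close> for all \<open>r\<close>; as \<open>b\<close> is no multiple of
  \<open>a\<close>, primeness leaves only \<open>u = \<zero>\<close>.\<close>

lemma twisted_no_eigenvector:
  assumes "twisted a b u (q \<odot> u)" "q \<in> carrier k" "u \<in> carrier A"
  shows "u = \<zero>"
proof -
  have "(b \<ominus> q \<odot> a) \<otimes> r \<otimes> u = \<zero>" if "r \<in> carrier A" for r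
  proof -
    have "a \<otimes> r \<otimes> (q \<odot> u) = b \<otimes> r \<otimes> u" using assms that unfolding twisted_def by simp
    then have "(q \<odot> a) \<otimes> r \<otimes> u = b \<otimes> r \<otimes> u"
      using assms ab that by (simp add: smult_mult_right smult_mult_left)
    then show ?thesis using assms ab that by (simp add: a_minus_def A.l_distr A.l_minus M.r_neg)
  qed
  then have "b \<ominus> q \<odot> a = \<zero> \<or> u = \<zero>" using assms ab by (intro A.prime_ringD[OF pr]) auto
  moreover have "b \<ominus> q \<odot> a \<noteq> \<zero>" using nprop[OF assms(2)] ab assms(2) by simp
  ultimately show ?thesis by blast
qed

text \<open>\<open>y i\<close> stands for \<open>\<lambda>^i\<close> applied to \<open>y 0\<close>,
  and \<open>y m \<oplus> z\<close> for a monic polynomial in \<open>\<lambda>\<close>. It splits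
  into factors \<open>\<lambda> - q\<close>, each of which keeps nonzero elements nonzero because
  there are no eigenvectors.\<close>

lemma twisted_orbit_independent:
  assumes "\<And>i. y i \<in> carrier A" "\<And>i. twisted a b (y i) (y (Suc i))" "y 0 \<noteq> \<zero>"
    and "z \<in> lspan (y ` {..<m})"
  shows "y m \<oplus> z \<noteq> \<zero>"
  using assms
proof (induction m arbitrary: y z)
  case 0
  then have "z = \<zero>" by (auto elim: lspan.cases)
  then show ?case using 0 by simp
next
  case (Suc m)
  obtain q z' where q: "q \<in> carrier k" and z': "z' \<in> lspan ((\<lambda>i. y (Suc i) \<ominus> q \<odot> y i) ` {..<m})"
    and e: "y (Suc m) \<oplus> z = (y (Suc m) \<ominus> q \<odot> y m) \<oplus> z'"
    using monic_root[OF ac Suc.prems(1,4)] by blast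
  have q': "\<ominus>\<^bsub>k\<^esub> q \<in> carrier k" using q by simp
  have eq: "y (Suc i) \<ominus> q \<odot> y i = y (Suc i) \<oplus> (\<ominus>\<^bsub>k\<^esub> q) \<odot> y i" for i
    using q Suc.prems(1) by (simp add: a_minus_def smult_l_minus)
  have "y (Suc m) \<ominus> q \<odot> y m \<oplus> z' \<noteq> \<zero>"
  proof (rule Suc.IH[of "\<lambda>i. y (Suc i) \<ominus> q \<odot> y i"])
    fix i
    show "y (Suc i) \<ominus> q \<odot> y i \<in> carrier A" using q Suc.prems(1) by simp
    show "twisted a b (y (Suc i) \<ominus> q \<odot> y i) (y (Suc (Suc i)) \<ominus> q \<odot> y (Suc i))"
      unfolding eq using Suc.prems(1,2) q' by (intro twisted_add twisted_smult) auto
  next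
    show "y (Suc 0) \<ominus> q \<odot> y 0 \<noteq> \<zero>"
    proof
      assume "y (Suc 0) \<ominus> q \<odot> y 0 = \<zero>"
      then have "y (Suc 0) = q \<odot> y 0" using q Suc.prems(1) by simp
      then have "twisted a b (y 0) (q \<odot> y 0)" using Suc.prems(2)[of 0] by simp
      then show False using twisted_no_eigenvector[OF _ q] Suc.prems(1,3) by blast
    qed
  qed (rule z')
  then show ?case unfolding e .
qed

text \<open>The elements \<open>z i = (\<lambda> - \<alpha> i)\<^sup>-\<^sup>1 y\<close> are linearly independent.\<close>

lemma twisted_resolvents_independent:
  assumes al: "\<And>i. \<alpha> i \<in> carrier k" "inj \<alpha>" and y: "y \<in> carrier A" "y \<noteq> \<zero>"
    and z: "\<And>i. z i \<in> carrier A" "\<And>i. twisted a b (z i) (\<alpha> i \<odot> z i \<oplus> y)"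
  shows "z m \<notin> lspan (z ` {..<m::nat})"
proof
  assume zm: "z m \<in> lspan (z ` {..<m})"
  define n where "n = (LEAST m. z m \<in> lspan (z ` {..<m}))"
  have n: "z n \<in> lspan (z ` {..<n})" unfolding n_def using zm by (rule LeastI)
  have least: "z j \<notin> lspan (z ` {..<j})" if "j < n" for j
    using not_less_Least that unfolding n_def by blast
  \<comment> \<open>\<open>\<lambda>\<close> sends \<open>z i\<close> to
    \<open>\<alpha> i \<odot> z i \<oplus> y\<close>, so it maps spans of the \<open>z i\<close>
    into themselves up to multiples of \<open>y\<close>.\<close>
  have K: "\<exists>w\<in>lspan (z ` {..<j}). \<exists>\<gamma>\<in>carrier k. twisted a b v (w \<oplus> \<gamma> \<odot> y)"
    if "v \<in> lspan (z ` {..<j})" for v j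
    using that
  proof (induction rule: lspan.induct)
    case zero
    then show ?case using twisted_zero lspan.zero y
      by (intro bexI[of _ \<zero>] bexI[of _ "\<zero>\<^bsub>k\<^esub>"]) (auto simp: smult_l_null)
  next
    case (step c s v)
    obtain w \<gamma> where w: "w \<in> lspan (z ` {..<j})" "\<gamma> \<in> carrier k" "twisted a b v (w \<oplus> \<gamma> \<odot> y)" using step by blast
    obtain i where i: "i < j" "s = z i" using step by blast
    have wc: "w \<in> carrier A" using w lspan_carrier by blast
    have vc: "v \<in> carrier A" using step lspan_carrier by blast
    have t: "twisted a b (c \<odot> s \<oplus> v) (c \<odot> (\<alpha> i \<odot> z i \<oplus> y) \<oplus> (w \<oplus> \<gamma> \<odot> y))"
      unfolding i(2) using z al w wc vc y step(1) by (intro twisted_add twisted_smult) auto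
    have "c \<odot> (\<alpha> i \<odot> z i \<oplus> y) \<oplus> (w \<oplus> \<gamma> \<odot> y) = ((c \<otimes>\<^bsub>k\<^esub> \<alpha> i) \<odot> z i \<oplus> w) \<oplus> (c \<oplus>\<^bsub>k\<^esub> \<gamma>) \<odot> y"
      using step(1) al(1)[of i] z(1)[of i] wc w(2) y
      by (simp add: smult_r_distr smult_l_distr smult_assoc1 M.a_ac)
    moreover have "(c \<otimes>\<^bsub>k\<^esub> \<alpha> i) \<odot> z i \<oplus> w \<in> lspan (z ` {..<j})"
      using step(1) al(1)[of i] z(1)[of i] w(1) i by (intro lspan.step) auto
    ultimately show ?case using t step(1) w(2) by auto
  qed
  show False
  proof (cases "y \<in> lspan (z ` {..<n})")
    \<comment> \<open>Now the span is stable under \<open>\<lambda>\<close>, so it contains the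
      orbit of \<open>y\<close>; being finite-dimensional, it contradicts the independence of
      orbits.\<close>
    case True
    have "\<exists>w. w \<in> lspan (z ` {..<n}) \<and> twisted a b v w" if v: "v \<in> lspan (z ` {..<n})" for v
    proof -
      obtain w \<gamma> where "w \<in> lspan (z ` {..<n})" "\<gamma> \<in> carrier k" "twisted a b v (w \<oplus> \<gamma> \<odot> y)" using K[OF v] by blast
      then show ?thesis using True lspan_add lspan_smult by blast
    qed
    then have "\<exists>x. \<forall>i::nat. (x i \<in> lspan (z ` {..<n}) \<and> (i = 0 \<longrightarrow> x i = y)) \<and> twisted a b (x i) (x (Suc i))"
      by (intro dependent_nat_choice) (use True in auto)
    then obtain x where x: "\<And>i::nat. x i \<in> lspan (z ` {..<n})" "x 0 = y" "\<And>i. twisted a b (x i) (x (Suc i))" by blast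
    have xc: "x i \<in> carrier A" for i using x(1) lspan_carrier by blast
    have "\<exists>j\<le>card (z ` {..<n}). x j \<in> lspan (x ` {..<j} \<union> {})"
      by (rule lspan_dependent[where S = "z ` {..<n}"]) (use x(1) z(1) in auto)
    then obtain j where "x j \<in> lspan (x ` {..<j})" by auto
    then have "\<ominus> x j \<in> lspan (x ` {..<j})" by (rule subsp_uminus[OF subsp_lspan])
    then have "x j \<oplus> \<ominus> x j \<noteq> \<zero>" using twisted_orbit_independent[of x] x xc y by blast
    then show False using xc by (simp add: M.r_neg)
  next
    case False
    have "z n \<noteq> \<zero>"
    proof
      assume "z n = \<zero>"
      then have "twisted a b \<zero> y" using z(2)[of n] al y by simp
      then show False using twisted_unique[OF _ twisted_zero] y by blast
    qed
    then obtain j \<beta> v where j: "j < n" and \<beta>: "\<beta> \<in> carrier k" "\<beta> \<noteq> \<zero>\<^bsub>k\<^esub>" and v: "v \<in> lspan (z ` {..<j})"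
      and e: "z n = \<beta> \<odot> z j \<oplus> v"
      using lspan_top[OF n z(1)] by blast
    obtain w \<gamma> where w: "w \<in> lspan (z ` {..<j})" "\<gamma> \<in> carrier k" "twisted a b v (w \<oplus> \<gamma> \<odot> y)" using K[OF v] by blast
    have c: "v \<in> carrier A" "w \<in> carrier A" "z j \<in> carrier A" "\<alpha> j \<in> carrier k" "\<alpha> n \<in> carrier k"
      using v w lspan_carrier z al by auto
    have "twisted a b (z n) (\<beta> \<odot> (\<alpha> j \<odot> z j \<oplus> y) \<oplus> (w \<oplus> \<gamma> \<odot> y))"
      unfolding e using z w c \<beta> y by (intro twisted_add twisted_smult) auto
    \<comment> \<open>\<open>\<lambda>\<close> applied to \<open>z n\<close>, computed from its own
      equation and through its leading term \<open>z j\<close>. Eliminating \<open>z n\<close> puts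
      \<open>\<delta> \<odot> z j \<ominus> \<epsilon> \<odot> y\<close> into the span of the
      \<open>z i\<close> with \<open>i < j\<close>, so either \<open>z j\<close> depends on its
      predecessors, against the minimality of \<open>n\<close>, or \<open>y\<close> lies in the
      span.\<close>
    then have eq: "\<alpha> n \<odot> z n \<oplus> y = \<beta> \<odot> (\<alpha> j \<odot> z j \<oplus> y) \<oplus> (w \<oplus> \<gamma> \<odot> y)"
      using twisted_unique[OF z(2)] z(1) c \<beta> y w(2) by simp
    define \<delta> where "\<delta> = \<beta> \<otimes>\<^bsub>k\<^esub> (\<alpha> n \<ominus>\<^bsub>k\<^esub> \<alpha> j)"
    define \<epsilon> where "\<epsilon> = \<beta> \<oplus>\<^bsub>k\<^esub> \<gamma> \<ominus>\<^bsub>k\<^esub> \<one>\<^bsub>k\<^esub>"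
    have de: "\<delta> \<in> carrier k" "\<epsilon> \<in> carrier k" unfolding \<delta>_def \<epsilon>_def using \<beta> w c by auto
    have "\<alpha> n \<noteq> \<alpha> j" using al(2) j by (metis injD less_irrefl)
    then have d0: "\<delta> \<noteq> \<zero>\<^bsub>k\<^esub>" unfolding \<delta>_def using \<beta> c R.r_right_minus_eq field.integral_iff[of \<beta> "\<alpha> n \<ominus>\<^bsub>k\<^esub> \<alpha> j"] by auto
    have main: "\<delta> \<odot> z j \<ominus> \<epsilon> \<odot> y = w \<ominus> \<alpha> n \<odot> v"
    proof -
      have 1: "\<delta> \<odot> z j = \<alpha> n \<odot> (\<beta> \<odot> z j) \<ominus> \<beta> \<odot> (\<alpha> j \<odot> z j)"
        unfolding \<delta>_def using \<beta> c
        by (simp add: a_minus_def R.r_distr R.r_minus smult_l_distr smult_l_minus smult_assoc1[symmetric] R.m_comm)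
      have 2: "\<epsilon> \<odot> y = \<beta> \<odot> y \<oplus> \<gamma> \<odot> y \<ominus> y"
        unfolding \<epsilon>_def using \<beta> w(2) y by (simp add: a_minus_def smult_l_distr smult_l_minus smult_one)
      have 3: "\<alpha> n \<odot> (\<beta> \<odot> z j) \<oplus> \<alpha> n \<odot> v \<oplus> y = \<beta> \<odot> (\<alpha> j \<odot> z j) \<oplus> \<beta> \<odot> y \<oplus> (w \<oplus> \<gamma> \<odot> y)"
        using eq unfolding e using c \<beta> y by (simp add: smult_r_distr)
      have gen: "P \<ominus> Q \<ominus> (B \<oplus> G \<ominus> Y) = W \<ominus> V"
        if h: "P \<oplus> V \<oplus> Y = Q \<oplus> B \<oplus> (W \<oplus> G)"
          and cl: "P \<in> carrier A" "Q \<in> carrier A" "B \<in> carrier A" "G \<in> carrier A" "Y \<in> carrier A" "W \<in> carrier A" "V \<in> carrier A"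
        for P Q B G Y W V
      proof -
        have "P \<ominus> Q \<ominus> (B \<oplus> G \<ominus> Y) = (P \<oplus> V \<oplus> Y) \<ominus> (Q \<oplus> B \<oplus> G \<oplus> V)"
          using cl by algebra
        also have "\<dots> = W \<ominus> V" unfolding h using cl by algebra
        finally show ?thesis .
      qed
      show ?thesis unfolding 1 2 by (rule gen[OF 3]) (use c \<beta> y w(2) in auto)
    qed
    have r: "w \<ominus> \<alpha> n \<odot> v \<in> lspan (z ` {..<j})"
      using subsp_minus[OF subsp_lspan w(1) lspan_smult[OF v c(5)]] .
    show False
    proof (cases "\<epsilon> = \<zero>\<^bsub>k\<^esub>")
      case True
      then have "\<delta> \<odot> z j \<in> lspan (z ` {..<j})" using main r de c y by (simp add: smult_l_null a_minus_def)
      then show False using subsp_smult_mem[OF subsp_lspan c(3) de(1) d0] least[OF j] by blast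
    next
      case ne: False
      have zj: "\<delta> \<odot> z j \<in> lspan (z ` {..<n})" using j c de by (intro lspan_smult lspan_base) auto
      have "\<delta> \<odot> z j \<ominus> \<epsilon> \<odot> y \<in> lspan (z ` {..<n})"
        unfolding main by (rule lspan_mono[OF r]) (use j in auto)
      then have "\<delta> \<odot> z j \<ominus> (\<delta> \<odot> z j \<ominus> \<epsilon> \<odot> y) \<in> lspan (z ` {..<n})" by (rule subsp_minus[OF subsp_lspan zj])
      moreover have "\<delta> \<odot> z j \<ominus> (\<delta> \<odot> z j \<ominus> \<epsilon> \<odot> y) = \<epsilon> \<odot> y"
      proof -
        have "p \<ominus> (p \<ominus> q) = q" if "p \<in> carrier A" "q \<in> carrier A" for p q using that by algebra
        then show ?thesis using de c y by simp
      qed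
      ultimately have "\<epsilon> \<odot> y \<in> lspan (z ` {..<n})" by simp
      then show False using subsp_smult_mem[OF subsp_lspan y(1) de(2) ne] False by blast
    qed
  qed
qed

text \<open>\<open>s (b - \<alpha>a) t\<close> is \<open>\<lambda> - \<alpha>\<close> applied to
  \<open>s a t\<close>, so a preimage of \<open>y\<close> is found term by term, replacing the
  middle factor by \<open>a\<close>.\<close>

lemma resolvent_exists:
  assumes \<alpha>: "\<alpha> \<in> carrier k"
    and y: "y \<in> lspan {s \<otimes> (b \<ominus> \<alpha> \<odot> a) \<otimes> t | s t. s \<in> carrier A \<and> t \<in> carrier A}"
  shows "\<exists>z\<in>carrier A. twisted a b z (\<alpha> \<odot> z \<oplus> y)"
  using y
proof (induction rule: lspan.induct)
  case zero
  then show ?case using twisted_zero \<alpha> by (intro bexI[of _ \<zero>]) (auto simp: smult_r_null)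
next
  case (step c x v)
  obtain z where z: "z \<in> carrier A" "twisted a b z (\<alpha> \<odot> z \<oplus> v)" using step by blast
  obtain s t where st: "s \<in> carrier A" "t \<in> carrier A" "x = s \<otimes> (b \<ominus> \<alpha> \<odot> a) \<otimes> t" using step by blast
  have vc: "v \<in> carrier A" using step lspan_carrier by blast
  let ?u = "s \<otimes> a \<otimes> t"
  have x: "\<alpha> \<odot> ?u \<oplus> x = s \<otimes> b \<otimes> t"
    unfolding st(3) using st ab \<alpha>
    by (simp add: a_minus_def A.r_distr A.l_distr A.r_minus A.l_minus smult_mult_left smult_mult_right
        M.a_lcomm M.r_neg)
  have "twisted a b ?u (\<alpha> \<odot> ?u \<oplus> x)"
    unfolding twisted_def x
  proof
    fix r assume r: "r \<in> carrier A"
    have "a \<otimes> r \<otimes> (s \<otimes> b \<otimes> t) = a \<otimes> (r \<otimes> s) \<otimes> b \<otimes> t" using r st ab by (simp add: A.m_assoc)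
    also have "\<dots> = b \<otimes> (r \<otimes> s) \<otimes> a \<otimes> t" using comm[of "r \<otimes> s"] r st by simp
    also have "\<dots> = b \<otimes> r \<otimes> ?u" using r st ab by (simp add: A.m_assoc)
    finally show "a \<otimes> r \<otimes> (s \<otimes> b \<otimes> t) = b \<otimes> r \<otimes> ?u" .
  qed
  then have "twisted a b (c \<odot> ?u \<oplus> z) (c \<odot> (\<alpha> \<odot> ?u \<oplus> x) \<oplus> (\<alpha> \<odot> z \<oplus> v))"
    using z st ab \<alpha> vc step by (intro twisted_add twisted_smult) auto
  moreover have "c \<odot> (\<alpha> \<odot> ?u \<oplus> x) \<oplus> (\<alpha> \<odot> z \<oplus> v) = \<alpha> \<odot> (c \<odot> ?u \<oplus> z) \<oplus> (c \<odot> x \<oplus> v)"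
  proof -
    have "c \<odot> (\<alpha> \<odot> ?u) = \<alpha> \<odot> (c \<odot> ?u)"
      using \<alpha> step(1) st ab by (simp add: smult_assoc1[symmetric] R.m_comm)
    then show ?thesis using z st ab \<alpha> vc step by (simp add: smult_r_distr M.a_ac)
  qed
  ultimately show ?case using z st ab step by (intro bexI[of _ "c \<odot> ?u \<oplus> z"]) auto
qed

end

theorem proportional:
  assumes ac: "algebraically_closed k" and pr: "prime_ring A" and unc: "uncountable (carrier k)"
    and C: "countable C" "C \<subseteq> carrier A" "\<And>x. x \<in> carrier A \<Longrightarrow> x \<in> lspan C"
    and ids: "\<And>I. \<lbrakk>ideal I A; I \<noteq> {\<zero>}\<rbrakk> \<Longrightarrow> \<exists>j::nat. F j \<in> I"
    and F: "\<And>j. F j \<in> carrier A" "\<And>j. F j \<noteq> \<zero>"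
    and ab: "a \<in> carrier A" "b \<in> carrier A" "a \<noteq> \<zero>"
    and comm: "\<And>s. s \<in> carrier A \<Longrightarrow> a \<otimes> s \<otimes> b = b \<otimes> s \<otimes> a"
  shows "\<exists>q\<in>carrier k. b = q \<odot> a"
proof (rule ccontr)
  assume "\<not> ?thesis"
  then have np: "\<And>q. q \<in> carrier k \<Longrightarrow> b \<noteq> q \<odot> a" by blast
  define I where "I \<alpha> = lspan {s \<otimes> (b \<ominus> \<alpha> \<odot> a) \<otimes> t | s t. s \<in> carrier A \<and> t \<in> carrier A}" for \<alpha>
  have dc: "b \<ominus> \<alpha> \<odot> a \<in> carrier A" if "\<alpha> \<in> carrier k" for \<alpha> using that ab by simp
  have Ii: "ideal (I \<alpha>) A" if \<alpha>: "\<alpha> \<in> carrier k" for \<alpha>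
  proof (rule A.idealI_elements)
    fix x r assume x: "x \<in> I \<alpha>" and r: "r \<in> carrier A"
    show "r \<otimes> x \<in> I \<alpha>"
    proof (rule lspan_image[OF linmap_mult_left[OF r] x[unfolded I_def]])
      fix y assume "y \<in> {s \<otimes> (b \<ominus> \<alpha> \<odot> a) \<otimes> t | s t. s \<in> carrier A \<and> t \<in> carrier A}"
      then obtain s t where st: "y = s \<otimes> (b \<ominus> \<alpha> \<odot> a) \<otimes> t" "s \<in> carrier A" "t \<in> carrier A" by blast
      have e: "r \<otimes> y = (r \<otimes> s) \<otimes> (b \<ominus> \<alpha> \<odot> a) \<otimes> t" unfolding st(1) using st r dc[OF \<alpha>] by (simp add: A.m_assoc)
      show "r \<otimes> y \<in> I \<alpha>" unfolding e I_def using st r dc[OF \<alpha>] by (intro lspan_base) blast+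
    qed (simp add: I_def subsp_lspan)
    show "x \<otimes> r \<in> I \<alpha>"
    proof (rule lspan_image[OF linmap_mult_right[OF r] x[unfolded I_def]])
      fix y assume "y \<in> {s \<otimes> (b \<ominus> \<alpha> \<odot> a) \<otimes> t | s t. s \<in> carrier A \<and> t \<in> carrier A}"
      then obtain s t where st: "y = s \<otimes> (b \<ominus> \<alpha> \<odot> a) \<otimes> t" "s \<in> carrier A" "t \<in> carrier A" by blast
      have e: "y \<otimes> r = s \<otimes> (b \<ominus> \<alpha> \<odot> a) \<otimes> (t \<otimes> r)" unfolding st(1) using st r dc[OF \<alpha>] by (simp add: A.m_assoc)
      show "y \<otimes> r \<in> I \<alpha>" unfolding e I_def using st r dc[OF \<alpha>] by (intro lspan_base) blast+
    qed (simp add: I_def subsp_lspan)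
  qed (use lspan_carrier lspan.zero lspan_add in \<open>auto simp: I_def\<close>)
  have I0: "I \<alpha> \<noteq> {\<zero>}" if \<alpha>: "\<alpha> \<in> carrier k" for \<alpha>
  proof -
    have "\<one> \<otimes> (b \<ominus> \<alpha> \<odot> a) \<otimes> \<one> \<in> I \<alpha>" unfolding I_def using dc[OF \<alpha>] by (intro lspan_base) blast+
    then have "b \<ominus> \<alpha> \<odot> a \<in> I \<alpha>" using dc[OF \<alpha>] by simp
    moreover have "b \<ominus> \<alpha> \<odot> a \<noteq> \<zero>" using np[OF \<alpha>] ab \<alpha> by simp
    ultimately show ?thesis by blast
  qed
  have "carrier k \<subseteq> (\<Union>j. {\<alpha> \<in> carrier k. F j \<in> I \<alpha>})" using ids[OF Ii I0] by blast
  from uncountable_UN[OF unc this] obtain j where unU: "uncountable {\<alpha> \<in> carrier k. F j \<in> I \<alpha>}" by (rule exE)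
  define U where "U = {\<alpha> \<in> carrier k. F j \<in> I \<alpha>}"
  have "\<forall>\<alpha>\<in>U. \<exists>z. z \<in> carrier A \<and> twisted a b z (\<alpha> \<odot> z \<oplus> F j)"
    using resolvent_exists[OF ac pr ab(1,2,3) comm np] unfolding U_def I_def by blast
  from bchoice[OF this] obtain z where z: "\<forall>\<alpha>\<in>U. z \<alpha> \<in> carrier A \<and> twisted a b (z \<alpha>) (\<alpha> \<odot> z \<alpha> \<oplus> F j)" by blast
  \<comment> \<open>The algebra is the union of the spans of the finite sets \<open>cs n\<close>.
    One of them contains resolvents for uncountably many scalars, more than its dimension
    permits.\<close>
  define cs where "cs n = from_nat_into C ` {..<n}" for n :: nat
  have Cne: "C \<noteq> {}"
  proof
    assume "C = {}"
    then have "a \<in> lspan {}" using C(3) ab by blast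
    then have "a = \<zero>" by (auto elim: lspan.cases)
    then show False using ab by blast
  qed
  have csC: "cs n \<subseteq> carrier A" for n unfolding cs_def using from_nat_into[OF Cne] C(2) by auto
  have csm: "cs n \<subseteq> cs m" if "n \<le> m" for n m unfolding cs_def using that by auto
  have ex: "\<exists>n. x \<in> lspan (cs n)" if "x \<in> carrier A" for x
    using C(3)[OF that]
  proof (induction rule: lspan.induct)
    case zero
    then show ?case using lspan.zero by blast
  next
    case (step c s v)
    obtain n where n: "v \<in> lspan (cs n)" using step by blast
    obtain i where i: "s = from_nat_into C i" using from_nat_into_surj[OF C(1) step(2)] by metis
    have "v \<in> lspan (cs (max n (Suc i)))" by (rule lspan_mono[OF n csm]) simp
    moreover have "s \<in> cs (max n (Suc i))" unfolding cs_def i by auto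
    ultimately show ?case using step by (intro exI[of _ "max n (Suc i)"] lspan.step)
  qed
  have "U \<subseteq> (\<Union>n. {\<alpha> \<in> U. z \<alpha> \<in> lspan (cs n)})" using ex z by blast
  from uncountable_UN[OF unU[folded U_def] this] obtain n where "uncountable {\<alpha> \<in> U. z \<alpha> \<in> lspan (cs n)}"
    by (rule exE)
  then have "infinite {\<alpha> \<in> U. z \<alpha> \<in> lspan (cs n)}" using countable_finite by blast
  then obtain e :: "nat \<Rightarrow> 'a" where e: "inj e" "range e \<subseteq> {\<alpha> \<in> U. z \<alpha> \<in> lspan (cs n)}"
    using infinite_countable_subset by blast
  have eU: "e i \<in> U" "z (e i) \<in> lspan (cs n)" for i using e(2) by auto
  have "\<exists>m\<le>card (cs n). z (e m) \<in> lspan ((\<lambda>i. z (e i)) ` {..<m} \<union> {})"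
    by (rule lspan_dependent[OF _ le_refl csC]) (use eU in \<open>auto simp: cs_def\<close>)
  then obtain m where "z (e m) \<in> lspan ((\<lambda>i. z (e i)) ` {..<m})" by auto
  moreover have "z (e m) \<notin> lspan ((\<lambda>i. z (e i)) ` {..<m})"
    by (rule twisted_resolvents_independent[OF ac pr ab(1,2,3) comm np, of e "F j"])
      (use eU z e(1) F in \<open>auto simp: U_def\<close>)
  ultimately show False by blast
qed

end

section \<open>Transport of identities along homomorphisms and to quotient algebras\<close>

lemma ring_transfer:
  assumes "ring B" "carrier B' = carrier B" "monoid.mult B' = monoid.mult B" "one B' = one B"
    "ring.zero B' = ring.zero B" "add B' = add B"
  shows "ring B'"
proof -
  interpret B: ring B by fact
  show ?thesis
  proof (rule ringI)
    show "abelian_group B'"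
    proof (rule abelian_groupI)
      fix x assume "x \<in> carrier B'"
      then have "\<ominus>\<^bsub>B\<^esub> x \<in> carrier B'" "\<ominus>\<^bsub>B\<^esub> x \<oplus>\<^bsub>B'\<^esub> x = \<zero>\<^bsub>B'\<^esub>" using assms by (auto simp: B.l_neg)
      then show "\<exists>y\<in>carrier B'. y \<oplus>\<^bsub>B'\<^esub> x = \<zero>\<^bsub>B'\<^esub>" by blast
    qed (use assms in \<open>auto simp: B.a_ac\<close>)
    show "monoid B'" by (rule monoidI) (use assms in \<open>auto simp: B.m_assoc\<close>)
  qed (use assms in \<open>auto simp: B.l_distr B.r_distr\<close>)
qed

lemma finsum_hom:
  assumes "abelian_group A" "abelian_group B" and h: "\<And>x. x \<in> carrier A \<Longrightarrow> h x \<in> carrier B"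
    "\<And>x y. \<lbrakk>x \<in> carrier A; y \<in> carrier A\<rbrakk> \<Longrightarrow> h (x \<oplus>\<^bsub>A\<^esub> y) = h x \<oplus>\<^bsub>B\<^esub> h y"
    and S: "finite S" "\<And>s. s \<in> S \<Longrightarrow> f s \<in> carrier A"
  shows "h (finsum A f S) = finsum B (\<lambda>s. h (f s)) S"
proof -
  interpret A: abelian_group A by fact
  interpret B: abelian_group B by fact
  have "h \<zero>\<^bsub>A\<^esub> \<oplus>\<^bsub>B\<^esub> h \<zero>\<^bsub>A\<^esub> = h \<zero>\<^bsub>A\<^esub>" using h(2)[of "\<zero>\<^bsub>A\<^esub>" "\<zero>\<^bsub>A\<^esub>"] by simp
  then have h0: "h \<zero>\<^bsub>A\<^esub> = \<zero>\<^bsub>B\<^esub>" using h(1)[of "\<zero>\<^bsub>A\<^esub>"] by simp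
  show ?thesis using S
  proof (induction S)
    case (insert s S)
    then show ?case using h by (simp add: Pi_def)
  qed (simp add: h0)
qed

lemma word_val_hom:
  assumes "ring A" "ring B" "h \<in> ring_hom A B" "set ws \<subseteq> carrier A"
  shows "h (word_val A ws) = word_val B (map h ws)"
proof -
  interpret A: ring A by fact
  interpret B: ring B by fact
  show ?thesis using assms(4)
    by (induction ws) (auto simp: ring_hom_one[OF assms(3)] ring_hom_mult[OF assms(3)] A.word_val_closed)
qed

lemma alt_hom:
  assumes A: "ring A" and B: "ring B" and hc: "\<And>x. x \<in> carrier A \<Longrightarrow> h x \<in> carrier B"
    and ha: "\<And>x y. \<lbrakk>x \<in> carrier A; y \<in> carrier A\<rbrakk> \<Longrightarrow> h (x \<oplus>\<^bsub>A\<^esub> y) = h x \<oplus>\<^bsub>B\<^esub> h y"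
    and F: "\<And>p. F p \<in> carrier A"
  shows "h (ring.alt A D F) = ring.alt B D (\<lambda>p. h (F p))"
proof -
  interpret A: ring A by fact
  interpret B: ring B by fact
  have m: "h (x \<ominus>\<^bsub>A\<^esub> y) = h x \<ominus>\<^bsub>B\<^esub> h y" if xy: "x \<in> carrier A" "y \<in> carrier A" for x y
  proof -
    have "h x = h (x \<ominus>\<^bsub>A\<^esub> y) \<oplus>\<^bsub>B\<^esub> h y" using ha[of "x \<ominus>\<^bsub>A\<^esub> y" y] xy
      by (simp add: a_minus_def A.a_assoc A.l_neg)
    then show ?thesis using xy hc by (simp add: a_minus_def B.a_assoc B.r_neg)
  qed
  have f: "h (finsum A F S) = finsum B (\<lambda>p. h (F p)) S" if "finite S" for S
    by (rule finsum_hom[OF A.abelian_group_axioms B.abelian_group_axioms hc ha that F])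
  have "finsum A F S \<in> carrier A" for S using F by (intro A.finsum_closed) auto
  then show ?thesis unfolding A.alt_def B.alt_def by (simp add: m f)
qed

lemma stdp_hom:
  assumes A: "ring A" and B: "ring B" and h: "h \<in> ring_hom A B" and a: "\<And>i. a i \<in> carrier A"
  shows "h (ring.stdp A D a) = ring.stdp B D (\<lambda>i. h (a i))"
    and "h (ring.rstdp A D a) = ring.rstdp B D (\<lambda>i. h (a i))"
proof -
  interpret A: ring A by fact
  interpret B: ring B by fact
  note alt = alt_hom[OF A B ring_hom_closed[OF h] ring_hom_add[OF h]]
  have "h (word_val A (map (a \<circ> p) is)) = word_val B (map ((\<lambda>i. h (a i)) \<circ> p) is)" for p :: "nat \<Rightarrow> nat" and "is"
  proof -
    have "set (map (a \<circ> p) is) \<subseteq> carrier A" using a by auto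
    from word_val_hom[OF A B h this] show ?thesis by (simp add: o_def)
  qed
  moreover have "word_val A (map (a \<circ> p) is) \<in> carrier A" for p :: "nat \<Rightarrow> nat" and "is"
    using a by (intro A.word_val_closed) auto
  ultimately show "h (ring.stdp A D a) = ring.stdp B D (\<lambda>i. h (a i))"
    "h (ring.rstdp A D a) = ring.rstdp B D (\<lambda>i. h (a i))"
    unfolding A.stdp_def B.stdp_def A.rstdp_def B.rstdp_def by (simp_all add: alt)
qed

lemma PI_algebra_of_identity:
  fixes k :: "'k ring" and A :: "('k, 'r) module"
  assumes A: "ring A" and k: "field k"
    and sm: "\<And>x. x \<in> carrier A \<Longrightarrow> \<one>\<^bsub>k\<^esub> \<odot>\<^bsub>A\<^esub> x = x" "\<And>x. x \<in> carrier A \<Longrightarrow> (\<ominus>\<^bsub>k\<^esub> \<one>\<^bsub>k\<^esub>) \<odot>\<^bsub>A\<^esub> x = \<ominus>\<^bsub>A\<^esub> x"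
    and id: "\<And>a b c. \<lbrakk>\<And>i. a i \<in> carrier A; \<And>i. b i \<in> carrier A; \<And>i. c i \<in> carrier A\<rbrakk> \<Longrightarrow>
      ring.stdp A D a \<otimes>\<^bsub>A\<^esub> (ring.stdp A D b \<otimes>\<^bsub>A\<^esub> ring.rstdp A E c) = \<zero>\<^bsub>A\<^esub>"
  shows "PI_algebra k A"
  using ring.stdp_identity_PI[OF A k sm id] unfolding PI_algebra_def nc_eval_def .

lemma quot_algebra_ring:
  assumes "ideal I A"
  shows "ring (quot_algebra A I)" "(+>\<^bsub>A\<^esub>) I \<in> ring_hom A (quot_algebra A I)"
    "carrier (quot_algebra A I) = (+>\<^bsub>A\<^esub>) I ` carrier A"
    "\<And>x. x \<in> carrier A \<Longrightarrow> I +>\<^bsub>A\<^esub> x = \<zero>\<^bsub>quot_algebra A I\<^esub> \<longleftrightarrow> x \<in> I"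
proof -
  interpret I: ideal I A by fact
  show "ring (quot_algebra A I)"
    by (rule ring_transfer[OF I.quotient_is_ring]) (simp_all add: quot_algebra_def)
  show "(+>\<^bsub>A\<^esub>) I \<in> ring_hom A (quot_algebra A I)"
    using I.rcos_ring_hom unfolding ring_hom_def quot_algebra_def by simp
  show "carrier (quot_algebra A I) = (+>\<^bsub>A\<^esub>) I ` carrier A"
    unfolding quot_algebra_def FactRing_def A_RCOSETS_def' by auto
  show "I +>\<^bsub>A\<^esub> x = \<zero>\<^bsub>quot_algebra A I\<^esub> \<longleftrightarrow> x \<in> I" if "x \<in> carrier A" for x
  proof -
    have "\<zero>\<^bsub>quot_algebra A I\<^esub> = I" by (simp add: quot_algebra_def FactRing_def)
    moreover have "x \<in> I +>\<^bsub>A\<^esub> x" by (rule I.a_rcos_self[OF that])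
    moreover have "x \<in> I \<Longrightarrow> I +>\<^bsub>A\<^esub> x = I" by (rule I.a_rcos_const)
    ultimately show ?thesis by auto
  qed
qed

text \<open>An evaluation in the quotient lifts to \<open>A\<close> by choosing representatives, and
  its value there lies in \<open>I\<close>. A scalar acts on a coset by a union over all
  representatives, which collapses as soon as they give the same coset.\<close>

lemma quot_PI:
  fixes k :: "'k ring" and A :: "('k, 'r) module"
  assumes k: "field k" and I: "ideal I A"
    and sm: "\<And>x. x \<in> carrier A \<Longrightarrow> \<one>\<^bsub>k\<^esub> \<odot>\<^bsub>A\<^esub> x = x" "\<And>x. x \<in> carrier A \<Longrightarrow> (\<ominus>\<^bsub>k\<^esub> \<one>\<^bsub>k\<^esub>) \<odot>\<^bsub>A\<^esub> x = \<ominus>\<^bsub>A\<^esub> x"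
    and id: "\<And>a b c. \<lbrakk>\<And>i. a i \<in> carrier A; \<And>i. b i \<in> carrier A; \<And>i. c i \<in> carrier A\<rbrakk> \<Longrightarrow>
      ring.stdp A D a \<otimes>\<^bsub>A\<^esub> (ring.stdp A D b \<otimes>\<^bsub>A\<^esub> ring.rstdp A E c) \<in> I"
  shows "PI_algebra k (quot_algebra A I)"
proof -
  interpret I: ideal I A by fact
  let ?Q = "quot_algebra A I" and ?\<phi> = "(+>\<^bsub>A\<^esub>) I"
  note Q = quot_algebra_ring[OF I]
  interpret Q: ring ?Q by (rule Q(1))
  have A: "ring A" by (rule I.ring_axioms)
  have sat: "?\<phi> y = ?\<phi> x" if "y \<in> ?\<phi> x" "x \<in> carrier A" for x y
    using I.a_repr_independence[OF that I.a_subgroup] by simp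
  have sub: "?\<phi> x \<subseteq> carrier A" if "x \<in> carrier A" for x
    by (rule I.a_r_coset_subset_G) (use I.a_subset that in auto)
  have self: "x \<in> ?\<phi> x" if "x \<in> carrier A" for x by (rule I.a_rcos_self[OF that])
  have neg: "?\<phi> (\<ominus>\<^bsub>A\<^esub> x) = \<ominus>\<^bsub>?Q\<^esub> ?\<phi> x" if x: "x \<in> carrier A" for x
  proof -
    have "?\<phi> (\<ominus>\<^bsub>A\<^esub> x) \<oplus>\<^bsub>?Q\<^esub> ?\<phi> x = ?\<phi> (\<ominus>\<^bsub>A\<^esub> x \<oplus>\<^bsub>A\<^esub> x)" using x by (intro ring_hom_add[OF Q(2), symmetric]) auto
    also have "\<dots> = \<zero>\<^bsub>?Q\<^esub>" using x Q(4)[of "\<zero>\<^bsub>A\<^esub>"] by (simp add: I.l_neg I.zero_closed)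
    finally show ?thesis using x ring_hom_closed[OF Q(2)] by (intro Q.minus_equality[symmetric]) auto
  qed
  have smQ: "c \<odot>\<^bsub>?Q\<^esub> C = (\<Union>y\<in>C. ?\<phi> (c \<odot>\<^bsub>A\<^esub> y))" for c C unfolding quot_algebra_def by simp
  show ?thesis
  proof (rule PI_algebra_of_identity[OF Q(1) k])
    fix U assume "U \<in> carrier ?Q"
    then obtain x where x: "x \<in> carrier A" "U = ?\<phi> x" unfolding Q(3) by blast
    have "?\<phi> (\<one>\<^bsub>k\<^esub> \<odot>\<^bsub>A\<^esub> y) = ?\<phi> x" "?\<phi> ((\<ominus>\<^bsub>k\<^esub> \<one>\<^bsub>k\<^esub>) \<odot>\<^bsub>A\<^esub> y) = \<ominus>\<^bsub>?Q\<^esub> ?\<phi> x" if y: "y \<in> ?\<phi> x" for y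
    proof -
      have yc: "y \<in> carrier A" using sub x(1) y by blast
      show "?\<phi> (\<one>\<^bsub>k\<^esub> \<odot>\<^bsub>A\<^esub> y) = ?\<phi> x" using sm(1)[OF yc] sat[OF y x(1)] by simp
      show "?\<phi> ((\<ominus>\<^bsub>k\<^esub> \<one>\<^bsub>k\<^esub>) \<odot>\<^bsub>A\<^esub> y) = \<ominus>\<^bsub>?Q\<^esub> ?\<phi> x"
        using sm(2)[OF yc] neg[OF yc] sat[OF y x(1)] by simp
    qed
    then show "\<one>\<^bsub>k\<^esub> \<odot>\<^bsub>?Q\<^esub> U = U" "(\<ominus>\<^bsub>k\<^esub> \<one>\<^bsub>k\<^esub>) \<odot>\<^bsub>?Q\<^esub> U = \<ominus>\<^bsub>?Q\<^esub> U"
      unfolding smQ x(2) using self[OF x(1)] by auto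
  next
    fix a b c :: "nat \<Rightarrow> 'r set"
    assume abc: "\<And>i. a i \<in> carrier ?Q" "\<And>i. b i \<in> carrier ?Q" "\<And>i. c i \<in> carrier ?Q"
    have lift: "\<exists>a'. (\<forall>i. a' i \<in> carrier A) \<and> a = (\<lambda>i. ?\<phi> (a' i))" if "\<And>i. a i \<in> carrier ?Q" for a :: "nat \<Rightarrow> 'r set"
    proof -
      have "\<forall>i. \<exists>x. x \<in> carrier A \<and> a i = ?\<phi> x" using that unfolding Q(3) by blast
      from choice[OF this] show ?thesis by auto
    qed
    from lift[OF abc(1)] obtain a' where "(\<forall>i. a' i \<in> carrier A) \<and> a = (\<lambda>i. ?\<phi> (a' i))" by (rule exE)
    note a' = conjunct1[OF this] conjunct2[OF this]
    from lift[OF abc(2)] obtain b' where "(\<forall>i. b' i \<in> carrier A) \<and> b = (\<lambda>i. ?\<phi> (b' i))" by (rule exE)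
    note b' = conjunct1[OF this] conjunct2[OF this]
    from lift[OF abc(3)] obtain c' where "(\<forall>i. c' i \<in> carrier A) \<and> c = (\<lambda>i. ?\<phi> (c' i))" by (rule exE)
    note c' = conjunct1[OF this] conjunct2[OF this]
    have cl: "ring.stdp A D a' \<in> carrier A" "ring.stdp A D b' \<in> carrier A" "ring.rstdp A E c' \<in> carrier A"
      using ring.stdp_closed[OF A] ring.rstdp_closed[OF A] a' b' c' by blast+
    have "ring.stdp ?Q D a \<otimes>\<^bsub>?Q\<^esub> (ring.stdp ?Q D b \<otimes>\<^bsub>?Q\<^esub> ring.rstdp ?Q E c)
      = ?\<phi> (ring.stdp A D a' \<otimes>\<^bsub>A\<^esub> (ring.stdp A D b' \<otimes>\<^bsub>A\<^esub> ring.rstdp A E c'))"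
      unfolding a'(2) b'(2) c'(2) using a'(1) b'(1) c'(1) cl
      by (simp add: stdp_hom[OF A Q(1) Q(2), symmetric] ring_hom_mult[OF Q(2)] I.m_closed)
    also have "\<dots> = \<zero>\<^bsub>?Q\<^esub>" using id[of a' b' c'] a' b' c' cl by (subst Q(4)) (auto intro: I.m_closed)
    finally show "ring.stdp ?Q D a \<otimes>\<^bsub>?Q\<^esub> (ring.stdp ?Q D b \<otimes>\<^bsub>?Q\<^esub> ring.rstdp ?Q E c) = \<zero>\<^bsub>?Q\<^esub>" .
  qed
qed

context kalg
begin

text \<open>Zorn's lemma gives a subspace \<open>M\<close> that contains \<open>W\<close> and is
  maximal without \<open>e\<close>. It is a complement of the line through \<open>e\<close>, and
  \<open>l v\<close> is the coordinate of \<open>v\<close> along \<open>e\<close>.\<close>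

lemma functional_exists:
  assumes W: "subsp W" and e: "e \<in> carrier A" "e \<notin> W"
  shows "\<exists>l. (\<forall>v\<in>carrier A. l v \<in> carrier k) \<and>
    (\<forall>u\<in>carrier A. \<forall>v\<in>carrier A. l (u \<oplus> v) = l u \<oplus>\<^bsub>k\<^esub> l v) \<and>
    (\<forall>c\<in>carrier k. \<forall>v\<in>carrier A. l (c \<odot> v) = c \<otimes>\<^bsub>k\<^esub> l v) \<and>
    (\<forall>v\<in>W. l v = \<zero>\<^bsub>k\<^esub>) \<and> l e = \<one>\<^bsub>k\<^esub>"
proof -
  define \<M> where "\<M> = {M. subsp M \<and> W \<subseteq> M \<and> e \<notin> M}"
  have "\<exists>M\<in>\<M>. \<forall>U\<in>\<M>. M \<subseteq> U \<longrightarrow> U = M"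
  proof (rule subset_Zorn_nonempty)
    show "\<M> \<noteq> {}" using W e unfolding \<M>_def by blast
    fix C assume C: "C \<noteq> {}" "subset.chain \<M> C"
    then have CM: "\<And>U. U \<in> C \<Longrightarrow> subsp U \<and> W \<subseteq> U \<and> e \<notin> U" unfolding \<M>_def subset.chain_def by blast
    obtain U0 where U0: "U0 \<in> C" using C by blast
    have "subsp (\<Union>C)"
      unfolding subsp_def
    proof (intro conjI ballI)
      show "\<Union>C \<subseteq> carrier A" using CM subspD(1) by blast
      show "\<zero> \<in> \<Union>C" using CM[OF U0] U0 subspD(2) by blast
      fix x assume x: "x \<in> \<Union>C"
      then obtain U where U: "U \<in> C" "x \<in> U" by blast
      show "c \<odot> x \<in> \<Union>C" if "c \<in> carrier k" for c
        using subspD(4)[of U c x] CM[OF U(1)] U that by blast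
      fix y assume "y \<in> \<Union>C"
      then obtain Y where Y: "Y \<in> C" "y \<in> Y" by blast
      have "U \<subseteq> Y \<or> Y \<subseteq> U" using C(2) U Y unfolding subset.chain_def by blast
      then obtain Z where "Z \<in> C" "x \<in> Z" "y \<in> Z" using U Y by blast
      then show "x \<oplus> y \<in> \<Union>C" using subspD(3)[of Z x y] CM[of Z] by blast
    qed
    then show "\<Union>C \<in> \<M>" unfolding \<M>_def using CM U0 by blast
  qed
  then obtain M where MM: "M \<in> \<M>" "\<And>U. \<lbrakk>U \<in> \<M>; M \<subseteq> U\<rbrakk> \<Longrightarrow> U = M" by blast
  have M: "subsp M" "W \<subseteq> M" "e \<notin> M" using MM(1) unfolding \<M>_def by blast+
  have mx: "U = M" if "subsp U" "W \<subseteq> U" "e \<notin> U" "M \<subseteq> U" for U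
    by (rule MM(2)) (use that in \<open>auto simp: \<M>_def\<close>)
  have ex: "\<exists>a\<in>carrier k. v \<ominus> a \<odot> e \<in> M" if v: "v \<in> carrier A" for v
  proof (cases "v \<in> M")
    case True
    then show ?thesis using v e by (intro bexI[of _ "\<zero>\<^bsub>k\<^esub>"]) (auto simp: smult_l_null a_minus_def)
  next
    case False
    let ?U = "lspan (insert v M)"
    have MX: "M \<subseteq> ?U" using subspD(1)[OF M(1)] by (auto intro: lspan_base)
    have "v \<in> ?U" using v by (auto intro: lspan_base)
    then have "e \<in> ?U" using mx[OF subsp_lspan _ _ MX] M(2) MX False by blast
    then have "v \<in> lspan (insert e M)"
      using lspan_exchange[of e v M] M v subspD(1)[OF M(1)] lspan_of_subsp[OF M(1)] by blast
    then obtain c m where c: "c \<in> carrier k" "m \<in> lspan M" "v = c \<odot> e \<oplus> m" using lspan_insertE[OF _ e(1)] by blast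
    have m: "m \<in> M" "m \<in> carrier A" using c lspan_of_subsp[OF M(1)] lspan_carrier by auto
    have "v \<ominus> c \<odot> e = m" unfolding c(3) using c(1) m e by (simp add: a_minus_def M.a_ac M.r_neg)
    then show ?thesis using c m by blast
  qed
  have uniq: "a = a'" if a: "a \<in> carrier k" "a' \<in> carrier k" "v \<in> carrier A" "v \<ominus> a \<odot> e \<in> M" "v \<ominus> a' \<odot> e \<in> M" for a a' v
  proof (rule ccontr)
    assume "a \<noteq> a'"
    then have ne: "a' \<ominus>\<^bsub>k\<^esub> a \<noteq> \<zero>\<^bsub>k\<^esub>" using a by simp
    have "(v \<ominus> a \<odot> e) \<ominus> (v \<ominus> a' \<odot> e) \<in> M" by (rule subsp_minus[OF M(1) a(4,5)])
    moreover have "(v \<ominus> p) \<ominus> (v \<ominus> q) = q \<ominus> p" if "p \<in> carrier A" "q \<in> carrier A" for p q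
      using that a(3) by algebra
    moreover have "a' \<odot> e \<ominus> a \<odot> e = (a' \<ominus>\<^bsub>k\<^esub> a) \<odot> e" using a e by (simp add: a_minus_def smult_l_distr smult_l_minus)
    ultimately have "(a' \<ominus>\<^bsub>k\<^esub> a) \<odot> e \<in> M" using a e by simp
    then have "e \<in> M" using subsp_smult_mem[OF M(1) e(1) _ ne] a by simp
    then show False using M by blast
  qed
  have "\<forall>v. \<exists>a. v \<in> carrier A \<longrightarrow> a \<in> carrier k \<and> v \<ominus> a \<odot> e \<in> M" using ex by blast
  from choice[OF this] obtain l where "\<forall>v. v \<in> carrier A \<longrightarrow> l v \<in> carrier k \<and> v \<ominus> l v \<odot> e \<in> M" by (rule exE)
  then have l: "\<And>v. v \<in> carrier A \<Longrightarrow> l v \<in> carrier k" "\<And>v. v \<in> carrier A \<Longrightarrow> v \<ominus> l v \<odot> e \<in> M" by auto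
  have lI: "l v = a" if "v \<in> carrier A" "a \<in> carrier k" "v \<ominus> a \<odot> e \<in> M" for v a
    using uniq[OF l(1)[OF that(1)] that(2,1) l(2)[OF that(1)] that(3)] .
  have "l (u \<oplus> v) = l u \<oplus>\<^bsub>k\<^esub> l v" if uv: "u \<in> carrier A" "v \<in> carrier A" for u v
  proof (rule lI)
    have "(u \<ominus> l u \<odot> e) \<oplus> (v \<ominus> l v \<odot> e) \<in> M" using subspD(3)[OF M(1) l(2) l(2)] uv by blast
    moreover have "(u \<ominus> l u \<odot> e) \<oplus> (v \<ominus> l v \<odot> e) = (u \<oplus> v) \<ominus> (l u \<oplus>\<^bsub>k\<^esub> l v) \<odot> e"
      using uv l(1) e by (simp add: a_minus_def smult_l_distr M.minus_add M.a_ac)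
    ultimately show "(u \<oplus> v) \<ominus> (l u \<oplus>\<^bsub>k\<^esub> l v) \<odot> e \<in> M" by simp
  qed (use uv l in auto)
  moreover have "l (c \<odot> v) = c \<otimes>\<^bsub>k\<^esub> l v" if cv: "c \<in> carrier k" "v \<in> carrier A" for c v
  proof (rule lI)
    have "c \<odot> (v \<ominus> l v \<odot> e) \<in> M" using subspD(4)[OF M(1) cv(1) l(2)] cv by blast
    moreover have "c \<odot> (v \<ominus> l v \<odot> e) = c \<odot> v \<ominus> (c \<otimes>\<^bsub>k\<^esub> l v) \<odot> e"
      using cv l(1) e by (simp add: a_minus_def smult_r_distr smult_r_minus smult_assoc1)
    ultimately show "c \<odot> v \<ominus> (c \<otimes>\<^bsub>k\<^esub> l v) \<odot> e \<in> M" by simp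
  qed (use cv l in auto)
  moreover have "l v = \<zero>\<^bsub>k\<^esub>" if "v \<in> W" for v
    using that W M(2) subspD(1)[OF W] e by (intro lI) (auto simp: smult_l_null a_minus_def)
  moreover have "l e = \<one>\<^bsub>k\<^esub>"
    using e subspD(2)[OF M(1)] by (intro lI) (auto simp: smult_one a_minus_def M.r_neg)
  ultimately show ?thesis using l(1) by (intro exI[of _ l] conjI ballI) blast+
qed

end

section \<open>Extension of scalars\<close>

lemma frag_extend_add_fun:
  "frag_extend (\<lambda>p. F p + G p) f = frag_extend F f + frag_extend G f"
  by (simp add: frag_extend_def frag_cmul_distrib2 sum.distrib)

lemma frag_extend_diff_fun:
  "frag_extend (\<lambda>p. F p - G p) f = frag_extend F f - frag_extend G f"
  using frag_extend_add_fun[of "\<lambda>p. F p - G p" G f] by simp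

lemma frag_extend_zero_fun: "frag_extend (\<lambda>p. 0) f = 0"
  by (simp add: frag_extend_def)

locale scalar_extension = plain_kalg k R for k :: "'k ring" and R :: "('k, 'r) module" (structure) +
  fixes K :: "'c ring" and h :: "'k \<Rightarrow> 'c"
  assumes K: "field K" and h: "h \<in> ring_hom k K"
begin

sublocale K: field K
  by (rule K)

definition D :: "('r \<times> 'c) set" where
  "D = carrier R \<times> carrier K"

definition fm :: "(('r \<times> 'c) \<Rightarrow>\<^sub>0 int) \<Rightarrow> (('r \<times> 'c) \<Rightarrow>\<^sub>0 int) \<Rightarrow> (('r \<times> 'c) \<Rightarrow>\<^sub>0 int)" where
  "fm f g = monoid.mult (free_on_pairs R K) f g"

definition N :: "(('r \<times> 'c) \<Rightarrow>\<^sub>0 int) set" where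
  "N = generate (free_Abelian_group D) (tensor_relations k R K h)"

lemma mem_D [simp]: "(x, c) \<in> D \<longleftrightarrow> x \<in> carrier R \<and> c \<in> carrier K"
  unfolding D_def by simp

lemma fm_eq: "fm f g = frag_extend (\<lambda>p. frag_extend (\<lambda>q. frag_of (fst p \<otimes> fst q, snd p \<otimes>\<^bsub>K\<^esub> snd q)) g) f"
  unfolding fm_def free_on_pairs_def by (simp add: case_prod_unfold)

lemma fm_add: "fm (f + g) e = fm f e + fm g e" "fm f (g + e) = fm f g + fm f e"
  unfolding fm_eq by (simp_all add: frag_extend_add frag_extend_add_fun)

lemma fm_diff: "fm (f - g) e = fm f e - fm g e" "fm f (g - e) = fm f g - fm f e"
  unfolding fm_eq by (simp_all add: frag_extend_diff frag_extend_diff_fun)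

lemma fm_zero: "fm 0 e = 0" "fm f 0 = 0"
  unfolding fm_eq by (simp_all add: frag_extend_zero_fun)

lemma fm_of: "fm (frag_of (x, c)) (frag_of (y, d)) = frag_of (x \<otimes> y, c \<otimes>\<^bsub>K\<^esub> d)"
  unfolding fm_eq by simp

lemma FP_simps:
  "carrier (free_on_pairs R K) = {f. Poly_Mapping.keys f \<subseteq> D}"
  "\<one>\<^bsub>free_on_pairs R K\<^esub> = frag_of (\<one>, \<one>\<^bsub>K\<^esub>)" "\<zero>\<^bsub>free_on_pairs R K\<^esub> = 0"
  "f \<oplus>\<^bsub>free_on_pairs R K\<^esub> g = f + g" "f \<otimes>\<^bsub>free_on_pairs R K\<^esub> g = fm f g"
  unfolding fm_def by (simp_all add: free_on_pairs_def free_Abelian_group_def D_def)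

lemma keys_add_D: "\<lbrakk>Poly_Mapping.keys f \<subseteq> D; Poly_Mapping.keys g \<subseteq> D\<rbrakk> \<Longrightarrow> Poly_Mapping.keys (f + g) \<subseteq> D"
  using keys_add[of f g] by blast

lemma keys_diff_D: "\<lbrakk>Poly_Mapping.keys f \<subseteq> D; Poly_Mapping.keys g \<subseteq> D\<rbrakk> \<Longrightarrow> Poly_Mapping.keys (f - g) \<subseteq> D"
  using keys_diff[of f g] by blast

lemma keys_fm:
  assumes "Poly_Mapping.keys f \<subseteq> D" "Poly_Mapping.keys g \<subseteq> D"
  shows "Poly_Mapping.keys (fm f g) \<subseteq> D"
  using assms(1)
proof (induction f rule: frag_induction)
  case (one p)
  show ?case using assms(2)
  proof (induction g rule: frag_induction)
    case (one q)
    then show ?case using \<open>p \<in> D\<close> unfolding D_def by (cases p, cases q) (auto simp: fm_of)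
  qed (simp_all add: fm_zero fm_diff keys_diff_D)
qed (simp_all add: fm_zero fm_diff keys_diff_D)

lemma fm_assoc:
  assumes f: "Poly_Mapping.keys f \<subseteq> D" and g: "Poly_Mapping.keys g \<subseteq> D" and e: "Poly_Mapping.keys e \<subseteq> D"
  shows "fm (fm f g) e = fm f (fm g e)"
  using f
proof (induction f rule: frag_induction)
  case (one p)
  show ?case using g
  proof (induction g rule: frag_induction)
    case (one q)
    show ?case using e
    proof (induction e rule: frag_induction)
      case (one r)
      then show ?case using \<open>p \<in> D\<close> \<open>q \<in> D\<close> unfolding D_def
        by (cases p, cases q, cases r) (auto simp: fm_of A.m_assoc K.m_assoc)
    qed (auto simp: fm_zero fm_diff)
  qed (auto simp: fm_zero fm_diff)
qed (auto simp: fm_zero fm_diff)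

lemma fm_one:
  assumes "Poly_Mapping.keys f \<subseteq> D"
  shows "fm (frag_of (\<one>, \<one>\<^bsub>K\<^esub>)) f = f" "fm f (frag_of (\<one>, \<one>\<^bsub>K\<^esub>)) = f"
proof -
  show "fm (frag_of (\<one>, \<one>\<^bsub>K\<^esub>)) f = f" using assms
    by (induction f rule: frag_induction) (auto simp: D_def fm_of fm_zero fm_diff)
  show "fm f (frag_of (\<one>, \<one>\<^bsub>K\<^esub>)) = f" using assms
    by (induction f rule: frag_induction) (auto simp: D_def fm_of fm_zero fm_diff)
qed

lemma ring_FP: "ring (free_on_pairs R K)"
proof (rule ringI)
  show "abelian_group (free_on_pairs R K)"
  proof (rule abelian_groupI)
    fix f assume "f \<in> carrier (free_on_pairs R K)"
    then show "\<exists>g\<in>carrier (free_on_pairs R K). g \<oplus>\<^bsub>free_on_pairs R K\<^esub> f = \<zero>\<^bsub>free_on_pairs R K\<^esub>"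
      by (intro bexI[of _ "- f"]) (auto simp: FP_simps)
  qed (auto simp: FP_simps add.assoc add.commute dest: keys_add_D[THEN subsetD, rotated 2])
  have "(\<one>, \<one>\<^bsub>K\<^esub>) \<in> D" unfolding D_def by simp
  then show "monoid (free_on_pairs R K)"
    by (intro monoidI) (auto simp: FP_simps fm_assoc fm_one dest: keys_fm[THEN subsetD, rotated 2])
qed (auto simp: FP_simps fm_add)

sublocale FP: ring "free_on_pairs R K"
  by (rule ring_FP)

lemma h_props:
  "a \<in> carrier k \<Longrightarrow> h a \<in> carrier K"
  "\<lbrakk>a \<in> carrier k; b \<in> carrier k\<rbrakk> \<Longrightarrow> h (a \<oplus>\<^bsub>k\<^esub> b) = h a \<oplus>\<^bsub>K\<^esub> h b"
  "\<lbrakk>a \<in> carrier k; b \<in> carrier k\<rbrakk> \<Longrightarrow> h (a \<otimes>\<^bsub>k\<^esub> b) = h a \<otimes>\<^bsub>K\<^esub> h b"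
  "h \<one>\<^bsub>k\<^esub> = \<one>\<^bsub>K\<^esub>"
  using h by (auto simp: ring_hom_def)

lemma relations_cases:
  assumes "t \<in> tensor_relations k R K h"
  obtains x y c where "t = frag_of (x \<oplus> y, c) - frag_of (x, c) - frag_of (y, c)" "x \<in> carrier R" "y \<in> carrier R" "c \<in> carrier K"
  | x c d where "t = frag_of (x, c \<oplus>\<^bsub>K\<^esub> d) - frag_of (x, c) - frag_of (x, d)" "x \<in> carrier R" "c \<in> carrier K" "d \<in> carrier K"
  | a x c where "t = frag_of (a \<odot> x, c) - frag_of (x, h a \<otimes>\<^bsub>K\<^esub> c)" "a \<in> carrier k" "x \<in> carrier R" "c \<in> carrier K"
  using assms unfolding tensor_relations_def by blast

lemma relationsI:
  "\<lbrakk>x \<in> carrier R; y \<in> carrier R; c \<in> carrier K\<rbrakk> \<Longrightarrow>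
    frag_of (x \<oplus> y, c) - frag_of (x, c) - frag_of (y, c) \<in> tensor_relations k R K h"
  "\<lbrakk>x \<in> carrier R; c \<in> carrier K; d \<in> carrier K\<rbrakk> \<Longrightarrow>
    frag_of (x, c \<oplus>\<^bsub>K\<^esub> d) - frag_of (x, c) - frag_of (x, d) \<in> tensor_relations k R K h"
  "\<lbrakk>a \<in> carrier k; x \<in> carrier R; c \<in> carrier K\<rbrakk> \<Longrightarrow>
    frag_of (a \<odot> x, c) - frag_of (x, h a \<otimes>\<^bsub>K\<^esub> c) \<in> tensor_relations k R K h"
  unfolding tensor_relations_def by blast+

lemma relations_D:
  assumes "t \<in> tensor_relations k R K h" shows "Poly_Mapping.keys t \<subseteq> D"
  using assms
  by (cases rule: relations_cases) (simp_all add: keys_diff_D h_props(1))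

lemma N_D: "t \<in> N \<Longrightarrow> Poly_Mapping.keys t \<subseteq> D"
  unfolding N_def
  by (induction rule: generate.induct) (auto simp: relations_D keys_add_D dest!: relations_D keys_add_D[THEN subsetD, rotated 2])

lemma N_closed:
  "0 \<in> N" "\<lbrakk>s \<in> N; t \<in> N\<rbrakk> \<Longrightarrow> s + t \<in> N" "t \<in> N \<Longrightarrow> - t \<in> N"
  "t \<in> tensor_relations k R K h \<Longrightarrow> t \<in> N"
proof -
  show 0: "0 \<in> N" using generate.one[of "free_Abelian_group D"] unfolding N_def by simp
  show add: "s + t \<in> N" if "s \<in> N" "t \<in> N" for s t
    using generate.eng[of s "free_Abelian_group D" _ t] that unfolding N_def by simp
  show incl: "t \<in> N" if "t \<in> tensor_relations k R K h" for t
    using that unfolding N_def by (rule generate.incl)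
  show "- t \<in> N" if "t \<in> N" for t
    using that unfolding N_def
  proof (induction rule: generate.induct)
    case (incl r)
    then show ?case using generate.inv[OF incl, of "free_Abelian_group D"] relations_D[OF incl] by simp
  next
    case (inv r)
    then show ?case using generate.incl[OF inv] relations_D[OF inv] by simp
  next
    case (eng s t)
    then show ?case using add[unfolded N_def, of "- s" "- t"] by simp
  qed (use 0 N_def in simp)
qed

text \<open>The set of relations is stable under multiplication by pairs from either side, so the
  subgroup that it generates is an ideal.\<close>

lemma relation_mult:
  assumes t: "t \<in> tensor_relations k R K h" and p: "y \<in> carrier R" "d \<in> carrier K"
  shows "fm (frag_of (y, d)) t \<in> tensor_relations k R K h" "fm t (frag_of (y, d)) \<in> tensor_relations k R K h"
proof -
  have "fm (frag_of (y, d)) t \<in> tensor_relations k R K h \<and> fm t (frag_of (y, d)) \<in> tensor_relations k R K h"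
    using t
  proof (cases rule: relations_cases)
    case (1 x x' c)
    then show ?thesis using p
      by (simp add: fm_diff fm_of A.r_distr A.l_distr relationsI)
  next
    case (2 x c c')
    then show ?thesis using p
      by (simp add: fm_diff fm_of K.r_distr K.l_distr relationsI)
  next
    case (3 a x c)
    have "d \<otimes>\<^bsub>K\<^esub> (h a \<otimes>\<^bsub>K\<^esub> c) = h a \<otimes>\<^bsub>K\<^esub> (d \<otimes>\<^bsub>K\<^esub> c)" using 3 p h_props(1) by (simp add: K.m_lcomm)
    moreover have "h a \<otimes>\<^bsub>K\<^esub> c \<otimes>\<^bsub>K\<^esub> d = h a \<otimes>\<^bsub>K\<^esub> (c \<otimes>\<^bsub>K\<^esub> d)" using 3 p h_props(1) by (simp add: K.m_assoc)
    ultimately show ?thesis using 3 p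
      by (simp add: fm_diff fm_of smult_mult_right smult_mult_left relationsI)
  qed
  then show "fm (frag_of (y, d)) t \<in> tensor_relations k R K h" "fm t (frag_of (y, d)) \<in> tensor_relations k R K h" by auto
qed

lemma N_mult:
  assumes t: "t \<in> N" and f: "Poly_Mapping.keys f \<subseteq> D"
  shows "fm f t \<in> N \<and> fm t f \<in> N"
  using f
proof (induction f rule: frag_induction)
  case zero
  then show ?case by (simp add: fm_zero N_closed)
next
  case (one p)
  obtain y d where p: "p = (y, d)" "y \<in> carrier R" "d \<in> carrier K" using one unfolding D_def by auto
  have neg: "fm e (- r) = - fm e r" "fm (- r) e = - fm r e" for e r
    using fm_diff(2)[of e 0 r] fm_diff(1)[of 0 r e] by (simp_all add: fm_zero)
  show ?case using t unfolding N_def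
  proof (induction rule: generate.induct)
    case one
    then show ?case using N_closed(1) by (simp add: fm_zero N_def)
  next
    case (incl r)
    then show ?case using relation_mult p by (auto intro: generate.incl)
  next
    case (inv r)
    have "fm (frag_of p) r \<in> N" "fm r (frag_of p) \<in> N" using relation_mult[OF inv] p N_closed(4) by auto
    then show ?case using relations_D[OF inv] N_closed(3) by (simp add: neg N_def)
  next
    case (eng r s)
    then show ?case using N_closed(2) by (simp add: fm_add N_def)
  qed
next
  case (diff a b)
  then show ?case using N_closed(2)[of "fm a t" "- fm b t"] N_closed(2)[of "fm t a" "- fm t b"] N_closed(3)
    by (simp add: fm_diff)
qed

lemma ideal_N: "ideal N (free_on_pairs R K)"
  by (rule FP.idealI_elements) (use N_D N_closed N_mult in \<open>auto simp: FP_simps\<close>)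

abbreviation S where "S \<equiv> base_change k R K h"

lemma S_eq: "S = quot_algebra (free_on_pairs R K) N"
  unfolding base_change_def N_def D_def ..

sublocale S: ring S
  unfolding S_eq by (rule quot_algebra_ring(1)[OF ideal_N])

definition cls :: "(('r \<times> 'c) \<Rightarrow>\<^sub>0 int) \<Rightarrow> (('r \<times> 'c) \<Rightarrow>\<^sub>0 int) set" where
  "cls f = N +>\<^bsub>free_on_pairs R K\<^esub> f"

lemma cls_hom: "cls \<in> ring_hom (free_on_pairs R K) S"
  using quot_algebra_ring(2)[OF ideal_N] unfolding S_eq cls_def[abs_def] .

lemma cls_closed: "Poly_Mapping.keys f \<subseteq> D \<Longrightarrow> cls f \<in> carrier S"
  using ring_hom_closed[OF cls_hom] by (simp add: FP_simps)

lemma cls_add: "\<lbrakk>Poly_Mapping.keys f \<subseteq> D; Poly_Mapping.keys g \<subseteq> D\<rbrakk> \<Longrightarrow> cls (f + g) = cls f \<oplus>\<^bsub>S\<^esub> cls g"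
  using ring_hom_add[OF cls_hom, of f g] by (simp add: FP_simps)

lemma cls_mult: "\<lbrakk>Poly_Mapping.keys f \<subseteq> D; Poly_Mapping.keys g \<subseteq> D\<rbrakk> \<Longrightarrow> cls (fm f g) = cls f \<otimes>\<^bsub>S\<^esub> cls g"
  using ring_hom_mult[OF cls_hom, of f g] by (simp add: FP_simps)

lemma cls_zero_iff: "Poly_Mapping.keys f \<subseteq> D \<Longrightarrow> cls f = \<zero>\<^bsub>S\<^esub> \<longleftrightarrow> f \<in> N"
  using quot_algebra_ring(4)[OF ideal_N, of f] unfolding S_eq cls_def by (simp add: FP_simps)

lemma cls_zero: "cls 0 = \<zero>\<^bsub>S\<^esub>"
  using cls_zero_iff[of 0] N_closed(1) by simp

lemma cls_diff:
  assumes "Poly_Mapping.keys f \<subseteq> D" "Poly_Mapping.keys g \<subseteq> D"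
  shows "cls (f - g) = cls f \<ominus>\<^bsub>S\<^esub> cls g"
proof -
  have "cls f = cls (f - g) \<oplus>\<^bsub>S\<^esub> cls g" using cls_add[OF keys_diff_D[OF assms] assms(2)] by simp
  then show ?thesis using cls_closed assms cls_closed[OF keys_diff_D[OF assms]]
    by (simp add: a_minus_def S.a_assoc S.r_neg)
qed

lemma cls_eq_iff:
  assumes "Poly_Mapping.keys f \<subseteq> D" "Poly_Mapping.keys g \<subseteq> D"
  shows "cls f = cls g \<longleftrightarrow> f - g \<in> N"
proof -
  have "f - g \<in> N \<longleftrightarrow> cls f \<ominus>\<^bsub>S\<^esub> cls g = \<zero>\<^bsub>S\<^esub>"
    using cls_zero_iff[OF keys_diff_D[OF assms]] cls_diff[OF assms] by simp
  then show ?thesis using cls_closed assms by simp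
qed

lemma S_elem: "s \<in> carrier S \<Longrightarrow> \<exists>f. Poly_Mapping.keys f \<subseteq> D \<and> s = cls f"
  using quot_algebra_ring(3)[OF ideal_N] unfolding S_eq cls_def by (auto simp: FP_simps)

definition tens :: "'r \<Rightarrow> 'c \<Rightarrow> (('r \<times> 'c) \<Rightarrow>\<^sub>0 int) set" where
  "tens x c = cls (frag_of (x, c))"

lemma keys_D: "\<lbrakk>x \<in> carrier R; c \<in> carrier K\<rbrakk> \<Longrightarrow> Poly_Mapping.keys (frag_of (x, c)) \<subseteq> D"
  unfolding D_def by simp

lemma tens_closed: "\<lbrakk>x \<in> carrier R; c \<in> carrier K\<rbrakk> \<Longrightarrow> tens x c \<in> carrier S"
  unfolding tens_def by (intro cls_closed keys_D)

lemma tens_add_left: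
  assumes "x \<in> carrier R" "y \<in> carrier R" "c \<in> carrier K"
  shows "tens (x \<oplus> y) c = tens x c \<oplus>\<^bsub>S\<^esub> tens y c"
proof -
  have "cls (frag_of (x \<oplus> y, c)) = cls (frag_of (x, c) + frag_of (y, c))"
    by (subst cls_eq_iff) (use assms N_closed(4)[OF relationsI(1)[OF assms]] in \<open>simp_all add: diff_diff_eq keys_add_D\<close>)
  then show ?thesis unfolding tens_def using assms keys_D by (simp add: cls_add)
qed

lemma tens_add_right:
  assumes "x \<in> carrier R" "c \<in> carrier K" "d \<in> carrier K"
  shows "tens x (c \<oplus>\<^bsub>K\<^esub> d) = tens x c \<oplus>\<^bsub>S\<^esub> tens x d"
proof -
  have "cls (frag_of (x, c \<oplus>\<^bsub>K\<^esub> d)) = cls (frag_of (x, c) + frag_of (x, d))"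
    by (subst cls_eq_iff) (use assms N_closed(4)[OF relationsI(2)[OF assms]] in \<open>simp_all add: diff_diff_eq keys_add_D\<close>)
  then show ?thesis unfolding tens_def using assms keys_D by (simp add: cls_add)
qed

lemma tens_balanced:
  assumes "a \<in> carrier k" "x \<in> carrier R" "c \<in> carrier K"
  shows "tens (a \<odot> x) c = tens x (h a \<otimes>\<^bsub>K\<^esub> c)"
  unfolding tens_def
  by (subst cls_eq_iff) (use assms N_closed(4)[OF relationsI(3)[OF assms]] keys_D h_props(1) in \<open>auto\<close>)

lemma tens_mult:
  "\<lbrakk>x \<in> carrier R; c \<in> carrier K; y \<in> carrier R; d \<in> carrier K\<rbrakk> \<Longrightarrow>
    tens x c \<otimes>\<^bsub>S\<^esub> tens y d = tens (x \<otimes> y) (c \<otimes>\<^bsub>K\<^esub> d)"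
  unfolding tens_def using keys_D by (simp add: cls_mult[symmetric] fm_of)

lemma tens_one: "tens \<one> \<one>\<^bsub>K\<^esub> = \<one>\<^bsub>S\<^esub>"
  unfolding tens_def using ring_hom_one[OF cls_hom] by (simp add: FP_simps)

lemma tens_zero_left: "c \<in> carrier K \<Longrightarrow> tens \<zero> c = \<zero>\<^bsub>S\<^esub>"
  using tens_add_left[of \<zero> \<zero> c] tens_closed[of \<zero> c] by simp

lemma tens_zero_right: "x \<in> carrier R \<Longrightarrow> tens x \<zero>\<^bsub>K\<^esub> = \<zero>\<^bsub>S\<^esub>"
  using tens_add_right[of x "\<zero>\<^bsub>K\<^esub>" "\<zero>\<^bsub>K\<^esub>"] tens_closed[of x "\<zero>\<^bsub>K\<^esub>"] by simp

text \<open>Differences take the place of sums, following the induction principle for free abelian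
  groups. For this reason linearity of standard polynomials is later stated for differences.\<close>

lemma tens_induct [consumes 1, case_names zero tens diff]:
  assumes s: "s \<in> carrier S" and "P \<zero>\<^bsub>S\<^esub>" "\<And>x c. \<lbrakk>x \<in> carrier R; c \<in> carrier K\<rbrakk> \<Longrightarrow> P (tens x c)"
    "\<And>s t. \<lbrakk>s \<in> carrier S; t \<in> carrier S; P s; P t\<rbrakk> \<Longrightarrow> P (s \<ominus>\<^bsub>S\<^esub> t)"
  shows "P s"
proof -
  obtain f where f: "Poly_Mapping.keys f \<subseteq> D" "s = cls f" using S_elem[OF s] by blast
  have "Poly_Mapping.keys f \<subseteq> D \<Longrightarrow> Poly_Mapping.keys f \<subseteq> D \<and> P (cls f)"
  proof (induction f rule: frag_induction)
    case zero
    then show ?case using assms(2) by (simp add: cls_zero)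
  next
    case (one p)
    then show ?case using assms(3) unfolding D_def tens_def by auto
  next
    case (diff a b)
    then show ?case using assms(4)[OF cls_closed cls_closed] keys_diff_D[of a b] by (simp add: cls_diff)
  qed
  then show ?thesis using f by blast
qed

text \<open>The scalar action, a union over representatives, is multiplication by
  \<open>tens \<one> \<alpha>\<close>; so it does not depend on them, and scalar laws reduce to ring
  laws.\<close>

lemma smult_S:
  assumes a: "\<alpha> \<in> carrier K" and s: "s \<in> carrier S"
  shows "\<alpha> \<odot>\<^bsub>S\<^esub> s = tens \<one> \<alpha> \<otimes>\<^bsub>S\<^esub> s"
proof -
  obtain f where f: "Poly_Mapping.keys f \<subseteq> D" "s = cls f" using S_elem[OF s] by blast
  interpret I: ideal N "free_on_pairs R K" by (rule ideal_N)
  have e: "\<alpha> \<odot>\<^bsub>free_on_pairs R K\<^esub> g = fm (frag_of (\<one>, \<alpha>)) g" if g: "Poly_Mapping.keys g \<subseteq> D" for g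
  proof -
    have "\<alpha> \<odot>\<^bsub>free_on_pairs R K\<^esub> g = frag_extend (\<lambda>q. frag_of (fst q, \<alpha> \<otimes>\<^bsub>K\<^esub> snd q)) g"
      by (simp add: free_on_pairs_def case_prod_unfold)
    also have "\<dots> = frag_extend (\<lambda>q. frag_of (\<one> \<otimes> fst q, \<alpha> \<otimes>\<^bsub>K\<^esub> snd q)) g"
      by (rule frag_extend_eq) (use g in \<open>auto simp: D_def\<close>)
    finally show ?thesis unfolding fm_eq by simp
  qed
  have "cls (\<alpha> \<odot>\<^bsub>free_on_pairs R K\<^esub> g) = tens \<one> \<alpha> \<otimes>\<^bsub>S\<^esub> s" if g: "g \<in> cls f" for g
  proof -
    have gD: "Poly_Mapping.keys g \<subseteq> D"
      using g FP.a_r_coset_subset_G[of N f] I.a_subset f(1) unfolding cls_def by (auto simp: FP_simps)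
    have "cls g = cls f"
      using FP.a_repr_independence[OF g[unfolded cls_def] _ I.a_subgroup] f(1) unfolding cls_def by (simp add: FP_simps)
    then show ?thesis unfolding e[OF gD] tens_def f(2) using cls_mult[OF keys_D gD] a by simp
  qed
  moreover have "f \<in> cls f" unfolding cls_def by (rule I.a_rcos_self) (use f in \<open>simp add: FP_simps\<close>)
  moreover have "\<alpha> \<odot>\<^bsub>S\<^esub> s = (\<Union>g\<in>s. cls (\<alpha> \<odot>\<^bsub>free_on_pairs R K\<^esub> g))"
    unfolding S_eq quot_algebra_def cls_def by simp
  ultimately show ?thesis unfolding f(2) by auto
qed

lemma smult_S_one: "s \<in> carrier S \<Longrightarrow> \<one>\<^bsub>K\<^esub> \<odot>\<^bsub>S\<^esub> s = s"
  using smult_S[of "\<one>\<^bsub>K\<^esub>" s] by (simp add: tens_one)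

lemma smult_S_minus_one:
  assumes s: "s \<in> carrier S" shows "(\<ominus>\<^bsub>K\<^esub> \<one>\<^bsub>K\<^esub>) \<odot>\<^bsub>S\<^esub> s = \<ominus>\<^bsub>S\<^esub> s"
proof -
  have "tens \<one> (\<ominus>\<^bsub>K\<^esub> \<one>\<^bsub>K\<^esub>) \<oplus>\<^bsub>S\<^esub> \<one>\<^bsub>S\<^esub> = \<zero>\<^bsub>S\<^esub>"
    using tens_add_right[of \<one> "\<ominus>\<^bsub>K\<^esub> \<one>\<^bsub>K\<^esub>" "\<one>\<^bsub>K\<^esub>"] tens_zero_right[of \<one>] by (simp add: tens_one K.l_neg)
  then have "tens \<one> (\<ominus>\<^bsub>K\<^esub> \<one>\<^bsub>K\<^esub>) = \<ominus>\<^bsub>S\<^esub> \<one>\<^bsub>S\<^esub>"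
    using S.minus_equality[of "tens \<one> (\<ominus>\<^bsub>K\<^esub> \<one>\<^bsub>K\<^esub>)" "\<one>\<^bsub>S\<^esub>"] tens_closed[of \<one> "\<ominus>\<^bsub>K\<^esub> \<one>\<^bsub>K\<^esub>"] by simp
  then show ?thesis using smult_S[of "\<ominus>\<^bsub>K\<^esub> \<one>\<^bsub>K\<^esub>" s] s by (simp add: S.l_minus)
qed

text \<open>The map of the extension back to \<open>R\<close> induced by a functional
  \<open>l\<close> on \<open>K\<close>. It is built on the free abelian group and kills the
  relations, so the choice of a representative by \<open>SOME\<close> does not matter.\<close>

lemma contraction_exists:
  assumes l: "\<And>c. c \<in> carrier K \<Longrightarrow> l c \<in> carrier k"
    "\<And>c d. \<lbrakk>c \<in> carrier K; d \<in> carrier K\<rbrakk> \<Longrightarrow> l (c \<oplus>\<^bsub>K\<^esub> d) = l c \<oplus>\<^bsub>k\<^esub> l d"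
    "\<And>a c. \<lbrakk>a \<in> carrier k; c \<in> carrier K\<rbrakk> \<Longrightarrow> l (h a \<otimes>\<^bsub>K\<^esub> c) = a \<otimes>\<^bsub>k\<^esub> l c"
  shows "\<exists>L. (\<forall>s\<in>carrier S. L s \<in> carrier R) \<and>
    (\<forall>s\<in>carrier S. \<forall>t\<in>carrier S. L (s \<oplus>\<^bsub>S\<^esub> t) = L s \<oplus> L t) \<and>
    (\<forall>x\<in>carrier R. \<forall>c\<in>carrier K. L (tens x c) = l c \<odot> x)"
proof -
  have im: "(\<lambda>(x, c). l c \<odot> x) ` D \<subseteq> carrier (add_monoid R)" unfolding D_def using l(1) by auto
  obtain \<phi> where ph: "\<phi> \<in> hom (free_Abelian_group D) (add_monoid R)"
    and phi: "\<And>p. p \<in> D \<Longrightarrow> \<phi> (frag_of p) = (case p of (x, c) \<Rightarrow> l c \<odot> x)"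
    using comm_group.free_Abelian_group_universal[OF M.a_comm_group im] by blast
  have pc: "\<phi> f \<in> carrier R" if "Poly_Mapping.keys f \<subseteq> D" for f using ph that unfolding hom_def by auto
  have pa: "\<phi> (f + g) = \<phi> f \<oplus> \<phi> g" if "Poly_Mapping.keys f \<subseteq> D" "Poly_Mapping.keys g \<subseteq> D" for f g
    using ph that unfolding hom_def by auto
  have p0: "\<phi> 0 = \<zero>" using pa[of 0 0] pc[of 0] by simp
  have pd: "\<phi> (f - g) = \<phi> f \<ominus> \<phi> g" if fg: "Poly_Mapping.keys f \<subseteq> D" "Poly_Mapping.keys g \<subseteq> D" for f g
  proof -
    have "\<phi> f = \<phi> (f - g) \<oplus> \<phi> g" using pa[OF keys_diff_D[OF fg] fg(2)] by simp
    then show ?thesis using pc fg pc[OF keys_diff_D[OF fg]] by (simp add: a_minus_def M.a_assoc M.r_neg)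
  qed
  have pof: "\<phi> (frag_of (x, c)) = l c \<odot> x" if "x \<in> carrier R" "c \<in> carrier K" for x c
    using phi[of "(x, c)"] that unfolding D_def by simp
  have sub: "p \<oplus> q \<ominus> p \<ominus> q = \<zero>" if "p \<in> carrier R" "q \<in> carrier R" for p q
    using that by algebra
  have prel: "\<phi> t = \<zero>" if t: "t \<in> tensor_relations k R K h" for t
    using t
  proof (cases rule: relations_cases)
    case (1 x y c)
    then show ?thesis using keys_D l(1)
      by (simp add: pd keys_diff_D pof smult_r_distr sub)
  next
    case (2 x c d)
    then show ?thesis using keys_D l(1,2)
      by (simp add: pd keys_diff_D pof smult_l_distr sub)
  next
    case (3 a x c)
    have "l c \<odot> (a \<odot> x) = (a \<otimes>\<^bsub>k\<^esub> l c) \<odot> x"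
      using 3 l(1) by (simp add: smult_assoc1[symmetric] R.m_comm)
    then show ?thesis using 3 keys_D h_props(1) l(1,3)
      by (simp add: pd pof a_minus_def M.r_neg)
  qed
  have pN: "\<phi> t = \<zero>" if "t \<in> N" for t
    using that unfolding N_def
  proof (induction rule: generate.induct)
    case (inv r)
    then have "\<phi> (0 - r) = \<phi> 0 \<ominus> \<phi> r" using relations_D by (intro pd) auto
    then show ?case using inv prel relations_D p0 by (simp add: a_minus_def)
  next
    case (eng s t)
    then have "s \<in> N" "t \<in> N" unfolding N_def by auto
    then show ?case using eng pa[OF N_D N_D] by simp
  qed (use p0 prel in auto)
  define L where "L s = \<phi> (SOME f. Poly_Mapping.keys f \<subseteq> D \<and> s = cls f)" for s
  have L: "L (cls f) = \<phi> f" if f: "Poly_Mapping.keys f \<subseteq> D" for f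
  proof -
    define g where "g = (SOME g. Poly_Mapping.keys g \<subseteq> D \<and> cls f = cls g)"
    have "Poly_Mapping.keys g \<subseteq> D \<and> cls f = cls g" unfolding g_def by (rule someI[of _ f]) (use f in simp)
    then have g: "Poly_Mapping.keys g \<subseteq> D" "f - g \<in> N" using cls_eq_iff[OF f] by auto
    have "\<phi> f \<ominus> \<phi> g = \<zero>" using pN[OF g(2)] pd[OF f g(1)] by simp
    then have "\<phi> f = \<phi> g" using pc f g(1) by simp
    then show ?thesis unfolding L_def g_def by simp
  qed
  have "L s \<in> carrier R" if "s \<in> carrier S" for s using S_elem[OF that] L pc by auto
  moreover have "L (s \<oplus>\<^bsub>S\<^esub> t) = L s \<oplus> L t" if s: "s \<in> carrier S" and t: "t \<in> carrier S" for s t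
  proof -
    obtain f where f: "Poly_Mapping.keys f \<subseteq> D" "s = cls f" using S_elem[OF s] by blast
    obtain g where g: "Poly_Mapping.keys g \<subseteq> D" "t = cls g" using S_elem[OF t] by blast
    show ?thesis unfolding f(2) g(2) cls_add[OF f(1) g(1), symmetric]
      using L[OF keys_add_D[OF f(1) g(1)]] L[OF f(1)] L[OF g(1)] pa[OF f(1) g(1)] by simp
  qed
  moreover have "L (tens x c) = l c \<odot> x" if "x \<in> carrier R" "c \<in> carrier K" for x c
    unfolding tens_def using L[OF keys_D[OF that]] pof[OF that] by simp
  ultimately show ?thesis by (intro exI[of _ L]) blast
qed

end

section \<open>Multilinearity of standard polynomials and extension of identities\<close>

context ring
begin

lemma word_val_linear:
  assumes L: "distinct L" "i \<in> set L" and a: "\<And>j. a j \<in> carrier R" and st: "s \<in> carrier R" "t \<in> carrier R"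
  shows "word_val R (map (a(i := s \<ominus> t)) L) = word_val R (map (a(i := s)) L) \<ominus> word_val R (map (a(i := t)) L)"
proof -
  obtain u v where uv: "L = u @ i # v" using L(2) by (meson split_list)
  then have ni: "i \<notin> set u" "i \<notin> set v" using L(1) by auto
  have m: "map (a(i := z)) L = map a u @ z # map a v" for z
    unfolding uv using ni by (simp add: map_fun_upd)
  have c: "word_val R (map a u) \<in> carrier R" "word_val R (map a v) \<in> carrier R"
    using a by (auto intro!: word_val_closed)
  have w: "word_val R (map (a(i := z)) L) = word_val R (map a u) \<otimes> (z \<otimes> word_val R (map a v))"
    if "z \<in> carrier R" for z
    unfolding m using a that by (subst word_val_append) auto
  show ?thesis using st c by (simp add: w a_minus_def l_distr r_distr l_minus r_minus)
qed

lemma alt_diff: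
  assumes "\<And>p. p permutes {..<D} \<Longrightarrow> F p \<in> carrier R" "\<And>p. p permutes {..<D} \<Longrightarrow> G p \<in> carrier R"
  shows "alt D (\<lambda>p. F p \<ominus> G p) = alt D F \<ominus> alt D G"
proof -
  have "alt D F = alt D (\<lambda>p. (F p \<ominus> G p) \<oplus> G p)"
    using assms by (intro alt_cong) (auto simp: a_minus_def a_assoc l_neg)
  also have "\<dots> = alt D (\<lambda>p. F p \<ominus> G p) \<oplus> alt D G" using assms by (intro alt_add) auto
  finally show ?thesis using assms alt_closed[of D "\<lambda>p. F p \<ominus> G p"] alt_closed[of D G]
    by (simp add: a_minus_def a_assoc r_neg)
qed

lemma stdp_linear:
  assumes i: "i < D" and a: "\<And>j. a j \<in> carrier R" and st: "s \<in> carrier R" "t \<in> carrier R"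
  shows "stdp D (a(i := s \<ominus> t)) = stdp D (a(i := s)) \<ominus> stdp D (a(i := t))"
    and "rstdp D (a(i := s \<ominus> t)) = rstdp D (a(i := s)) \<ominus> rstdp D (a(i := t))"
proof -
  have wc: "word_val R (map (a(i := z)) L) \<in> carrier R" if "z \<in> carrier R" for z L
    using a that by (intro word_val_closed) auto
  have d: "distinct (map p L) \<and> i \<in> set (map p L)" if p: "p permutes {..<D}" and "distinct L" "set L = {..<D}" for p L
    using that permutes_image[OF p] i by (auto simp: distinct_map intro: inj_on_subset[OF permutes_inj])
  have e: "alt D (\<lambda>p. word_val R (map (a(i := s \<ominus> t)) (map p L))) =
      alt D (\<lambda>p. word_val R (map (a(i := s)) (map p L))) \<ominus> alt D (\<lambda>p. word_val R (map (a(i := t)) (map p L)))"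
    if L: "distinct L" "set L = {..<D}" for L
  proof -
    have "alt D (\<lambda>p. word_val R (map (a(i := s \<ominus> t)) (map p L))) =
        alt D (\<lambda>p. word_val R (map (a(i := s)) (map p L)) \<ominus> word_val R (map (a(i := t)) (map p L)))"
    proof (rule alt_cong)
      fix p :: "nat \<Rightarrow> nat" assume p: "p permutes {..<D}"
      show "word_val R (map (a(i := s \<ominus> t)) (map p L)) =
          word_val R (map (a(i := s)) (map p L)) \<ominus> word_val R (map (a(i := t)) (map p L))"
        using d[OF p L] a st by (intro word_val_linear) auto
    qed (rule minus_closed[OF wc[OF st(1)] wc[OF st(2)]])
    also have "\<dots> = alt D (\<lambda>p. word_val R (map (a(i := s)) (map p L))) \<ominus> alt D (\<lambda>p. word_val R (map (a(i := t)) (map p L)))"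
      by (rule alt_diff) (rule wc, rule st)+
    finally show ?thesis .
  qed
  show "stdp D (a(i := s \<ominus> t)) = stdp D (a(i := s)) \<ominus> stdp D (a(i := t))"
    using e[of "[0..<D]"] unfolding stdp_def by (simp add: lessThan_atLeast0)
  show "rstdp D (a(i := s \<ominus> t)) = rstdp D (a(i := s)) \<ominus> rstdp D (a(i := t))"
    using e[of "rev [0..<D]"] unfolding rstdp_def by (simp add: lessThan_atLeast0)
qed

lemma stdp_cong:
  assumes "\<And>i. i < D \<Longrightarrow> a i = b i" "\<And>i. b i \<in> carrier R"
  shows "stdp D a = stdp D b" "rstdp D a = rstdp D b"
proof -
  have m: "map (a \<circ> p) L = map (b \<circ> p) L" if p: "p permutes {..<D}" and "set L \<subseteq> {..<D}" for p L
    using that assms(1) permutes_in_image[OF p] by (intro map_cong) auto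
  show "stdp D a = stdp D b"
    unfolding stdp_def
  proof (rule alt_cong)
    fix p :: "nat \<Rightarrow> nat" assume p: "p permutes {..<D}"
    show "word_val R (map (a \<circ> p) ([0..<D])) = word_val R (map (b \<circ> p) ([0..<D]))"
      by (rule arg_cong[OF m[OF p]]) auto
  qed (use assms(2) in \<open>auto intro!: word_val_closed\<close>)
  show "rstdp D a = rstdp D b"
    unfolding rstdp_def
  proof (rule alt_cong)
    fix p :: "nat \<Rightarrow> nat" assume p: "p permutes {..<D}"
    show "word_val R (map (a \<circ> p) (rev [0..<D])) = word_val R (map (b \<circ> p) (rev [0..<D]))"
      by (rule arg_cong[OF m[OF p]]) auto
  qed (use assms(2) in \<open>auto intro!: word_val_closed\<close>)
qed

end

lemma (in comm_monoid) word_val_finprod: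
  "\<lbrakk>distinct L; \<And>i. f i \<in> carrier G\<rbrakk> \<Longrightarrow> foldr (\<otimes>) (map f L) \<one> = finprod G f (set L)"
  by (induction L) (auto simp: Pi_def)

context scalar_extension
begin

lemma word_val_tens:
  assumes "\<And>i. x i \<in> carrier R" "\<And>i. c i \<in> carrier K"
  shows "word_val S (map (\<lambda>i. tens (x i) (c i)) L) = tens (word_val R (map x L)) (word_val K (map c L))"
proof (induction L)
  case (Cons i L)
  have "word_val R (map x L) \<in> carrier R" "word_val K (map c L) \<in> carrier K"
    using assms by (auto intro!: A.word_val_closed K.word_val_closed)
  then show ?case using Cons assms by (simp add: tens_mult)
qed (simp add: tens_one)

text \<open>The scalar factors commute, so every permutation produces the same product
  \<open>g\<close>, which comes out of the alternating sum.\<close>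

lemma stdp_tens:
  assumes x: "\<And>i. x i \<in> carrier R" and c: "\<And>i. c i \<in> carrier K"
  shows "\<exists>g\<in>carrier K. S.stdp d (\<lambda>i. tens (x i) (c i)) = tens (A.stdp d x) g"
    and "\<exists>g\<in>carrier K. S.rstdp d (\<lambda>i. tens (x i) (c i)) = tens (A.rstdp d x) g"
proof -
  define g where "g = finprod K c {..<d}"
  have g: "g \<in> carrier K" unfolding g_def using c by (intro K.finprod_closed) auto
  have e: "S.alt d (\<lambda>p. word_val S (map ((\<lambda>i. tens (x i) (c i)) \<circ> p) L)) =
      tens (A.alt d (\<lambda>p. word_val R (map (x \<circ> p) L))) g" if L: "distinct L" "set L = {..<d}" for L
  proof -
    have wc: "word_val R (map (x \<circ> p) L) \<in> carrier R" for p using x by (intro A.word_val_closed) auto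
    have "S.alt d (\<lambda>p. word_val S (map ((\<lambda>i. tens (x i) (c i)) \<circ> p) L)) =
        S.alt d (\<lambda>p. tens (word_val R (map (x \<circ> p) L)) g)"
    proof (rule S.alt_cong)
      fix p :: "nat \<Rightarrow> nat" assume p: "p permutes {..<d}"
      have "word_val K (map (c \<circ> p) L) = finprod K (c \<circ> p) {..<d}"
        using K.word_val_finprod[OF L(1), of "c \<circ> p"] c L(2) unfolding word_val_def by simp
      also have "\<dots> = finprod K c (p ` {..<d})"
        using c permutes_inj_on[OF p] by (subst K.finprod_reindex) (auto simp: o_def)
      also have "\<dots> = g" unfolding g_def permutes_image[OF p] ..
      finally have "word_val K (map (c \<circ> p) L) = g" .
      then show "word_val S (map ((\<lambda>i. tens (x i) (c i)) \<circ> p) L) = tens (word_val R (map (x \<circ> p) L)) g"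
        using word_val_tens[of "x \<circ> p" "c \<circ> p" L] x c by (simp add: o_def)
      show "tens (word_val R (map (x \<circ> p) L)) g \<in> carrier S" by (rule tens_closed[OF wc g])
    qed
    also have "\<dots> = tens (A.alt d (\<lambda>p. word_val R (map (x \<circ> p) L))) g"
      by (rule alt_hom[OF ring S.ring_axioms tens_closed[OF _ g] tens_add_left[OF _ _ g] wc, symmetric])
    finally show ?thesis .
  qed
  show "\<exists>g\<in>carrier K. S.stdp d (\<lambda>i. tens (x i) (c i)) = tens (A.stdp d x) g"
    using e[of "[0..<d]"] g unfolding S.stdp_def A.stdp_def by (auto simp: lessThan_atLeast0)
  show "\<exists>g\<in>carrier K. S.rstdp d (\<lambda>i. tens (x i) (c i)) = tens (A.rstdp d x) g"
    using e[of "rev [0..<d]"] g unfolding S.rstdp_def A.rstdp_def by (auto simp: lessThan_atLeast0)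
qed

definition pure :: "(('r \<times> 'c) \<Rightarrow>\<^sub>0 int) set \<Rightarrow> bool" where
  "pure s \<longleftrightarrow> (\<exists>x\<in>carrier R. \<exists>c\<in>carrier K. s = tens x c)"

lemma pure_closed: "pure s \<Longrightarrow> s \<in> carrier S"
  unfolding pure_def using tens_closed by blast

lemma pure_zero: "pure \<zero>\<^bsub>S\<^esub>"
  unfolding pure_def using tens_zero_left[of "\<zero>\<^bsub>K\<^esub>"] by (intro bexI[of _ \<zero>] bexI[of _ "\<zero>\<^bsub>K\<^esub>"]) auto

text \<open>Arguments are reduced to pure tensors one position at a time; in the induction those
  from \<open>m\<close> on are already pure.\<close>

lemma multilinear_mem:
  fixes d :: nat
  assumes J: "ideal J S"
    and lin: "\<And>a i s t. \<lbrakk>i < d; \<And>j. a j \<in> carrier S; s \<in> carrier S; t \<in> carrier S; F (a(i := s)) \<in> J; F (a(i := t)) \<in> J\<rbrakk>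
      \<Longrightarrow> F (a(i := s \<ominus>\<^bsub>S\<^esub> t)) \<in> J"
    and cong: "\<And>a b. \<lbrakk>\<And>i. i < d \<Longrightarrow> a i = b i; \<And>i. b i \<in> carrier S\<rbrakk> \<Longrightarrow> F a = F b"
    and p: "\<And>a. (\<And>i. pure (a i)) \<Longrightarrow> F a \<in> J" and a: "\<And>i. a i \<in> carrier S"
  shows "F a \<in> J"
proof -
  have main: "\<lbrakk>m \<le> d; \<And>i. a i \<in> carrier S; \<And>i. m \<le> i \<Longrightarrow> pure (a i)\<rbrakk> \<Longrightarrow> F a \<in> J" for m a
  proof (induction m arbitrary: a)
    case 0
    then show ?case using p by simp
  next
    case (Suc m)
    have "F (a(m := s)) \<in> J" if "s \<in> carrier S" for s
      using that
    proof (induction rule: tens_induct)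
      case zero
      show ?case
        by (rule Suc.IH) (use Suc.prems pure_zero S.zero_closed in \<open>auto simp: le_Suc_eq Suc_le_eq\<close>)
    next
      case (tens x c)
      then have "pure (tens x c)" unfolding pure_def by blast
      then show ?case
        using Suc.prems pure_closed by (intro Suc.IH) (auto simp: Suc_le_eq)
    next
      case (diff s t)
      show ?case by (rule lin[OF _ Suc.prems(2) diff]) (use Suc.prems(1) in simp)
    qed
    from this[of "a m"] show ?case using Suc.prems(2) by simp
  qed
  \<comment> \<open>The induction wants purity at every index from \<open>d\<close> on. Zero is
    pure, and \<open>cong\<close> allows these positions to be changed.\<close>
  define a' where "a' i = (if i < d then a i else \<zero>\<^bsub>S\<^esub>)" for i
  have "F a' \<in> J" by (rule main[OF le_refl]) (use a pure_zero in \<open>auto simp: a'_def\<close>)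
  moreover have "F a' = F a" by (rule cong) (use a in \<open>auto simp: a'_def\<close>)
  ultimately show ?thesis by simp
qed

lemma identity_extends:
  assumes J: "ideal J S"
    and id: "\<And>a b c. \<lbrakk>\<And>i. a i \<in> carrier R; \<And>i. b i \<in> carrier R; \<And>i. c i \<in> carrier R\<rbrakk> \<Longrightarrow>
      tens (A.stdp d a \<otimes> (A.stdp d b \<otimes> A.rstdp e c)) \<one>\<^bsub>K\<^esub> \<in> J"
    and abc: "\<And>i. a i \<in> carrier S" "\<And>i. b i \<in> carrier S" "\<And>i. c i \<in> carrier S"
  shows "S.stdp d a \<otimes>\<^bsub>S\<^esub> (S.stdp d b \<otimes>\<^bsub>S\<^esub> S.rstdp e c) \<in> J"
proof -
  interpret J: ideal J S by fact
  let ?P = "\<lambda>a b c. S.stdp d a \<otimes>\<^bsub>S\<^esub> (S.stdp d b \<otimes>\<^bsub>S\<^esub> S.rstdp e c)"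
  have diffJ: "s \<ominus>\<^bsub>S\<^esub> t \<in> J" if "s \<in> J" "t \<in> J" for s t
    using that by (simp add: a_minus_def J.a_closed J.a_inv_closed)
  note cl = S.stdp_closed S.rstdp_closed
  have tri: "x \<otimes>\<^bsub>S\<^esub> (y \<ominus>\<^bsub>S\<^esub> z) = x \<otimes>\<^bsub>S\<^esub> y \<ominus>\<^bsub>S\<^esub> x \<otimes>\<^bsub>S\<^esub> z" "(y \<ominus>\<^bsub>S\<^esub> z) \<otimes>\<^bsub>S\<^esub> x = y \<otimes>\<^bsub>S\<^esub> x \<ominus>\<^bsub>S\<^esub> z \<otimes>\<^bsub>S\<^esub> x"
    if "x \<in> carrier S" "y \<in> carrier S" "z \<in> carrier S" for x y z
    using that by (simp_all add: a_minus_def S.l_distr S.r_distr S.l_minus S.r_minus)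
  have 0: "?P a b c \<in> J" if "\<And>i. pure (a i)" "\<And>i. pure (b i)" "\<And>i. pure (c i)" for a b c
  proof -
    have split: "\<exists>x g. (\<forall>i. x i \<in> carrier R) \<and> (\<forall>i. g i \<in> carrier K) \<and> a = (\<lambda>i. tens (x i) (g i))"
      if "\<And>i. pure (a i)" for a :: "nat \<Rightarrow> (('r \<times> 'c) \<Rightarrow>\<^sub>0 int) set"
    proof -
      have "\<forall>i. \<exists>xg. fst xg \<in> carrier R \<and> snd xg \<in> carrier K \<and> a i = tens (fst xg) (snd xg)"
        using that unfolding pure_def by fastforce
      from choice[OF this] obtain f where "\<forall>i. fst (f i) \<in> carrier R \<and> snd (f i) \<in> carrier K \<and> a i = tens (fst (f i)) (snd (f i))"
        by (rule exE)
      then show ?thesis by (intro exI[of _ "\<lambda>i. fst (f i)"] exI[of _ "\<lambda>i. snd (f i)"]) auto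
    qed
    from split[of a, OF that(1)] obtain xa ga where A1: "\<forall>i. xa i \<in> carrier R" "\<forall>i. ga i \<in> carrier K" "a = (\<lambda>i. tens (xa i) (ga i))" by (elim exE conjE) (rule that)
    from split[of b, OF that(2)] obtain xb gb where B1: "\<forall>i. xb i \<in> carrier R" "\<forall>i. gb i \<in> carrier K" "b = (\<lambda>i. tens (xb i) (gb i))" by (elim exE conjE) (rule that)
    from split[of c, OF that(3)] obtain xc gc where C1: "\<forall>i. xc i \<in> carrier R" "\<forall>i. gc i \<in> carrier K" "c = (\<lambda>i. tens (xc i) (gc i))" by (elim exE conjE) (rule that)
    obtain u where u: "u \<in> carrier K" "S.stdp d a = tens (A.stdp d xa) u"
      unfolding A1(3) using stdp_tens(1)[of xa ga d] A1(1,2) by auto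
    obtain v where v: "v \<in> carrier K" "S.stdp d b = tens (A.stdp d xb) v"
      unfolding B1(3) using stdp_tens(1)[of xb gb d] B1(1,2) by auto
    obtain w where w: "w \<in> carrier K" "S.rstdp e c = tens (A.rstdp e xc) w"
      unfolding C1(3) using stdp_tens(2)[of xc gc e] C1(1,2) by auto
    let ?r = "A.stdp d xa \<otimes> (A.stdp d xb \<otimes> A.rstdp e xc)"
    have cr: "A.stdp d xa \<in> carrier R" "A.stdp d xb \<in> carrier R" "A.rstdp e xc \<in> carrier R"
      using A.stdp_closed A.rstdp_closed A1 B1 C1 by blast+
    have "tens ?r \<one>\<^bsub>K\<^esub> \<otimes>\<^bsub>S\<^esub> tens \<one> (u \<otimes>\<^bsub>K\<^esub> (v \<otimes>\<^bsub>K\<^esub> w)) \<in> J"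
      using id[of xa xb xc] A1(1) B1(1) C1(1) u v w by (intro J.I_r_closed tens_closed) auto
    then show ?thesis unfolding u(2) v(2) w(2) using cr u(1) v(1) w(1) by (simp add: tens_mult)
  qed
  \<comment> \<open>From pure arguments in all three factors, three passes free the arguments of one
    factor after the other.\<close>
  have 1: "?P a b c \<in> J" if a: "\<And>i. a i \<in> carrier S" and b: "\<And>i. pure (b i)" and c: "\<And>i. pure (c i)" for a b c
  proof (rule multilinear_mem[OF J, where d = d and F = "\<lambda>a. ?P a b c"])
    have y: "S.stdp d b \<otimes>\<^bsub>S\<^esub> S.rstdp e c \<in> carrier S" using cl b c pure_closed by simp
    show "?P (a(i := s \<ominus>\<^bsub>S\<^esub> t)) b c \<in> J"
      if "i < d" "\<And>j. a j \<in> carrier S" "s \<in> carrier S" "t \<in> carrier S" "?P (a(i := s)) b c \<in> J" "?P (a(i := t)) b c \<in> J" for a i s t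
      using that y by (simp add: S.stdp_linear tri cl diffJ)
    show "?P a b c = ?P a' b c" if "\<And>i. i < d \<Longrightarrow> a i = a' i" "\<And>i. a' i \<in> carrier S" for a a'
      using S.stdp_cong(1)[of d a a'] that by simp
  qed (use 0 a b c in auto)
  have 2: "?P a b c \<in> J" if a: "\<And>i. a i \<in> carrier S" and b: "\<And>i. b i \<in> carrier S" and c: "\<And>i. pure (c i)" for a b c
  proof (rule multilinear_mem[OF J, where d = d and F = "\<lambda>b. ?P a b c"])
    have y: "S.stdp d a \<in> carrier S" "S.rstdp e c \<in> carrier S" using cl a c pure_closed by simp_all
    show "?P a (b(i := s \<ominus>\<^bsub>S\<^esub> t)) c \<in> J"
      if "i < d" "\<And>j. b j \<in> carrier S" "s \<in> carrier S" "t \<in> carrier S" "?P a (b(i := s)) c \<in> J" "?P a (b(i := t)) c \<in> J" for b i s t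
      using that y by (simp add: S.stdp_linear tri cl diffJ)
    show "?P a b c = ?P a b' c" if "\<And>i. i < d \<Longrightarrow> b i = b' i" "\<And>i. b' i \<in> carrier S" for b b'
      using S.stdp_cong(1)[of d b b'] that by simp
  qed (use 1 a b c in auto)
  show ?thesis
  proof (rule multilinear_mem[OF J, where d = e and F = "\<lambda>c. ?P a b c"])
    have y: "S.stdp d a \<in> carrier S" "S.stdp d b \<in> carrier S" using cl abc by simp_all
    show "?P a b (c(i := s \<ominus>\<^bsub>S\<^esub> t)) \<in> J"
      if "i < e" "\<And>j. c j \<in> carrier S" "s \<in> carrier S" "t \<in> carrier S" "?P a b (c(i := s)) \<in> J" "?P a b (c(i := t)) \<in> J" for c i s t
      using that y by (simp add: S.stdp_linear tri cl diffJ)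
    show "?P a b c = ?P a b c'" if "\<And>i. i < e \<Longrightarrow> c i = c' i" "\<And>i. c' i \<in> carrier S" for c c'
      using S.stdp_cong(2)[of e c c'] that by simp
  qed (use 2 abc in auto)
qed

end

section \<open>Tensors over independent scalars and ideals of the extended algebra\<close>

context scalar_extension
begin

text \<open>\<open>K\<close> as an algebra over \<open>k\<close> along \<open>h\<close>, so that
  spans and functionals become available for scalars.\<close>

definition Kmod :: "('k, 'c) module" where
  "Kmod = \<lparr>carrier = carrier K, monoid.mult = monoid.mult K, one = one K, ring.zero = ring.zero K, add = add K,
     smult = (\<lambda>a c. h a \<otimes>\<^bsub>K\<^esub> c)\<rparr>"

lemma Kmod_simps [simp]:
  "carrier Kmod = carrier K" "x \<otimes>\<^bsub>Kmod\<^esub> y = x \<otimes>\<^bsub>K\<^esub> y" "\<one>\<^bsub>Kmod\<^esub> = \<one>\<^bsub>K\<^esub>" "\<zero>\<^bsub>Kmod\<^esub> = \<zero>\<^bsub>K\<^esub>"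
  "x \<oplus>\<^bsub>Kmod\<^esub> y = x \<oplus>\<^bsub>K\<^esub> y" "a \<odot>\<^bsub>Kmod\<^esub> c = h a \<otimes>\<^bsub>K\<^esub> c"
  unfolding Kmod_def by simp_all

lemma kalg_Kmod: "kalg k Kmod"
proof -
  have r: "ring Kmod" by (rule ring_transfer[OF K.ring_axioms]) (simp_all add: Kmod_def)
  interpret r: ring Kmod by (rule r)
  have "Module.module k Kmod"
    by (rule moduleI) (use R.is_cring r.abelian_group_axioms h_props in \<open>auto simp: K.l_distr K.r_distr K.m_assoc\<close>)
  then show ?thesis
    unfolding kalg_def assoc_algebra_def assoc_algebra_axioms_def vectorspace_def
    using r vectorspace_axioms h_props by (auto simp: vectorspace_def K.m_assoc K.m_lcomm)
qed

sublocale KM: kalg k Kmod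
  by (rule kalg_Kmod)

text \<open>Linear independence over \<open>k\<close> of the first \<open>n\<close> scalars, in the
  ordered form that an induction on \<open>n\<close> consumes.\<close>

definition free_seq :: "(nat \<Rightarrow> 'c) \<Rightarrow> nat \<Rightarrow> bool" where
  "free_seq c n \<longleftrightarrow> (\<forall>i. c i \<in> carrier K) \<and> (\<forall>m<n. c m \<notin> KM.lspan (c ` {..<m}))"

definition tsum :: "(nat \<Rightarrow> 'r) \<Rightarrow> (nat \<Rightarrow> 'c) \<Rightarrow> nat \<Rightarrow> (('r \<times> 'c) \<Rightarrow>\<^sub>0 int) set" where
  "tsum x c n = finsum S (\<lambda>i. tens (x i) (c i)) {..<n}"

context
  fixes c :: "nat \<Rightarrow> 'c" assumes c: "\<And>i. c i \<in> carrier K"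
begin

lemma tsum_0: "tsum x c 0 = \<zero>\<^bsub>S\<^esub>"
  unfolding tsum_def by simp

lemma tsum_Suc: "(\<And>i. x i \<in> carrier R) \<Longrightarrow> tsum x c (Suc n) = tens (x n) (c n) \<oplus>\<^bsub>S\<^esub> tsum x c n"
  unfolding tsum_def lessThan_Suc using c tens_closed by (intro S.finsum_insert) auto

lemma tsum_closed: "(\<And>i. x i \<in> carrier R) \<Longrightarrow> tsum x c n \<in> carrier S"
  unfolding tsum_def using c tens_closed by (intro S.finsum_closed) auto

lemma tsum_cong:
  assumes "\<And>i. i < n \<Longrightarrow> x i = y i" "\<And>i. y i \<in> carrier R"
  shows "tsum x c n = tsum y c n"
  unfolding tsum_def using assms c tens_closed by (intro S.finsum_cong') auto

lemma tsum_add: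
  assumes "\<And>i. x i \<in> carrier R" "\<And>i. y i \<in> carrier R"
  shows "tsum (\<lambda>i. x i \<oplus> y i) c n = tsum x c n \<oplus>\<^bsub>S\<^esub> tsum y c n"
proof -
  have "tsum (\<lambda>i. x i \<oplus> y i) c n = finsum S (\<lambda>i. tens (x i) (c i) \<oplus>\<^bsub>S\<^esub> tens (y i) (c i)) {..<n}"
    unfolding tsum_def using assms c tens_closed tens_add_left by (intro S.finsum_cong') auto
  also have "\<dots> = tsum x c n \<oplus>\<^bsub>S\<^esub> tsum y c n"
    unfolding tsum_def using assms c tens_closed by (intro S.finsum_addf) auto
  finally show ?thesis .
qed

lemma tsum_mult:
  assumes x: "\<And>i. x i \<in> carrier R" and r: "r \<in> carrier R"
  shows "tens r \<one>\<^bsub>K\<^esub> \<otimes>\<^bsub>S\<^esub> tsum x c n = tsum (\<lambda>i. r \<otimes> x i) c n"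
    "tsum x c n \<otimes>\<^bsub>S\<^esub> tens r \<one>\<^bsub>K\<^esub> = tsum (\<lambda>i. x i \<otimes> r) c n"
proof -
  have "tens r \<one>\<^bsub>K\<^esub> \<otimes>\<^bsub>S\<^esub> tsum x c n = finsum S (\<lambda>i. tens r \<one>\<^bsub>K\<^esub> \<otimes>\<^bsub>S\<^esub> tens (x i) (c i)) {..<n}"
    unfolding tsum_def using assms c tens_closed by (intro S.finsum_rdistr) auto
  also have "\<dots> = tsum (\<lambda>i. r \<otimes> x i) c n"
    unfolding tsum_def using assms c tens_closed tens_mult by (intro S.finsum_cong') auto
  finally show "tens r \<one>\<^bsub>K\<^esub> \<otimes>\<^bsub>S\<^esub> tsum x c n = tsum (\<lambda>i. r \<otimes> x i) c n" .
  have "tsum x c n \<otimes>\<^bsub>S\<^esub> tens r \<one>\<^bsub>K\<^esub> = finsum S (\<lambda>i. tens (x i) (c i) \<otimes>\<^bsub>S\<^esub> tens r \<one>\<^bsub>K\<^esub>) {..<n}"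
    unfolding tsum_def using assms c tens_closed by (intro S.finsum_ldistr) auto
  also have "\<dots> = tsum (\<lambda>i. x i \<otimes> r) c n"
    unfolding tsum_def using assms c tens_closed tens_mult by (intro S.finsum_cong') auto
  finally show "tsum x c n \<otimes>\<^bsub>S\<^esub> tens r \<one>\<^bsub>K\<^esub> = tsum (\<lambda>i. x i \<otimes> r) c n" .
qed

lemma tsum_minus:
  assumes "\<And>i. x i \<in> carrier R" "\<And>i. y i \<in> carrier R"
  shows "tsum (\<lambda>i. x i \<ominus> y i) c n = tsum x c n \<ominus>\<^bsub>S\<^esub> tsum y c n"
proof -
  have "tsum x c n = tsum (\<lambda>i. (x i \<ominus> y i) \<oplus> y i) c n"
    using assms by (intro tsum_cong) (auto simp: a_minus_def M.a_assoc M.l_neg)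
  also have "\<dots> = tsum (\<lambda>i. x i \<ominus> y i) c n \<oplus>\<^bsub>S\<^esub> tsum y c n" using assms by (intro tsum_add) auto
  finally show ?thesis using assms tsum_closed[of "\<lambda>i. x i \<ominus> y i"] tsum_closed[of y]
    by (simp add: a_minus_def S.a_assoc S.r_neg)
qed

lemma tsum_span:
  assumes x: "x \<in> carrier R" and e: "e \<in> KM.lspan (c ` {..<n})"
  shows "\<exists>y. (\<forall>i. y i \<in> carrier R) \<and> tens x e = tsum y c n"
  using e
proof (induction rule: KM.lspan.induct)
  case zero
  have "tsum (\<lambda>_. \<zero>) c n = finsum S (\<lambda>_. \<zero>\<^bsub>S\<^esub>) {..<n}"
    unfolding tsum_def using c tens_zero_left by (intro S.finsum_cong') auto
  then show ?case using x tens_zero_right by (intro exI[of _ "\<lambda>_. \<zero>"]) auto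
next
  case (step a s v)
  obtain y where y: "\<forall>i. y i \<in> carrier R" "tens x v = tsum y c n" using step by blast
  obtain j where j: "j < n" "s = c j" using step by blast
  have vc: "v \<in> carrier K" using KM.lspan_carrier[OF step(4)] by simp
  let ?z = "\<lambda>i. if j = i then a \<odot> x else \<zero>"
  have "tsum ?z c n = finsum S (\<lambda>i. if j = i then tens (a \<odot> x) (c i) else \<zero>\<^bsub>S\<^esub>) {..<n}"
    unfolding tsum_def using c x step(1) tens_zero_left tens_closed by (intro S.finsum_cong') auto
  also have "\<dots> = tens (a \<odot> x) (c j)"
    using j(1) c x step(1) tens_closed by (intro S.finsum_singleton) auto
  also have "\<dots> = tens x (h a \<otimes>\<^bsub>K\<^esub> s)" unfolding j(2) using tens_balanced step(1) x c by simp
  finally have "tens x (a \<odot>\<^bsub>Kmod\<^esub> s \<oplus>\<^bsub>Kmod\<^esub> v) = tsum ?z c n \<oplus>\<^bsub>S\<^esub> tsum y c n"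
    using tens_add_right[OF x _ vc] y(2) c j(2) h_props(1)[OF step(1)] by simp
  also have "\<dots> = tsum (\<lambda>i. ?z i \<oplus> y i) c n" using y(1) x step(1) by (intro tsum_add[symmetric]) auto
  finally show ?case using y(1) x step(1) by (intro exI[of _ "\<lambda>i. ?z i \<oplus> y i"]) auto
qed

text \<open>A functional on \<open>K\<close> that is one at \<open>c n\<close> and zero at the
  earlier scalars induces a contraction to \<open>R\<close> which isolates the coefficient
  \<open>y n\<close>.\<close>

lemma tsum_eq_zero:
  assumes f: "free_seq c n" and y: "\<And>i. y i \<in> carrier R" and z: "tsum y c n = \<zero>\<^bsub>S\<^esub>"
  shows "\<forall>i<n. y i = \<zero>"
  using f z
proof (induction n)
  case (Suc n)
  have nf: "c n \<notin> KM.lspan (c ` {..<n})" using Suc.prems(1) unfolding free_seq_def by blast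
  have "c n \<in> carrier Kmod" using c by simp
  from KM.functional_exists[OF KM.subsp_lspan this nf] obtain l where
    l: "\<forall>v\<in>carrier K. l v \<in> carrier k" "\<forall>u\<in>carrier K. \<forall>v\<in>carrier K. l (u \<oplus>\<^bsub>K\<^esub> v) = l u \<oplus>\<^bsub>k\<^esub> l v"
      "\<forall>a\<in>carrier k. \<forall>v\<in>carrier K. l (h a \<otimes>\<^bsub>K\<^esub> v) = a \<otimes>\<^bsub>k\<^esub> l v"
      "\<forall>v\<in>KM.lspan (c ` {..<n}). l v = \<zero>\<^bsub>k\<^esub>" "l (c n) = \<one>\<^bsub>k\<^esub>" by auto
  from contraction_exists[of l] l(1-3) obtain L where
    L: "\<forall>s\<in>carrier S. L s \<in> carrier R" "\<forall>s\<in>carrier S. \<forall>t\<in>carrier S. L (s \<oplus>\<^bsub>S\<^esub> t) = L s \<oplus> L t"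
      "\<forall>x\<in>carrier R. \<forall>c\<in>carrier K. L (tens x c) = l c \<odot> x" by auto
  have "L (tsum y c (Suc n)) = finsum R (\<lambda>i. L (tens (y i) (c i))) {..<Suc n}"
    unfolding tsum_def using L y c tens_closed
    by (intro finsum_hom[OF S.abelian_group_axioms M.abelian_group_axioms]) auto
  also have "\<dots> = finsum R (\<lambda>i. if n = i then y i else \<zero>) {..<Suc n}"
  proof (rule M.finsum_cong')
    fix i assume i: "i \<in> {..<Suc n}"
    show "L (tens (y i) (c i)) = (if n = i then y i else \<zero>)"
    proof (cases "n = i")
      case True
      then show ?thesis using L(3) y c l(5) by (auto simp: smult_one)
    next
      case False
      then have "c i \<in> KM.lspan (c ` {..<n})" using i c by (intro KM.lspan_base) auto
      then show ?thesis using L(3) y c l(4) False by (simp add: smult_l_null)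
    qed
  qed (use y in auto)
  also have "\<dots> = y n" using y by (intro M.finsum_singleton) auto
  finally have "y n = L \<zero>\<^bsub>S\<^esub>" using Suc.prems(2) by simp
  moreover have "L \<zero>\<^bsub>S\<^esub> = \<zero>"
  proof -
    have "L \<zero>\<^bsub>S\<^esub> \<oplus> L \<zero>\<^bsub>S\<^esub> = L \<zero>\<^bsub>S\<^esub>" using L(2)[rule_format, of "\<zero>\<^bsub>S\<^esub>" "\<zero>\<^bsub>S\<^esub>"] by simp
    then show ?thesis using L(1)[rule_format, of "\<zero>\<^bsub>S\<^esub>"] by simp
  qed
  ultimately have yn: "y n = \<zero>" by simp
  then have "tsum y c n = \<zero>\<^bsub>S\<^esub>"
    using Suc.prems(2) tsum_Suc[of y n] tens_zero_left[OF c] tsum_closed[of y n] y by simp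
  moreover have "free_seq c n" using Suc.prems(1) unfolding free_seq_def by simp
  ultimately show ?case using Suc.IH yn less_Suc_eq by auto
qed simp

text \<open>The commutators \<open>x\<^sub>n r t - t r x\<^sub>n\<close> lie in \<open>J\<close> and have fewer terms. If they all vanish, every
  coefficient is proportional to \<open>x\<^sub>n\<close> and \<open>t\<close> is a pure tensor.\<close>

lemma ideal_contains_pure:
  assumes J: "ideal J S"
    and central: "\<And>a b. \<lbrakk>a \<in> carrier R; b \<in> carrier R; a \<noteq> \<zero>; \<And>s. s \<in> carrier R \<Longrightarrow> a \<otimes> s \<otimes> b = b \<otimes> s \<otimes> a\<rbrakk>
      \<Longrightarrow> \<exists>q\<in>carrier k. b = q \<odot> a"
    and "free_seq c n" "\<And>i. x i \<in> carrier R" "tsum x c n \<in> J" "tsum x c n \<noteq> \<zero>\<^bsub>S\<^esub>"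
  shows "\<exists>r\<in>carrier R. r \<noteq> \<zero> \<and> tens r \<one>\<^bsub>K\<^esub> \<in> J"
  using assms(3-)
proof (induction n arbitrary: x)
  case 0
  then show ?case using tsum_0 by simp
next
  case (Suc n)
  interpret J: ideal J S by fact
  have x: "\<And>i. x i \<in> carrier R" by (rule Suc.prems(2))
  have f: "free_seq c n" using Suc.prems(1) unfolding free_seq_def by simp
  define u where "u r i = x n \<otimes> r \<otimes> x i \<ominus> x i \<otimes> (r \<otimes> x n)" for r i
  have uc: "u r i \<in> carrier R" if "r \<in> carrier R" for r i unfolding u_def using x that by simp
  have uJ: "tsum (u r) c n \<in> J" if r: "r \<in> carrier R" for r
  proof -
    have "tens (x n \<otimes> r) \<one>\<^bsub>K\<^esub> \<otimes>\<^bsub>S\<^esub> tsum x c (Suc n) \<ominus>\<^bsub>S\<^esub> tsum x c (Suc n) \<otimes>\<^bsub>S\<^esub> tens (r \<otimes> x n) \<one>\<^bsub>K\<^esub> \<in> J"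
      using Suc.prems(3) x r tens_closed J.I_l_closed J.I_r_closed J.a_closed J.a_inv_closed by (simp add: a_minus_def)
    moreover have "tens (x n \<otimes> r) \<one>\<^bsub>K\<^esub> \<otimes>\<^bsub>S\<^esub> tsum x c (Suc n) \<ominus>\<^bsub>S\<^esub> tsum x c (Suc n) \<otimes>\<^bsub>S\<^esub> tens (r \<otimes> x n) \<one>\<^bsub>K\<^esub>
        = tsum (u r) c (Suc n)"
      unfolding u_def using x r by (subst tsum_minus) (auto simp: tsum_mult)
    moreover have "u r n = \<zero>" unfolding u_def using x r by (simp add: A.m_assoc a_minus_def M.r_neg)
    then have "tsum (u r) c (Suc n) = tsum (u r) c n"
      using tsum_Suc[of "u r" n] uc[OF r] tens_zero_left[OF c] tsum_closed[of "u r" n] by simp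
    ultimately show ?thesis by simp
  qed
  show ?case
  proof (cases "\<exists>r\<in>carrier R. tsum (u r) c n \<noteq> \<zero>\<^bsub>S\<^esub>")
    case True
    then obtain r where "r \<in> carrier R" "tsum (u r) c n \<noteq> \<zero>\<^bsub>S\<^esub>" by blast
    then show ?thesis using Suc.IH[OF f, of "u r"] uc uJ by blast
  next
    case False
    have comm: "x n \<otimes> r \<otimes> x i = x i \<otimes> r \<otimes> x n" if "r \<in> carrier R" "i < n" for r i
    proof -
      have "u r i = \<zero>" using tsum_eq_zero[OF f, of "u r"] uc False that by blast
      then have "x n \<otimes> r \<otimes> x i = x i \<otimes> (r \<otimes> x n)" unfolding u_def using x that by simp
      then show ?thesis using x that by (simp add: A.m_assoc)
    qed
    show ?thesis
    proof (cases "x n = \<zero>")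
      case True
      then have "tsum x c (Suc n) = tsum x c n"
        using tsum_Suc[of x n] x tens_zero_left[OF c] tsum_closed[of x n] by simp
      then show ?thesis using Suc.IH[OF f, of x] Suc.prems by simp
    next
      case ne: False
      have "\<forall>i. \<exists>q. q \<in> carrier k \<and> (i < Suc n \<longrightarrow> x i = q \<odot> x n)"
      proof
        fix i
        consider "i < n" | "i = n" | "n < i" by linarith
        then show "\<exists>q. q \<in> carrier k \<and> (i < Suc n \<longrightarrow> x i = q \<odot> x n)"
        proof cases
          case 1
          then show ?thesis using central[OF x x ne, of i] comm by blast
        next
          case 2
          then show ?thesis using x smult_one by (intro exI[of _ "\<one>\<^bsub>k\<^esub>"]) auto
        qed auto
      qed
      from choice[OF this] obtain q where q: "\<forall>i. q i \<in> carrier k \<and> (i < Suc n \<longrightarrow> x i = q i \<odot> x n)" by (rule exE)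
      \<comment> \<open>With all coefficients proportional to \<open>x n\<close>, the scalars gather
        in one factor \<open>g\<close>. It is nonzero, hence invertible in \<open>K\<close>, and can
        be removed inside \<open>J\<close>.\<close>
      define g where "g = finsum K (\<lambda>i. h (q i) \<otimes>\<^bsub>K\<^esub> c i) {..<Suc n}"
      have hq: "h (q i) \<otimes>\<^bsub>K\<^esub> c i \<in> carrier K" for i using q c h_props(1) by simp
      have gc: "g \<in> carrier K" unfolding g_def using hq by (intro K.finsum_closed) auto
      have "tens (x n) g = finsum S (\<lambda>i. tens (x n) (h (q i) \<otimes>\<^bsub>K\<^esub> c i)) {..<Suc n}"
        unfolding g_def using x hq tens_closed tens_add_right
        by (intro finsum_hom[OF K.abelian_group_axioms S.abelian_group_axioms]) auto
      also have "\<dots> = tsum x c (Suc n)"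
        unfolding tsum_def
      proof (rule S.finsum_cong')
        fix i assume "i \<in> {..<Suc n}"
        then have "i < Suc n" by simp
        then have xi: "x i = q i \<odot> x n" and qi: "q i \<in> carrier k" using spec[OF q, of i] by blast+
        show "tens (x n) (h (q i) \<otimes>\<^bsub>K\<^esub> c i) = tens (x i) (c i)"
          unfolding xi by (rule tens_balanced[OF qi x c, symmetric])
      qed (use x c tens_closed in auto)
      finally have t: "tens (x n) g = tsum x c (Suc n)" .
      have "g \<noteq> \<zero>\<^bsub>K\<^esub>" using t Suc.prems(4) tens_zero_right[OF x] by auto
      then have gU: "g \<in> Units K" using gc K.field_Units by simp
      have "tens (x n) g \<otimes>\<^bsub>S\<^esub> tens \<one> (inv\<^bsub>K\<^esub> g) \<in> J"
        using Suc.prems(3) t gU tens_closed by (intro J.I_r_closed) auto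
      moreover have "tens (x n) g \<otimes>\<^bsub>S\<^esub> tens \<one> (inv\<^bsub>K\<^esub> g) = tens (x n) \<one>\<^bsub>K\<^esub>"
        using x gc gU by (simp add: tens_mult)
      ultimately show ?thesis using ne x by auto
    qed
  qed
qed

end

lemma tsum_cong_scalars:
  assumes "\<And>i. i < n \<Longrightarrow> c i = e i" "\<And>i. i < n \<Longrightarrow> x i = y i" "\<And>i. y i \<in> carrier R" "\<And>i. e i \<in> carrier K"
  shows "tsum x c n = tsum y e n"
  unfolding tsum_def using assms tens_closed by (intro S.finsum_cong') auto

definition represented :: "(('r \<times> 'c) \<Rightarrow>\<^sub>0 int) set \<Rightarrow> bool" where
  "represented s \<longleftrightarrow> (\<exists>n x c. free_seq c n \<and> (\<forall>i. x i \<in> carrier R) \<and> s = tsum x c n)"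

text \<open>A scalar that depends on those already present is absorbed into their coefficients; an
  independent one extends the sequence.\<close>

lemma represented_add_pure:
  assumes s: "represented s" and xe: "x \<in> carrier R" "e \<in> carrier K"
  shows "represented (s \<oplus>\<^bsub>S\<^esub> tens x e)"
proof -
  obtain n y c where f: "free_seq c n" and y: "\<forall>i. y i \<in> carrier R" and s: "s = tsum y c n"
    using s unfolding represented_def by blast
  have c: "\<And>i. c i \<in> carrier K" using f unfolding free_seq_def by blast
  show ?thesis
  proof (cases "e \<in> KM.lspan (c ` {..<n})")
    case True
    obtain z where z: "\<forall>i. z i \<in> carrier R" "tens x e = tsum z c n" using tsum_span[where c = c, OF c xe(1) True] by blast
    have "s \<oplus>\<^bsub>S\<^esub> tens x e = tsum (\<lambda>i. y i \<oplus> z i) c n"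
      unfolding s z(2) using tsum_add[where c = c, OF c, of y z n] y z(1) by simp
    then show ?thesis unfolding represented_def using f y z(1)
      by (intro exI[of _ n] exI[of _ "\<lambda>i. y i \<oplus> z i"] exI[of _ c]) auto
  next
    case False
    let ?c = "c(n := e)" and ?y = "y(n := x)"
    have im: "?c ` {..<m} = c ` {..<m}" if "m \<le> n" for m using that by auto
    have c': "\<And>i. ?c i \<in> carrier K" using c xe by simp
    have y': "\<And>i. ?y i \<in> carrier R" using y xe by simp
    have "?c m \<notin> KM.lspan (?c ` {..<m})" if "m < Suc n" for m
    proof (cases "m = n")
      case True
      then show ?thesis unfolding im[OF eq_imp_le[OF True]] using False by simp
    next
      case m: False
      then have "m < n" using that by simp
      then show ?thesis unfolding im[OF less_imp_le[OF \<open>m < n\<close>]] using f unfolding free_seq_def by simp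
    qed
    then have "free_seq ?c (Suc n)"
      unfolding free_seq_def using c' by blast
    moreover have "s \<oplus>\<^bsub>S\<^esub> tens x e = tsum ?y ?c (Suc n)"
    proof -
      have "tsum ?y ?c n = tsum y c n" by (rule tsum_cong_scalars) (use y c in auto)
      then show ?thesis using tsum_Suc[where c = ?c and x = ?y and n = n] c' y' tens_closed[OF xe] tsum_closed[where c = c and x = y and n = n] c y unfolding s
        by (simp add: S.a_comm)
    qed
    ultimately show ?thesis unfolding represented_def using y' by blast
  qed
qed

lemma all_represented:
  assumes s: "s \<in> carrier S" shows "represented s"
proof -
  have cl: "u \<in> carrier S" if "represented u" for u
    using that tsum_closed unfolding represented_def free_seq_def by blast
  \<comment> \<open>Strengthened to adding \<open>s\<close> to, and subtracting it from, any
    represented tensor, since closure of \<open>represented\<close> under sums is known only for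
    pure summands.\<close>
  have "\<forall>u. represented u \<longrightarrow> represented (u \<oplus>\<^bsub>S\<^esub> s) \<and> represented (u \<ominus>\<^bsub>S\<^esub> s)"
    using s
  proof (induction rule: tens_induct)
    case zero
    then show ?case using cl by (simp add: a_minus_def)
  next
    case (tens x c)
    have "tens (\<ominus> x) c = \<ominus>\<^bsub>S\<^esub> tens x c"
      using tens_add_left[of "\<ominus> x" x c] tens tens_zero_left[of c] tens_closed[of "\<ominus> x" c] tens_closed[of x c]
      by (simp add: M.l_neg S.minus_equality)
    then show ?case using represented_add_pure[of _ x c] represented_add_pure[of _ "\<ominus> x" c] tens
      by (simp add: a_minus_def)
  next
    case (diff s t)
    show ?case
    proof (intro allI impI)
      fix u assume u: "represented u"
      have "u \<oplus>\<^bsub>S\<^esub> (s \<ominus>\<^bsub>S\<^esub> t) = (u \<oplus>\<^bsub>S\<^esub> s) \<ominus>\<^bsub>S\<^esub> t" "u \<ominus>\<^bsub>S\<^esub> (s \<ominus>\<^bsub>S\<^esub> t) = (u \<ominus>\<^bsub>S\<^esub> s) \<oplus>\<^bsub>S\<^esub> t"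
        using cl[OF u] diff(1,2) by (simp_all add: a_minus_def S.minus_add S.a_assoc)
      then show "represented (u \<oplus>\<^bsub>S\<^esub> (s \<ominus>\<^bsub>S\<^esub> t)) \<and> represented (u \<ominus>\<^bsub>S\<^esub> (s \<ominus>\<^bsub>S\<^esub> t))"
        using diff(3,4) u by simp
    qed
  qed
  moreover have "represented \<zero>\<^bsub>S\<^esub>"
    unfolding represented_def
    by (intro exI[of _ 0] exI[of _ "\<lambda>_. \<zero>"] exI[of _ "\<lambda>_. \<zero>\<^bsub>K\<^esub>"]) (auto simp: free_seq_def tsum_def)
  ultimately have "represented (\<zero>\<^bsub>S\<^esub> \<oplus>\<^bsub>S\<^esub> s)" by blast
  then show ?thesis using s by simp
qed

lemma not_PI_extends:
  assumes n: "\<not> PI_algebra k R" shows "\<not> PI_algebra K S"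
proof
  assume "PI_algebra K S"
  then obtain f w0 where f: "f \<in> nc_polys K" "f w0 \<noteq> \<zero>\<^bsub>K\<^esub>"
    and ev: "\<And>x. range x \<subseteq> carrier S \<Longrightarrow> nc_eval K S f x = \<zero>\<^bsub>S\<^esub>" unfolding PI_algebra_def by blast
  have fc: "f w \<in> carrier K" for w using f(1) unfolding nc_polys_def by auto
  have fin: "finite {w. f w \<noteq> \<zero>\<^bsub>K\<^esub>}" using f(1) unfolding nc_polys_def by simp
  have "f w0 \<in> carrier Kmod" "f w0 \<notin> KM.lspan {}" using fc f(2) by (auto elim: KM.lspan.cases)
  from KM.functional_exists[OF KM.subsp_lspan this] obtain l where
    l: "\<forall>v\<in>carrier K. l v \<in> carrier k" "\<forall>u\<in>carrier K. \<forall>v\<in>carrier K. l (u \<oplus>\<^bsub>K\<^esub> v) = l u \<oplus>\<^bsub>k\<^esub> l v"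
      "\<forall>a\<in>carrier k. \<forall>v\<in>carrier K. l (h a \<otimes>\<^bsub>K\<^esub> v) = a \<otimes>\<^bsub>k\<^esub> l v"
      "\<forall>v\<in>KM.lspan {}. l v = \<zero>\<^bsub>k\<^esub>" "l (f w0) = \<one>\<^bsub>k\<^esub>" by auto
  have l0: "l \<zero>\<^bsub>K\<^esub> = \<zero>\<^bsub>k\<^esub>" using l(4) KM.lspan.zero[of "{}"] by simp
  from contraction_exists[of l] l(1-3) obtain L where
    L: "\<forall>s\<in>carrier S. L s \<in> carrier R" "\<forall>s\<in>carrier S. \<forall>t\<in>carrier S. L (s \<oplus>\<^bsub>S\<^esub> t) = L s \<oplus> L t"
      "\<forall>x\<in>carrier R. \<forall>c\<in>carrier K. L (tens x c) = l c \<odot> x" by auto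
  define g where "g w = l (f w)" for w
  have sub: "{w. g w \<noteq> \<zero>\<^bsub>k\<^esub>} \<subseteq> {w. f w \<noteq> \<zero>\<^bsub>K\<^esub>}" unfolding g_def using l0 by auto
  have gc: "g w \<in> carrier k" for w unfolding g_def using l(1) fc by simp
  have "g \<in> nc_polys k" unfolding nc_polys_def using gc finite_subset[OF sub fin] by auto
  moreover have "g w0 \<noteq> \<zero>\<^bsub>k\<^esub>" unfolding g_def l(5) by simp
  moreover have "nc_eval k R g x = \<zero>" if x: "range x \<subseteq> carrier R" for x
  proof -
    have xc: "x i \<in> carrier R" for i using x by blast
    have wc: "word_val R (map x w) \<in> carrier R" for w using xc by (intro A.word_val_closed) auto
    let ?y = "\<lambda>i. tens (x i) \<one>\<^bsub>K\<^esub>"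
    have ones: "word_val K (map (\<lambda>i. \<one>\<^bsub>K\<^esub>) w) = \<one>\<^bsub>K\<^esub>" for w :: "nat list" by (induction w) auto
    have tm: "f w \<odot>\<^bsub>S\<^esub> word_val S (map ?y w) = tens (word_val R (map x w)) (f w)" for w
    proof -
      have "word_val S (map ?y w) = tens (word_val R (map x w)) \<one>\<^bsub>K\<^esub>"
        using word_val_tens[of x "\<lambda>_. \<one>\<^bsub>K\<^esub>" w] xc ones by simp
      then show ?thesis using smult_S[OF fc tens_closed[OF wc K.one_closed]] fc wc by (simp add: tens_mult)
    qed
    have "nc_eval K S f ?y = \<zero>\<^bsub>S\<^esub>" by (rule ev) (use xc tens_closed in auto)
    then have z: "finsum S (\<lambda>w. tens (word_val R (map x w)) (f w)) {w. f w \<noteq> \<zero>\<^bsub>K\<^esub>} = \<zero>\<^bsub>S\<^esub>"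
      unfolding nc_eval_def tm .
    have "L (finsum S (\<lambda>w. tens (word_val R (map x w)) (f w)) {w. f w \<noteq> \<zero>\<^bsub>K\<^esub>}) =
        finsum R (\<lambda>w. L (tens (word_val R (map x w)) (f w))) {w. f w \<noteq> \<zero>\<^bsub>K\<^esub>}"
      using L fin wc fc tens_closed by (intro finsum_hom[OF S.abelian_group_axioms M.abelian_group_axioms]) auto
    also have "\<dots> = finsum R (\<lambda>w. g w \<odot> word_val R (map x w)) {w. f w \<noteq> \<zero>\<^bsub>K\<^esub>}"
      unfolding g_def using L(3) wc fc l(1) by (intro M.finsum_cong') auto
    also have "\<dots> = finsum R (\<lambda>w. g w \<odot> word_val R (map x w)) {w. g w \<noteq> \<zero>\<^bsub>k\<^esub>}"
      using fin sub gc wc by (intro M.add.finprod_mono_neutral_cong_right) (auto simp: smult_l_null)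
    finally have e: "L \<zero>\<^bsub>S\<^esub> = nc_eval k R g x" unfolding z nc_eval_def .
    have "L \<zero>\<^bsub>S\<^esub> \<oplus> L \<zero>\<^bsub>S\<^esub> = L \<zero>\<^bsub>S\<^esub>" using L(2)[rule_format, of "\<zero>\<^bsub>S\<^esub>" "\<zero>\<^bsub>S\<^esub>"] by simp
    then have "L \<zero>\<^bsub>S\<^esub> = \<zero>" using L(1)[rule_format, of "\<zero>\<^bsub>S\<^esub>"] by simp
    then show ?thesis using e by simp
  qed
  ultimately show False using n unfolding PI_algebra_def by blast
qed

theorem almost_PI_extends:
  assumes n: "\<not> PI_algebra k R"
    and central: "\<And>a b. \<lbrakk>a \<in> carrier R; b \<in> carrier R; a \<noteq> \<zero>; \<And>s. s \<in> carrier R \<Longrightarrow> a \<otimes> s \<otimes> b = b \<otimes> s \<otimes> a\<rbrakk>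
      \<Longrightarrow> \<exists>q\<in>carrier k. b = q \<odot> a"
    and ids: "\<And>I. \<lbrakk>ideal I R; I \<noteq> {\<zero>}\<rbrakk> \<Longrightarrow> \<exists>d e. \<forall>a b c. (\<forall>i. a i \<in> carrier R) \<longrightarrow> (\<forall>i. b i \<in> carrier R) \<longrightarrow>
      (\<forall>i. c i \<in> carrier R) \<longrightarrow> A.stdp d a \<otimes> (A.stdp d b \<otimes> A.rstdp e c) \<in> I"
  shows "almost_PI K S"
  unfolding almost_PI_def
proof (intro conjI allI impI)
  show "\<not> PI_algebra K S" by (rule not_PI_extends[OF n])
  fix J assume J: "ideal J S \<and> J \<noteq> {\<zero>\<^bsub>S\<^esub>}"
  then interpret J: ideal J S by blast
  obtain t where t: "t \<in> J" "t \<noteq> \<zero>\<^bsub>S\<^esub>" using J J.zero_closed by blast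
  obtain m x c where f: "free_seq c m" "\<And>i. x i \<in> carrier R" "t = tsum x c m"
    using all_represented[of t] t J.a_Hcarr unfolding represented_def by blast
  have cK: "\<And>i. c i \<in> carrier K" using f(1) unfolding free_seq_def by blast
  have "\<exists>r\<in>carrier R. r \<noteq> \<zero> \<and> tens r \<one>\<^bsub>K\<^esub> \<in> J"
  proof (rule ideal_contains_pure[where c = c and x = x and n = m])
    show "ideal J S" by (rule J.is_ideal)
    show "tsum x c m \<in> J" "tsum x c m \<noteq> \<zero>\<^bsub>S\<^esub>" using t f(3) by simp_all
  qed (use cK f(1,2) central in blast)+
  then obtain r where r: "r \<in> carrier R" "r \<noteq> \<zero>" "tens r \<one>\<^bsub>K\<^esub> \<in> J" by blast
  \<comment> \<open>The contraction of \<open>J\<close> to \<open>R\<close>, nonzero because of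
    \<open>r\<close>. An identity with values in \<open>I\<close> on \<open>R\<close> has its values
    in \<open>J\<close> on the extension.\<close>
  define I where "I = {r \<in> carrier R. tens r \<one>\<^bsub>K\<^esub> \<in> J}"
  have I: "ideal I R"
  proof (rule A.idealI_elements)
    show "\<zero> \<in> I" unfolding I_def using tens_zero_left[of "\<one>\<^bsub>K\<^esub>"] J.zero_closed by simp
    fix x y assume x: "x \<in> I"
    show "x \<oplus> y \<in> I" if "y \<in> I" using x that J.a_closed unfolding I_def by (auto simp: tens_add_left)
    fix a assume a: "a \<in> carrier R"
    show "a \<otimes> x \<in> I" using x a J.I_l_closed[of "tens x \<one>\<^bsub>K\<^esub>" "tens a \<one>\<^bsub>K\<^esub>"] tens_closed
      unfolding I_def by (auto simp: tens_mult)
    show "x \<otimes> a \<in> I" using x a J.I_r_closed[of "tens x \<one>\<^bsub>K\<^esub>" "tens a \<one>\<^bsub>K\<^esub>"] tens_closed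
      unfolding I_def by (auto simp: tens_mult)
  qed (auto simp: I_def)
  have "I \<noteq> {\<zero>}" using r unfolding I_def by blast
  from ids[OF I this] obtain d e where id: "\<forall>a b c. (\<forall>i. a i \<in> carrier R) \<longrightarrow> (\<forall>i. b i \<in> carrier R) \<longrightarrow>
      (\<forall>i. c i \<in> carrier R) \<longrightarrow> A.stdp d a \<otimes> (A.stdp d b \<otimes> A.rstdp e c) \<in> I" by (elim exE)
  show "PI_algebra K (quot_algebra S J)"
  proof (rule quot_PI[OF K J.is_ideal smult_S_one smult_S_minus_one])
    fix a b c :: "nat \<Rightarrow> (('r \<times> 'c) \<Rightarrow>\<^sub>0 int) set"
    assume "\<And>i. a i \<in> carrier S" "\<And>i. b i \<in> carrier S" "\<And>i. c i \<in> carrier S"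
    then show "S.stdp d a \<otimes>\<^bsub>S\<^esub> (S.stdp d b \<otimes>\<^bsub>S\<^esub> S.rstdp e c) \<in> J"
      by (intro identity_extends[OF J.is_ideal]) (use id in \<open>auto simp: I_def\<close>)
  qed
qed

end

theorem corollary2p13:
  fixes k :: "'k ring" and R :: "('k, 'r) module"
  assumes "algebraically_closed k"
    and "uncountable (carrier k)"
    and "assoc_algebra k R"
    and "affine_algebra k R"
    and "prime_ring R"
    and "goldie_ring R"
    and "\<not> simple_ring R"
    and "\<not> PI_algebra k R"
    and "GKdim k R < 3"
  shows "stably_almost_PI TYPE('c) k R"
proof -
  have kalg: "kalg k R" using assms(3) by (rule kalg.intro)
  interpret plain_kalg k R by (rule plain_kalg.intro) (rule kalg)
  have k: "field k" by (rule field_axioms)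
  have ids: "\<exists>d e. \<forall>a b c. (\<forall>i. a i \<in> carrier R) \<longrightarrow> (\<forall>i. b i \<in> carrier R) \<longrightarrow>
      (\<forall>i. c i \<in> carrier R) \<longrightarrow> A.stdp d a \<otimes>\<^bsub>R\<^esub> (A.stdp d b \<otimes>\<^bsub>R\<^esub> A.rstdp e c) \<in> I"
    if "ideal I R" "I \<noteq> {\<zero>\<^bsub>R\<^esub>}" for I
    by (rule quotient_identity[OF kalg assms(1,4,5) _ assms(9) that]) (use assms(6) in \<open>simp add: goldie_ring_def\<close>)
  have "almost_PI k R"
    unfolding almost_PI_def
  proof (intro conjI allI impI)
    fix I assume I: "ideal I R \<and> I \<noteq> {\<zero>\<^bsub>R\<^esub>}"
    obtain d e where de: "\<forall>a b c. (\<forall>i. a i \<in> carrier R) \<longrightarrow> (\<forall>i. b i \<in> carrier R) \<longrightarrow>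
      (\<forall>i. c i \<in> carrier R) \<longrightarrow> A.stdp d a \<otimes>\<^bsub>R\<^esub> (A.stdp d b \<otimes>\<^bsub>R\<^esub> A.rstdp e c) \<in> I"
      using ids I by blast
    show "PI_algebra k (quot_algebra R I)"
      by (rule quot_PI[OF k _ smult_one minus_one_smult, where D = d and E = e]) (use I de in auto)
  qed (rule assms(8))
  have "\<exists>a b c. (\<forall>i. a i \<in> carrier R) \<and> (\<forall>i. b i \<in> carrier R) \<and> (\<forall>i. c i \<in> carrier R) \<and>
      A.stdp d a \<otimes>\<^bsub>R\<^esub> (A.stdp d b \<otimes>\<^bsub>R\<^esub> A.rstdp e c) \<noteq> \<zero>\<^bsub>R\<^esub>" for d e
  proof (rule ccontr)
    assume n: "\<not> ?thesis"
    have "PI_algebra k R"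
    proof (rule PI_algebra_of_identity[OF ring k smult_one minus_one_smult])
      fix a b c :: "nat \<Rightarrow> 'r" assume abc: "\<And>i. a i \<in> carrier R" "\<And>i. b i \<in> carrier R" "\<And>i. c i \<in> carrier R"
      show "A.stdp d a \<otimes>\<^bsub>R\<^esub> (A.stdp d b \<otimes>\<^bsub>R\<^esub> A.rstdp e c) = \<zero>\<^bsub>R\<^esub>"
      proof (rule ccontr)
        assume "A.stdp d a \<otimes>\<^bsub>R\<^esub> (A.stdp d b \<otimes>\<^bsub>R\<^esub> A.rstdp e c) \<noteq> \<zero>\<^bsub>R\<^esub>"
        then have "\<exists>a b c. (\<forall>i. a i \<in> carrier R) \<and> (\<forall>i. b i \<in> carrier R) \<and> (\<forall>i. c i \<in> carrier R) \<and>
          A.stdp d a \<otimes>\<^bsub>R\<^esub> (A.stdp d b \<otimes>\<^bsub>R\<^esub> A.rstdp e c) \<noteq> \<zero>\<^bsub>R\<^esub>" using abc by (intro exI[of _ a] exI[of _ b] exI[of _ c]) simp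
        then show False using n by (rule notE[rotated])
      qed
    qed
    then show False using assms(8) by blast
  qed
  then have "\<forall>p. \<exists>a b c. (\<forall>i. a i \<in> carrier R) \<and> (\<forall>i. b i \<in> carrier R) \<and> (\<forall>i. c i \<in> carrier R) \<and>
      A.stdp (fst p) a \<otimes>\<^bsub>R\<^esub> (A.stdp (fst p) b \<otimes>\<^bsub>R\<^esub> A.rstdp (snd p) c) \<noteq> \<zero>\<^bsub>R\<^esub>" by blast
  then obtain a b c where abc: "\<And>p i. a p i \<in> carrier R" "\<And>p i. b p i \<in> carrier R" "\<And>p i. c p i \<in> carrier R"
    and ne: "\<And>p. A.stdp (fst p) (a p) \<otimes>\<^bsub>R\<^esub> (A.stdp (fst p) (b p) \<otimes>\<^bsub>R\<^esub> A.rstdp (snd p) (c p)) \<noteq> \<zero>\<^bsub>R\<^esub>"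
    by metis
  \<comment> \<open>One nonzero value for each pair of degrees, listed through
    \<open>prod_decode\<close>; an ideal that contains all values for a pair contains the chosen
    one.\<close>
  define F where "F j = (let p = prod_decode j in
      A.stdp (fst p) (a p) \<otimes>\<^bsub>R\<^esub> (A.stdp (fst p) (b p) \<otimes>\<^bsub>R\<^esub> A.rstdp (snd p) (c p)))" for j
  have F: "F j \<in> carrier R" "F j \<noteq> \<zero>\<^bsub>R\<^esub>" for j
    unfolding F_def Let_def using abc ne by (simp_all add: A.stdp_closed A.rstdp_closed)
  have FI: "\<exists>j. F j \<in> I" if I: "ideal I R" "I \<noteq> {\<zero>\<^bsub>R\<^esub>}" for I
  proof -
    obtain d e where "\<forall>a b c. (\<forall>i. a i \<in> carrier R) \<longrightarrow> (\<forall>i. b i \<in> carrier R) \<longrightarrow>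
      (\<forall>i. c i \<in> carrier R) \<longrightarrow> A.stdp d a \<otimes>\<^bsub>R\<^esub> (A.stdp d b \<otimes>\<^bsub>R\<^esub> A.rstdp e c) \<in> I"
      using ids[OF I] by blast
    then have "F (prod_encode (d, e)) \<in> I" unfolding F_def Let_def using abc by simp
    then show ?thesis ..
  qed
  obtain S where S: "finite S" "S \<subseteq> carrier R" "\<forall>B. subalgebra_of k B R \<and> S \<subseteq> B \<longrightarrow> B = carrier R"
    using assms(4) unfolding affine_algebra_def by blast
  let ?C = "word_val R ` lists S"
  have C: "countable ?C" "?C \<subseteq> carrier R"
    using countable_finite[OF S(1)] A.word_val_closed S(2) by (auto intro!: countable_image)
  have central: "\<exists>q\<in>carrier k. y = q \<odot>\<^bsub>R\<^esub> x"
    if "x \<in> carrier R" "y \<in> carrier R" "x \<noteq> \<zero>\<^bsub>R\<^esub>"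
      "\<And>s. s \<in> carrier R \<Longrightarrow> x \<otimes>\<^bsub>R\<^esub> s \<otimes>\<^bsub>R\<^esub> y = y \<otimes>\<^bsub>R\<^esub> s \<otimes>\<^bsub>R\<^esub> x" for x y
    by (rule proportional[OF assms(1,5,2) C affine_spanned[OF S(2,3)] FI F that])
  have "almost_PI K (base_change k R K h)" if "field K" "h \<in> ring_hom k K" for K :: "'c ring" and h
  proof -
    interpret ext: scalar_extension k R K h
      by (intro scalar_extension.intro plain_kalg_axioms scalar_extension_axioms.intro that)
    show ?thesis by (rule ext.almost_PI_extends[OF assms(8) central ids])
  qed
  then show ?thesis using \<open>almost_PI k R\<close> unfolding stably_almost_PI_def by blast
qed

end
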